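(* Let $n\ge k+1\ge 2$ and suppose $n=km$ for an integer $m$. Suppose that the parameters satisfy $t^{k+1}q=1$, i.e. let $s\in\mathcal{A}$ be an irreducible factor of $t^{k+1}q-1$ and regard all parameters as elements of $\mathbb{K}_s$. Let $\lambda=(m-1,\dots,1,0,\ m-1,\dots,1,0,\ \dots,\ m-1,\dots,1,0)\in\mathbb{Z}^n$ (the block $(m-1,\dots,1,0)$ repeated $k$ times). Then in $P_n^s$ $$E_{\lambda}|_{s=0}=\prod_{\ell=1}^{k}\ \prod_{m(\ell-1)<i<j\le m\ell}(x_i-t^{-1}x_j)\left(1-\frac{t^\ell q}{x_ix_j}\right).$$
   Context: $n\ge 2$; $\mathcal{A}=\mathbb{C}[q^{\pm1/2},t^{\pm1/2},t_n^{\pm1/2},t_0^{\pm1/2},u_n^{\pm1/2},u_0^{\pm1/2}]$, $\mathbb{K}=\mathrm{Frac}(\mathcal{A})$, $P_n=\mathbb{K}[x_1^{\pm1},\dots,x_n^{\pm1}]$. Put $a=t_n^{1/2}u_n^{1/2}$, $b=-t_n^{1/2}u_n^{-1/2}$, $c=q^{1/2}t_0^{1/2}u_0^{1/2}$, $d=-q^{1/2}t_0^{1/2}u_0^{-1/2}$, $a^*=t_n^{1/2}t_0^{1/2}$. On Laurent polynomials, $s_i$ ($1\le i\le n-1$) exchanges $x_i,x_{i+1}$, $s_n$ sends $x_n\mapsto x_n^{-1}$, $s_0$ sends $x_1\mapsto qx_1^{-1}$. Define $\widehat T_0=t_0^{1/2}+t_0^{-1/2}\frac{(1-cx_1^{-1})(1-dx_1^{-1})}{1-qx_1^{-2}}(s_0-1)$,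 $\widehat T_i=t^{1/2}+t^{-1/2}\frac{1-tx_ix_{i+1}^{-1}}{1-x_ix_{i+1}^{-1}}(s_i-1)$ ($1\le i\le n-1$), $\widehat T_n=t_n^{1/2}+t_n^{-1/2}\frac{(1-ax_n)(1-bx_n)}{1-x_n^2}(s_n-1)$, $\widehat Y_i=\widehat T_i\cdots\widehat T_{n-1}\widehat T_n\widehat T_{n-1}\cdots\widehat T_1\widehat T_0\widehat T_1^{-1}\cdots\widehat T_{i-1}^{-1}$ (mutually commuting). $W_0$ is the group of signed permutations acting on $\mathbb{Z}^n$. For $\lambda\in\mathbb{Z}^n$, $\lambda^+$ is the dominant element of $W_0\lambda$ (a partition), $w_\lambda^+\in W_0$ the shortest element with $w_\lambda^+\lambda^+=\lambda$, $\rho(\lambda)=w_\lambda^+(n-1,\dots,1,0)$, $\sigma(\lambda)_i=\mathrm{sgn}(\lambda_i)$ with $\mathrm{sgn}(0)=+1$. $\lambda\ge\mu$ means $\lambda-\mu$ is a $\mathbb{Z}_{\ge0}$-combination of $\epsilon_1-\epsilon_2,\dots,\epsilon_{n-1}-\epsilon_n,\epsilon_n$; $\lambda\succeq\mu$ means $\lambda^+>\mu^+$, or $\lambda^+=\mu^+$ and $\lambda\ge\mu$. $y(\lambda)_i=q^{\lambda_i}t^{\rho(\lambda)_i}(a^* )^{\sigma(\lambda)_i}$. The non-symmetric Koornwinder polynomial $E_\lambda\in P_n$ is the unique element with $\widehat Y_iE_\lambda=y(\lambda)_iE_\lambda$ for all $i$ and $E_\lambda\in x^\lambda+\sum_{\mu\prec\lambda}\mathbb{K}x^\mu$.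 For an irreducible $s\in\mathcal{A}$, $\mathbb{K}_s=\mathrm{Frac}(\mathcal{A}/s\mathcal{A})$, $P_n^s=\mathbb{K}_s[x_1^{\pm1},\dots,x_n^{\pm1}]$, and $|_{s=0}$ denotes coefficientwise reduction to $\mathbb{K}_s$ of Laurent polynomials whose coefficients have non-negative $s$-adic valuation. *)

theory Defs
  imports
    "HOL-Computational_Algebra.Computational_Algebra"
    "HOL-Combinatorics.Permutations"
    "HOL-Library.Poly_Mapping"
    "HOL-Library.Extended_Nat"
begin

section \<open>Coefficient rings\<close>

text \<open>
  The constructors name the square roots: \<open>ParQ\<close> is the variable $q^{1/2}$, \<open>ParTn\<close> is
  $t_n^{1/2}$, and so on. The linear order on them is arbitrary; it is only needed to obtain the
  \<open>idom\<close> instance for the ring of Laurent polynomials.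
\<close>

datatype param = ParQ | ParT | ParTn | ParT0 | ParUn | ParU0

primrec param_index :: "param \<Rightarrow> nat" where
  "param_index ParQ = 0"
| "param_index ParT = 1"
| "param_index ParTn = 2"
| "param_index ParT0 = 3"
| "param_index ParUn = 4"
| "param_index ParU0 = 5"

lemma param_index_inject: "param_index x = param_index y \<Longrightarrow> x = y"
  by (cases x; cases y) simp_all

instantiation param :: linorder
begin

definition less_eq_param :: "param \<Rightarrow> param \<Rightarrow> bool" where
  "less_eq_param x y \<longleftrightarrow> param_index x \<le> param_index y"

definition less_param :: "param \<Rightarrow> param \<Rightarrow> bool" where
  "less_param x y \<longleftrightarrow> param_index x < param_index y"

instance
  by standard (auto simp: less_eq_param_def less_param_def intro: param_index_inject)

end

text \<open>A Laurent polynomial is a finitely supported function on integer exponent vectors.\<close>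

type_synonym ringA = "(param \<Rightarrow>\<^sub>0 int) \<Rightarrow>\<^sub>0 complex"

type_synonym fieldK = "ringA fract"

definition varA :: "param \<Rightarrow> ringA" where
  "varA p = Poly_Mapping.single (Poly_Mapping.single p 1) 1"

definition qA :: ringA where "qA = varA ParQ ^ 2"

definition tA :: ringA where "tA = varA ParT ^ 2"

definition qh :: fieldK where "qh = to_fract (varA ParQ)"
definition th :: fieldK where "th = to_fract (varA ParT)"
definition tnh :: fieldK where "tnh = to_fract (varA ParTn)"
definition t0h :: fieldK where "t0h = to_fract (varA ParT0)"
definition unh :: fieldK where "unh = to_fract (varA ParUn)"
definition u0h :: fieldK where "u0h = to_fract (varA ParU0)"

definition qK :: fieldK where "qK = to_fract qA"
definition tK :: fieldK where "tK = to_fract tA"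

definition aK :: fieldK where "aK = tnh * unh"
definition bK :: fieldK where "bK = - (tnh / unh)"
definition cK :: fieldK where "cK = qh * t0h * u0h"
definition dK :: fieldK where "dK = - (qh * t0h / u0h)"
definition astarK :: fieldK where "astarK = tnh * t0h"


section \<open>Laurent polynomials in \<open>x\<^sub>1, \<dots>, x\<^sub>n\<close>\<close>

text \<open>
  Elements of $\mathbb{Z}^n$ are the finitely supported \<open>\<mu> :: nat \<Rightarrow>\<^sub>0 int\<close> with support in
  \<open>{1..n}\<close>; accordingly $P_n$ is the subring \<open>Pn n\<close> of the Laurent polynomials in
  $x_0, x_1, x_2, \dots$.
\<close>

type_synonym weight = "nat \<Rightarrow>\<^sub>0 int"

type_synonym 'a laurent = "weight \<Rightarrow>\<^sub>0 'a"

definition lattice :: "nat \<Rightarrow> weight set" where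
  "lattice n = {\<mu>. Poly_Mapping.keys \<mu> \<subseteq> {1..n}}"

definition Pn :: "nat \<Rightarrow> 'a::zero laurent set" where
  "Pn n = {f. Poly_Mapping.keys f \<subseteq> lattice n}"

definition xpow :: "nat \<Rightarrow> int \<Rightarrow> 'a::comm_ring_1 laurent" where
  "xpow i e = Poly_Mapping.single (Poly_Mapping.single i e) 1"

definition const :: "'a::comm_ring_1 \<Rightarrow> 'a laurent" where
  "const z = Poly_Mapping.single 0 z"


section \<open>Signed permutations and orders on weights\<close>

definition negate_coord :: "nat \<Rightarrow> weight \<Rightarrow> weight" where
  "negate_coord i \<mu> = Poly_Mapping.update i (- Poly_Mapping.lookup \<mu> i) \<mu>"

definition swap_coords :: "nat \<Rightarrow> nat \<Rightarrow> weight \<Rightarrow> weight" where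
  "swap_coords i j \<mu> = Poly_Mapping.map_key (Transposition.transpose i j) \<mu>"

definition simple_refl :: "nat \<Rightarrow> nat \<Rightarrow> weight \<Rightarrow> weight" where
  "simple_refl n i = (if i = n then negate_coord n else swap_coords i (Suc i))"

definition W0 :: "nat \<Rightarrow> (weight \<Rightarrow> weight) set" where
  "W0 n = {w. \<exists>\<pi> \<epsilon>. \<pi> permutes {1..n} \<and> (\<forall>i. \<epsilon> i \<in> {1, -1}) \<and> (\<forall>i. i \<notin> {1..n} \<longrightarrow> \<epsilon> i = 1) \<and>
     (\<forall>\<mu> i. Poly_Mapping.lookup (w \<mu>) i = \<epsilon> i * Poly_Mapping.lookup \<mu> (\<pi> i))}"

definition compose_list :: "('a \<Rightarrow> 'a) list \<Rightarrow> 'a \<Rightarrow> 'a" where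
  "compose_list fs = foldr (\<circ>) fs id"

definition W0_length :: "nat \<Rightarrow> (weight \<Rightarrow> weight) \<Rightarrow> nat" where
  "W0_length n w = (LEAST l. \<exists>is. length is = l \<and> set is \<subseteq> {1..n} \<and>
     w = compose_list (map (simple_refl n) is))"

definition dominant :: "nat \<Rightarrow> weight \<Rightarrow> bool" where
  "dominant n \<mu> \<longleftrightarrow>
     (\<forall>i\<in>{1..<n}. Poly_Mapping.lookup \<mu> (Suc i) \<le> Poly_Mapping.lookup \<mu> i) \<and>
     (\<forall>i\<in>{1..n}. 0 \<le> Poly_Mapping.lookup \<mu> i)"

definition dominant_rep :: "nat \<Rightarrow> weight \<Rightarrow> weight" where
  "dominant_rep n \<mu> = (THE \<nu>. (\<exists>w\<in>W0 n. \<nu> = w \<mu>) \<and> dominant n \<nu>)"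

definition shortest_elt :: "nat \<Rightarrow> weight \<Rightarrow> weight \<Rightarrow> weight" where
  "shortest_elt n \<mu> = (THE w. w \<in> W0 n \<and> w (dominant_rep n \<mu>) = \<mu> \<and>
     (\<forall>v\<in>W0 n. v (dominant_rep n \<mu>) = \<mu> \<longrightarrow> W0_length n w \<le> W0_length n v))"

definition rho :: "nat \<Rightarrow> weight \<Rightarrow> weight" where
  "rho n \<mu> = shortest_elt n \<mu> (\<Sum>i\<in>{1..n}. Poly_Mapping.single i (int n - int i))"

definition sigma :: "weight \<Rightarrow> nat \<Rightarrow> int" where
  "sigma \<mu> i = (if Poly_Mapping.lookup \<mu> i < 0 then -1 else 1)"

definition wt_ge :: "nat \<Rightarrow> weight \<Rightarrow> weight \<Rightarrow> bool" where
  "wt_ge n \<mu> \<nu> \<longleftrightarrow> (\<exists>c :: nat \<Rightarrow> nat. \<mu> - \<nu> =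
     (\<Sum>i\<in>{1..<n}. Poly_Mapping.single i (int (c i)) - Poly_Mapping.single (Suc i) (int (c i)))
       + Poly_Mapping.single n (int (c n)))"

definition wt_succeq :: "nat \<Rightarrow> weight \<Rightarrow> weight \<Rightarrow> bool" where
  "wt_succeq n \<mu> \<nu> \<longleftrightarrow>
     (wt_ge n (dominant_rep n \<mu>) (dominant_rep n \<nu>) \<and> dominant_rep n \<mu> \<noteq> dominant_rep n \<nu>) \<or>
     (dominant_rep n \<mu> = dominant_rep n \<nu> \<and> wt_ge n \<mu> \<nu>)"

definition wt_prec :: "nat \<Rightarrow> weight \<Rightarrow> weight \<Rightarrow> bool" where
  "wt_prec n \<nu> \<mu> \<longleftrightarrow> wt_succeq n \<mu> \<nu> \<and> \<nu> \<noteq> \<mu>"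


section \<open>Operators and non-symmetric Koornwinder polynomials\<close>

text \<open>
  The action of $s_0, \dots, s_n$ on Laurent polynomials. For $i = 0$ the substitution
  $x_1 \mapsto q x_1^{-1}$ sends $x^\mu$ to $q^{\mu_1}$ times the monomial with the first exponent
  negated.
\<close>

definition s_act :: "nat \<Rightarrow> nat \<Rightarrow> fieldK laurent \<Rightarrow> fieldK laurent" where
  "s_act n i f = (\<Sum>\<mu>\<in>Poly_Mapping.keys f.
     if i = 0 then Poly_Mapping.single (negate_coord 1 \<mu>)
                     (Poly_Mapping.lookup f \<mu> * qK powi Poly_Mapping.lookup \<mu> 1)
     else Poly_Mapping.single (simple_refl n i \<mu>) (Poly_Mapping.lookup f \<mu>))"

text \<open>
  Quotient in an integral domain, used only for divisible arguments: $(s_i - 1) f$ is always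
  divisible by the denominator occurring in $\widehat T_i$.
\<close>

definition exact_quot :: "'a::idom \<Rightarrow> 'a \<Rightarrow> 'a" where
  "exact_quot f g = (THE h. h * g = f)"

definition T_op :: "nat \<Rightarrow> nat \<Rightarrow> fieldK laurent \<Rightarrow> fieldK laurent" where
  "T_op n i f =
    (if i = 0 then
       const t0h * f + const (inverse t0h) *
         exact_quot ((1 - const cK * xpow 1 (-1)) * (1 - const dK * xpow 1 (-1)) * (s_act n 0 f - f))
                    (1 - const qK * xpow 1 (-2))
     else if i = n then
       const tnh * f + const (inverse tnh) *
         exact_quot ((1 - const aK * xpow n 1) * (1 - const bK * xpow n 1) * (s_act n n f - f))
                    (1 - xpow n 2)
     else
       const th * f + const (inverse th) *
         exact_quot ((1 - const tK * xpow i 1 * xpow (Suc i) (-1)) * (s_act n i f - f))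
                    (1 - xpow i 1 * xpow (Suc i) (-1)))"

text \<open>
  Each \<open>T_op n i\<close> with $i \le n$ is a bijection of the whole type (by its quadratic relation) which
  preserves \<open>Pn n\<close>, so \<open>inv\<close> is a two-sided inverse and restricts to the inverse on $P_n$.
\<close>

definition Y_op :: "nat \<Rightarrow> nat \<Rightarrow> fieldK laurent \<Rightarrow> fieldK laurent" where
  "Y_op n i =
     compose_list (map (T_op n) [i..<n]) \<circ> T_op n n \<circ>
     compose_list (map (T_op n) (rev [1..<n])) \<circ> T_op n 0 \<circ>
     compose_list (map (\<lambda>j. inv (T_op n j)) [1..<i])"

definition spectrum :: "nat \<Rightarrow> weight \<Rightarrow> nat \<Rightarrow> fieldK" where
  "spectrum n \<mu> i = qK powi Poly_Mapping.lookup \<mu> i * tK powi Poly_Mapping.lookup (rho n \<mu>) i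
     * astarK powi sigma \<mu> i"

definition koornwinder_E :: "nat \<Rightarrow> weight \<Rightarrow> fieldK laurent" where
  "koornwinder_E n \<mu> = (THE f. f \<in> Pn n \<and>
     (\<forall>i\<in>{1..n}. Y_op n i f = const (spectrum n \<mu> i) * f) \<and>
     Poly_Mapping.lookup f \<mu> = 1 \<and>
     (\<forall>\<nu>\<in>Poly_Mapping.keys f. \<nu> = \<mu> \<or> wt_prec n \<nu> \<mu>))"


section \<open>Specialization at an irreducible element\<close>

text \<open>
  \<open>residue_field_map s \<phi>\<close> says that \<open>\<phi>\<close> exhibits the field \<open>'k\<close> as $\mathbb{K}_s$, the field of
  fractions of $\mathcal{A}/s\mathcal{A}$: it is a ring homomorphism whose kernel is
  $s\mathcal{A}$, and every element of \<open>'k\<close> is a fraction of elements of its image. This determines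
  \<open>('k, \<phi>)\<close> up to a unique isomorphism. A predicate is used because $\mathbb{K}_s$ depends on the
  value \<open>s\<close> and thus cannot be introduced as a type of its own.
\<close>

definition residue_field_map :: "ringA \<Rightarrow> (ringA \<Rightarrow> 'k::field) \<Rightarrow> bool" where
  "residue_field_map s \<phi> \<longleftrightarrow>
     \<phi> 1 = 1 \<and> (\<forall>f g. \<phi> (f + g) = \<phi> f + \<phi> g) \<and> (\<forall>f g. \<phi> (f * g) = \<phi> f * \<phi> g) \<and>
     (\<forall>f. \<phi> f = 0 \<longleftrightarrow> s dvd f) \<and>
     (\<forall>z. \<exists>f g. \<phi> g \<noteq> 0 \<and> z = \<phi> f / \<phi> g)"

text \<open>The $s$-adic valuation on $\mathcal{A}$, with value \<open>\<infinity>\<close> at \<open>0\<close>.\<close>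

definition adic_ord :: "ringA \<Rightarrow> ringA \<Rightarrow> enat" where
  "adic_ord s f = (SUP m\<in>{m. s ^ m dvd f}. enat m)"

definition val_nonneg :: "ringA \<Rightarrow> fieldK \<Rightarrow> bool" where
  "val_nonneg s z \<longleftrightarrow> (\<exists>f g. g \<noteq> 0 \<and> z = Fract f g \<and> adic_ord s g \<le> adic_ord s f)"

text \<open>
  An element of non-negative valuation can be written as \<open>f / g\<close> with \<open>g\<close> not divisible by \<open>s\<close>.
\<close>

definition reduce :: "ringA \<Rightarrow> (ringA \<Rightarrow> 'k::field) \<Rightarrow> fieldK \<Rightarrow> 'k" where
  "reduce s \<phi> z = (THE r. \<exists>f g. \<not> s dvd g \<and> z = Fract f g \<and> r = \<phi> f / \<phi> g)"

definition regular_at :: "ringA \<Rightarrow> fieldK laurent \<Rightarrow> bool" where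
  "regular_at s F \<longleftrightarrow> (\<forall>\<mu>. val_nonneg s (Poly_Mapping.lookup F \<mu>))"

definition reduce_laurent :: "ringA \<Rightarrow> (ringA \<Rightarrow> 'k::field) \<Rightarrow> fieldK laurent \<Rightarrow> 'k laurent" where
  "reduce_laurent s \<phi> F = Poly_Mapping.map (reduce s \<phi>) F"


section \<open>The weight \<open>(m-1, \<dots>, 1, 0)\<close> repeated \<open>k\<close> times\<close>

definition staircase_weight :: "nat \<Rightarrow> nat \<Rightarrow> weight" where
  "staircase_weight k m =
     (\<Sum>i\<in>{1..k * m}. Poly_Mapping.single i (int m - 1 - int ((i - 1) mod m)))"

end

theory Submission
  imports Defs
begin

text \<open>
  Modulo \<open>s\<close> we have \<open>t\<^sup>k\<^sup>+\<^sup>1 q = 1\<close>, and then the product \<open>F\<close> is a joint eigenvector of the \<open>Y\<^sub>i\<close>.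
  Inside a block it is antisymmetric, \<open>T\<^sub>j F = - t\<^sup>-\<^sup>1\<^sup>/\<^sup>2 F\<close>; it is fixed by \<open>s\<^sub>0\<close> because of the factors
  with \<open>1 - t q / (x\<^sub>1 x\<^sub>j)\<close>, and by \<open>s\<^sub>n\<close> because \<open>t\<^sup>k q = t\<^sup>-\<^sup>1\<close> in the last block. Between neighbouring
  blocks a Garnir relation holds: the alternating sum of the vectors obtained by moving one letter
  step by step across a block vanishes, as a divided difference of a polynomial of small degree.
  Therefore moving a letter across a block by the \<open>T\<^sub>j\<close> or by their inverses differs only by a
  scalar, which collapses the word of \<open>Y\<^sub>i\<close>.

  Next, \<open>\<lambda>\<close> is the only weight with the eigenvalues of \<open>F\<close>. The element \<open>s\<close> is homogeneous for
  every grading in which \<open>t\<^sup>k\<^sup>+\<^sup>1 q\<close> has degree \<open>0\<close>, so two monomials agree modulo \<open>s\<close> only if their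
  degrees agree, and a count of equal entries finishes the argument.

  Hence for each \<open>\<nu> \<prec> \<lambda>\<close> some \<open>Y\<^sub>i - y(\<nu>)\<^sub>i\<close> has a nonzero eigenvalue at \<open>\<lambda>\<close> modulo \<open>s\<close>. The product
  of these operators kills all lower terms. Applied to \<open>x\<^sup>\<lambda>\<close> over \<open>\<A>\<close> it gives \<open>E\<^sub>\<lambda>\<close> up to a scalar
  that is not divisible by \<open>s\<close>; modulo \<open>s\<close> it sends \<open>x\<^sup>\<lambda>\<close> to the same multiple of \<open>F\<close>, as \<open>F\<close> is
  triangular as well.
\<close>

section \<open>Ring homomorphisms and Laurent polynomials\<close>

text \<open>\<open>E\<close> lives over K, whereas the product is an eigenvector only modulo
  \<open>s\<close>, and an element of K need not reduce. The operators are therefore rebuilt without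
  division over any domain with invertible parameters and used over A, over K and over the residue
  field; coefficientwise homomorphisms intertwine the three versions. Removing the lower terms one
  maximal weight at a time requires that the \<open>Y_i\<close> commute. This follows from the braid
  relations, which are checked in the field of fractions of the Laurent ring, where
  \<open>T_i\<close> is a combination of \<open>1\<close> and \<open>s_i\<close>. The Garnir
  relation rests on a count: a letter crossing a block gives \<open>m + 1\<close> nodes, while the
  rest of its own block contributes a polynomial of degree \<open>m - 1\<close> in
  \<open>z + beta / z\<close>. That the factors depend on this combination only is due to the
  parameters \<open>t^l q\<close> of consecutive blocks differing by the factor
  \<open>t\<close>.\<close>

definition rhom :: "('a::comm_ring_1 \<Rightarrow> 'b::comm_ring_1) \<Rightarrow> bool" where
  "rhom h \<longleftrightarrow> h 1 = 1 \<and> (\<forall>x y. h (x + y) = h x + h y) \<and> (\<forall>x y. h (x * y) = h x * h y)"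

lemma rhomD:
  assumes "rhom h"
  shows "h 1 = 1" "h (x + y) = h x + h y" "h (x * y) = h x * h y" "h 0 = 0" "h (- x) = - h x"
    "h (x - y) = h x - h y" "h (x ^ k) = h x ^ k"
proof -
  show 1: "h 1 = 1" and a: "\<And>x y. h (x + y) = h x + h y" and m: "\<And>x y. h (x * y) = h x * h y"
    using assms by (auto simp: rhom_def)
  show z: "h 0 = 0" using a[of 0 0] by simp
  show u: "\<And>x. h (- x) = - h x" using a[of x "-x" for x] z
    by (metis add.right_inverse neg_eq_iff_add_eq_0)
  show "h (x - y) = h x - h y" using a[of x "- y"] u by simp
  show "h (x ^ k) = h x ^ k" by (induction k) (simp_all add: 1 m)
qed

lemma rhom_sum: "rhom h \<Longrightarrow> h (sum f A) = (\<Sum>x\<in>A. h (f x))"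
  by (induction A rule: infinite_finite_induct) (simp_all add: rhomD)

lemma rhom_prod: "rhom h \<Longrightarrow> h (prod f A) = (\<Prod>x\<in>A. h (f x))"
  by (induction A rule: infinite_finite_induct) (simp_all add: rhomD)

lemma rhom_inverse:
  fixes h :: "'a::field \<Rightarrow> 'b::field"
  assumes "rhom h" shows "h (inverse x) = inverse (h x)"
proof (cases "x = 0")
  case False
  then have "h x * h (inverse x) = 1"
    using rhomD(3)[OF assms, of x "inverse x"] rhomD(1)[OF assms] by simp
  then show ?thesis by (metis inverse_unique)
qed (simp add: rhomD(4)[OF assms])

lemma rhom_divide:
  fixes h :: "'a::field \<Rightarrow> 'b::field"
  shows "rhom h \<Longrightarrow> h (x / y) = h x / h y"
  by (simp add: divide_inverse rhomD(3) rhom_inverse)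

lemma rhom_to_fract: "rhom to_fract"
  by (simp add: rhom_def)

text \<open>Meant for injective ring homomorphisms \<open>h\<close>, where all representations of
  \<open>z\<close> give the same value.\<close>

definition fract_map :: "('a::idom \<Rightarrow> 'b::idom) \<Rightarrow> 'a fract \<Rightarrow> 'b fract" where
  "fract_map h z = (SOME u. \<exists>a b. b \<noteq> 0 \<and> z = Fract a b \<and> u = Fract (h a) (h b))"

lemma fract_map_Fract:
  assumes h: "rhom h" and i: "\<And>x. h x = 0 \<Longrightarrow> x = 0" and b: "b \<noteq> 0"
  shows "fract_map h (Fract a b) = Fract (h a) (h b)"
proof -
  let ?P = "\<lambda>u. \<exists>a' b'. b' \<noteq> 0 \<and> Fract a b = Fract a' b' \<and> u = Fract (h a') (h b')"
  have "?P (Fract (h a) (h b))" using b by blast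
  then have "?P (fract_map h (Fract a b))"
    unfolding fract_map_def by (rule someI)
  then obtain a' b' where 1: "b' \<noteq> 0" "Fract a b = Fract a' b'"
    "fract_map h (Fract a b) = Fract (h a') (h b')" by blast
  have "a * b' = a' * b" using 1 b by (simp add: eq_fract)
  then have "h a * h b' = h a' * h b" using rhomD(3)[OF h] by metis
  moreover have "h b \<noteq> 0" "h b' \<noteq> 0" using i b 1 by blast+
  ultimately show ?thesis using 1 by (simp add: eq_fract)
qed

lemma rhom_fract_map:
  assumes h: "rhom h" and i: "\<And>x. h x = 0 \<Longrightarrow> x = 0"
  shows "rhom (fract_map h)"
proof -
  note f = fract_map_Fract[OF h i] and r = rhomD[OF h]
  have nz: "b \<noteq> 0 \<Longrightarrow> h b \<noteq> 0" for b using i by blast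
  have "fract_map h 1 = 1" using f[of 1 1] by (simp add: One_fract_def r)
  moreover have "fract_map h (x + y) = fract_map h x + fract_map h y" for x y
  proof -
    obtain a b c d where "x = Fract a b" "b \<noteq> 0" "y = Fract c d" "d \<noteq> 0"
      by (metis Fract_cases)
    then show ?thesis by (simp add: f r nz)
  qed
  moreover have "fract_map h (x * y) = fract_map h x * fract_map h y" for x y
  proof -
    obtain a b c d where "x = Fract a b" "b \<noteq> 0" "y = Fract c d" "d \<noteq> 0"
      by (metis Fract_cases)
    then show ?thesis by (simp add: f r nz)
  qed
  ultimately show ?thesis by (simp add: rhom_def)
qed

lemma fract_map_to_fract:
  assumes "rhom h" and "\<And>x. h x = 0 \<Longrightarrow> x = 0"
  shows "fract_map h (to_fract x) = to_fract (h x)"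
  using fract_map_Fract[OF assms, of 1 x] by (simp add: to_fract_def rhomD(1)[OF assms(1)])

lemma poly_mapping_sum_single:
  "f = (\<Sum>\<mu>\<in>Poly_Mapping.keys f. Poly_Mapping.single \<mu> (Poly_Mapping.lookup f \<mu>))"
proof (rule poly_mapping_eqI)
  fix k
  have "(\<Sum>\<mu>\<in>Poly_Mapping.keys f. Poly_Mapping.lookup (Poly_Mapping.single \<mu> (Poly_Mapping.lookup f \<mu>)) k)
    = (\<Sum>\<mu>\<in>Poly_Mapping.keys f. if \<mu> = k then Poly_Mapping.lookup f \<mu> else 0)"
    by (intro sum.cong) (auto simp: lookup_single when_def)
  then show "Poly_Mapping.lookup f k = Poly_Mapping.lookup
    (\<Sum>\<mu>\<in>Poly_Mapping.keys f. Poly_Mapping.single \<mu> (Poly_Mapping.lookup f \<mu>)) k"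
    by (simp add: lookup_sum sum.delta in_keys_iff)
qed

text \<open>The additive step is for arbitrary \<open>f\<close> and \<open>g\<close>, so that
  identities between additive maps are checked on monomials alone.\<close>

lemma poly_mapping_additive_induct [case_names zero single add]:
  fixes f :: "'a \<Rightarrow>\<^sub>0 'b::comm_monoid_add"
  assumes z: "P 0" and s: "\<And>\<mu> c. P (Poly_Mapping.single \<mu> c)"
    and a: "\<And>f g. P f \<Longrightarrow> P g \<Longrightarrow> P (f + g)"
  shows "P f"
proof -
  have "P (\<Sum>\<mu>\<in>A. Poly_Mapping.single \<mu> (Poly_Mapping.lookup f \<mu>))" for A
    by (induction A rule: infinite_finite_induct) (simp_all add: z s a)
  then show ?thesis using poly_mapping_sum_single[of f] by metis
qed

lemma rhom_poly_mappingI: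
  fixes h :: "('m::comm_monoid_add \<Rightarrow>\<^sub>0 'a::comm_ring_1) \<Rightarrow> 'b::comm_ring_1"
  assumes a: "\<And>f g. h (f + g) = h f + h g" and o: "h 1 = 1"
    and m: "\<And>\<mu> \<nu> a b. h (Poly_Mapping.single \<mu> a * Poly_Mapping.single \<nu> b)
      = h (Poly_Mapping.single \<mu> a) * h (Poly_Mapping.single \<nu> b)"
  shows "rhom h"
proof -
  have z: "h 0 = 0" using a[of 0 0] by simp
  have 1: "h (Poly_Mapping.single \<mu> x * g) = h (Poly_Mapping.single \<mu> x) * h g" for \<mu> x g
    by (induction g rule: poly_mapping_additive_induct) (simp_all add: z m a algebra_simps)
  have "h (f * g) = h f * h g" for f g
    by (induction f rule: poly_mapping_additive_induct) (simp_all add: z 1 a distrib_right)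
  then show ?thesis using a o by (simp add: rhom_def)
qed

definition lin_ext :: "('m \<Rightarrow> 'a::zero \<Rightarrow> 'b::comm_monoid_add) \<Rightarrow> ('m \<Rightarrow>\<^sub>0 'a) \<Rightarrow> 'b" where
  "lin_ext B f = (\<Sum>\<mu>\<in>Poly_Mapping.keys f. B \<mu> (Poly_Mapping.lookup f \<mu>))"

lemma lin_ext_add:
  assumes "\<And>\<mu>. B \<mu> 0 = 0" "\<And>\<mu> a b. B \<mu> (a + b) = B \<mu> a + B \<mu> b"
  shows "lin_ext B (f + g) = lin_ext B f + lin_ext B g"
  unfolding lin_ext_def by (rule setsum_keys_plus_distrib) (simp_all add: assms)

lemma lin_ext_single: "B \<mu> 0 = 0 \<Longrightarrow> lin_ext B (Poly_Mapping.single \<mu> c) = B \<mu> c"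
  by (simp add: lin_ext_def)

lemma lin_ext_0 [simp]: "lin_ext B 0 = 0"
  by (simp add: lin_ext_def)

lemma const_mult_single: "const a * Poly_Mapping.single \<mu> c = Poly_Mapping.single \<mu> (a * c)"
  by (simp add: const_def mult_single)

lemma lookup_const_mult: "Poly_Mapping.lookup (const a * f) \<mu> = a * Poly_Mapping.lookup f \<mu>"
  by (induction f rule: poly_mapping_additive_induct)
    (simp_all add: const_mult_single lookup_single lookup_add distrib_left when_def)

lemma rhom_const: "rhom const"
  by (simp add: rhom_def const_def single_add mult_single)

lemma const_eq_iff: "const a = const b \<longleftrightarrow> a = b"
  unfolding const_def by (metis lookup_single_eq)

lemma rhom_map:
  assumes "rhom h"
  shows "rhom (Poly_Mapping.map h :: ('m::comm_monoid_add \<Rightarrow>\<^sub>0 'a::comm_ring_1) \<Rightarrow> 'm \<Rightarrow>\<^sub>0 'b::comm_ring_1)"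
proof (rule rhom_poly_mappingI)
  note r = rhomD[OF assms]
  have l: "Poly_Mapping.lookup (Poly_Mapping.map h f) \<mu> = h (Poly_Mapping.lookup f \<mu>)" for f :: "'m \<Rightarrow>\<^sub>0 'a" and \<mu>
    by (simp add: map.rep_eq when_def r)
  show "Poly_Mapping.map h (f + g) = Poly_Mapping.map h f + Poly_Mapping.map h g" for f g :: "'m \<Rightarrow>\<^sub>0 'a"
    by (rule poly_mapping_eqI) (simp add: l lookup_add r)
  show "Poly_Mapping.map h (1 :: 'm \<Rightarrow>\<^sub>0 'a) = 1"
    by (rule poly_mapping_eqI) (simp add: l lookup_one when_def r)
  show "Poly_Mapping.map h (Poly_Mapping.single \<mu> a * Poly_Mapping.single \<nu> b)
      = Poly_Mapping.map h (Poly_Mapping.single \<mu> a) * Poly_Mapping.map h (Poly_Mapping.single \<nu> b)"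
    for \<mu> \<nu> :: 'm and a b
    by (simp add: mult_single r)
qed

lemma lookup_map_rhom:
  "rhom h \<Longrightarrow> Poly_Mapping.lookup (Poly_Mapping.map h f) \<mu> = h (Poly_Mapping.lookup f \<mu>)"
  by (simp add: map.rep_eq when_def rhomD)

lemma map_const: "rhom h \<Longrightarrow> Poly_Mapping.map h (const c) = const (h c)"
  by (simp add: const_def rhomD)

lemma map_xpow: "rhom h \<Longrightarrow> Poly_Mapping.map h (xpow i e) = xpow i e"
  by (simp add: xpow_def rhomD)

section \<open>Reflections of weights\<close>

text \<open>The exponent of \<open>Z^r\<close>, where \<open>1 - Z\<close> is the denominator
  occurring in \<open>T_i\<close>. For \<open>i = 0\<close> the power of \<open>q\<close> in
  \<open>Z\<close> is carried separately by \<open>zc\<close>.\<close>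

definition zw :: "nat \<Rightarrow> nat \<Rightarrow> int \<Rightarrow> weight" where
  "zw n i r = (if i = 0 then Poly_Mapping.single 1 (-2 * r) else if i = n then Poly_Mapping.single n (2 * r)
     else Poly_Mapping.single i r - Poly_Mapping.single (Suc i) r)"

text \<open>The multiple of \<open>zw n i 1\<close> by which the linear part of \<open>s_i\<close>
  moves \<open>\<mu>\<close>, that is, minus the pairing with the coroot.\<close>

definition dd :: "nat \<Rightarrow> nat \<Rightarrow> weight \<Rightarrow> int" where
  "dd n i \<mu> = (if i = 0 then Poly_Mapping.lookup \<mu> 1 else if i = n then - Poly_Mapping.lookup \<mu> n
     else Poly_Mapping.lookup \<mu> (Suc i) - Poly_Mapping.lookup \<mu> i)"

definition rw :: "nat \<Rightarrow> nat \<Rightarrow> weight \<Rightarrow> weight" where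
  "rw n i = (if i = 0 then negate_coord 1 else simple_refl n i)"

lemma lookup_negate_coord:
  "Poly_Mapping.lookup (negate_coord i \<mu>) j = (if j = i then - Poly_Mapping.lookup \<mu> i else Poly_Mapping.lookup \<mu> j)"
  by (simp add: negate_coord_def lookup_update)

lemma lookup_swap_coords:
  "Poly_Mapping.lookup (swap_coords i j \<mu>) k = Poly_Mapping.lookup \<mu> (Transposition.transpose i j k)"
  unfolding swap_coords_def by (subst map_key.rep_eq) simp_all

lemma lookup_rw:
  "Poly_Mapping.lookup (rw n i \<mu>) k = (if i = 0 then (if k = 1 then - Poly_Mapping.lookup \<mu> 1 else Poly_Mapping.lookup \<mu> k)
    else if i = n then (if k = n then - Poly_Mapping.lookup \<mu> n else Poly_Mapping.lookup \<mu> k)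
    else if k = i then Poly_Mapping.lookup \<mu> (Suc i) else if k = Suc i then Poly_Mapping.lookup \<mu> i
    else Poly_Mapping.lookup \<mu> k)"
  by (auto simp: rw_def simple_refl_def lookup_negate_coord lookup_swap_coords Transposition.transpose_def)

lemma rw_eq: "rw n i \<mu> = \<mu> + zw n i (dd n i \<mu>)"
  by (rule poly_mapping_eqI)
    (auto simp: lookup_rw zw_def dd_def lookup_add lookup_minus lookup_single when_def)

lemma rw_add: "rw n i (\<mu> + \<nu>) = rw n i \<mu> + rw n i \<nu>"
  by (rule poly_mapping_eqI) (auto simp: lookup_rw lookup_add)

lemma rw_0 [simp]: "rw n i 0 = 0"
  by (rule poly_mapping_eqI) (auto simp: lookup_rw)

lemma rw_rw [simp]: "rw n i (rw n i \<mu>) = \<mu>"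
  by (rule poly_mapping_eqI) (auto simp: lookup_rw)

lemma dd_rw: "dd n i (rw n i \<mu>) = - dd n i \<mu>"
  by (auto simp: lookup_rw dd_def)

lemma dd_add: "dd n i (\<mu> + \<nu>) = dd n i \<mu> + dd n i \<nu>"
  by (auto simp: dd_def lookup_add)

lemma dd_0 [simp]: "dd n i 0 = 0"
  by (auto simp: dd_def)

lemma zw_add: "zw n i (r + s) = zw n i r + zw n i s"
  by (rule poly_mapping_eqI)
    (auto simp: zw_def lookup_add lookup_minus lookup_single when_def algebra_simps)

lemma zw_0 [simp]: "zw n i 0 = 0"
  by (auto simp: zw_def)

lemma dd_zw: "dd n i (zw n i r) = - 2 * r"
  by (auto simp: dd_def zw_def lookup_single lookup_minus when_def)

lemma zw_eq_0_iff: "zw n i r = 0 \<longleftrightarrow> r = 0"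
  using dd_zw[of n i r] by auto

text \<open>Integer powers in a ring where the inverse is supplied as an element, since A is not a
  field.\<close>

definition upow :: "'a::monoid_mult \<Rightarrow> 'a \<Rightarrow> int \<Rightarrow> 'a" where
  "upow a b r = (if 0 \<le> r then a ^ nat r else b ^ nat (- r))"

lemma upow_0 [simp]: "upow a b 0 = 1" and upow_1 [simp]: "upow a b 1 = a"
  and upow_m1 [simp]: "upow a b (-1) = b"
  by (simp_all add: upow_def)

lemma upow_suc:
  fixes a b :: "'a::comm_ring_1"
  assumes "a * b = 1"
  shows "upow a b (r + 1) = a * upow a b r"
proof -
  consider "r \<ge> 0" | "r < 0" by linarith
  then show ?thesis
  proof cases
    case 1 then show ?thesis by (simp add: upow_def nat_add_distrib)
  next
    case 2
    then have "nat (- r) = Suc (nat (- (r + 1)))" by simp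
    then show ?thesis using 2 assms
      by (simp add: upow_def flip: mult.assoc)
  qed
qed

lemma upow_add:
  fixes a b :: "'a::comm_ring_1"
  assumes "a * b = 1"
  shows "upow a b (r + s) = upow a b r * upow a b s"
proof (induction s rule: int_induct[where k = 0])
  case (step1 i)
  then show ?case using upow_suc[OF assms, of "r + i"] upow_suc[OF assms, of i]
    by (simp add: algebra_simps)
next
  case (step2 i)
  have "b * upow a b (j + 1) = upow a b j" for j
    using upow_suc[OF assms, of j] assms by (simp add: mult.commute flip: mult.assoc)
  from this[of "r + i - 1"] this[of "i - 1"]
  have "b * upow a b (r + i) = upow a b (r + (i - 1))" "b * upow a b i = upow a b (i - 1)"
    by (simp_all add: algebra_simps)
  then show ?case using step2 by (metis mult.left_commute)
qed simp

lemma rhom_upow: "rhom h \<Longrightarrow> h (upow a b r) = upow (h a) (h b) r"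
  by (simp add: upow_def rhomD)

lemma upow_field:
  fixes a :: "'a::field" assumes "a * b = 1"
  shows "upow a b r = a powi r"
proof -
  have "b = inverse a" using assms by (simp add: inverse_unique)
  then show ?thesis by (simp add: upow_def power_int_def)
qed

section \<open>Demazure--Lusztig operators\<close>

text \<open>The square roots of the parameters and their inverses lie in an arbitrary domain, so
  that the results apply to A, to K and to the residue field alike.\<close>

locale koornwinder_params =
  fixes n :: nat and P Pi :: "param \<Rightarrow> 'r::idom"
  assumes P_Pi: "\<And>p. P p * Pi p = 1" and n_ge: "2 \<le> n"
begin

definition tau :: "nat \<Rightarrow> 'r" where
  "tau i = P (if i = 0 then ParT0 else if i = n then ParTn else ParT)"

definition taui :: "nat \<Rightarrow> 'r" where
  "taui i = Pi (if i = 0 then ParT0 else if i = n then ParTn else ParT)"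

definition qpow :: "int \<Rightarrow> 'r" where "qpow = upow (P ParQ ^ 2) (Pi ParQ ^ 2)"

definition zc :: "nat \<Rightarrow> int \<Rightarrow> 'r" where
  "zc i r = (if i = 0 then qpow r else 1)"

definition Zm :: "nat \<Rightarrow> int \<Rightarrow> 'r laurent" where
  "Zm i r = Poly_Mapping.single (zw n i r) (zc i r)"

text \<open>The quotient \<open>(Z^d - 1) / (1 - Z)\<close>, written as a geometric sum on either
  side of zero to avoid division.\<close>

definition geo :: "nat \<Rightarrow> int \<Rightarrow> 'r laurent" where
  "geo i d = (if 0 \<le> d then - (\<Sum>r\<in>{0..<d}. Zm i r) else (\<Sum>r\<in>{d..<0}. Zm i r))"

definition num :: "nat \<Rightarrow> 'r laurent" where
  "num i = (if i = 0 then (1 - const (P ParQ * P ParT0 * P ParU0) * xpow 1 (-1)) *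
                          (1 - const (- (P ParQ * P ParT0 * Pi ParU0)) * xpow 1 (-1))
     else if i = n then (1 - const (P ParTn * P ParUn) * xpow n 1) * (1 - const (- (P ParTn * Pi ParUn)) * xpow n 1)
     else 1 - const (P ParT ^ 2) * xpow i 1 * xpow (Suc i) (-1))"

definition sact :: "nat \<Rightarrow> 'r laurent \<Rightarrow> 'r laurent" where
  "sact i = lin_ext (\<lambda>\<mu> c. Poly_Mapping.single (rw n i \<mu>) (c * zc i (dd n i \<mu>)))"

text \<open>The divided difference \<open>(s_i f - f) / (1 - Z)\<close>, given on monomials by
  \<open>geo\<close>.\<close>

definition del :: "nat \<Rightarrow> 'r laurent \<Rightarrow> 'r laurent" where
  "del i = lin_ext (\<lambda>\<mu> c. geo i (dd n i \<mu>) * Poly_Mapping.single \<mu> c)"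

definition T :: "nat \<Rightarrow> 'r laurent \<Rightarrow> 'r laurent" where
  "T i f = const (tau i) * f + const (taui i) * (num i * del i f)"

text \<open>The inverse of \<open>T i\<close>, in the form dictated by the quadratic
  relation.\<close>

definition Ti :: "nat \<Rightarrow> 'r laurent \<Rightarrow> 'r laurent" where
  "Ti i f = T i f - const (tau i - taui i) * f"

lemma tau_taui: "tau i * taui i = 1"
  by (simp add: tau_def taui_def P_Pi)

lemma qpow_add: "qpow (r + s) = qpow r * qpow s"
  unfolding qpow_def by (rule upow_add) (metis P_Pi power_mult_distrib power_one)

lemma qpow_0 [simp]: "qpow 0 = 1" by (simp add: qpow_def)

lemma zc_add: "zc i (r + s) = zc i r * zc i s"
  by (simp add: zc_def qpow_add)

lemma zc_0 [simp]: "zc i 0 = 1" by (simp add: zc_def)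

lemma zc_neg: "zc i r * zc i (- r) = 1"
  using zc_add[of i r "-r"] by simp

lemma Zm_add: "Zm i (r + s) = Zm i r * Zm i s"
  by (simp add: Zm_def mult_single zw_add zc_add)

lemma Zm_0 [simp]: "Zm i 0 = 1" by (simp add: Zm_def)

lemma geo_suc: "geo i (d + 1) = geo i d - Zm i d"
proof (cases "0 \<le> d")
  case True
  then have "{0..<d+1} = insert d {0..<d}" by auto
  then show ?thesis using True by (simp add: geo_def)
next
  case False
  then have "{d..<0} = insert d {d+1..<0}" by auto
  then show ?thesis using False by (auto simp: geo_def)
qed

lemma geo_0 [simp]: "geo i 0 = 0" by (simp add: geo_def)

lemma one_minus_Zm_geo: "(1 - Zm i 1) * geo i d = Zm i d - 1"
proof (induction d rule: int_induct[where k = 0])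
  case (step1 d)
  then show ?case by (simp only: geo_suc Zm_add right_diff_distrib) (simp add: algebra_simps)
next
  case (step2 d)
  have "geo i d = geo i (d - 1) - Zm i (d - 1)" "Zm i d = Zm i (d - 1) * Zm i 1"
    using geo_suc[of i "d - 1"] Zm_add[of i "d - 1" 1] by simp_all
  then have "(1 - Zm i 1) * (geo i (d - 1) - Zm i (d - 1)) = Zm i (d - 1) * Zm i 1 - 1"
    using step2(2) by simp
  then show ?case by algebra
qed simp

lemma sact_add: "sact i (f + g) = sact i f + sact i g"
  unfolding sact_def by (rule lin_ext_add) (simp_all add: algebra_simps single_add)

lemma sact_single: "sact i (Poly_Mapping.single \<mu> c) = Poly_Mapping.single (rw n i \<mu>) (c * zc i (dd n i \<mu>))"
  unfolding sact_def by (rule lin_ext_single) simp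

lemma del_add: "del i (f + g) = del i f + del i g"
  unfolding del_def by (rule lin_ext_add) (simp_all add: algebra_simps single_add)

lemma del_single: "del i (Poly_Mapping.single \<mu> c) = geo i (dd n i \<mu>) * Poly_Mapping.single \<mu> c"
  unfolding del_def by (rule lin_ext_single) simp

lemma del_0 [simp]: "del i 0 = 0" by (simp add: del_def)
lemma sact_0 [simp]: "sact i 0 = 0" by (simp add: sact_def)

lemma rhom_sact: "rhom (sact i)"
proof (rule rhom_poly_mappingI)
  show "sact i 1 = 1" using sact_single[of i 0 1] by simp
qed (simp_all add: sact_add sact_single mult_single rw_add dd_add zc_add ac_simps)

lemma sact_sact [simp]: "sact i (sact i f) = f"
  by (induction f rule: poly_mapping_additive_induct)
    (simp_all add: sact_add sact_single dd_rw zc_neg mult.assoc)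

lemma sact_eq_0: "sact i f = 0 \<Longrightarrow> f = 0"
  using sact_sact[of i f] by simp

lemma sact_const [simp]: "sact i (const c) = const c"
  by (simp add: const_def sact_single)

text \<open>As \<open>1 - Zm i 1\<close> is nonzero, this identity determines \<open>del\<close> and
  connects it with \<open>exact_quot\<close>.\<close>

lemma one_minus_Zm_del: "(1 - Zm i 1) * del i f = sact i f - f"
proof (induction f rule: poly_mapping_additive_induct)
  case (single \<mu> c)
  have "(1 - Zm i 1) * (geo i (dd n i \<mu>) * Poly_Mapping.single \<mu> c) = (Zm i (dd n i \<mu>) - 1) * Poly_Mapping.single \<mu> c"
    using one_minus_Zm_geo[of i "dd n i \<mu>"] by (simp flip: mult.assoc)
  then show ?case
    by (simp add: del_single sact_single Zm_def algebra_simps mult_single rw_eq)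
qed (simp_all add: del_add sact_add distrib_left)

lemma Zm_ne_1: "Zm i 1 \<noteq> 1"
proof
  assume "Zm i 1 = 1"
  then have "Poly_Mapping.lookup (Zm i 1) (zw n i 1) = Poly_Mapping.lookup 1 (zw n i 1)" by simp
  moreover have "zc i 1 \<noteq> 0" using zc_neg[of i 1] by auto
  ultimately show False by (simp add: Zm_def lookup_one zw_eq_0_iff when_def)
qed

lemma T_add: "T i (f + g) = T i f + T i g"
  by (simp add: T_def del_add algebra_simps)

lemma del_const_mult: "del i (const c * f) = const c * del i f"
proof (induction f rule: poly_mapping_additive_induct)
  case (single \<mu> d)
  show ?case by (simp add: const_mult_single del_single mult.left_commute[of "const c"])
qed (simp_all add: del_add distrib_left)

lemma T_const_mult: "T i (const c * f) = const c * T i f"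
  by (simp only: T_def del_const_mult) (simp add: algebra_simps)

lemma Zm_1: "Zm i 1 = (if i = 0 then const (P ParQ ^ 2) * xpow 1 (-2) else if i = n then xpow n 2
   else xpow i 1 * xpow (Suc i) (-1))"
proof -
  have "Poly_Mapping.single (Suc i) (-1) = - (Poly_Mapping.single (Suc i) 1 :: weight)"
    by (rule single_uminus)
  then show ?thesis
    by (auto simp: Zm_def zw_def zc_def const_def xpow_def mult_single qpow_def)
qed

section \<open>Extension to the field of fractions\<close>

definition sL :: "nat \<Rightarrow> 'r laurent fract \<Rightarrow> 'r laurent fract" where
  "sL i = fract_map (sact i)"

lemma rhom_sL: "rhom (sL i)"
  unfolding sL_def by (rule rhom_fract_map[OF rhom_sact sact_eq_0])

lemma sL_to_fract [simp]: "sL i (to_fract f) = to_fract (sact i f)"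
  unfolding sL_def by (rule fract_map_to_fract[OF rhom_sact sact_eq_0])

lemma rhom_ext_fract:
  assumes "rhom h" "rhom h'" "\<And>f. h (to_fract f) = h' (to_fract f)"
  shows "h (u::'x::idom fract) = (h' u :: 'y::field)"
proof (cases u)
  case (Fract a b)
  then have "u = to_fract a / to_fract b" by (simp add: Fract_conv_to_fract)
  then show ?thesis by (simp add: rhom_divide assms)
qed

lemma rhom_comp: "rhom f \<Longrightarrow> rhom g \<Longrightarrow> rhom (\<lambda>x. f (g x))"
  by (simp add: rhom_def)

lemma rhom_id: "rhom (\<lambda>x. x)"
  by (simp add: rhom_def)

lemma sL_sL [simp]: "sL i (sL i u) = u"
  by (rule rhom_ext_fract[OF rhom_comp[OF rhom_sL rhom_sL] rhom_id]) simp

definition cst :: "'r \<Rightarrow> 'r laurent fract" where "cst c = to_fract (const c)"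

lemma rhom_cst: "rhom cst"
  unfolding cst_def by (rule rhom_comp[OF rhom_to_fract rhom_const])

lemma sL_cst [simp]: "sL i (cst c) = cst c"
  by (simp add: cst_def)

definition zL :: "nat \<Rightarrow> 'r laurent fract" where "zL i = to_fract (Zm i 1)"

definition cL :: "nat \<Rightarrow> 'r laurent fract" where
  "cL i = cst (taui i) * to_fract (num i) / (1 - zL i)"

text \<open>Here \<open>s_i\<close> is a field automorphism and \<open>T_i\<close> becomes
  \<open>t + c (s_i - 1)\<close>, so relations between operators reduce to relations between the
  coefficients \<open>c\<close>.\<close>

definition TL :: "nat \<Rightarrow> 'r laurent fract \<Rightarrow> 'r laurent fract" where
  "TL i u = cst (tau i) * u + cL i * (sL i u - u)"

lemma zL_ne_1: "zL i \<noteq> 1"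
  unfolding zL_def using Zm_ne_1[of i] by (metis to_fract_1 to_fract_eq_iff)

lemma T_fract: "to_fract (T i f) = TL i (to_fract f)"
proof -
  have "(1 - zL i) * to_fract (del i f) = sL i (to_fract f) - to_fract f"
    using arg_cong[OF one_minus_Zm_del[of i f], of to_fract] by (simp add: zL_def)
  then have "to_fract (del i f) = (sL i (to_fract f) - to_fract f) / (1 - zL i)"
    using zL_ne_1[of i] by (simp add: field_simps)
  then show ?thesis by (simp add: TL_def T_def cL_def cst_def)
qed

end

section \<open>Quadratic and braid relations\<close>

text \<open>Since \<open>s c = t + t' - c\<close>, expanding \<open>T (T u)\<close> with
  \<open>t * t' = 1\<close> leaves the quadratic relation.\<close>

lemma quadratic_relation:
  fixes s :: "'a::field \<Rightarrow> 'a"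
  assumes h: "rhom s" and i: "\<And>u. s (s u) = u" and c: "c + s c = t + t'" and st: "s t = t" and tt: "t * t' = 1"
    and T: "\<And>u. T u = t * u + c * (s u - u)"
  shows "T (T u) = (t - t') * T u + u"
proof -
  note r = rhomD[OF h]
  have sc: "s c = t + t' - c" using c by algebra
  show ?thesis unfolding T r i st sc using tt by algebra
qed

lemma commuting_operators:
  fixes s1 s2 :: "'a::field \<Rightarrow> 'a"
  assumes h: "rhom s1" "rhom s2" and c: "\<And>u. s1 (s2 u) = s2 (s1 u)"
    and v: "s1 c2 = c2" "s2 c1 = c1" "s1 t2 = t2" "s2 t1 = t1"
    and T1: "\<And>u. T1 u = t1 * u + c1 * (s1 u - u)"
    and T2: "\<And>u. T2 u = t2 * u + c2 * (s2 u - u)"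
  shows "T1 (T2 u) = T2 (T1 u)"
proof -
  note r = rhomD[OF h(1)] rhomD[OF h(2)]
  show ?thesis unfolding T1 T2 r v c by algebra
qed

text \<open>\<open>p1\<close>, \<open>p2\<close> and \<open>p\<close> stand for
  \<open>1 / (1 - z)\<close> at the two simple roots and at their sum; \<open>rel\<close> is the
  addition law for \<open>z = z1 * z2\<close>. With these as unknowns the braid relation is a
  polynomial identity.\<close>

lemma braid_relation_A2_aux:
  fixes s1 s2 :: "'a::field \<Rightarrow> 'a"
  assumes h: "rhom s1" "rhom s2" and i: "\<And>u. s1 (s1 u) = u" "\<And>u. s2 (s2 u) = u"
    and br: "\<And>u. s1 (s2 (s1 u)) = s2 (s1 (s2 u))"
    and v: "s1 p1 = 1 - p1" "s1 p2 = p" "s1 p = p2" "s2 p1 = p" "s2 p = p1" "s2 p2 = 1 - p2"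
      "s1 g = g" "s2 g = g" "s1 t = t" "s2 t = t"
    and rel: "p1 * p2 = p * (p1 + p2 - 1)"
    and T1: "\<And>u. T1 u = t * u + (t + g * p1) * (s1 u - u)"
    and T2: "\<And>u. T2 u = t * u + (t + g * p2) * (s2 u - u)"
  shows "T1 (T2 (T1 u)) = T2 (T1 (T2 u))"
proof -
  note r = rhomD[OF h(1)] rhomD[OF h(2)]
  have br': "s2 (s1 (s2 u)) = s1 (s2 (s1 u))" for u using br by simp
  have "T1 (T2 (T1 u)) - T2 (T1 (T2 u)) = 0"
    apply (simp only: T1 T2 r v i br')
    using rel by algebra
  then show ?thesis by simp
qed

text \<open>\<open>p1\<close> and \<open>p2\<close> belong to the two roots exchanged by
  \<open>s2\<close>, \<open>X\<close> and \<open>Y\<close> to the two exchanged by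
  \<open>s1\<close>; \<open>rel\<close> ties the four together.\<close>

lemma braid_relation_B2_aux:
  fixes s1 s2 :: "'a::field \<Rightarrow> 'a"
  assumes h: "rhom s1" "rhom s2" and i: "\<And>u. s1 (s1 u) = u" "\<And>u. s2 (s2 u) = u"
    and br: "\<And>u. s1 (s2 (s1 (s2 u))) = s2 (s1 (s2 (s1 u)))"
    and v: "s1 p1 = 1 - p1" "s1 p2 = p2" "s1 X = Y" "s1 Y = X"
      "s2 p1 = p2" "s2 p2 = p1" "s2 X = g2 - X" "s2 Y = Y"
      "s1 g1 = g1" "s2 g1 = g1" "s1 g2 = g2" "s2 g2 = g2"  "s1 t1 = t1" "s2 t1 = t1" "s1 t2 = t2" "s2 t2 = t2"
    and rel: "p1 * (X - Y) = p2 * (X + Y - g2) - Y"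
    and T1: "\<And>u. T1 u = t1 * s1 u + g1 * p1 * (s1 u - u)"
    and T2: "\<And>u. T2 u = t2 * s2 u + X * (s2 u - u)"
  shows "T1 (T2 (T1 (T2 u))) = T2 (T1 (T2 (T1 u)))"
proof -
  note r = rhomD[OF h(1)] rhomD[OF h(2)]
  have br': "s2 (s1 (s2 (s1 u))) = s1 (s2 (s1 (s2 u)))" for u using br by simp
  have "T1 (T2 (T1 (T2 u))) - T2 (T1 (T2 (T1 u))) = 0"
    apply (simp only: T1 T2 r v i br')
    using rel by algebra
  then show ?thesis by simp
qed

lemma braid_relation_A2:
  fixes s1 s2 :: "'a::field \<Rightarrow> 'a"
  assumes h: "rhom s1" "rhom s2" and i: "\<And>u. s1 (s1 u) = u" "\<And>u. s2 (s2 u) = u"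
    and br: "\<And>u. s1 (s2 (s1 u)) = s2 (s1 (s2 u))"
    and v: "s1 x = y" "s1 y = x" "s1 z = z" "s2 x = x" "s2 y = z" "s2 z = y"
      "s1 g = g" "s2 g = g" "s1 t = t" "s2 t = t"
    and nz: "x \<noteq> 0" "x \<noteq> y"
    and T1: "\<And>u. T1 u = t * u + (t + g / (1 - x / y)) * (s1 u - u)"
    and T2: "\<And>u. T2 u = t * u + (t + g / (1 - y / z)) * (s2 u - u)"
  shows "T1 (T2 (T1 u)) = T2 (T1 (T2 u))"
proof -
  note r = rhomD[OF h(1)] rhomD[OF h(2)] rhom_divide[OF h(1)] rhom_divide[OF h(2)]
  have 1: "y \<noteq> 0" using nz v r(4) i by metis
  have 2: "z \<noteq> 0" using 1 v r i by metis
  have 3: "x \<noteq> z" using nz(2) v i by metis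
  have 4: "y \<noteq> z" using 3 v i by metis
  show ?thesis
  proof (rule braid_relation_A2_aux[OF h i br, where t = t and g = g and p = "1 / (1 - x / z)"
        and ?p1.0 = "1 / (1 - x / y)" and ?p2.0 = "1 / (1 - y / z)"])
    show "s1 (1 / (1 - x / y)) = 1 - 1 / (1 - x / y)" using nz 1 by (simp add: r v field_simps)
    show "s2 (1 / (1 - y / z)) = 1 - 1 / (1 - y / z)" using 1 2 4 by (simp add: r v field_simps)
    have "1 / (1 - x / y) = y / (y - x)" "1 / (1 - y / z) = z / (z - y)" "1 / (1 - x / z) = z / (z - x)"
      using 1 2 by (simp_all add: divide_simps)
    moreover have "y / (y - x) * (z / (z - y)) = z / (z - x) * (y / (y - x) + z / (z - y) - 1)"
      using nz 3 4 by (simp add: divide_simps) algebra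
    ultimately show "1 / (1 - x / y) * (1 / (1 - y / z)) = 1 / (1 - x / z) * (1 / (1 - x / y) + 1 / (1 - y / z) - 1)"
      by simp
  qed (simp_all add: r v T1 T2)
qed

text \<open>The numerator \<open>g2 - ups * x\<close> fits both ends of the diagram. The
  nonvanishing of all other denominators is carried over from \<open>nz\<close> by the
  automorphisms.\<close>

lemma braid_relation_B2:
  fixes s1 s2 :: "'a::field \<Rightarrow> 'a"
  assumes h: "rhom s1" "rhom s2" and i: "\<And>u. s1 (s1 u) = u" "\<And>u. s2 (s2 u) = u"
    and br: "\<And>u. s1 (s2 (s1 (s2 u))) = s2 (s1 (s2 (s1 u)))"
    and v: "s1 x = y" "s1 y = x" "s2 x = 1 / x" "s2 y = y"
      "s1 g1 = g1" "s2 g1 = g1" "s1 g2 = g2" "s2 g2 = g2"  "s1 t1 = t1" "s2 t1 = t1" "s1 t2 = t2" "s2 t2 = t2"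
      "s1 ups = ups" "s2 ups = ups"
    and nz: "x \<noteq> 0" "x \<noteq> y" "x^2 \<noteq> 1"
    and T1: "\<And>u. T1 u = t1 * u + (t1 + g1 / (1 - y / x)) * (s1 u - u)"
    and T2: "\<And>u. T2 u = t2 * u + (t2 + (g2 - ups * x) / (1 - x^2)) * (s2 u - u)"
  shows "T1 (T2 (T1 (T2 u))) = T2 (T1 (T2 (T1 u)))"
proof -
  note r = rhomD[OF h(1)] rhomD[OF h(2)] rhom_divide[OF h(1)] rhom_divide[OF h(2)]
  have 1: "y \<noteq> 0" using nz v r(4) i by metis
  have 2: "y^2 \<noteq> 1" using nz(3) v r i by metis
  have 3: "1 / x \<noteq> y" using nz(2) v i by metis
  then have 3: "x * y \<noteq> 1" using nz by (simp add: field_simps)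
  have e: "1 / (1 - y / x) = x / (x - y)" using nz by (simp add: divide_simps)
  show ?thesis
  proof (rule braid_relation_B2_aux[OF h i br, where ?t1.0 = t1 and ?t2.0 = t2 and ?g1.0 = g1 and ?g2.0 = g2
      and ?p1.0 = "1 / (1 - y / x)" and ?p2.0 = "1 / (1 - x * y)" and X = "(g2 - ups * x) / (1 - x^2)"
      and Y = "(g2 - ups * y) / (1 - y^2)"])
    show "s1 (1 / (1 - y / x)) = 1 - 1 / (1 - y / x)" using nz 1 by (simp add: r v field_simps)
    have "1 / (1 - (1/x)^2) = - (x^2) / (1 - x^2)" using nz by (simp add: divide_simps) algebra
    then have "(g2 - ups / x) / (1 - (1/x)^2) = (g2 - ups / x) * (- (x^2) / (1 - x^2))"
      by (metis divide_inverse mult_1)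
    also have "\<dots> = g2 - (g2 - ups * x) / (1 - x^2)"
      using nz by (simp add: divide_simps) algebra
    finally show "s2 ((g2 - ups * x) / (1 - x^2)) = g2 - (g2 - ups * x) / (1 - x^2)"
      by (simp add: r v)
    show "1 / (1 - y / x) * ((g2 - ups * x) / (1 - x\<^sup>2) - (g2 - ups * y) / (1 - y\<^sup>2)) =
      1 / (1 - x * y) * ((g2 - ups * x) / (1 - x\<^sup>2) + (g2 - ups * y) / (1 - y\<^sup>2) - g2) - (g2 - ups * y) / (1 - y\<^sup>2)"
      unfolding e using nz 2 3 by (simp add: divide_simps) algebra
    show "s2 (1 / (1 - y / x)) = 1 / (1 - x * y)" "s2 (1 / (1 - x * y)) = 1 / (1 - y / x)"
      using nz 1 by (simp_all add: r v mult.commute)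
  qed (simp_all add: r v T1 T2 algebra_simps)
qed

context koornwinder_params
begin

section \<open>The coefficients of the operators as rational functions\<close>

definition xL :: "nat \<Rightarrow> 'r laurent fract" where "xL j = to_fract (xpow j 1)"

lemma xpow_add: "xpow j (a + b) = xpow j a * (xpow j b :: 'a::comm_ring_1 laurent)"
  by (simp add: xpow_def mult_single single_add)

lemma xpow_0 [simp]: "xpow j 0 = 1" by (simp add: xpow_def)

lemma xL_nz [simp]: "xL j \<noteq> 0"
proof -
  have "xpow j 1 * xpow j (-1) = (1 :: 'r laurent)" by (simp flip: xpow_add)
  then show ?thesis unfolding xL_def by auto
qed

lemma xpow_m1_fract: "to_fract (xpow j (-1)) = 1 / xL j"
proof -
  have "xpow j 1 * xpow j (-1) = (1 :: 'r laurent)" by (simp flip: xpow_add)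
  then have "xL j * to_fract (xpow j (-1)) = 1"
    unfolding xL_def by (metis to_fract_1 to_fract_mult)
  then show ?thesis using xL_nz[of j] by (simp add: field_simps)
qed

lemma xpow_2: "xpow j 2 = (xpow j 1 :: 'a::comm_ring_1 laurent) ^ 2"
  and xpow_m2: "xpow j (-2) = (xpow j (-1) :: 'a laurent) ^ 2"
  by (simp_all add: power2_eq_square flip: xpow_add)

lemma to_fract_power: "to_fract (x ^ k) = to_fract x ^ k"
  by (rule rhomD(7)[OF rhom_to_fract])

lemma cst_nz: "cst c \<noteq> 0 \<longleftrightarrow> c \<noteq> 0"
  unfolding cst_def using const_eq_iff[of c 0] rhomD(4)[OF rhom_const, where ?'a = 'r]
  by (metis to_fract_eq_0_iff)

lemma P_nz [simp]: "P p \<noteq> 0" and Pi_nz [simp]: "Pi p \<noteq> 0"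
  using P_Pi[of p] by auto

lemma sact_xpow: "sact i (xpow j e) = (if i = 0 then if j = 1 then const (qpow e) * xpow 1 (- e) else xpow j e
   else if i = n then if j = n then xpow n (- e) else xpow j e
   else if j = i then xpow (Suc i) e else if j = Suc i then xpow i e else xpow j e)"
proof -
  have "rw n i (Poly_Mapping.single j e) = (if i = 0 then if j = 1 then Poly_Mapping.single 1 (- e) else Poly_Mapping.single j e
   else if i = n then if j = n then Poly_Mapping.single n (- e) else Poly_Mapping.single j e
   else if j = i then Poly_Mapping.single (Suc i) e else if j = Suc i then Poly_Mapping.single i e else Poly_Mapping.single j e)"
    by (rule poly_mapping_eqI) (auto simp: lookup_rw lookup_single when_def)
  then show ?thesis
    unfolding xpow_def sact_single
    by (simp add: zc_def dd_def lookup_single const_mult_single)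
qed

lemma sL_xL: "sL i (xL j) = (if i = 0 then if j = 1 then cst (P ParQ) ^ 2 / xL 1 else xL j
   else if i = n then if j = n then 1 / xL n else xL j
   else if j = i then xL (Suc i) else if j = Suc i then xL i else xL j)"
  by (auto simp: xL_def sact_xpow xpow_m1_fract qpow_def cst_def rhomD(7)[OF rhom_const] to_fract_power)

lemma zL_eq: "zL i = (if i = 0 then (cst (P ParQ) / xL 1) ^ 2 else if i = n then xL n ^ 2 else xL i / xL (Suc i))"
  unfolding zL_def Zm_1
  by (auto simp: xpow_2 xpow_m2 to_fract_power xpow_m1_fract power_divide rhomD(7)[OF rhom_const] cst_def)
    (simp_all add: xL_def)

lemma cL_mid:
  assumes "i \<noteq> 0" "i \<noteq> n"
  shows "cL i = cst (tau i) + cst (taui i - tau i) / (1 - xL i / xL (Suc i))"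
proof -
  have nz: "1 - xL i / xL (Suc i) \<noteq> 0" using zL_ne_1[of i] assms by (simp add: zL_eq)
  have tt: "cst (tau i) * cst (taui i) = 1"
    using tau_taui[of i] rhomD(1,3)[OF rhom_cst] by metis
  have "to_fract (num i) = 1 - cst (tau i) ^ 2 * (xL i / xL (Suc i))"
    using assms by (simp add: num_def xpow_m1_fract cst_def rhomD(7)[OF rhom_const] to_fract_power tau_def)
      (simp add: xL_def)
  then have "cL i = cst (taui i) * (1 - cst (tau i) ^ 2 * (xL i / xL (Suc i))) / (1 - xL i / xL (Suc i))"
    using assms by (simp add: cL_def zL_eq)
  also have "cst (taui i) * (1 - cst (tau i) ^ 2 * (xL i / xL (Suc i)))
    = cst (tau i) * (1 - xL i / xL (Suc i)) + cst (taui i - tau i)"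
    using tt unfolding rhomD(6)[OF rhom_cst] by algebra
  finally show ?thesis using nz by (simp add: add_divide_distrib)
qed

text \<open>A square root of \<open>zL i\<close> at the two end nodes, so that one formula serves
  both.\<close>

definition uL :: "nat \<Rightarrow> 'r laurent fract" where
  "uL i = (if i = 0 then cst (P ParQ) / xL 1 else xL n)"

text \<open>Expanding the numerator gives \<open>ups = U - U'\<close> with the remaining parameter
  \<open>U\<close> and its inverse; later arguments use only that \<open>ups\<close> is a
  scalar.\<close>

lemma cL_end:
  assumes i: "i = 0 \<or> i = n"
  obtains ups where "cL i = cst (tau i) + (cst (taui i - tau i) - cst ups * uL i) / (1 - uL i ^ 2)"
proof -
  define U U' where "U = P (if i = 0 then ParU0 else ParUn)" and "U' = Pi (if i = 0 then ParU0 else ParUn)"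
  have UU: "cst U * cst U' = 1"
    using P_Pi rhomD(1,3)[OF rhom_cst] unfolding U_def U'_def by metis
  have nz: "1 - uL i ^ 2 \<noteq> 0" using zL_ne_1[of i] i n_ge by (auto simp: zL_eq uL_def)
  have tt: "cst (tau i) * cst (taui i) = 1"
    using tau_taui[of i] rhomD(1,3)[OF rhom_cst] by metis
  note rc = rhomD[OF rhom_cst]
  have "to_fract (num i) = (1 - cst (tau i) * cst U * uL i) * (1 + cst (tau i) * cst U' * uL i)"
    using i n_ge by (auto simp: num_def xpow_m1_fract uL_def U_def U'_def tau_def
        rc(3,5)[unfolded cst_def] cst_def)
      (auto simp: xL_def ac_simps)
  then have "cL i = cst (taui i) * ((1 - cst (tau i) * cst U * uL i) * (1 + cst (tau i) * cst U' * uL i)) / (1 - uL i ^ 2)"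
    using i n_ge by (auto simp: cL_def zL_eq uL_def)
  also have "cst (taui i) * ((1 - cst (tau i) * cst U * uL i) * (1 + cst (tau i) * cst U' * uL i))
    = cst (tau i) * (1 - uL i ^ 2) + (cst (taui i - tau i) - cst (U - U') * uL i)"
    using tt UU unfolding rc by algebra
  finally have "cL i = cst (tau i) + (cst (taui i - tau i) - cst (U - U') * uL i) / (1 - uL i ^ 2)"
    using nz by (simp add: add_divide_distrib)
  then show thesis by (rule that)
qed

text \<open>The hypothesis of \<open>quadratic_relation\<close>. At an end node, inverting
  \<open>u\<close> turns \<open>1 / (1 - u^2)\<close> into \<open>- u^2 / (1 - u^2)\<close>, and the
  terms with \<open>ups\<close> cancel in the sum. At an inner node it is
  \<open>1 / (1 - z) + 1 / (1 - 1 / z) = 1\<close>.\<close>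

lemma cL_sum: "cL i + sL i (cL i) = cst (tau i) + cst (taui i)"
proof (cases "i = 0 \<or> i = n")
  case True
  obtain ups where c: "cL i = cst (tau i) + (cst (taui i - tau i) - cst ups * uL i) / (1 - uL i ^ 2)"
    using cL_end[OF True] by blast
  have nz: "uL i ^ 2 \<noteq> 1" using zL_ne_1[of i] True n_ge by (auto simp: zL_eq uL_def)
  have nz': "uL i \<noteq> 0" by (simp add: uL_def cst_nz)
  have s: "sL i (uL i) = 1 / uL i"
    using True n_ge by (auto simp: uL_def sL_xL rhom_divide[OF rhom_sL] power2_eq_square cst_nz)
  have a: "g / (1 - u^2) + g' / (1 - (1 / u)^2) = (g - g' * u^2) / (1 - u^2)"
    if "u^2 \<noteq> 1" "u \<noteq> 0" for u g g' :: "'r laurent fract"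
  proof -
    have "1 / (1 - (1/u)^2) = - (u^2) / (1 - u^2)" using that by (simp add: divide_simps) algebra
    then have "g' / (1 - (1/u)^2) = g' * (- (u^2) / (1 - u^2))" by (metis divide_inverse mult_1)
    then show ?thesis by (simp add: diff_divide_distrib)
  qed
  have "cL i + sL i (cL i) = 2 * cst (tau i) + ((cst (taui i - tau i) - cst ups * uL i) / (1 - uL i ^ 2)
     + (cst (taui i - tau i) - cst ups * (1 / uL i)) / (1 - (1 / uL i) ^ 2))"
    unfolding c by (simp add: rhomD[OF rhom_sL] rhom_divide[OF rhom_sL] s)
  also have "\<dots> = 2 * cst (tau i) + (cst (taui i - tau i) - cst ups * uL i - (cst (taui i - tau i) - cst ups * (1 / uL i)) * uL i ^ 2) / (1 - uL i ^ 2)"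
    unfolding a[OF nz nz'] by simp
  also have "cst (taui i - tau i) - cst ups * uL i - (cst (taui i - tau i) - cst ups * (1 / uL i)) * uL i ^ 2
    = cst (taui i - tau i) * (1 - uL i ^ 2)" using nz' by (simp add: field_simps power2_eq_square)
  finally show ?thesis using nz by (simp add: rhomD[OF rhom_cst])
next
  case False
  define p where "p = xL i"
  define r where "r = xL (Suc i)"
  have nz: "p \<noteq> r" using zL_ne_1[of i] False by (auto simp: zL_eq p_def r_def)
  have "1 / (1 - p / r) + 1 / (1 - r / p) = 1"
    using nz by (simp add: p_def r_def divide_simps) (simp add: algebra_simps)
  then have "g / (1 - p / r) + g / (1 - r / p) = g" for g
    by (metis (no_types) distrib_left divide_inverse mult.right_neutral mult_1)
  moreover have "sL i p = r" "sL i r = p" using False by (auto simp: p_def r_def sL_xL)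
  ultimately have "cL i + sL i (cL i) = 2 * cst (tau i) + cst (taui i - tau i)"
    using False by (simp add: cL_mid rhomD[OF rhom_sL] rhom_divide[OF rhom_sL] flip: p_def r_def)
  then show ?thesis by (simp add: rhomD[OF rhom_cst])
qed

lemma T_T: "T i (T i f) = const (tau i - taui i) * T i f + f"
proof -
  have "TL i (TL i u) = (cst (tau i) - cst (taui i)) * TL i u + u" for u
  proof (rule quadratic_relation[OF rhom_sL[of i] _ cL_sum])
    show "cst (tau i) * cst (taui i) = 1"
      using tau_taui[of i] rhomD(1,3)[OF rhom_cst] by metis
  qed (simp_all add: TL_def)
  then have "to_fract (T i (T i f)) = to_fract (const (tau i - taui i) * T i f + f)"
    by (simp add: T_fract cst_def rhomD[OF rhom_const])
  then show ?thesis by (simp only: to_fract_eq_iff)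
qed

lemma T_linear: "T i (f + g) = T i f + T i g" "T i (const c * f) = const c * T i f"
  "T i (f - g) = T i f - T i g" "T i 0 = 0" "T i (- f) = - T i f"
proof -
  show a: "T i (f + g) = T i f + T i g" for f g by (rule T_add)
  show b: "T i (const c * f) = const c * T i f" for c f by (rule T_const_mult)
  show c: "T i 0 = 0" by (simp add: T_def)
  show d: "T i (- f) = - T i f" for f using a[of f "-f"] c by (simp add: eq_neg_iff_add_eq_0 add.commute)
  show "T i (f - g) = T i f - T i g" using a[of f "-g"] d by simp
qed

lemma T_Ti [simp]: "T i (Ti i f) = f"
  by (simp add: Ti_def T_linear T_T)

lemma Ti_T [simp]: "Ti i (T i f) = f"
  by (simp add: Ti_def T_T)

lemma Ti_linear: "Ti i (f + g) = Ti i f + Ti i g" "Ti i (const c * f) = const c * Ti i f"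
  "Ti i (f - g) = Ti i f - Ti i g" "Ti i 0 = 0" "Ti i (- f) = - Ti i f"
  by (simp_all add: Ti_def T_linear right_diff_distrib distrib_left mult.left_commute[of "const (tau i - taui i)"])

lemma inv_T: "inv (T i) = Ti i"
  by (rule inv_equality) auto

text \<open>Reduces identities between products of reflections to a computation with weights and
  powers of \<open>q\<close>.\<close>

lemma sL_eqI:
  assumes "\<And>\<mu> c. A (Poly_Mapping.single \<mu> c) = (B (Poly_Mapping.single \<mu> c) :: 'r laurent)"
    and "rhom A" "rhom B" and "rhom A'" "rhom B'"
    and "\<And>f. A' (to_fract f) = to_fract (A f)" "\<And>f. B' (to_fract f) = to_fract (B f)"
  shows "A' u = (B' u :: 'r laurent fract)"
proof (rule rhom_ext_fract[OF assms(4,5)])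
  fix f
  have "A f = B f"
    by (induction f rule: poly_mapping_additive_induct) (simp_all add: assms(1) rhomD[OF assms(2)] rhomD[OF assms(3)])
  then show "A' (to_fract f) = B' (to_fract f)" by (simp add: assms(6,7))
qed

lemmas rhom_sact2 = rhom_comp[OF rhom_sact rhom_sact]
lemmas rhom_sact3 = rhom_comp[OF rhom_sact rhom_sact2]
lemmas rhom_sact4 = rhom_comp[OF rhom_sact rhom_sact3]
lemmas rhom_sL2 = rhom_comp[OF rhom_sL rhom_sL]
lemmas rhom_sL3 = rhom_comp[OF rhom_sL rhom_sL2]
lemmas rhom_sL4 = rhom_comp[OF rhom_sL rhom_sL3]

lemma sL_commute:
  assumes "i \<le> n" "j \<le> n" "i + 2 \<le> j"
  shows "sL i (sL j u) = sL j (sL i u)"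
proof (rule sL_eqI[OF _ rhom_sact2 rhom_sact2 rhom_sL2 rhom_sL2])
  fix \<mu> c
  have 1: "rw n i (rw n j \<mu>) = rw n j (rw n i \<mu>)"
    using assms by (intro poly_mapping_eqI) (auto simp: lookup_rw)
  have 2: "zc i (dd n i (rw n j \<mu>)) = zc i (dd n i \<mu>)"
    using assms by (auto simp: zc_def dd_def lookup_rw)
  have 3: "zc j (dd n j (rw n i \<mu>)) = zc j (dd n j \<mu>)"
    using assms by (auto simp: zc_def)
  show "sact i (sact j (Poly_Mapping.single \<mu> c)) = sact j (sact i (Poly_Mapping.single \<mu> c))"
    by (simp add: sact_single 1 2 3 ac_simps)
qed simp_all

lemma sL_braid_A:
  assumes "1 \<le> i" "Suc i < n"
  shows "sL i (sL (Suc i) (sL i u)) = sL (Suc i) (sL i (sL (Suc i) u))"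
proof (rule sL_eqI[OF _ rhom_sact3 rhom_sact3 rhom_sL3 rhom_sL3])
  fix \<mu> c
  have 1: "rw n i (rw n (Suc i) (rw n i \<mu>)) = rw n (Suc i) (rw n i (rw n (Suc i) \<mu>))"
    using assms by (intro poly_mapping_eqI) (auto simp: lookup_rw)
  show "sact i (sact (Suc i) (sact i (Poly_Mapping.single \<mu> c))) = sact (Suc i) (sact i (sact (Suc i) (Poly_Mapping.single \<mu> c)))"
    using assms by (simp add: sact_single 1 zc_def)
qed simp_all

lemma sL_braid_B:
  assumes "(i = 1 \<and> j = 0) \<or> (i = n - 1 \<and> j = n)"
  shows "sL i (sL j (sL i (sL j u))) = sL j (sL i (sL j (sL i u)))"
proof (rule sL_eqI[OF _ rhom_sact4 rhom_sact4 rhom_sL4 rhom_sL4])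
  fix \<mu> c
  have 1: "rw n i (rw n j (rw n i (rw n j \<mu>))) = rw n j (rw n i (rw n j (rw n i \<mu>)))"
    using assms n_ge by (intro poly_mapping_eqI) (auto simp: lookup_rw)
  show "sact i (sact j (sact i (sact j (Poly_Mapping.single \<mu> c)))) = sact j (sact i (sact j (sact i (Poly_Mapping.single \<mu> c))))"
    using assms n_ge by (auto simp: sact_single 1 zc_def dd_def lookup_rw ac_simps)
qed simp_all

lemma sL_cL_far:
  assumes "i \<le> n" "j \<le> n" "i + 2 \<le> j \<or> j + 2 \<le> i"
  shows "sL i (cL j) = cL j"
proof (cases "j = 0 \<or> j = n")
  case True
  obtain ups where c: "cL j = cst (tau j) + (cst (taui j - tau j) - cst ups * uL j) / (1 - uL j ^ 2)"
    using cL_end[OF True] by blast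
  have "sL i (uL j) = uL j"
    using assms True by (auto simp: uL_def sL_xL rhom_divide[OF rhom_sL])
  then show ?thesis unfolding c by (simp add: rhomD[OF rhom_sL] rhom_divide[OF rhom_sL])
next
  case False
  then have "sL i (xL j) = xL j" "sL i (xL (Suc j)) = xL (Suc j)"
    using assms by (auto simp: sL_xL)
  then show ?thesis using False by (simp add: cL_mid rhomD[OF rhom_sL] rhom_divide[OF rhom_sL])
qed

lemma T_commute:
  assumes "i \<le> n" "j \<le> n" "i + 2 \<le> j \<or> j + 2 \<le> i"
  shows "T i (T j f) = T j (T i f)"
proof -
  have "TL i (TL j u) = TL j (TL i u)" for u
  proof (rule commuting_operators[OF rhom_sL[of i] rhom_sL[of j],
        where ?t1.0 = "cst (tau i)" and ?t2.0 = "cst (tau j)" and ?c1.0 = "cL i" and ?c2.0 = "cL j"])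
    show "sL i (sL j u) = sL j (sL i u)" for u using sL_commute[of i j u] sL_commute[of j i u] assms by metis
    show "sL i (cL j) = cL j" "sL j (cL i) = cL i" using assms by (auto intro: sL_cL_far)
  qed (simp_all add: TL_def)
  then have "to_fract (T i (T j f)) = to_fract (T j (T i f))" by (simp only: T_fract)
  then show ?thesis by simp
qed

lemma T_braid_A:
  assumes "1 \<le> i" "Suc i < n"
  shows "T i (T (Suc i) (T i f)) = T (Suc i) (T i (T (Suc i) f))"
proof -
  have "TL i (TL (Suc i) (TL i u)) = TL (Suc i) (TL i (TL (Suc i) u))" for u
  proof (rule braid_relation_A2[OF rhom_sL[of i] rhom_sL[of "Suc i"]])
    show "sL i (sL (Suc i) (sL i u)) = sL (Suc i) (sL i (sL (Suc i) u))" for u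
      by (rule sL_braid_A[OF assms])
    show "xL i \<noteq> xL (Suc i)" using zL_ne_1[of i] assms by (auto simp: zL_eq)
    show "TL i u = cst (tau i) * u + (cst (tau i) + cst (taui i - tau i) / (1 - xL i / xL (Suc i))) * (sL i u - u)" for u
      using assms by (simp add: TL_def cL_mid)
    show "TL (Suc i) u = cst (tau i) * u + (cst (tau i) + cst (taui i - tau i) / (1 - xL (Suc i) / xL (Suc (Suc i)))) * (sL (Suc i) u - u)" for u
      using assms by (simp add: TL_def cL_mid tau_def taui_def)
  qed (use assms in \<open>auto simp: sL_xL\<close>)
  then have "to_fract (T i (T (Suc i) (T i f))) = to_fract (T (Suc i) (T i (T (Suc i) f)))" by (simp only: T_fract)
  then show ?thesis by simp
qed

lemma T_braid_B:
  assumes ij: "(i = 1 \<and> j = 0) \<or> (i = n - 1 \<and> j = n)"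
  shows "T i (T j (T i (T j f))) = T j (T i (T j (T i f)))"
proof -
  have j: "j = 0 \<or> j = n" using ij by auto
  have i: "i \<noteq> 0" "i \<noteq> n" using ij n_ge by auto
  obtain ups where c: "cL j = cst (tau j) + (cst (taui j - tau j) - cst ups * uL j) / (1 - uL j ^ 2)"
    using cL_end[OF j] by blast
  define y where "y = sL i (uL j)"
  have y: "y = (if j = 0 then cst (P ParQ) / xL 2 else xL (n - 1))"
  proof (cases "j = 0")
    case True
    then have "i = 1" using ij n_ge by auto
    then show ?thesis using True n_ge by (simp add: y_def uL_def sL_xL rhom_divide[OF rhom_sL] numeral_2_eq_2)
  next
    case False
    then have "i = n - 1" using ij by auto
    then have "i \<noteq> 0" "n \<noteq> i" "i \<noteq> n" "n = Suc i" using n_ge by linarith+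
    then have "sL i (xL n) = xL i" using sL_xL[of i n] by metis
    then show ?thesis using False \<open>i = n - 1\<close> by (simp add: y_def uL_def)
  qed
  have z: "xL i / xL (Suc i) = y / uL j"
    unfolding y using ij n_ge by (auto simp: uL_def cst_nz numeral_2_eq_2)
  have "TL i (TL j (TL i (TL j u))) = TL j (TL i (TL j (TL i u)))" for u
  proof (rule braid_relation_B2[OF rhom_sL[of i] rhom_sL[of j]])
    show "sL i (sL j (sL i (sL j u))) = sL j (sL i (sL j (sL i u)))" for u
      by (rule sL_braid_B[OF ij])
    show "sL i (uL j) = y" "sL i y = uL j" by (simp_all add: y_def)
    show "sL j (uL j) = 1 / uL j"
      using j n_ge by (auto simp: uL_def sL_xL rhom_divide[OF rhom_sL] power2_eq_square cst_nz)
    show "sL j y = y"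
    proof (cases "j = 0")
      case False
      moreover have "n - 1 \<noteq> n" using n_ge by linarith
      ultimately show ?thesis unfolding y using j n_ge by (simp add: sL_xL del: One_nat_def)
    qed (simp add: y sL_xL rhom_divide[OF rhom_sL])
    show "uL j \<noteq> 0" by (simp add: uL_def cst_nz)
    then show "uL j \<noteq> y" using zL_ne_1[of i] i z by (auto simp: zL_eq)
    show "uL j ^ 2 \<noteq> 1" using zL_ne_1[of j] j n_ge by (auto simp: zL_eq uL_def)
    show "TL i u = cst (tau i) * u + (cst (tau i) + cst (taui i - tau i) / (1 - y / uL j)) * (sL i u - u)" for u
      using i z by (simp add: TL_def cL_mid)
    show "TL j u = cst (tau j) * u + (cst (tau j) + (cst (taui j - tau j) - cst ups * uL j) / (1 - uL j ^ 2)) * (sL j u - u)" for u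
      by (simp add: TL_def c)
  qed simp_all
  then have "to_fract (T i (T j (T i (T j f)))) = to_fract (T j (T i (T j (T i f))))" by (simp only: T_fract)
  then show ?thesis by simp
qed

end

section \<open>Commutativity of the operators \<open>Y\<^sub>i\<close>\<close>

lemma compose_list_simps [simp]:
  "compose_list [] = id" "compose_list (f # fs) = f \<circ> compose_list fs"
  "compose_list (fs @ gs) = compose_list fs \<circ> compose_list gs"
  by (simp_all add: compose_list_def) (induction fs; simp add: fun_eq_iff)

text \<open>The braid relations of the affine diagram of type C and invertibility suffice for
  commutativity of the \<open>Y_i\<close>, so the operators act on a bare type here.\<close>

locale affine_braid =
  fixes n :: nat and T Ti :: "nat \<Rightarrow> 'a \<Rightarrow> 'a"
  assumes n2: "2 \<le> n"
    and inv1 [simp]: "\<And>i v. T i (Ti i v) = v" and inv2 [simp]: "\<And>i v. Ti i (T i v) = v"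
    and far: "\<And>i j v. i \<le> n \<Longrightarrow> j \<le> n \<Longrightarrow> i + 2 \<le> j \<or> j + 2 \<le> i \<Longrightarrow> T i (T j v) = T j (T i v)"
    and brA: "\<And>i v. 1 \<le> i \<Longrightarrow> Suc i < n \<Longrightarrow> T i (T (Suc i) (T i v)) = T (Suc i) (T i (T (Suc i) v))"
    and brB: "\<And>i j v. (i = 1 \<and> j = 0) \<or> (i = n - 1 \<and> j = n) \<Longrightarrow> T i (T j (T i (T j v))) = T j (T i (T j (T i v)))"
begin

definition Y :: "nat \<Rightarrow> 'a \<Rightarrow> 'a" where
  "Y i = compose_list (map T [i..<n]) \<circ> T n \<circ> compose_list (map T (rev [1..<n])) \<circ> T 0 \<circ>
     compose_list (map Ti [1..<i])"

text \<open>A Jucys-Murphy element of the finite braid group of type B on the nodes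
  \<open>i, ..., n\<close>.\<close>

definition X :: "nat \<Rightarrow> 'a \<Rightarrow> 'a" where
  "X i = compose_list (map T [i..<n]) \<circ> T n \<circ> compose_list (map T (rev [i..<n]))"

lemma X_n: "X n = T n" by (simp add: X_def fun_eq_iff)

lemma X_rec: "i < n \<Longrightarrow> X i v = T i (X (Suc i) (T i v))"
  by (simp add: X_def upt_conv_Cons)

lemma Y_1: "Y 1 v = X 1 (T 0 v)"
  by (simp add: Y_def X_def)

lemma Y_rec: "1 \<le> i \<Longrightarrow> i < n \<Longrightarrow> Y i v = T i (Y (Suc i) (T i v))"
  by (simp add: Y_def upt_conv_Cons)

lemma Y_Suc: "1 \<le> i \<Longrightarrow> i < n \<Longrightarrow> Y (Suc i) v = Ti i (Y i (Ti i v))"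
  by (simp add: Y_rec)

lemma comm_inv: "(\<And>v. A (T j v) = T j (A v)) \<Longrightarrow> A (Ti j v) = Ti j (A v)"
  by (metis inv1 inv2)

lemma X_far: "i \<le> n \<Longrightarrow> j + 2 \<le> i \<Longrightarrow> T j (X i v) = X i (T j v)"
proof (induction i arbitrary: v rule: inc_induct)
  case base
  then show ?case by (simp add: X_n far)
next
  case (step i)
  then have "T j (T i v) = T i (T j v)" for v by (intro far) auto
  then show ?case using step by (simp add: X_rec)
qed

text \<open>For \<open>j = i + 1\<close>, in \<open>T_i T_j X_(j+1) T_j T_i\<close> the braid
  relation turns \<open>T_j\<close> into \<open>T_i\<close>, which passes \<open>X_(j+1)\<close>,
  and the braid relation then restores \<open>T_j\<close>. Larger \<open>j\<close> commute with the
  outer letters.\<close>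

lemma X_in: "1 \<le> i \<Longrightarrow> i < j \<Longrightarrow> j < n \<Longrightarrow> T j (X i v) = X i (T j v)"
proof (induction "j - i" arbitrary: i v rule: less_induct)
  case less
  show ?case
  proof (cases "j = Suc i")
    case True
    have r: "X i v = T i (T j (X (Suc j) (T j (T i v))))" for v
      using less(2-4) True by (simp add: X_rec)
    have c: "T i (X (Suc j) v) = X (Suc j) (T i v)" for v
      using less(2-4) True by (intro X_far) auto
    have b: "T j (T i (T j v)) = T i (T j (T i v))" for v
      using brA[of i v] less(2-4) True by simp
    show ?thesis unfolding r b c by (simp flip: b)
  next
    case False
    have "T j (T i v) = T i (T j v)" for v using less(2-4) False by (intro far) auto
    moreover have "T j (X (Suc i) v) = X (Suc i) (T j v)" for v
      using less False by auto
    ultimately show ?thesis using less(2-4) by (simp add: X_rec)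
  qed
qed

text \<open>\<open>X i\<close> takes the place of the end node in the braid relation of type B2. The
  induction descends from \<open>X n = T n\<close>, expanding \<open>X i\<close> as
  \<open>T_i X_(i+1) T_i\<close>.\<close>

lemma X_braid: "i \<le> n \<Longrightarrow> 2 \<le> i \<Longrightarrow>
  T (i - 1) (X i (T (i - 1) (X i v))) = X i (T (i - 1) (X i (T (i - 1) v)))"
proof (induction i arbitrary: v rule: inc_induct)
  case base
  then show ?case using brB[of "n - 1" n v] by (simp add: X_n)
next
  case (step i)
  define a where "a = T (i - 1)"
  define b where "b = T i"
  define z where "z = X (Suc i)"
  have r: "X i v = b (z (b v))" for v using step by (simp add: X_rec b_def z_def)
  have c: "a (z v) = z (a v)" for v unfolding a_def z_def using step by (intro X_far) auto
  have b: "b (a (b v)) = a (b (a v))" for v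
    using brA[of "i - 1" v] step by (simp add: a_def b_def)
  have h: "b (z (b (z v))) = z (b (z (b v)))" for v
    using step(3)[of v] step(1,4) by (simp add: b_def z_def)
  have "a (b (z (b (a (b (z (b v))))))) = b (z (b (a (b (z (b (a v)))))))"
  proof -
    have "a (b (z (b (a (b (z (b v))))))) = b (a (b (z (b (z (a (b v)))))))"
      by (simp add: b c flip: c)
    also have "\<dots> = b (z (b (a (b (z (b (a v)))))))"
    proof -
      have "b (z (b (a (b (z (b (a v))))))) = b (a (z (b (z (a (b (a v)))))))" by (simp add: b c)
      also have "\<dots> = b (a (z (b (z (b (a (b v)))))))" by (simp add: b)
      also have "\<dots> = b (a (b (z (b (z (a (b v)))))))" by (simp add: h)
      finally show ?thesis by simp
    qed
    finally show ?thesis .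
  qed
  then show ?case unfolding r a_def[symmetric] .
qed

lemma Y_1_T: "2 \<le> j \<Longrightarrow> j < n \<Longrightarrow> T j (Y 1 v) = Y 1 (T j v)"
  using far[of j 0] X_in[of 1 j] by (simp add: Y_1 del: One_nat_def)

text \<open>Induction along \<open>Y (i' + 1) = T_i'^(-1) Y i' T_i'^(-1)\<close>. The letter
  \<open>T_j\<close> with \<open>j = i' - 1\<close> does not commute with \<open>T_i'\<close>; there
  two steps are peeled off and the braid relation trades \<open>T_j\<close> for \<open>T_i'\<close>
  and back.\<close>

lemma Y_T: "1 \<le> i \<Longrightarrow> i \<le> n \<Longrightarrow> 1 \<le> j \<Longrightarrow> j < n \<Longrightarrow> j \<noteq> i \<Longrightarrow> Suc j \<noteq> i \<Longrightarrow> T j (Y i v) = Y i (T j v)"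
proof (induction i arbitrary: j v rule: less_induct)
  case (less i j)
  show ?case
  proof (cases "i = 1")
    case True
    then show ?thesis using less.prems Y_1_T[of j v] by simp
  next
    case False
    then obtain i' where i: "i = Suc i'" "1 \<le> i'" using less.prems by (cases i) auto
    show ?thesis
    proof (cases "Suc j = i'")
      case False
      have 1: "T j (T i' v) = T i' (T j v)" for v using less.prems i False by (intro far) auto
      have 2: "T j (Ti i' v) = Ti i' (T j v)" for v using 1 by (rule comm_inv)
      have 3: "T j (Y i' v) = Y i' (T j v)" for v
        by (rule less.IH) (use less.prems i False in auto)
      show ?thesis using i less.prems by (simp add: Y_Suc 2 3)
    next
      case True
      have 1: "T i' (Y j v) = Y j (T i' v)" for v
        by (rule less.IH) (use less.prems i True in auto)
      have b: "T j (T i' (T j v)) = T i' (T j (T i' v))" for v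
        using brA[of j v] less.prems i True by auto
      have b1: "Ti i' (Ti j (T i' v)) = T j (Ti i' (Ti j v))" for v
        using b by (metis inv1 inv2)
      have b2: "T i' (Ti j (Ti i' v)) = Ti j (Ti i' (T j v))" for v
        using b by (metis inv1 inv2)
      have "Y i v = Ti i' (Ti j (Y j (Ti j (Ti i' v))))" for v
        using Y_Suc[of i' v] Y_Suc[of j "Ti i' v"] less.prems i(2) unfolding i(1) True[symmetric] by simp
      then show ?thesis by (simp only: b1[symmetric] 1 b2)
    qed
  qed
qed

text \<open>The core of commutativity: \<open>T_1\<close> satisfies the B2 braid relation both with
  \<open>X 2\<close> and with \<open>T_0\<close>, and these two commute. The other pairs are reduced
  to this one through letters commuting with one of the two operators.\<close>

lemma Y_1_Y_2: "Y 1 (Y 2 v) = Y 2 (Y 1 v)"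
proof -
  define x where "x = X 2"
  have x1: "X 1 v = T 1 (x (T 1 v))" for v using n2 by (simp add: X_rec x_def numeral_2_eq_2)
  have c: "T 0 (x v) = x (T 0 v)" for v unfolding x_def using n2 by (intro X_far) auto
  have h: "T 1 (x (T 1 (x v))) = x (T 1 (x (T 1 v)))" for v using X_braid[of 2 v] n2 by (simp add: x_def)
  have b: "T 1 (T 0 (T 1 (T 0 v))) = T 0 (T 1 (T 0 (T 1 v)))" for v by (rule brB) simp
  have y1: "Y 1 v = T 1 (x (T 1 (T 0 v)))" for v by (simp add: Y_1 x1 del: One_nat_def)
  have y2: "Y 2 v = x (T 1 (T 0 (Ti 1 v)))" for v
  proof -
    have "Y 2 v = Ti 1 (Y 1 (Ti 1 v))" using Y_Suc[of 1 v] n2 by (simp add: numeral_2_eq_2)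
    then show ?thesis by (simp only: y1 inv2)
  qed
  have "Y 1 (Y 2 v) = T 1 (x (T 1 (x (T 0 (T 1 (T 0 (Ti 1 v)))))))" by (simp only: y1 y2 c)
  also have "\<dots> = x (T 1 (x (T 1 (T 0 (T 1 (T 0 (Ti 1 v)))))))" by (simp only: h)
  also have "\<dots> = x (T 1 (x (T 0 (T 1 (T 0 v)))))" by (simp only: b inv1)
  also have "\<dots> = Y 2 (Y 1 v)" by (simp only: y1 y2 c inv2)
  finally show ?thesis .
qed

lemma Y_1_Y: "2 \<le> j \<Longrightarrow> j \<le> n \<Longrightarrow> Y 1 (Y j v) = Y j (Y 1 v)"
proof (induction j arbitrary: v rule: dec_induct)
  case base
  show ?case by (rule Y_1_Y_2)
next
  case (step j)
  have 1: "Y 1 (Ti j v) = Ti j (Y 1 v)" for v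
    by (rule comm_inv) (use step Y_1_T[of j] in auto)
  show ?case using step by (simp add: Y_Suc 1 del: One_nat_def)
qed

lemma Y_less_commute: "1 \<le> i \<Longrightarrow> i < j \<Longrightarrow> j \<le> n \<Longrightarrow> Y i (Y j v) = Y j (Y i v)"
proof (induction i arbitrary: v rule: dec_induct)
  case base
  then show ?case by (intro Y_1_Y) auto
next
  case (step i)
  have 1: "Y j (Ti i v) = Ti i (Y j v)" for v
    by (rule comm_inv) (use step Y_T[of j i] in auto)
  show ?case using step by (simp add: Y_Suc flip: 1)
qed

lemma Y_commute: "1 \<le> i \<Longrightarrow> i \<le> n \<Longrightarrow> 1 \<le> j \<Longrightarrow> j \<le> n \<Longrightarrow> Y i (Y j v) = Y j (Y i v)"
  using Y_less_commute[of i j v] Y_less_commute[of j i v] by (cases i j rule: linorder_cases) auto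

end

context koornwinder_params
begin

lemma affine_braid_T: "affine_braid n T Ti"
proof (rule affine_braid.intro)
  show "T i (T j v) = T j (T i v)" if "i \<le> n" "j \<le> n" "i + 2 \<le> j \<or> j + 2 \<le> i" for i j v
    using that by (rule T_commute)
  show "T i (T (Suc i) (T i v)) = T (Suc i) (T i (T (Suc i) v))" if "1 \<le> i" "Suc i < n" for i v
    using that by (rule T_braid_A)
  show "T i (T j (T i (T j v))) = T j (T i (T j (T i v)))"
    if "(i = 1 \<and> j = 0) \<or> (i = n - 1 \<and> j = n)" for i j v
    using that by (rule T_braid_B)
qed (rule n_ge T_Ti Ti_T)+

sublocale affine_braid n T Ti
  by (rule affine_braid_T)

end

section \<open>Dominant weights and the orders on weights\<close>

abbreviation lk :: "('a \<Rightarrow>\<^sub>0 'b::zero) \<Rightarrow> 'a \<Rightarrow> 'b" where "lk \<equiv> Poly_Mapping.lookup"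

lemma latticeD: "\<mu> \<in> lattice n \<Longrightarrow> i \<notin> {1..n} \<Longrightarrow> lk \<mu> i = 0"
  by (auto simp: lattice_def in_keys_iff subset_iff)

lemma latticeI: "(\<And>i. i \<notin> {1..n} \<Longrightarrow> lk \<mu> i = 0) \<Longrightarrow> \<mu> \<in> lattice n"
  by (auto simp: lattice_def in_keys_iff subset_iff)

lemma lattice_add: "\<mu> \<in> lattice n \<Longrightarrow> \<nu> \<in> lattice n \<Longrightarrow> \<mu> + \<nu> \<in> lattice n"
  by (rule latticeI) (simp add: lookup_add latticeD)

lemma rw_lattice: "i \<le> n \<Longrightarrow> 1 \<le> n \<Longrightarrow> \<mu> \<in> lattice n \<Longrightarrow> rw n i \<mu> \<in> lattice n"
  by (rule latticeI) (auto simp: lookup_rw latticeD)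

section \<open>Words in simple reflections\<close>

definition word :: "nat \<Rightarrow> nat list \<Rightarrow> weight \<Rightarrow> weight" where
  "word n is = compose_list (map (simple_refl n) is)"

lemma word_simps [simp]: "word n [] \<mu> = \<mu>" "word n (i # is) \<mu> = simple_refl n i (word n is \<mu>)"
  "word n (is @ js) \<mu> = word n is (word n js \<mu>)"
  by (simp_all add: word_def)

lemma simple_refl_rw: "1 \<le> i \<Longrightarrow> simple_refl n i = rw n i"
  by (simp add: rw_def)

lemma W0E:
  assumes "w \<in> W0 n"
  obtains \<pi> \<epsilon> where "\<pi> permutes {1..n}" "\<And>i. \<epsilon> i \<in> {1, -1}" "\<And>i. i \<notin> {1..n} \<Longrightarrow> \<epsilon> i = 1"
    "\<And>\<mu> i. lk (w \<mu>) i = \<epsilon> i * lk \<mu> (\<pi> i)"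
  using assms unfolding W0_def by blast

lemma W0I:
  assumes "\<pi> permutes {1..n}" "\<And>i. \<epsilon> i \<in> {1, -1}" "\<And>i. i \<notin> {1..n} \<Longrightarrow> \<epsilon> i = 1"
    "\<And>\<mu> i. lk (w \<mu>) i = \<epsilon> i * lk \<mu> (\<pi> i)"
  shows "w \<in> W0 n"
  unfolding W0_def using assms by blast

lemma W0_id: "id \<in> W0 n"
  by (rule W0I[of id _ "\<lambda>_. 1"]) (auto simp: permutes_id)

lemma W0_comp:
  assumes "v \<in> W0 n" "w \<in> W0 n"
  shows "v \<circ> w \<in> W0 n"
proof -
  obtain \<pi> \<epsilon> where 1: "\<pi> permutes {1..n}" "\<And>i. \<epsilon> i \<in> {1, -1}" "\<And>i. i \<notin> {1..n} \<Longrightarrow> \<epsilon> i = 1"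
    "\<And>\<mu> i. lk (v \<mu>) i = \<epsilon> i * lk \<mu> (\<pi> i)" using assms(1) by (rule W0E) blast
  obtain \<pi>' \<epsilon>' where 2: "\<pi>' permutes {1..n}" "\<And>i. \<epsilon>' i \<in> {1, -1}" "\<And>i. i \<notin> {1..n} \<Longrightarrow> \<epsilon>' i = 1"
    "\<And>\<mu> i. lk (w \<mu>) i = \<epsilon>' i * lk \<mu> (\<pi>' i)" using assms(2) by (rule W0E) blast
  show ?thesis
  proof (rule W0I[of "\<pi>' \<circ> \<pi>" _ "\<lambda>i. \<epsilon> i * \<epsilon>' (\<pi> i)"])
    show "\<pi>' \<circ> \<pi> permutes {1..n}" using 1 2 by (simp add: permutes_compose)
    show "\<epsilon> i * \<epsilon>' (\<pi> i) \<in> {1, -1}" for i using 1(2)[of i] 2(2)[of "\<pi> i"] by auto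
    show "i \<notin> {1..n} \<Longrightarrow> \<epsilon> i * \<epsilon>' (\<pi> i) = 1" for i using 1(3)[of i] 2(3)[of i] 1(1) by (simp add: permutes_not_in)
    show "lk ((v \<circ> w) \<mu>) i = \<epsilon> i * \<epsilon>' (\<pi> i) * lk \<mu> ((\<pi>' \<circ> \<pi>) i)" for \<mu> i
      using 1(4) 2(4) by simp
  qed
qed

lemma rw_W0:
  assumes "1 \<le> i" "i \<le> n" shows "rw n i \<in> W0 n"
proof (cases "i = n")
  case True
  show ?thesis
    by (rule W0I[of id _ "\<lambda>j. if j = n then -1 else 1"])
      (use assms True in \<open>auto simp: permutes_id lookup_rw\<close>)
next
  case False
  show ?thesis
    by (rule W0I[of "Transposition.transpose i (Suc i)" _ "\<lambda>_. 1"])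
      (use assms False in \<open>auto simp: permutes_swap_id lookup_rw Transposition.transpose_def\<close>)
qed

lemma word_W0: "set is \<subseteq> {1..n} \<Longrightarrow> word n is \<in> W0 n"
proof (induction "is")
  case Nil
  then show ?case using W0_id[of n] by (simp add: word_def id_def)
next
  case (Cons i "is")
  then have "rw n i \<circ> word n is \<in> W0 n" by (intro W0_comp rw_W0) auto
  moreover have "word n (i # is) = rw n i \<circ> word n is" using Cons by (auto simp: fun_eq_iff simple_refl_rw)
  ultimately show ?case by metis
qed

lemma word_rev: "set is \<subseteq> {1..n} \<Longrightarrow> word n (rev is) (word n is \<mu>) = \<mu>"
  by (induction "is") (auto simp: simple_refl_rw)

text \<open>The pairing with \<open>(n, ..., 1)\<close>, a regular dominant vector. It detects the
  sign of a root and grows when a reflection moves a weight towards dominance.\<close>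

definition hgt :: "nat \<Rightarrow> weight \<Rightarrow> int" where
  "hgt n \<mu> = (\<Sum>i\<in>{1..n}. (int n + 1 - int i) * lk \<mu> i)"

lemma hgt_add: "hgt n (\<mu> + \<nu>) = hgt n \<mu> + hgt n \<nu>"
  by (simp add: hgt_def lookup_add distrib_left sum.distrib)

lemma hgt_diff: "hgt n (\<mu> - \<nu>) = hgt n \<mu> - hgt n \<nu>"
  by (simp add: hgt_def lookup_minus right_diff_distrib sum_subtractf)

lemma hgt_single: "i \<in> {1..n} \<Longrightarrow> hgt n (Poly_Mapping.single i r) = (int n + 1 - int i) * r"
proof -
  assume i: "i \<in> {1..n}"
  have "hgt n (Poly_Mapping.single i r) = (\<Sum>j\<in>{1..n}. if i = j then (int n + 1 - int i) * r else 0)"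
    unfolding hgt_def by (rule sum.cong) (auto simp: lookup_single when_def)
  then show ?thesis using i by simp
qed

lemma hgt_rw: "1 \<le> i \<Longrightarrow> i \<le> n \<Longrightarrow> hgt n (rw n i \<mu>) = hgt n \<mu> + (if i = n then 2 else 1) * dd n i \<mu>"
  by (auto simp: rw_eq hgt_add zw_def hgt_diff hgt_single algebra_simps)

lemma sum_W0:
  assumes "\<pi> permutes {1..n}" "\<And>i. \<epsilon> i \<in> {1::int, -1}" "\<And>i. lk \<nu> i = \<epsilon> i * lk \<mu> (\<pi> i)" "S \<subseteq> {1..n}"
  shows "(\<Sum>i\<in>S. \<bar>lk \<nu> i\<bar>) = (\<Sum>i\<in>\<pi> ` S. \<bar>lk \<mu> i\<bar>)"
proof -
  have "\<bar>lk \<nu> i\<bar> = \<bar>lk \<mu> (\<pi> i)\<bar>" for i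
    using assms(2)[of i] assms(3)[of i] by (auto simp: abs_mult)
  moreover have "inj_on \<pi> S" using assms(1) by (meson permutes_inj inj_on_subset subset_UNIV)
  ultimately show ?thesis by (simp add: sum.reindex)
qed

definition sqn :: "nat \<Rightarrow> weight \<Rightarrow> int" where "sqn n \<mu> = (\<Sum>i\<in>{1..n}. (lk \<mu> i)^2)"

lemma sqn_W0: "w \<in> W0 n \<Longrightarrow> sqn n (w \<mu>) = sqn n \<mu>"
proof (erule W0E)
  fix \<pi> \<epsilon> assume a: "\<pi> permutes {1..n}" "\<And>i. \<epsilon> i \<in> {1::int, -1}" "\<And>\<mu> i. lk (w \<mu>) i = \<epsilon> i * lk \<mu> (\<pi> i)"
  have "(lk (w \<mu>) i)^2 = (lk \<mu> (\<pi> i))^2" for i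
    using a(2)[of i] a(3)[of \<mu> i] by auto
  then have "sqn n (w \<mu>) = (\<Sum>i\<in>{1..n}. (lk \<mu> (\<pi> i))^2)" by (simp add: sqn_def)
  also have "\<dots> = sqn n \<mu>" unfolding sqn_def using sum.permute[OF a(1), of "\<lambda>i. (lk \<mu> i)^2"] by (simp add: o_def)
  finally show ?thesis .
qed

lemma exists_dominant_word:
  "\<exists>is. set is \<subseteq> {1..n} \<and> dominant n (word n is \<nu>)"
proof -
  have b: "hgt n \<nu> \<le> (\<Sum>i\<in>{1..n}. int n * (lk \<nu> i)^2)" for \<nu>
    unfolding hgt_def
  proof (rule sum_mono)
    fix i assume i: "i \<in> {1..n}"
    have "x \<le> x^2" for x :: int using self_le_power[of x 2] by (cases "x \<le> 0") (auto intro: order_trans)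
    then have "lk \<nu> i \<le> (lk \<nu> i)^2" .
    then have "(int n + 1 - int i) * lk \<nu> i \<le> (int n + 1 - int i) * (lk \<nu> i)^2"
      using i by (intro mult_left_mono) auto
    also have "\<dots> \<le> int n * (lk \<nu> i)^2" using i by (intro mult_right_mono) auto
    finally show "(int n + 1 - int i) * lk \<nu> i \<le> int n * (lk \<nu> i)^2" .
  qed
  have s: "(\<Sum>i\<in>{1..n}. int n * (lk \<nu> i)^2) = int n * sqn n \<nu>" for \<nu>
    by (simp add: sqn_def sum_distrib_left)
  show ?thesis
  \<comment> \<open>Each reflection with positive \<open>dd\<close> raises \<open>hgt\<close>, which
    is bounded by \<open>n\<close> times the invariant \<open>sqn\<close>; so the gap between the
    two decreases.\<close>
  proof (induction "nat (int n * sqn n \<nu> - hgt n \<nu>)" arbitrary: \<nu> rule: less_induct)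
    case less
    show ?case
    proof (cases "dominant n \<nu>")
      case True
      then show ?thesis by (intro exI[of _ "[]"]) simp
    next
      case False
      have "\<exists>i\<in>{1..n}. dd n i \<nu> > 0"
      proof (rule ccontr)
        assume "\<not> ?thesis"
        then have a: "dd n i \<nu> \<le> 0" if "i \<in> {1..n}" for i using that by force
        have dec: "lk \<nu> (Suc i) \<le> lk \<nu> i" if "i \<in> {1..<n}" for i using a[of i] that by (auto simp: dd_def)
        have "0 \<le> lk \<nu> i" if "1 \<le> i" "i \<le> n" for i
          using that(2,1)
        proof (induction i rule: inc_induct)
          case base then show ?case using a[of n] by (auto simp: dd_def)
        next
          case (step i) then show ?case using dec[of i] by auto
        qed
        then have "dominant n \<nu>" using dec by (auto simp: dominant_def)
        with False show False by simp
      qed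
      then obtain i where i: "1 \<le> i" "i \<le> n" "dd n i \<nu> > 0" by auto
      have "hgt n (rw n i \<nu>) > hgt n \<nu>" using hgt_rw[OF i(1,2), of \<nu>] i(3) by auto
      moreover have "sqn n (rw n i \<nu>) = sqn n \<nu>" using sqn_W0[OF rw_W0[OF i(1,2)]] .
      moreover have "hgt n (rw n i \<nu>) \<le> int n * sqn n (rw n i \<nu>)" using b[of "rw n i \<nu>"] s by simp
      ultimately have "nat (int n * sqn n (rw n i \<nu>) - hgt n (rw n i \<nu>)) < nat (int n * sqn n \<nu> - hgt n \<nu>)"
        by simp
      from less[OF this] obtain "is" where "set is \<subseteq> {1..n}" "dominant n (word n is (rw n i \<nu>))" by blast
      then show ?thesis using i by (intro exI[of _ "is @ [i]"]) (auto simp: simple_refl_rw)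
    qed
  qed
qed

section \<open>Partial sums and the dominance order\<close>

definition psum :: "nat \<Rightarrow> weight \<Rightarrow> int" where "psum j \<mu> = (\<Sum>i\<in>{1..j}. lk \<mu> i)"

text \<open>On a dominant weight this is the \<open>j\<close>-th partial sum. It is constant on
  orbits of \<open>W0\<close>, so the order on dominant representatives can be read off from any
  weight of the orbit.\<close>

definition maxsum :: "nat \<Rightarrow> nat \<Rightarrow> weight \<Rightarrow> int" where
  "maxsum n j \<mu> = Max ((\<lambda>S. \<Sum>i\<in>S. \<bar>lk \<mu> i\<bar>) ` {S. S \<subseteq> {1..n} \<and> card S = j})"

lemma maxsum_ge: "S \<subseteq> {1..n} \<Longrightarrow> (\<Sum>i\<in>S. \<bar>lk \<mu> i\<bar>) \<le> maxsum n (card S) \<mu>"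
  unfolding maxsum_def by (rule Max_ge) auto

lemma maxsum_le:
  assumes "j \<le> n" "\<And>S. S \<subseteq> {1..n} \<Longrightarrow> card S = j \<Longrightarrow> (\<Sum>i\<in>S. \<bar>lk \<mu> i\<bar>) \<le> B"
  shows "maxsum n j \<mu> \<le> B"
proof -
  have "{1..j} \<in> {S. S \<subseteq> {1..n} \<and> card S = j}" using assms(1) by auto
  then have "{S. S \<subseteq> {1..n} \<and> card S = j} \<noteq> {}" by blast
  then show ?thesis unfolding maxsum_def by (subst Max_le_iff) (use assms(2) in auto)
qed

lemma maxsum_W0:
  assumes "w \<in> W0 n" shows "maxsum n j (w \<mu>) = maxsum n j \<mu>"
proof -
  obtain \<pi> \<epsilon> where a: "\<pi> permutes {1..n}" "\<And>i. \<epsilon> i \<in> {1::int, -1}" "\<And>\<mu> i. lk (w \<mu>) i = \<epsilon> i * lk \<mu> (\<pi> i)"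
    using assms by (rule W0E) blast
  let ?A = "{S. S \<subseteq> {1..n} \<and> card S = j}"
  have inj: "inj \<pi>" using a(1) by (rule permutes_inj)
  have "(\<lambda>S. \<Sum>i\<in>S. \<bar>lk (w \<mu>) i\<bar>) ` ?A = (\<lambda>S. \<Sum>i\<in>S. \<bar>lk \<mu> i\<bar>) ` ((\<lambda>S. \<pi> ` S) ` ?A)"
    unfolding image_image by (intro image_cong refl) (use sum_W0[OF a(1,2,3)] in auto)
  also have "(\<lambda>S. \<pi> ` S) ` ?A = ?A"
  proof (intro equalityI subsetI)
    fix S assume "S \<in> (\<lambda>S. \<pi> ` S) ` ?A"
    then show "S \<in> ?A" using permutes_image[OF a(1)] inj by (auto simp: card_image inj_on_subset)
  next
    fix S assume S: "S \<in> ?A"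
    have "S = \<pi> ` (inv \<pi> ` S)" using permutes_surj[OF a(1)] by (simp add: image_f_inv_f)
    moreover have "inv \<pi> ` S \<in> ?A"
      using S permutes_image[OF permutes_inv[OF a(1)]] permutes_inj[OF permutes_inv[OF a(1)]]
      by (auto simp: card_image inj_on_subset)
    ultimately show "S \<in> (\<lambda>S. \<pi> ` S) ` ?A" by blast
  qed
  finally show ?thesis by (simp add: maxsum_def)
qed

lemma dominant_antimono:
  assumes "dominant n \<nu>" "1 \<le> i" "i \<le> j" "j \<le> n"
  shows "lk \<nu> j \<le> lk \<nu> i"
  using assms(3,4)
proof (induction j rule: dec_induct)
  case (step j)
  then have "lk \<nu> (Suc j) \<le> lk \<nu> j" using assms by (auto simp: dominant_def)
  then show ?case using step by simp
qed simp

text \<open>Exchange argument: the members of \<open>S\<close> beyond \<open>j\<close> carry at most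
  the \<open>j\<close>-th entry each, the indices up to \<open>j\<close> missing from
  \<open>S\<close> carry at least that much, and both are equally many.\<close>

lemma dominant_maxsum:
  assumes d: "dominant n \<nu>" and j: "j \<le> n"
  shows "maxsum n j \<nu> = psum j \<nu>"
proof (rule antisym)
  have pos: "0 \<le> lk \<nu> i" if "i \<in> {1..n}" for i using d that by (auto simp: dominant_def)
  show "maxsum n j \<nu> \<le> psum j \<nu>"
  proof (rule maxsum_le[OF j])
    fix S assume S: "S \<subseteq> {1..n}" "card S = j"
    have fS: "finite S" using S finite_subset by blast
    have "card (S - {1..j}) = card ({1..j} - S)"
    proof -
      have "card (S - {1..j}) = j - card (S \<inter> {1..j})" using S fS by (simp add: card_Diff_subset_Int)
      moreover have "card ({1..j} - S) = j - card ({1..j} \<inter> S)" by (simp add: card_Diff_subset_Int)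
      ultimately show ?thesis by (simp add: Int_commute)
    qed
    then have c: "int (card (S - {1..j})) = int (card ({1..j} - S))" by simp
    have "(\<Sum>i\<in>S. \<bar>lk \<nu> i\<bar>) = (\<Sum>i\<in>S. lk \<nu> i)" using pos S by (intro sum.cong) auto
    also have "\<dots> = (\<Sum>i\<in>S \<inter> {1..j}. lk \<nu> i) + (\<Sum>i\<in>S - {1..j}. lk \<nu> i)"
      by (rule sum.Int_Diff[OF fS])
    also have "(\<Sum>i\<in>S - {1..j}. lk \<nu> i) \<le> int (card (S - {1..j})) * lk \<nu> j"
    proof (cases "j = 0")
      case True
      then show ?thesis using S fS by auto
    next
      case False
      show ?thesis
      by (rule sum_bounded_above) (use S j False dominant_antimono[OF d, of j] in force)
    qed
    also have "int (card (S - {1..j})) * lk \<nu> j \<le> (\<Sum>i\<in>{1..j} - S. lk \<nu> i)"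
      unfolding c by (rule sum_bounded_below) (use j dominant_antimono[OF d, of _ j] in auto)
    also have "(\<Sum>i\<in>S \<inter> {1..j}. lk \<nu> i) + (\<Sum>i\<in>{1..j} - S. lk \<nu> i) = psum j \<nu>"
      unfolding psum_def by (subst sum.Int_Diff[of "{1..j}" _ S]) (simp_all add: Int_commute)
    finally show "(\<Sum>i\<in>S. \<bar>lk \<nu> i\<bar>) \<le> psum j \<nu>" by simp
  qed
  have "psum j \<nu> = (\<Sum>i\<in>{1..j}. \<bar>lk \<nu> i\<bar>)" unfolding psum_def using pos j by (intro sum.cong) auto
  also have "\<dots> \<le> maxsum n (card {1..j}) \<nu>" using j by (intro maxsum_ge) auto
  finally show "psum j \<nu> \<le> maxsum n j \<nu>" by simp
qed

lemma psum_ext: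
  assumes "\<And>j. j \<in> {1..n} \<Longrightarrow> psum j \<mu> = psum j \<nu>" "i \<in> {1..n}"
  shows "lk \<mu> i = lk \<nu> i"
proof -
  obtain i' where i: "i = Suc i'" using assms(2) by (cases i) auto
  have "psum i' \<mu> = psum i' \<nu>" using assms i by (cases "i' = 0") (auto simp: psum_def)
  moreover have "psum i \<mu> = psum i \<nu>" using assms by blast
  moreover have "psum (Suc i') \<kappa> = psum i' \<kappa> + lk \<kappa> (Suc i')" for \<kappa> by (simp add: psum_def)
  ultimately show ?thesis by (simp add: i)
qed

text \<open>A dominant weight is determined by its partial sums, which are the orbit invariants
  \<open>maxsum\<close>.\<close>

lemma dominant_unique:
  assumes "v \<in> W0 n" "w \<in> W0 n" "dominant n (v \<mu>)" "dominant n (w \<mu>)"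
  shows "v \<mu> = w \<mu>"
proof (rule poly_mapping_eqI)
  fix i
  show "lk (v \<mu>) i = lk (w \<mu>) i"
  proof (cases "i \<in> {1..n}")
    case True
    show ?thesis
    proof (rule psum_ext[OF _ True])
      fix j assume "j \<in> {1..n}"
      then show "psum j (v \<mu>) = psum j (w \<mu>)"
        using dominant_maxsum[OF assms(3), of j] dominant_maxsum[OF assms(4), of j] maxsum_W0[OF assms(1)] maxsum_W0[OF assms(2)]
        by simp
    qed
  next
    case False
    have "lk (u \<mu>) i = lk \<mu> i" if "u \<in> W0 n" for u
      using that by (rule W0E) (use False in \<open>simp add: permutes_not_in\<close>)
    then show ?thesis using assms by simp
  qed
qed

lemma dominant_rep_eqI:
  assumes "w \<in> W0 n" "dominant n (w \<mu>)"
  shows "dominant_rep n \<mu> = w \<mu>"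
  unfolding dominant_rep_def
  by (rule the_equality) (use assms dominant_unique in blast)+

lemma dominant_rep_word:
  obtains "is" where "set is \<subseteq> {1..n}" "dominant_rep n \<mu> = word n is \<mu>" "dominant n (dominant_rep n \<mu>)"
  using exists_dominant_word[of n \<mu>] dominant_rep_eqI word_W0 by metis

lemma psum_dominant_rep: "j \<le> n \<Longrightarrow> psum j (dominant_rep n \<mu>) = maxsum n j \<mu>"
  by (rule dominant_rep_word[of n \<mu>]) (metis dominant_maxsum maxsum_W0 word_W0)

lemma word_lattice: "set is \<subseteq> {1..n} \<Longrightarrow> \<mu> \<in> lattice n \<Longrightarrow> word n is \<mu> \<in> lattice n"
  by (induction "is") (auto simp: simple_refl_rw rw_lattice)

lemma dominant_rep_lattice: "\<mu> \<in> lattice n \<Longrightarrow> dominant_rep n \<mu> \<in> lattice n"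
  by (rule dominant_rep_word[of n \<mu>]) (simp add: word_lattice)

lemma lattice_eqI:
  "\<mu> \<in> lattice n \<Longrightarrow> \<nu> \<in> lattice n \<Longrightarrow> (\<And>i. i \<in> {1..n} \<Longrightarrow> lk \<mu> i = lk \<nu> i) \<Longrightarrow> \<mu> = \<nu>"
  by (rule poly_mapping_eqI) (metis latticeD)

lemma sqn_eq:
  assumes "\<mu> \<in> lattice n" "\<nu> \<in> lattice n" "\<And>j. j \<in> {1..n} \<Longrightarrow> maxsum n j \<mu> = maxsum n j \<nu>"
  shows "dominant_rep n \<mu> = dominant_rep n \<nu>" "sqn n \<mu> = sqn n \<nu>"
proof -
  show 1: "dominant_rep n \<mu> = dominant_rep n \<nu>"
  proof (rule lattice_eqI[OF dominant_rep_lattice dominant_rep_lattice])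
    fix i assume "i \<in> {1..n}"
    then show "lk (dominant_rep n \<mu>) i = lk (dominant_rep n \<nu>) i"
      by (intro psum_ext[of n]) (use assms psum_dominant_rep in auto)
  qed (use assms in auto)
  have "sqn n (dominant_rep n \<kappa>) = sqn n \<kappa>" for \<kappa>
    by (rule dominant_rep_word[of n \<kappa>]) (metis sqn_W0 word_W0)
  then show "sqn n \<mu> = sqn n \<nu>" using 1 by metis
qed

lemma psum_add: "psum j (\<mu> + \<nu>) = psum j \<mu> + psum j \<nu>"
  by (simp add: psum_def lookup_add sum.distrib)

lemma psum_diff: "psum j (\<mu> - \<nu>) = psum j \<mu> - psum j \<nu>"
  by (simp add: psum_def lookup_minus sum_subtractf)

lemma psum_single: "psum j (Poly_Mapping.single i r) = (if i \<in> {1..j} then r else 0)"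
proof -
  have "psum j (Poly_Mapping.single i r) = (\<Sum>k\<in>{1..j}. if i = k then r else 0)"
    unfolding psum_def by (rule sum.cong) (auto simp: lookup_single when_def)
  then show ?thesis by simp
qed

lemma psum_sum: "psum j (sum f A) = (\<Sum>a\<in>A. psum j (f a))"
  unfolding psum_def lookup_sum by (rule sum.swap)

text \<open>The coefficient of the \<open>j\<close>-th simple root in a weight is its
  \<open>j\<close>-th partial sum.\<close>

lemma wt_ge_psum:
  assumes "1 \<le> n" "\<mu> \<in> lattice n" "\<nu> \<in> lattice n"
  shows "wt_ge n \<mu> \<nu> \<longleftrightarrow> (\<forall>j\<in>{1..n}. psum j \<nu> \<le> psum j \<mu>)"
proof -
  define R :: "(nat \<Rightarrow> nat) \<Rightarrow> weight" where "R c = (\<Sum>i\<in>{1..<n}. Poly_Mapping.single i (int (c i)) - Poly_Mapping.single (Suc i) (int (c i)))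
       + Poly_Mapping.single n (int (c n))" for c
  have p: "psum j (R c) = int (c j)" if j: "j \<in> {1..n}" for j c
  proof -
    have "psum j (R c) = (\<Sum>i\<in>{1..<n}. if i = j then int (c i) else 0) + (if n = j then int (c n) else 0)"
      unfolding R_def psum_add psum_sum psum_diff psum_single
      using j by (intro arg_cong2[where f = plus] sum.cong) auto
    then show ?thesis using j by auto
  qed
  have l: "R c \<in> lattice n" for c
    by (rule latticeI) (use assms(1) in \<open>auto simp: R_def lookup_add lookup_sum lookup_minus lookup_single when_def intro!: sum.neutral\<close>)
  have d: "\<mu> - \<nu> \<in> lattice n" using assms by (intro latticeI) (simp add: lookup_minus latticeD)
  show ?thesis
  proof
    assume "wt_ge n \<mu> \<nu>"
    then obtain c where "\<mu> - \<nu> = R c" unfolding wt_ge_def R_def by blast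
    then have "psum j \<mu> - psum j \<nu> = int (c j)" if "j \<in> {1..n}" for j
      using p[OF that] by (metis psum_diff)
    then show "\<forall>j\<in>{1..n}. psum j \<nu> \<le> psum j \<mu>" by force
  next
    assume a: "\<forall>j\<in>{1..n}. psum j \<nu> \<le> psum j \<mu>"
    define c where "c j = nat (psum j \<mu> - psum j \<nu>)" for j
    have "psum j (\<mu> - \<nu>) = psum j (R c)" if "j \<in> {1..n}" for j
      using a that p[OF that, of c] by (simp add: c_def psum_diff)
    then have "\<mu> - \<nu> = R c" by (intro lattice_eqI[OF d l] psum_ext[of n])
    then show "wt_ge n \<mu> \<nu>" unfolding wt_ge_def R_def by blast
  qed
qed

text \<open>\<open>mle\<close> compares dominant representatives and \<open>ple\<close> the weights
  themselves; \<open>wt_succeq\<close> is lexicographic in the two.\<close>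

definition mle :: "nat \<Rightarrow> weight \<Rightarrow> weight \<Rightarrow> bool" where
  "mle n \<nu> \<mu> \<longleftrightarrow> (\<forall>j\<in>{1..n}. maxsum n j \<nu> \<le> maxsum n j \<mu>)"

definition ple :: "nat \<Rightarrow> weight \<Rightarrow> weight \<Rightarrow> bool" where
  "ple n \<nu> \<mu> \<longleftrightarrow> (\<forall>j\<in>{1..n}. psum j \<nu> \<le> psum j \<mu>)"

lemma mle_trans: "mle n a b \<Longrightarrow> mle n b c \<Longrightarrow> mle n a c"
  by (force simp: mle_def)

lemma mle_refl [simp]: "mle n a a" by (simp add: mle_def)

lemma ple_trans: "ple n a b \<Longrightarrow> ple n b c \<Longrightarrow> ple n a c"
  by (force simp: ple_def)

lemma ple_refl [simp]: "ple n a a" by (simp add: ple_def)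

lemma ple_antisym: "\<mu> \<in> lattice n \<Longrightarrow> \<nu> \<in> lattice n \<Longrightarrow> ple n \<mu> \<nu> \<Longrightarrow> ple n \<nu> \<mu> \<Longrightarrow> \<mu> = \<nu>"
  by (rule lattice_eqI, assumption+, rule psum_ext[of n]) (auto simp: ple_def intro: antisym)

lemma wt_succeq_iff:
  assumes "1 \<le> n" "\<mu> \<in> lattice n" "\<nu> \<in> lattice n"
  shows "wt_succeq n \<mu> \<nu> \<longleftrightarrow> mle n \<nu> \<mu> \<and> (mle n \<mu> \<nu> \<longrightarrow> ple n \<nu> \<mu>)"
proof -
  have 1: "wt_ge n (dominant_rep n \<mu>) (dominant_rep n \<nu>) \<longleftrightarrow> mle n \<nu> \<mu>"
    using assms by (simp add: wt_ge_psum dominant_rep_lattice psum_dominant_rep mle_def)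
  have 2: "dominant_rep n \<mu> = dominant_rep n \<nu> \<longleftrightarrow> mle n \<nu> \<mu> \<and> mle n \<mu> \<nu>"
  proof
    assume "dominant_rep n \<mu> = dominant_rep n \<nu>"
    then have "maxsum n j \<mu> = maxsum n j \<nu>" if "j \<in> {1..n}" for j
      using that by (metis psum_dominant_rep atLeastAtMost_iff)
    then show "mle n \<nu> \<mu> \<and> mle n \<mu> \<nu>" by (simp add: mle_def)
  next
    assume "mle n \<nu> \<mu> \<and> mle n \<mu> \<nu>"
    then show "dominant_rep n \<mu> = dominant_rep n \<nu>"
      by (intro sqn_eq assms) (auto simp: mle_def intro: antisym)
  qed
  show ?thesis unfolding wt_succeq_def 1 2 using wt_ge_psum[OF assms] by (auto simp: ple_def)
qed

lemma mleI:
  assumes "\<And>S. S \<subseteq> {1..n} \<Longrightarrow> \<exists>S'\<subseteq>{1..n}. card S' = card S \<and> (\<Sum>i\<in>S. \<bar>lk \<theta> i\<bar>) \<le> (\<Sum>i\<in>S'. \<bar>lk \<mu> i\<bar>)"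
  shows "mle n \<theta> \<mu>"
  unfolding mle_def
proof
  fix j assume "j \<in> {1..n}"
  then show "maxsum n j \<theta> \<le> maxsum n j \<mu>"
  proof (intro maxsum_le)
    fix S assume S: "S \<subseteq> {1..n}" "card S = j"
    obtain S' where "S' \<subseteq> {1..n}" "card S' = j" "(\<Sum>i\<in>S. \<bar>lk \<theta> i\<bar>) \<le> (\<Sum>i\<in>S'. \<bar>lk \<mu> i\<bar>)"
      using assms[OF S(1)] S(2) by blast
    then show "(\<Sum>i\<in>S. \<bar>lk \<theta> i\<bar>) \<le> maxsum n j \<mu>" using maxsum_ge[of S' n \<mu>] by simp
  qed auto
qed

definition mless :: "nat \<Rightarrow> weight \<Rightarrow> weight \<Rightarrow> bool" where
  "mless n \<nu> \<mu> \<longleftrightarrow> mle n \<nu> \<mu> \<and> \<not> mle n \<mu> \<nu>"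

text \<open>Equal values of \<open>maxsum\<close> would mean equal dominant representatives and
  hence equal norms.\<close>

lemma mlessI:
  assumes "\<mu> \<in> lattice n" "\<theta> \<in> lattice n" "mle n \<theta> \<mu>" "sqn n \<theta> < sqn n \<mu>"
  shows "mless n \<theta> \<mu>"
  unfolding mless_def
proof
  show "\<not> mle n \<mu> \<theta>"
  proof
    assume "mle n \<mu> \<theta>"
    then have "sqn n \<mu> = sqn n \<theta>"
      using assms by (intro sqn_eq) (auto simp: mle_def intro: antisym)
    with assms show False by simp
  qed
qed (use assms in simp)

lemma mless_end:
  assumes "\<mu> \<in> lattice n" "i \<in> {1..n}" "\<bar>lk \<theta> i\<bar> < \<bar>lk \<mu> i\<bar>" "\<And>j. j \<noteq> i \<Longrightarrow> lk \<theta> j = lk \<mu> j"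
  shows "mless n \<theta> \<mu>"
proof (rule mlessI)
  have le: "\<bar>lk \<theta> j\<bar> \<le> \<bar>lk \<mu> j\<bar>" for j using assms(3,4) by (cases "j = i") auto
  show "\<theta> \<in> lattice n" using assms by (intro latticeI) (metis latticeD)
  show "mle n \<theta> \<mu>" by (rule mleI) (use le in \<open>auto intro!: sum_mono\<close>)
  have "(lk \<theta> j)^2 \<le> (lk \<mu> j)^2" for j using le[of j] by (simp add: abs_le_square_iff)
  moreover have "(lk \<theta> i)^2 < (lk \<mu> i)^2" using assms(3) by (metis abs_le_square_iff linorder_not_le)
  ultimately show "sqn n \<theta> < sqn n \<mu>" unfolding sqn_def by (intro sum_strict_mono_ex1) (use assms(2) in auto)
qed (use assms in auto)

text \<open>Two neighbouring entries move strictly between the old ones \<open>a\<close> and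
  \<open>b\<close> with the same sum. A set containing just one of them is compared with itself or
  with the set where the other takes its place, because a number between \<open>a\<close> and
  \<open>b\<close> does not exceed both in absolute value. The norm drops since
  \<open>(a' - a) * (a' - b) < 0\<close>.\<close>

lemma mless_mid:
  assumes "\<mu> \<in> lattice n" "i \<in> {1..<n}" "lk \<theta> i + lk \<theta> (Suc i) = lk \<mu> i + lk \<mu> (Suc i)"
    "min (lk \<mu> i) (lk \<mu> (Suc i)) < lk \<theta> i" "lk \<theta> i < max (lk \<mu> i) (lk \<mu> (Suc i))"
    "\<And>j. j \<noteq> i \<Longrightarrow> j \<noteq> Suc i \<Longrightarrow> lk \<theta> j = lk \<mu> j"
  shows "mless n \<theta> \<mu>"
proof (rule mlessI)
  show "\<theta> \<in> lattice n" using assms(1,2,6) by (intro latticeI) (metis Suc_leI atLeastAtMost_iff atLeastLessThan_iff latticeD le_Suc_eq less_imp_le_nat)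
  let ?s = "Transposition.transpose i (Suc i)"
  define a b a' b' where ab: "a = lk \<mu> i" "b = lk \<mu> (Suc i)" "a' = lk \<theta> i" "b' = lk \<theta> (Suc i)"
  note h = assms(3-5)[folded ab]
  show "mle n \<theta> \<mu>"
  proof (rule mleI)
    fix S assume S: "S \<subseteq> {1..n}"
    have fS: "finite S" using S finite_subset by blast
    let ?R = "S - {i, Suc i}"
    have R: "(\<Sum>j\<in>?R. \<bar>lk \<theta> j\<bar>) = (\<Sum>j\<in>?R. \<bar>lk \<mu> j\<bar>)" using assms(6) by (intro sum.cong) auto
    have fR: "finite ?R" using fS by simp
    consider "i \<in> S" "Suc i \<in> S" | "i \<notin> S" "Suc i \<notin> S" | "i \<in> S" "Suc i \<notin> S" | "i \<notin> S" "Suc i \<in> S" by blast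
    then show "\<exists>S'\<subseteq>{1..n}. card S' = card S \<and> (\<Sum>i\<in>S. \<bar>lk \<theta> i\<bar>) \<le> (\<Sum>i\<in>S'. \<bar>lk \<mu> i\<bar>)"
    proof cases
      case 1
      then have e: "S = insert i (insert (Suc i) ?R)" by auto
      have "(\<Sum>j\<in>S. \<bar>lk \<kappa> j\<bar>) = \<bar>lk \<kappa> i\<bar> + (\<bar>lk \<kappa> (Suc i)\<bar> + (\<Sum>j\<in>?R. \<bar>lk \<kappa> j\<bar>))" for \<kappa> :: weight
        by (subst e) (use fR in simp)
      moreover have "\<bar>a'\<bar> + \<bar>b'\<bar> \<le> \<bar>a\<bar> + \<bar>b\<bar>" using h by linarith
      ultimately show ?thesis using S R by (intro exI[of _ S]) (simp add: ab)
    next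
      case 2
      then have e: "S = ?R" by auto
      show ?thesis using S R e by (intro exI[of _ S]) simp
    next
      case 3
      then have e: "S = insert i ?R" by auto
      have s: "(\<Sum>j\<in>S. \<bar>lk \<theta> j\<bar>) = \<bar>a'\<bar> + (\<Sum>j\<in>?R. \<bar>lk \<mu> j\<bar>)"
        unfolding R[symmetric] ab by (subst e) (use fR in simp)
      have s1: "(\<Sum>j\<in>S. \<bar>lk \<mu> j\<bar>) = \<bar>a\<bar> + (\<Sum>j\<in>?R. \<bar>lk \<mu> j\<bar>)"
        unfolding ab by (subst e) (use fR in simp)
      have s2: "(\<Sum>j\<in>insert (Suc i) ?R. \<bar>lk \<mu> j\<bar>) = \<bar>b\<bar> + (\<Sum>j\<in>?R. \<bar>lk \<mu> j\<bar>)"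
        unfolding ab using fR by simp
      have c: "card (insert (Suc i) ?R) = card S" by (subst (2) e) (use fR in simp)
      have "\<bar>a'\<bar> \<le> \<bar>a\<bar> \<or> \<bar>a'\<bar> \<le> \<bar>b\<bar>" using h by linarith
      then show ?thesis
      proof
        assume "\<bar>a'\<bar> \<le> \<bar>a\<bar>" then show ?thesis using S s s1 by (intro exI[of _ S]) simp
      next
        assume "\<bar>a'\<bar> \<le> \<bar>b\<bar>" then show ?thesis using S s s2 c assms(2) by (intro exI[of _ "insert (Suc i) ?R"]) auto
      qed
    next
      case 4
      then have e: "S = insert (Suc i) ?R" by auto
      have s: "(\<Sum>j\<in>S. \<bar>lk \<theta> j\<bar>) = \<bar>b'\<bar> + (\<Sum>j\<in>?R. \<bar>lk \<mu> j\<bar>)"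
        unfolding R[symmetric] ab by (subst e) (use fR in simp)
      have s1: "(\<Sum>j\<in>S. \<bar>lk \<mu> j\<bar>) = \<bar>b\<bar> + (\<Sum>j\<in>?R. \<bar>lk \<mu> j\<bar>)"
        unfolding ab by (subst e) (use fR in simp)
      have s2: "(\<Sum>j\<in>insert i ?R. \<bar>lk \<mu> j\<bar>) = \<bar>a\<bar> + (\<Sum>j\<in>?R. \<bar>lk \<mu> j\<bar>)"
        unfolding ab using fR by simp
      have c: "card (insert i ?R) = card S" by (subst (2) e) (use fR in simp)
      have "\<bar>b'\<bar> \<le> \<bar>a\<bar> \<or> \<bar>b'\<bar> \<le> \<bar>b\<bar>" using h by linarith
      then show ?thesis
      proof
        assume "\<bar>b'\<bar> \<le> \<bar>b\<bar>" then show ?thesis using S s s1 by (intro exI[of _ S]) simp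
      next
        assume "\<bar>b'\<bar> \<le> \<bar>a\<bar>" then show ?thesis using S s s2 c assms(2) by (intro exI[of _ "insert i ?R"]) auto
      qed
    qed
  qed
  have e: "{1..n} = insert i (insert (Suc i) ({1..n} - {i, Suc i}))" using assms(2) by auto
  have s: "sqn n \<kappa> = (lk \<kappa> i)^2 + ((lk \<kappa> (Suc i))^2 + (\<Sum>j\<in>{1..n} - {i, Suc i}. (lk \<kappa> j)^2))" for \<kappa>
    unfolding sqn_def by (subst e) simp
  have "(\<Sum>j\<in>{1..n} - {i, Suc i}. (lk \<theta> j)^2) = (\<Sum>j\<in>{1..n} - {i, Suc i}. (lk \<mu> j)^2)"
    using assms(6) by (intro sum.cong) auto
  moreover have "a'^2 + b'^2 < a^2 + b^2"
  proof -
    have b': "b' = a + b - a'" using h by simp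
    have "(a' - a) * (a' - b) < 0" using h by (auto simp: mult_less_0_iff min_def max_def split: if_splits)
    moreover have "a'^2 + b'^2 - (a^2 + b^2) = 2 * ((a' - a) * (a' - b))" unfolding b' by algebra
    ultimately show ?thesis by linarith
  qed
  ultimately show "sqn n \<theta> < sqn n \<mu>" by (simp add: s flip: ab)
qed (use assms in auto)

lemma negate_1_W0: "1 \<le> n \<Longrightarrow> rw n 0 \<in> W0 n"
  by (rule W0I[of id _ "\<lambda>j. if j = 1 then -1 else 1"]) (auto simp: permutes_id lookup_rw)

lemma rw_W0': "1 \<le> n \<Longrightarrow> i \<le> n \<Longrightarrow> rw n i \<in> W0 n"
  using negate_1_W0 rw_W0 by (cases "i = 0") auto

lemma finite_mle: "finite {\<nu> \<in> lattice n. mle n \<nu> \<mu>}"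
proof -
  define B where "B = maxsum n 1 \<mu>"
  have b: "\<bar>lk \<nu> i\<bar> \<le> B" if "mle n \<nu> \<mu>" "i \<in> {1..n}" for \<nu> i
  proof -
    have "\<bar>lk \<nu> i\<bar> \<le> maxsum n 1 \<nu>" using maxsum_ge[of "{i}" n \<nu>] that by simp
    also have "\<dots> \<le> B" using that unfolding mle_def B_def by auto
    finally show ?thesis .
  qed
  have "(\<lambda>\<nu>. restrict (lk \<nu>) {1..n}) ` {\<nu> \<in> lattice n. mle n \<nu> \<mu>} \<subseteq> {1..n} \<rightarrow>\<^sub>E {-B..B}"
    using b by (fastforce simp: abs_le_iff)
  then have "finite ((\<lambda>\<nu>. restrict (lk \<nu>) {1..n}) ` {\<nu> \<in> lattice n. mle n \<nu> \<mu>})"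
    by (rule finite_subset) (simp add: finite_PiE)
  moreover have "inj_on (\<lambda>\<nu>. restrict (lk \<nu>) {1..n}) {\<nu> \<in> lattice n. mle n \<nu> \<mu>}"
  proof (rule inj_onI, rule lattice_eqI[of _ n])
    fix x y i assume "restrict (lk x) {1..n} = restrict (lk y) {1..n}" "i \<in> {1..n}"
    then show "lk x i = lk y i" by (metis restrict_apply')
  qed auto
  ultimately show ?thesis by (rule finite_imageD)
qed

section \<open>Shortest coset representatives\<close>

definition sroot :: "nat \<Rightarrow> nat \<Rightarrow> weight" where
  "sroot n j = (if j = n then Poly_Mapping.single n 1 else Poly_Mapping.single j 1 - Poly_Mapping.single (Suc j) 1)"

lemma lookup_sroot: "lk (sroot n j) i = (if i = j then 1 else if i = Suc j \<and> j \<noteq> n then -1 else 0)"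
  by (auto simp: sroot_def lookup_single lookup_minus when_def)

lemma W0_single:
  fixes w :: "weight \<Rightarrow> weight"
  assumes "\<pi> permutes {1..n}" "\<And>\<mu> i. lk (w \<mu>) i = \<epsilon> i * lk \<mu> (\<pi> i)"
  shows "w (Poly_Mapping.single j r) = Poly_Mapping.single (inv \<pi> j) (\<epsilon> (inv \<pi> j) * r)"
proof (rule poly_mapping_eqI)
  fix i
  have "j = \<pi> i \<longleftrightarrow> inv \<pi> j = i" using assms(1) by (metis permutes_inverses)
  then show "lk (w (Poly_Mapping.single j r)) i = lk (Poly_Mapping.single (inv \<pi> j) (\<epsilon> (inv \<pi> j) * r)) i"
    unfolding assms(2) lookup_single when_def by (metis mult_zero_right)
qed

lemma W0_diff: "w \<in> W0 n \<Longrightarrow> w (\<mu> - \<nu>) = w \<mu> - w \<nu>"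
  by (erule W0E, rule poly_mapping_eqI) (simp add: lookup_minus right_diff_distrib)

lemma W0_sroot:
  assumes "\<pi> permutes {1..n}" "\<And>i. \<epsilon> i \<in> {1, -1}" "\<And>i. i \<notin> {1..n} \<Longrightarrow> \<epsilon> i = 1"
    "\<And>\<mu> i. lk (w \<mu>) i = \<epsilon> i * lk \<mu> (\<pi> i)"
  shows "w (sroot n j) = (if j = n then Poly_Mapping.single (inv \<pi> n) (\<epsilon> (inv \<pi> n))
    else Poly_Mapping.single (inv \<pi> j) (\<epsilon> (inv \<pi> j)) - Poly_Mapping.single (inv \<pi> (Suc j)) (\<epsilon> (inv \<pi> (Suc j))))"
proof -
  have "w \<in> W0 n" by (rule W0I[OF assms])
  then show ?thesis by (simp add: sroot_def W0_diff W0_single[OF assms(1,4)])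
qed

lemma pm_one_cases: "x \<in> {1, -1 :: int} \<Longrightarrow> (x = 1 \<Longrightarrow> Q) \<Longrightarrow> (x = -1 \<Longrightarrow> Q) \<Longrightarrow> Q"
  by auto

text \<open>The classical fact that a simple reflection makes no positive root negative except its
  own simple root, checked on signed unit vectors.\<close>

lemma negative_after_reflection:
  assumes w: "w \<in> W0 n" and ij: "1 \<le> i" "i \<le> n" "1 \<le> j" "j \<le> n"
    and pos: "0 \<le> hgt n (w (sroot n j))" and neg: "hgt n (rw n i (w (sroot n j))) < 0"
  shows "w (sroot n j) = sroot n i" "i = n \<longleftrightarrow> j = n"
proof -
  obtain \<pi> \<epsilon> where a: "\<pi> permutes {1..n}" "\<And>i. \<epsilon> i \<in> {1, -1}" "\<And>i. i \<notin> {1..n} \<Longrightarrow> \<epsilon> i = 1"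
    "\<And>\<mu> i. lk (w \<mu>) i = \<epsilon> i * lk \<mu> (\<pi> i)" using w by (rule W0E) blast
  have inr: "inv \<pi> k \<in> {1..n}" if "k \<in> {1..n}" for k
    using permutes_in_image[OF permutes_inv[OF a(1)], of k] that by simp
  define p s where "p = inv \<pi> j" and "s = \<epsilon> p"
  define r s' where "r = inv \<pi> (Suc j)" and "s' = \<epsilon> r"
  have p: "1 \<le> p" "p \<le> n" using inr[of j] ij by (auto simp: p_def)
  have s: "s \<in> {1, -1}" "s' \<in> {1, -1}" using a(2) unfolding s_def s'_def by blast+
  have "(w (sroot n j) = sroot n i) \<and> (i = n \<longleftrightarrow> j = n)"
  proof (cases "j = n")
    case True
    then have g: "w (sroot n j) = Poly_Mapping.single p s"
      using W0_sroot[OF a, of j] by (simp add: p_def s_def)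
    have h: "hgt n (Poly_Mapping.single p s) = (int n + 1 - int p) * s"
      using hgt_single[of p n s] p by simp
    have "dd n i (Poly_Mapping.single p s) = (if i = n then - (if p = n then s else 0)
      else (if p = Suc i then s else 0) - (if p = i then s else 0))"
      using ij by (auto simp: dd_def lookup_single when_def)
    then have n: "(int n + 1 - int p) * s + (if i = n then 2 else 1) * (if i = n then - (if p = n then s else 0)
      else (if p = Suc i then s else 0) - (if p = i then s else 0)) < 0"
      using neg hgt_rw[OF ij(1,2), of "Poly_Mapping.single p s"] h g by simp
    show ?thesis
      using s(1)
    proof (rule pm_one_cases)
      assume s1: "s = 1"
      have "i = n \<and> p = n" using n p ij unfolding s1 by (auto split: if_splits)
      then show ?thesis using True g s1 by (simp add: sroot_def)
    next
      assume "s = -1"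
      then show ?thesis using pos h g p by simp
    qed
  next
    case False
    have r: "1 \<le> r" "r \<le> n" using inr[of "Suc j"] ij False by (auto simp: r_def)
    have pr: "p \<noteq> r" unfolding p_def r_def using permutes_inj[OF permutes_inv[OF a(1)]] by (metis injD n_not_Suc_n)
    have g: "w (sroot n j) = Poly_Mapping.single p s - Poly_Mapping.single r s'"
      using W0_sroot[OF a, of j] False by (simp add: p_def s_def r_def s'_def)
    have h: "hgt n (w (sroot n j)) = (int n + 1 - int p) * s - (int n + 1 - int r) * s'"
      using hgt_single[of p n s] hgt_single[of r n s'] p r by (simp add: g hgt_diff)
    have "dd n i (w (sroot n j)) = (if i = n then - (if p = n then s else 0) + (if r = n then s' else 0)
      else (if p = Suc i then s else 0) - (if r = Suc i then s' else 0) - (if p = i then s else 0) + (if r = i then s' else 0))"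
      unfolding g using ij by (auto simp: dd_def lookup_single lookup_minus when_def)
    then have n: "(int n + 1 - int p) * s - (int n + 1 - int r) * s' + (if i = n then 2 else 1) *
      (if i = n then - (if p = n then s else 0) + (if r = n then s' else 0)
      else (if p = Suc i then s else 0) - (if r = Suc i then s' else 0) - (if p = i then s else 0) + (if r = i then s' else 0)) < 0"
      using neg hgt_rw[OF ij(1,2), of "w (sroot n j)"] h by simp
    show ?thesis
      using s(1)
    proof (rule pm_one_cases)
      assume s1: "s = 1"
      show ?thesis using s(2)
      proof (rule pm_one_cases)
        assume s2: "s' = 1"
        have "p < r" using pos pr unfolding h s1 s2 by simp
        then have "i \<noteq> n \<and> p = i \<and> r = Suc i" using n p r ij unfolding s1 s2 by (auto split: if_splits)
        then show ?thesis using False g s1 s2 by (simp add: sroot_def)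
      next
        assume s2: "s' = -1"
        show ?thesis using n p r pr ij unfolding s1 s2 by (auto split: if_splits)
      qed
    next
      assume s1: "s = -1"
      show ?thesis using s(2)
      proof (rule pm_one_cases)
        assume s2: "s' = 1"
        show ?thesis using pos p r unfolding h s1 s2 by simp
      next
        assume s2: "s' = -1"
        have "r < p" using pos pr unfolding h s1 s2 by simp
        then have "i \<noteq> n \<and> r = i \<and> p = Suc i" using n p r ij unfolding s1 s2 by (auto split: if_splits)
        then show ?thesis using False g s1 s2 by (simp add: sroot_def single_uminus)
      qed
    qed
  qed
  then show "w (sroot n j) = sroot n i" "i = n \<longleftrightarrow> j = n" by auto
qed

lemma W0_conjugate_reflection:
  assumes w: "w \<in> W0 n" and ij: "1 \<le> i" "i \<le> n" "1 \<le> j" "j \<le> n" "i = n \<longleftrightarrow> j = n"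
    and r: "w (sroot n j) = sroot n i"
  shows "rw n i (w \<nu>) = w (rw n j \<nu>)"
proof -
  obtain \<pi> \<epsilon> where a: "\<pi> permutes {1..n}" "\<And>i. \<epsilon> i \<in> {1, -1}" "\<And>i. i \<notin> {1..n} \<Longrightarrow> \<epsilon> i = 1"
    "\<And>\<mu> i. lk (w \<mu>) i = \<epsilon> i * lk \<mu> (\<pi> i)" using w by (rule W0E) blast
  have e: "\<epsilon> k * lk (sroot n j) (\<pi> k) = lk (sroot n i) k" for k
    using arg_cong[OF r, of "\<lambda>x. lk x k"] a(4) by simp
  have z: "lk (zw n l d) k = (if l = n then 2 else 1) * d * lk (sroot n l) k" if "1 \<le> l" for l k d
    using that by (auto simp: zw_def lookup_sroot lookup_single lookup_minus when_def)
  have inj: "\<pi> k = \<pi> l \<longleftrightarrow> k = l" for k l using permutes_inj[OF a(1)] by (auto dest: injD)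
  have d: "dd n i (w \<nu>) = dd n j \<nu>"
  proof (cases "j = n")
    case True
    have "\<pi> n = n \<and> \<epsilon> n = 1" using e[of n] ij True by (auto simp: lookup_sroot split: if_splits)
    then show ?thesis using ij True by (auto simp: dd_def a(4))
  next
    case False
    have 1: "(\<pi> i = j \<and> \<epsilon> i = 1) \<or> (\<pi> i = Suc j \<and> \<epsilon> i = -1)"
      using e[of i] ij False by (auto simp: lookup_sroot split: if_splits)
    have 2: "(\<pi> (Suc i) = j \<and> \<epsilon> (Suc i) = -1) \<or> (\<pi> (Suc i) = Suc j \<and> \<epsilon> (Suc i) = 1)"
      using e[of "Suc i"] ij False by (auto simp: lookup_sroot split: if_splits)
    have "\<pi> i \<noteq> \<pi> (Suc i)" using inj by simp
    then show ?thesis using 1 2 ij False by (auto simp: dd_def a(4))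
  qed
  show ?thesis
  proof (rule poly_mapping_eqI)
    fix k
    have "lk (zw n i (dd n i (w \<nu>))) k = \<epsilon> k * lk (zw n j (dd n j \<nu>)) (\<pi> k)"
      using ij by (simp add: z d e[symmetric])
    then show "lk (rw n i (w \<nu>)) k = lk (w (rw n j \<nu>)) k"
      by (simp add: rw_eq lookup_add a(4) distrib_left)
  qed
qed

lemma hgt_sroot: "1 \<le> j \<Longrightarrow> j \<le> n \<Longrightarrow> hgt n (sroot n j) = 1"
  by (auto simp: sroot_def hgt_diff hgt_single)

text \<open>The exchange condition. At the letter where the image of the simple root turns negative,
  that image is the simple root of the letter, so the letter can be deleted.\<close>

lemma exchange:
  assumes "set is \<subseteq> {1..n}" "1 \<le> j" "j \<le> n" "hgt n (word n is (sroot n j)) < 0"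
  shows "\<exists>is'. set is' \<subseteq> {1..n} \<and> length is' < length is \<and> word n is' = word n is \<circ> rw n j"
  using assms
proof (induction "is")
  case Nil
  then show ?case by (simp add: hgt_sroot)
next
  case (Cons i "is")
  have i: "1 \<le> i" "i \<le> n" using Cons(2) by auto
  show ?case
  proof (cases "hgt n (word n is (sroot n j)) < 0")
    case True
    have "\<exists>is'. set is' \<subseteq> {1..n} \<and> length is' < length is \<and> word n is' = word n is \<circ> rw n j"
      by (rule Cons.IH) (use Cons.prems True in auto)
    then obtain is' where "set is' \<subseteq> {1..n}" "length is' < length is" "word n is' = word n is \<circ> rw n j"
      by blast
    then show ?thesis using i by (intro exI[of _ "i # is'"]) (auto simp: fun_eq_iff)
  next
    case False
    have w: "word n is \<in> W0 n" using Cons by (intro word_W0) auto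
    have n: "hgt n (rw n i (word n is (sroot n j))) < 0" using Cons i by (simp add: simple_refl_rw)
    note 1 = negative_after_reflection[OF w i Cons(3,4) _ n]
    have "rw n i (word n is \<nu>) = word n is (rw n j \<nu>)" for \<nu>
      using W0_conjugate_reflection[OF w i Cons(3,4)] 1 False by auto
    then have "word n is = word n (i # is) \<circ> rw n j"
      using i by (auto simp: fun_eq_iff simple_refl_rw)
    moreover have "set is \<subseteq> {1..n}" "length is < length (i # is)" using Cons(2) by auto
    ultimately show ?thesis by blast
  qed
qed

text \<open>Some word brings \<open>w \<delta>\<close> back to the dominant chamber, and the entries
  \<open>n, ..., 1\<close> of \<open>\<delta>\<close> are positive and distinct, so its stabilizer
  is trivial.\<close>

lemma W0_is_word:
  assumes w: "w \<in> W0 n"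
  shows "\<exists>is. set is \<subseteq> {1..n} \<and> w = word n is"
proof -
  define \<delta> :: weight where "\<delta> = (\<Sum>i\<in>{1..n}. Poly_Mapping.single i (int n + 1 - int i))"
  have l: "lk \<delta> i = int n + 1 - int i" if "i \<in> {1..n}" for i
  proof -
    have "lk \<delta> i = (\<Sum>j\<in>{1..n}. if j = i then int n + 1 - int i else 0)"
      unfolding \<delta>_def lookup_sum by (intro sum.cong) (auto simp: lookup_single when_def)
    then show ?thesis using that by simp
  qed
  have dom: "dominant n \<delta>" by (auto simp: dominant_def l)
  obtain "is" where i: "set is \<subseteq> {1..n}" "dominant n (word n is (w \<delta>))"
    using exists_dominant_word by blast
  have x: "word n is \<circ> w \<in> W0 n" using W0_comp word_W0 i w by blast
  have "(word n is \<circ> w) \<delta> = id \<delta>"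
    using i dom by (intro dominant_unique[OF x W0_id]) simp_all
  moreover obtain \<pi> \<epsilon> where a: "\<pi> permutes {1..n}" "\<And>i. \<epsilon> i \<in> {1, -1}" "\<And>i. i \<notin> {1..n} \<Longrightarrow> \<epsilon> i = 1"
    "\<And>\<mu> i. lk ((word n is \<circ> w) \<mu>) i = \<epsilon> i * lk \<mu> (\<pi> i)" using x by (rule W0E) blast
  ultimately have e: "\<epsilon> i * lk \<delta> (\<pi> i) = lk \<delta> i" for i by (metis id_apply)
  have "\<pi> i = i \<and> \<epsilon> i = 1" for i
  proof (cases "i \<in> {1..n}")
    case True
    then have "\<pi> i \<in> {1..n}" using permutes_in_image[OF a(1)] by simp
    then show ?thesis using e[of i] a(2)[of i] True l[of i] l[of "\<pi> i"] by auto
  next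
    case False
    then show ?thesis using a by (simp add: permutes_not_in)
  qed
  then have "(word n is \<circ> w) \<mu> = \<mu>" for \<mu> by (intro poly_mapping_eqI) (simp add: a(4) del: o_apply)
  then have "word n (rev is) \<mu> = w \<mu>" for \<mu> using word_rev[OF i(1), of "w \<mu>"] by simp
  then show ?thesis using i by (intro exI[of _ "rev is"]) (auto simp: fun_eq_iff)
qed

lemma W0_length_le: "set is \<subseteq> {1..n} \<Longrightarrow> W0_length n (word n is) \<le> length is"
  unfolding W0_length_def by (rule Least_le) (auto simp: word_def)

lemma W0_length_word:
  assumes "w \<in> W0 n"
  obtains "is" where "set is \<subseteq> {1..n}" "w = word n is" "length is = W0_length n w"
proof -
  have "\<exists>l is. length is = l \<and> set is \<subseteq> {1..n} \<and> w = compose_list (map (simple_refl n) is)"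
    using W0_is_word[OF assms] by (auto simp: word_def)
  from LeastI_ex[OF this] show thesis using that by (auto simp: word_def W0_length_def)
qed

text \<open>
  The rank function below counts the entries that stand behind the \<open>i\<close>-th one in the
  decreasing rearrangement when equal entries keep their order.
\<close>

definition wrank :: "nat \<Rightarrow> weight \<Rightarrow> nat \<Rightarrow> int" where
  "wrank n \<mu> i = int (card {l \<in> {1..<i}. lk \<mu> l < lk \<mu> i}) + int (card {l \<in> {Suc i..n}. lk \<mu> l \<le> lk \<mu> i})"

text \<open>If \<open>s_j\<close> fixes \<open>D\<close>, then \<open>w\<close> sends the
  \<open>j\<close>-th simple root to a positive root; otherwise the exchange condition would produce
  a shorter representative. This makes all signs positive and keeps equal entries in order, which
  determines \<open>\<pi>\<close>.\<close>

lemma minimal_coset_element: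
  assumes dom: "dominant n D" and w: "w \<in> W0 n" "w D = \<mu>"
    and min: "\<And>v. v \<in> W0 n \<Longrightarrow> v D = \<mu> \<Longrightarrow> W0_length n w \<le> W0_length n v"
    and nonneg: "\<And>i. i \<in> {1..n} \<Longrightarrow> 0 \<le> lk \<mu> i"
    and a: "\<pi> permutes {1..n}" "\<And>i. \<epsilon> i \<in> {1, -1}" "\<And>i. i \<notin> {1..n} \<Longrightarrow> \<epsilon> i = 1"
    "\<And>\<mu> i. lk (w \<mu>) i = \<epsilon> i * lk \<mu> (\<pi> i)"
    and i: "i \<in> {1..n}"
  shows "\<epsilon> i = 1" "int (\<pi> i) = int n - wrank n \<mu> i"
proof -
  have Dnn: "0 \<le> lk D j" if "j \<in> {1..n}" for j using dom that by (auto simp: dominant_def)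
  \<comment> \<open>The height of the image of the \<open>j\<close>-th unit vector under
    \<open>w\<close>.\<close>
  define h where "h j = \<epsilon> (inv \<pi> j) * (int n + 1 - int (inv \<pi> j))" for j
  have inr: "inv \<pi> k \<in> {1..n}" if "k \<in> {1..n}" for k
    using permutes_in_image[OF permutes_inv[OF a(1)], of k] that by simp
  have inr': "\<pi> k \<in> {1..n}" if "k \<in> {1..n}" for k
    using permutes_in_image[OF a(1), of k] that by simp
  have ip [simp]: "inv \<pi> (\<pi> k) = k" "\<pi> (inv \<pi> k) = k" for k using a(1) by (simp_all add: permutes_inverses)
  have hs: "hgt n (w (sroot n j)) = (if j = n then h n else h j - h (Suc j))" if "j \<in> {1..n}" for j
  proof (cases "j = n")
    case True
    then show ?thesis using W0_sroot[OF a, of n] hgt_single[OF inr[of n]] that by (simp add: h_def)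
  next
    case False
    then show ?thesis using W0_sroot[OF a, of j] hgt_single[OF inr[of j]] hgt_single[OF inr[of "Suc j"]] that
      by (simp add: h_def hgt_diff)
  qed
  have hne: "h j \<noteq> 0" "j < n \<Longrightarrow> h j \<noteq> h (Suc j)" if "j \<in> {1..n}" for j
  proof -
    show "h j \<noteq> 0" using inr[OF that] a(2)[of "inv \<pi> j"] by (auto simp: h_def)
    assume "j < n"
    then have 1: "inv \<pi> (Suc j) \<in> {1..n}" by (intro inr) auto
    have "inv \<pi> j \<noteq> inv \<pi> (Suc j)" by (metis ip(2) n_not_Suc_n)
    then show "h j \<noteq> h (Suc j)" using inr[OF that] 1 a(2)[of "inv \<pi> j"] a(2)[of "inv \<pi> (Suc j)"]
      by (auto simp: h_def)
  qed
  have pos: "0 < hgt n (w (sroot n j))" if j: "j \<in> {1..n}" "dd n j D = 0" for j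
  proof (rule ccontr)
    assume "\<not> ?thesis"
    moreover have "hgt n (w (sroot n j)) \<noteq> 0" using hs[OF j(1)] hne[OF j(1)] j(1) by auto
    ultimately have neg: "hgt n (w (sroot n j)) < 0" by simp
    obtain js where js: "set js \<subseteq> {1..n}" "w = word n js" "length js = W0_length n w"
      using W0_length_word[OF w(1)] by blast
    obtain js' where js': "set js' \<subseteq> {1..n}" "length js' < length js" "word n js' = word n js \<circ> rw n j"
      using exchange[OF js(1), of j] neg js(2) j(1) by auto
    have "word n js' D = \<mu>" using js' js(2) w(2) j by (simp add: rw_eq)
    then have "W0_length n w \<le> W0_length n (word n js')" by (intro min word_W0 js'(1))
    then show False using W0_length_le[OF js'(1)] js'(2) js(3) by simp
  qed
  have mu: "lk \<mu> j = \<epsilon> j * lk D (\<pi> j)" for j using a(4) w(2) by metis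
  have hpos: "0 < h j" if "lk D j = 0" "1 \<le> j" "j \<le> n" for j
    using that(3,2,1)
  proof (induction j rule: inc_induct)
    case base
    then show ?case using pos[of n] hs[of n] by (simp add: dd_def)
  next
    case (step j)
    have "lk D (Suc j) = 0" using dominant_antimono[OF dom, of j "Suc j"] Dnn[of "Suc j"] step by auto
    then have "0 < h (Suc j)" "dd n j D = 0" using step by (auto simp: dd_def)
    then show ?case using pos[of j] hs[of j] step by auto
  qed
  have eps: "\<epsilon> j = 1" if j: "j \<in> {1..n}" for j
  proof (cases "lk D (\<pi> j) = 0")
    case True
    then have "0 < h (\<pi> j)" using hpos inr'[OF j] by auto
    then show ?thesis using a(2)[of j] j by (auto simp: h_def)
  next
    case False
    then have "0 < lk D (\<pi> j)" using Dnn inr'[OF j] by force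
    then show ?thesis using mu[of j] nonneg[OF j] a(2)[of j] by auto
  qed
  then show "\<epsilon> i = 1" using i by blast
  have D\<mu>: "lk D (\<pi> j) = lk \<mu> j" if "j \<in> {1..n}" for j using mu[of j] eps[OF that] by simp
  have hdec: "h j < h k" if "Suc k \<le> j" "1 \<le> k" "j \<le> n" "lk D k = lk D j" for j k
    using that(1,3,4)
  proof (induction j rule: dec_induct)
    case base
    then have "dd n k D = 0" using that(2) by (auto simp: dd_def)
    then show ?case using pos[of k] hs[of k] base that(2) by auto
  next
    case (step j)
    have "lk D (Suc j) \<le> lk D j" "lk D j \<le> lk D k"
      using dominant_antimono[OF dom, of j "Suc j"] dominant_antimono[OF dom, of k j] that(2) step by auto
    then have e: "lk D j = lk D k" "lk D (Suc j) = lk D j" using step by auto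
    then have "dd n j D = 0" using step that(2) by (auto simp: dd_def)
    then have "h (Suc j) < h j" using pos[of j] hs[of j] step that(2) by auto
    moreover have "h j < h k" by (rule step.IH) (use step.prems e in simp_all)
    ultimately show ?case by simp
  qed
  \<comment> \<open>\<open>\<pi>\<close> ranks the entries in decreasing order, equal ones from left
    to right.\<close>
  have before: "\<pi> l < \<pi> i \<longleftrightarrow> lk \<mu> i < lk \<mu> l \<or> (lk \<mu> l = lk \<mu> i \<and> l < i)" if l: "l \<in> {1..n}" for l
  proof -
    have 1: "j < k" if "\<pi> j < \<pi> k" "lk \<mu> j = lk \<mu> k" "j \<in> {1..n}" "k \<in> {1..n}" for j k
      using hdec[of "\<pi> j" "\<pi> k"] that D\<mu>[of j] D\<mu>[of k] inr'[of j] inr'[of k] eps[of j] eps[of k]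
      by (auto simp: h_def)
    have 2: "lk \<mu> k \<le> lk \<mu> j" if "\<pi> j \<le> \<pi> k" "j \<in> {1..n}" "k \<in> {1..n}" for j k
      using dominant_antimono[OF dom, of "\<pi> j" "\<pi> k"] that D\<mu>[of j] D\<mu>[of k] inr'[of j] inr'[of k] by auto
    have 3: "\<pi> i = \<pi> l \<longleftrightarrow> i = l" by (metis ip(1))
    show ?thesis using 1[of l i] 1[of i l] 2[of l i] 2[of i l] l i 3
      by (cases "\<pi> l" "\<pi> i" rule: linorder_cases) auto
  qed
  have "{1..n} \<inter> {l. \<pi> l < \<pi> i} = inv \<pi> ` {1..<\<pi> i}"
    using inr inr'[OF i] ip inr' by (force simp: image_iff)
  then have c: "card ({1..n} \<inter> {l. \<pi> l < \<pi> i}) = \<pi> i - 1"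
    using permutes_inj[OF permutes_inv[OF a(1)]] by (simp add: card_image inj_on_subset)
  let ?A = "{l \<in> {1..<i}. lk \<mu> l < lk \<mu> i}" and ?B = "{l \<in> {Suc i..n}. lk \<mu> l \<le> lk \<mu> i}"
  have "{1..n} = insert i (({1..n} \<inter> {l. \<pi> l < \<pi> i}) \<union> (?A \<union> ?B))"
    using before i by (auto simp: not_less le_less)
  moreover have "i \<notin> ({1..n} \<inter> {l. \<pi> l < \<pi> i}) \<union> (?A \<union> ?B)" by auto
  moreover have "({1..n} \<inter> {l. \<pi> l < \<pi> i}) \<inter> (?A \<union> ?B) = {}" using before by auto
  moreover have "?A \<inter> ?B = {}" by auto
  ultimately have "n = Suc ((\<pi> i - 1) + (card ?A + card ?B))"
    using c by (metis (no_types, lifting) card_Un_disjoint card_atLeastAtMost card_insert_disjoint diff_Suc_1 finite_Int finite_Un finite_atLeastAtMost finite_insert)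
  then show "int (\<pi> i) = int n - wrank n \<mu> i"
    using inr'[OF i] unfolding wrank_def by auto
qed

text \<open>Two shortest elements have the same signs and the same permutation by
  \<open>minimal_coset_element\<close>. This resolves the \<open>THE\<close> in
  \<open>shortest_elt\<close>, whose value is then applied to
  \<open>(n - 1, ..., 0)\<close>.\<close>

lemma lookup_rho:
  assumes nonneg: "\<And>i. i \<in> {1..n} \<Longrightarrow> 0 \<le> lk \<mu> i" and i: "i \<in> {1..n}"
  shows "lk (rho n \<mu>) i = wrank n \<mu> i"
proof -
  define D where "D = dominant_rep n \<mu>"
  obtain js where js: "set js \<subseteq> {1..n}" "D = word n js \<mu>" "dominant n D"
    using dominant_rep_word[of n \<mu>] unfolding D_def by metis
  define C where "C = {w \<in> W0 n. w D = \<mu>}"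
  have "word n (rev js) \<in> C" using js word_rev[of js n \<mu>] word_W0[of "rev js" n] by (simp add: C_def)
  then obtain w where w: "w \<in> C" "\<And>v. v \<in> C \<Longrightarrow> W0_length n w \<le> W0_length n v"
    using ex_has_least_nat[of "\<lambda>w. w \<in> C" _ "W0_length n"] by blast
  have wW: "w \<in> W0 n" using w(1) by (simp add: C_def)
  have u: "v = w" if v: "v \<in> C" "\<And>v'. v' \<in> C \<Longrightarrow> W0_length n v \<le> W0_length n v'" for v
  proof -
    have vW: "v \<in> W0 n" using v(1) by (simp add: C_def)
    obtain \<pi> \<epsilon> where a: "\<pi> permutes {1..n}" "\<And>i. \<epsilon> i \<in> {1, -1}" "\<And>i. i \<notin> {1..n} \<Longrightarrow> \<epsilon> i = 1"
      "\<And>\<mu> i. lk (w \<mu>) i = \<epsilon> i * lk \<mu> (\<pi> i)" using wW by (rule W0E) blast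
    obtain \<pi>' \<epsilon>' where b: "\<pi>' permutes {1..n}" "\<And>i. \<epsilon>' i \<in> {1, -1}" "\<And>i. i \<notin> {1..n} \<Longrightarrow> \<epsilon>' i = 1"
      "\<And>\<mu> i. lk (v \<mu>) i = \<epsilon>' i * lk \<mu> (\<pi>' i)" using vW by (rule W0E) blast
    have "\<epsilon> i = \<epsilon>' i \<and> \<pi> i = \<pi>' i" for i
    proof (cases "i \<in> {1..n}")
      case True
      have "\<epsilon> i = 1" "int (\<pi> i) = int n - wrank n \<mu> i"
        using minimal_coset_element[OF js(3) _ _ _ nonneg a True] w unfolding C_def by auto
      moreover have "\<epsilon>' i = 1" "int (\<pi>' i) = int n - wrank n \<mu> i"
        using minimal_coset_element[OF js(3) _ _ _ nonneg b True] v unfolding C_def by auto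
      ultimately show ?thesis by simp
    next
      case False
      then show ?thesis using a b by (simp add: permutes_not_in)
    qed
    then show ?thesis by (intro ext poly_mapping_eqI) (simp add: a(4) b(4))
  qed
  have "shortest_elt n \<mu> = w"
    unfolding shortest_elt_def D_def[symmetric]
  proof (rule the_equality)
    show "w \<in> W0 n \<and> w D = \<mu> \<and> (\<forall>v\<in>W0 n. v D = \<mu> \<longrightarrow> W0_length n w \<le> W0_length n v)"
      using w unfolding C_def by blast
  next
    fix v assume v: "v \<in> W0 n \<and> v D = \<mu> \<and> (\<forall>v'\<in>W0 n. v' D = \<mu> \<longrightarrow> W0_length n v \<le> W0_length n v')"
    show "v = w"
    proof (rule u)
      show "v \<in> C" using v by (simp add: C_def)
      show "W0_length n v \<le> W0_length n v'" if "v' \<in> C" for v' using v that by (simp add: C_def)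
    qed
  qed
  moreover obtain \<pi> \<epsilon> where a: "\<pi> permutes {1..n}" "\<And>i. \<epsilon> i \<in> {1, -1}" "\<And>i. i \<notin> {1..n} \<Longrightarrow> \<epsilon> i = 1"
      "\<And>\<mu> i. lk (w \<mu>) i = \<epsilon> i * lk \<mu> (\<pi> i)" using wW by (rule W0E) blast
  moreover have "\<epsilon> i = 1" "int (\<pi> i) = int n - wrank n \<mu> i"
    using minimal_coset_element[OF js(3) _ _ _ nonneg a i] w unfolding C_def by auto
  moreover have "lk (\<Sum>i\<in>{1..n}. Poly_Mapping.single i (int n - int i)) j = int n - int j" if "j \<in> {1..n}" for j
  proof -
    have "lk (\<Sum>i\<in>{1..n}. Poly_Mapping.single i (int n - int i)) j = (\<Sum>i\<in>{1..n}. if i = j then int n - int j else 0)"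
      unfolding lookup_sum by (intro sum.cong) (auto simp: lookup_single when_def)
    then show ?thesis using that by simp
  qed
  moreover have "\<pi> i \<in> {1..n}" using permutes_in_image[OF a(1)] i by simp
  ultimately show ?thesis unfolding rho_def by simp
qed

section \<open>Triangularity\<close>

lemma wt_succeq_mless:
  assumes "1 \<le> n" "\<mu> \<in> lattice n" "\<nu> \<in> lattice n"
  shows "wt_succeq n \<mu> \<nu> \<longleftrightarrow> mless n \<nu> \<mu> \<or> (mle n \<nu> \<mu> \<and> mle n \<mu> \<nu> \<and> ple n \<nu> \<mu>)"
  using wt_succeq_iff[OF assms] by (auto simp: mless_def)

lemma mless_mle_trans: "mless n a b \<Longrightarrow> mle n b c \<Longrightarrow> mless n a c"
  unfolding mless_def by (meson mle_trans)

context koornwinder_params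
begin

definition low :: "weight \<Rightarrow> 'r laurent set" where
  "low \<mu> = {g. \<forall>\<theta>\<in>Poly_Mapping.keys g. \<theta> \<in> lattice n \<and> mless n \<theta> \<mu>}"

lemma low_iff: "g \<in> low \<mu> \<longleftrightarrow> (\<forall>\<theta>. \<not> (\<theta> \<in> lattice n \<and> mless n \<theta> \<mu>) \<longrightarrow> lk g \<theta> = 0)"
  by (auto simp: low_def in_keys_iff)

lemma low_add: "f \<in> low \<mu> \<Longrightarrow> g \<in> low \<mu> \<Longrightarrow> f + g \<in> low \<mu>"
  and low_const: "f \<in> low \<mu> \<Longrightarrow> const c * f \<in> low \<mu>"
  and low_0: "0 \<in> low \<mu>"
  and low_uminus: "f \<in> low \<mu> \<Longrightarrow> - f \<in> low \<mu>"
  by (simp_all add: low_iff lookup_add lookup_const_mult)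

lemma low_sum: "(\<And>x. x \<in> A \<Longrightarrow> f x \<in> low \<mu>) \<Longrightarrow> sum f A \<in> low \<mu>"
  by (simp add: low_iff lookup_sum)

lemma low_single: "\<theta> \<in> lattice n \<Longrightarrow> mless n \<theta> \<mu> \<Longrightarrow> Poly_Mapping.single \<theta> c \<in> low \<mu>"
  by (auto simp: low_def)

lemma n1: "1 \<le> n" using n_ge by simp

text \<open>These are the interior points of the string from \<open>\<mu>\<close> to
  \<open>s_i \<mu>\<close>, whose monomials occur in \<open>geo\<close>.\<close>

lemma mless_string:
  assumes "\<mu> \<in> lattice n" "i \<le> n" "(0 < r \<and> r < dd n i \<mu>) \<or> (dd n i \<mu> < r \<and> r < 0)"
  shows "\<mu> + zw n i r \<in> lattice n \<and> mless n (\<mu> + zw n i r) \<mu>"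
proof
  show "\<mu> + zw n i r \<in> lattice n"
    by (rule latticeI) (use assms n_ge in \<open>auto simp: lookup_add latticeD zw_def lookup_single lookup_minus when_def\<close>)
  consider "i = 0" | "i = n" "i \<noteq> 0" | "i \<noteq> 0" "i \<noteq> n" by blast
  then show "mless n (\<mu> + zw n i r) \<mu>"
  proof cases
    case 1
    show ?thesis
      by (rule mless_end[OF assms(1), of 1])
        (use assms 1 n_ge in \<open>auto simp: lookup_add zw_def lookup_single when_def dd_def\<close>)
  next
    case 2
    show ?thesis
      by (rule mless_end[OF assms(1), of n])
        (use assms 2 n_ge in \<open>auto simp: lookup_add zw_def lookup_single when_def dd_def\<close>)
  next
    case 3
    show ?thesis
      by (rule mless_mid[OF assms(1), of i])
        (use assms 3 n_ge in \<open>auto simp: lookup_add zw_def lookup_single lookup_minus when_def dd_def\<close>)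
  qed
qed

text \<open>The exponent of the linear term in the numerator of an end operator, half of that of
  \<open>Z\<close>.\<close>

definition half :: "nat \<Rightarrow> weight" where
  "half i = (if i = 0 then Poly_Mapping.single 1 (-1) else Poly_Mapping.single n 1)"

text \<open>The shift by \<open>half\<close> pushes the included end of the half-open string into
  its interior, which is why one bound is not strict.\<close>

lemma mless_half:
  assumes "\<mu> \<in> lattice n" "i = 0 \<or> i = n" "(0 \<le> r \<and> r < dd n i \<mu>) \<or> (dd n i \<mu> \<le> r \<and> r < 0)"
  shows "half i + (\<mu> + zw n i r) \<in> lattice n \<and> mless n (half i + (\<mu> + zw n i r)) \<mu>"
proof
  show "half i + (\<mu> + zw n i r) \<in> lattice n"
    by (rule latticeI) (use assms n_ge in \<open>auto simp: half_def lookup_add latticeD zw_def lookup_single lookup_minus when_def\<close>)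
  show "mless n (half i + (\<mu> + zw n i r)) \<mu>"
  proof (cases "i = 0")
    case True
    show ?thesis
      by (rule mless_end[OF assms(1), of 1])
        (use assms True n_ge in \<open>auto simp: half_def lookup_add zw_def lookup_single when_def dd_def\<close>)
  next
    case False
    then have "i = n" using assms by simp
    show ?thesis
      by (rule mless_end[OF assms(1), of n])
        (use assms False \<open>i = n\<close> n_ge in \<open>auto simp: half_def lookup_add zw_def lookup_single when_def dd_def\<close>)
  qed
qed

lemma num_form:
  obtains e where "num i = 1 - const (tau i ^ 2) * Zm i 1 - const e * Poly_Mapping.single (half i) 1"
    "e = 0 \<or> i = 0 \<or> i = n"
proof -
  note rc = rhomD[OF rhom_const, where ?'a = 'r]
  have x0: "Poly_Mapping.single (Poly_Mapping.single 1 (-1)) 1 = (xpow 1 (-1) :: 'r laurent)"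
    and xn: "Poly_Mapping.single (Poly_Mapping.single n 1) 1 = (xpow n 1 :: 'r laurent)"
    by (simp_all add: xpow_def)
  consider "i = 0" | "i = n" "i \<noteq> 0" | "i \<noteq> 0" "i \<noteq> n" by blast
  then show thesis
  proof cases
    case 1
    have U: "const (P ParU0) * const (Pi ParU0) = (1 :: 'r laurent)" by (simp add: P_Pi rc flip: rc(3))
    have "num i = 1 - const (tau i ^ 2) * Zm i 1 - const (P ParQ * P ParT0 * P ParU0 - P ParQ * P ParT0 * Pi ParU0) * Poly_Mapping.single (half i) 1"
      unfolding 1 Zm_1 num_def tau_def half_def if_P[OF refl] x0 rc xpow_m2 using U by algebra
    then show ?thesis using 1 by (intro that) auto
  next
    case 2
    have U: "const (P ParUn) * const (Pi ParUn) = (1 :: 'r laurent)" by (simp add: P_Pi rc flip: rc(3))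
    have "num i = (1 - const (P ParTn * P ParUn) * xpow n 1) * (1 - const (- (P ParTn * Pi ParUn)) * xpow n 1)"
      "Zm i 1 = xpow n 1 ^ 2" "const (tau i) = (const (P ParTn) :: 'r laurent)" "Poly_Mapping.single (half i) 1 = (xpow n 1 :: 'r laurent)"
      using 2 n_ge by (simp_all add: num_def Zm_1 xpow_2 tau_def half_def xn)
    then have "num i = 1 - const (tau i ^ 2) * Zm i 1 - const (P ParTn * P ParUn - P ParTn * Pi ParUn) * Poly_Mapping.single (half i) 1"
      unfolding rc using U by algebra
    then show ?thesis using 2 by (intro that) auto
  next
    case 3
    have "num i = 1 - const (tau i ^ 2) * Zm i 1 - const 0 * Poly_Mapping.single (half i) 1"
      using 3 by (simp add: num_def Zm_1 tau_def mult.assoc rc)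
    then show ?thesis by (intro that) auto
  qed
qed

text \<open>Modulo \<open>low\<close>, the operator \<open>T_i\<close> for \<open>b = True\<close>,
  its inverse for \<open>b = False\<close>, sends the monomial of \<open>\<mu>\<close> to
  \<open>tcoef\<close> times that of \<open>s_i \<mu>\<close> plus \<open>stay\<close> times
  itself.\<close>

definition tcoef :: "bool \<Rightarrow> nat \<Rightarrow> int \<Rightarrow> 'r" where
  "tcoef b i d = zc i d * (if (if b then d < 0 else d \<le> 0) then taui i else tau i)"

definition stay :: "bool \<Rightarrow> nat \<Rightarrow> int \<Rightarrow> 'r" where
  "stay b i d = (if b \<and> 0 < d then tau i - taui i else if \<not> b \<and> d < 0 then taui i - tau i else 0)"

definition op :: "bool \<times> nat \<Rightarrow> 'r laurent \<Rightarrow> 'r laurent" where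
  "op x = (if fst x then T (snd x) else Ti (snd x))"

lemma Zm_single: "Zm i r * Poly_Mapping.single \<mu> c = Poly_Mapping.single (\<mu> + zw n i r) (c * zc i r)"
  by (simp add: Zm_def mult_single ac_simps)

lemma const_tau_taui: "const (tau i) * const (taui i) = (1 :: 'r laurent)"
  using tau_taui[of i] rhomD(1,3)[OF rhom_const, where ?'a = 'r] by metis

text \<open>Multiplying the geometric sum by \<open>1 - tau^2 Z\<close> and using
  \<open>(1 - Z) geo = Z^d - 1\<close> leaves the two ends of the string with the stated
  coefficients; its interior and the terms with \<open>half\<close> lie in lower orbits.\<close>

lemma T_single:
  assumes \<mu>: "\<mu> \<in> lattice n" and i: "i \<le> n"
  shows "T i (Poly_Mapping.single \<mu> c) - (Poly_Mapping.single (rw n i \<mu>) (c * tcoef True i (dd n i \<mu>))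
    + Poly_Mapping.single \<mu> (c * stay True i (dd n i \<mu>))) \<in> low \<mu>"
proof -
  note rc = rhomD[OF rhom_const, where ?'a = 'r]
  define d where "d = dd n i \<mu>"
  obtain e where e: "num i = 1 - const (tau i ^ 2) * Zm i 1 - const e * Poly_Mapping.single (half i) 1"
    "e = 0 \<or> i = 0 \<or> i = n" by (rule num_form)
  define X where "X = Poly_Mapping.single \<mu> c"
  define t t' M where "t = (const (tau i) :: 'r laurent)" and "t' = (const (taui i) :: 'r laurent)"
    and "M = (Poly_Mapping.single (half i) 1 :: 'r laurent)"
  have tt: "t * t' = 1" unfolding t_def t'_def by (rule const_tau_taui)
  have Zd: "Zm i d * X = Poly_Mapping.single (rw n i \<mu>) (c * zc i d)"
    by (simp add: X_def Zm_single rw_eq d_def)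
  have geo: "Zm i 1 * geo i d = geo i d - Zm i d + 1"
    using one_minus_Zm_geo[of i d] by (simp add: algebra_simps)
  have T: "T i X = t * X + t' * ((1 - t^2 * Zm i 1 - const e * M) * (geo i d * X))"
    unfolding T_def X_def del_single d_def[symmetric] e(1) t_def t'_def M_def rc by simp
  have str: "Zm i r * X \<in> low \<mu>" if "(0 < r \<and> r < d) \<or> (d < r \<and> r < 0)" for r
    using mless_string[OF \<mu> i, of r] that unfolding X_def Zm_single d_def by (intro low_single) auto
  have "const e * (M * (Zm i r * X)) \<in> low \<mu>" if "(0 \<le> r \<and> r < d) \<or> (d \<le> r \<and> r < 0)" for r
  proof (cases "e = 0")
    case True
    then show ?thesis by (simp add: rc low_0)
  next
    case False
    then show ?thesis using mless_half[OF \<mu>, of i r] that e(2) unfolding X_def Zm_single M_def mult_single d_def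
      by (intro low_const low_single) auto
  qed
  then have hf: "const e * (M * (geo i d * X)) \<in> low \<mu>"
    unfolding geo_def by (auto simp: sum_distrib_right sum_distrib_left intro!: low_sum low_uminus)
  consider "d > 0" | "d < 0" | "d = 0" by linarith
  then have "T i X - (Poly_Mapping.single (rw n i \<mu>) (c * tcoef True i d) + Poly_Mapping.single \<mu> (c * stay True i d)) \<in> low \<mu>"
  proof cases
    case 1
    define S where "S = (\<Sum>r\<in>{0<..<d}. Zm i r)"
    have "{0..<d} = insert 0 {0<..<d}" using 1 by auto
    then have g: "geo i d = - (1 + S)" using 1 by (simp add: geo_def S_def)
    have SX: "S * X \<in> low \<mu>" unfolding S_def sum_distrib_right by (rule low_sum) (use str in auto)
    have s: "Poly_Mapping.single (rw n i \<mu>) (c * tcoef True i d) = t * (Zm i d * X)"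
      using 1 unfolding Zd t_def const_mult_single by (simp add: tcoef_def ac_simps)
    have s2: "Poly_Mapping.single \<mu> (c * stay True i d) = (t - t') * X"
      using 1 unfolding t_def t'_def rc(6)[symmetric] X_def const_mult_single by (simp add: stay_def ac_simps)
    have "T i X - (t * (Zm i d * X) + (t - t') * X) = (t - t') * (S * X) + - (t' * (const e * (M * (geo i d * X))))"
      using T geo tt unfolding g by algebra
    also have "\<dots> \<in> low \<mu>" unfolding t_def t'_def rc(6)[symmetric] by (intro low_add low_uminus low_const SX hf)
    finally show ?thesis unfolding s s2 .
  next
    case 2
    define S where "S = (\<Sum>r\<in>{d<..<0}. Zm i r)"
    have "{d..<0} = insert d {d<..<0}" using 2 by auto
    then have g: "geo i d = Zm i d + S" using 2 by (simp add: geo_def S_def)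
    have SX: "S * X \<in> low \<mu>" unfolding S_def sum_distrib_right by (rule low_sum) (use str in auto)
    have s: "Poly_Mapping.single (rw n i \<mu>) (c * tcoef True i d) = t' * (Zm i d * X)"
      using 2 unfolding Zd t'_def const_mult_single by (simp add: tcoef_def ac_simps)
    have s2: "Poly_Mapping.single \<mu> (c * stay True i d) = 0" using 2 by (simp add: stay_def)
    have "T i X - (t' * (Zm i d * X) + 0) = (t' - t) * (S * X) + - (t' * (const e * (M * (geo i d * X))))"
      using T geo tt unfolding g by algebra
    also have "\<dots> \<in> low \<mu>" unfolding t_def t'_def rc(6)[symmetric] by (intro low_add low_uminus low_const SX hf)
    finally show ?thesis unfolding s s2 .
  next
    case 3
    then have "T i X = t * X" using T by simp
    moreover have "rw n i \<mu> = \<mu>" using 3 by (simp add: rw_eq d_def)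
    ultimately have "T i X - (Poly_Mapping.single (rw n i \<mu>) (c * tcoef True i d) + Poly_Mapping.single \<mu> (c * stay True i d)) = 0"
      using 3 unfolding X_def t_def const_mult_single by (simp add: tcoef_def stay_def mult.commute)
    then show ?thesis by (simp add: low_0)
  qed
  then show ?thesis by (simp add: X_def d_def)
qed

lemma op_single:
  assumes \<mu>: "\<mu> \<in> lattice n" and i: "i \<le> n"
  shows "op (b, i) (Poly_Mapping.single \<mu> c) - (Poly_Mapping.single (rw n i \<mu>) (c * tcoef b i (dd n i \<mu>))
    + Poly_Mapping.single \<mu> (c * stay b i (dd n i \<mu>))) \<in> low \<mu>"
proof (cases b)
  case True
  then show ?thesis using T_single[OF assms] by (simp add: op_def)
next
  case False
  define d where "d = dd n i \<mu>"
  have cm: "const (tau i - taui i) * Poly_Mapping.single \<mu> c = Poly_Mapping.single \<mu> (c * (tau i - taui i))"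
    unfolding const_mult_single by (simp add: mult.commute)
  have "Poly_Mapping.single (rw n i \<mu>) (c * tcoef True i d) + Poly_Mapping.single \<mu> (c * stay True i d)
      - const (tau i - taui i) * Poly_Mapping.single \<mu> c
    = Poly_Mapping.single (rw n i \<mu>) (c * tcoef False i d) + Poly_Mapping.single \<mu> (c * stay False i d)"
  proof (cases "d = 0")
    case True
    then have "rw n i \<mu> = \<mu>" by (simp add: rw_eq d_def)
    then show ?thesis unfolding cm using True by (simp add: tcoef_def stay_def algebra_simps flip: single_add single_diff)
  next
    case False
    then show ?thesis unfolding cm by (auto simp: tcoef_def stay_def algebra_simps single_diff single_uminus)
  qed
  then show ?thesis using T_single[OF assms, of c] False
    by (simp add: op_def Ti_def d_def algebra_simps)
qed

section \<open>Leading terms of words of operators\<close>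

lemma op_add: "op x (f + g) = op x f + op x g"
  by (simp add: op_def T_linear Ti_linear)

lemma op_0: "op x 0 = 0"
  by (simp add: op_def T_linear Ti_linear)

lemma op_sum: "op x (sum f A) = (\<Sum>a\<in>A. op x (f a))"
  by (induction A rule: infinite_finite_induct) (simp_all add: op_add op_0)

text \<open>The sign of \<open>d\<close> for which \<open>stay\<close> can be nonzero.\<close>

definition bad :: "bool \<Rightarrow> int \<Rightarrow> bool" where "bad b d \<longleftrightarrow> (if b then 0 < d else d < 0)"

lemma stay_eq_0: "\<not> bad b d \<Longrightarrow> stay b i d = 0"
  by (auto simp: stay_def bad_def)

definition Rw :: "nat list \<Rightarrow> weight \<Rightarrow> weight" where
  "Rw is = compose_list (map (rw n) is)"

lemma Rw_simps [simp]: "Rw [] \<mu> = \<mu>" "Rw (i # is) \<mu> = rw n i (Rw is \<mu>)" "Rw (is @ js) \<mu> = Rw is (Rw js \<mu>)"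
  by (simp_all add: Rw_def)

lemma Rw_W0: "set is \<subseteq> {..n} \<Longrightarrow> Rw is \<in> W0 n"
proof (induction "is")
  case Nil
  then show ?case using W0_id[of n] by (simp add: Rw_def id_def)
next
  case (Cons i "is")
  then have "rw n i \<circ> Rw is \<in> W0 n" using n1 by (intro W0_comp rw_W0') auto
  moreover have "Rw (i # is) = rw n i \<circ> Rw is" by (simp add: Rw_def)
  ultimately show ?case by metis
qed

lemma Rw_add: "Rw is (\<mu> + \<nu>) = Rw is \<mu> + Rw is \<nu>"
  by (induction "is") (simp_all add: rw_add)

lemma Rw_lattice: "set is \<subseteq> {..n} \<Longrightarrow> \<mu> \<in> lattice n \<Longrightarrow> Rw is \<mu> \<in> lattice n"
  using n1 by (induction "is") (simp_all add: rw_lattice)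

lemma Rw_mle: "set is \<subseteq> {..n} \<Longrightarrow> mle n (Rw is \<mu>) \<nu> \<longleftrightarrow> mle n \<mu> \<nu>"
  "set is \<subseteq> {..n} \<Longrightarrow> mle n \<nu> (Rw is \<mu>) \<longleftrightarrow> mle n \<nu> \<mu>"
  using maxsum_W0[OF Rw_W0] by (simp_all add: mle_def)

lemma Rw_inj: "Rw is \<mu> = Rw is \<nu> \<Longrightarrow> \<mu> = \<nu>"
  by (induction "is") (simp, metis Rw_simps(2) rw_rw)

text \<open>
  \<open>transported G \<mu> \<eta> c f\<close>: once the remaining reflections \<open>G\<close> are applied to its weights, \<open>f\<close> is
  \<open>c x\<^sup>\<mu>\<close> plus lower terms; \<open>\<eta>\<close> is the weight that goes to \<open>\<mu>\<close>.
\<close>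

definition transported :: "(weight \<Rightarrow> weight) \<Rightarrow> weight \<Rightarrow> weight \<Rightarrow> 'r \<Rightarrow> 'r laurent \<Rightarrow> bool" where
  "transported G \<mu> \<eta> c f \<longleftrightarrow> G \<eta> = \<mu> \<and> \<eta> \<in> lattice n \<and> lk f \<eta> = c \<and>
    (\<forall>\<theta>\<in>Poly_Mapping.keys f. \<theta> \<in> lattice n \<and>
      (mless n \<theta> \<mu> \<or> (mle n \<theta> \<mu> \<and> mle n \<mu> \<theta> \<and> ple n (G \<theta>) \<mu>)))"

lemma keys_op_single:
  assumes "\<theta> \<in> lattice n" "i \<le> n" "\<kappa> \<in> Poly_Mapping.keys (op (b, i) (Poly_Mapping.single \<theta> c))"
  shows "\<kappa> = rw n i \<theta> \<or> (\<kappa> = \<theta> \<and> bad b (dd n i \<theta>)) \<or> (\<kappa> \<in> lattice n \<and> mless n \<kappa> \<theta>)"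
proof (rule ccontr)
  assume a: "\<not> ?thesis"
  then have "lk (op (b, i) (Poly_Mapping.single \<theta> c) - (Poly_Mapping.single (rw n i \<theta>) (c * tcoef b i (dd n i \<theta>))
    + Poly_Mapping.single \<theta> (c * stay b i (dd n i \<theta>)))) \<kappa> = 0"
    using op_single[OF assms(1,2), of b c] unfolding low_iff by blast
  then have "lk (op (b, i) (Poly_Mapping.single \<theta> c)) \<kappa> = 0"
    using a stay_eq_0 by (auto simp: lookup_minus lookup_add lookup_single when_def split: if_splits)
  then show False using assms(3) by (simp add: in_keys_iff)
qed

text \<open>A monomial is reflected, drops to a lower orbit, or stays in place; the last case is
  harmless by \<open>down\<close>. Nothing staying in place contributes at the new leading weight,
  because such a weight would lie both above and below its reflection.\<close>

lemma transported_step: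
  assumes f: "transported (\<lambda>\<nu>. Rw pre (rw n i \<nu>)) \<mu> \<eta> c f" and pre: "set pre \<subseteq> {..n}" and i: "i \<le> n"
    and down: "\<And>\<nu>. \<nu> \<in> lattice n \<Longrightarrow> bad b (dd n i \<nu>) \<Longrightarrow> ple n (Rw pre \<nu>) (Rw pre (rw n i \<nu>))"
  shows "transported (Rw pre) \<mu> (rw n i \<eta>) (c * tcoef b i (dd n i \<eta>)) (op (b, i) f)"
proof -
  have \<eta>: "Rw pre (rw n i \<eta>) = \<mu>" "\<eta> \<in> lattice n" "lk f \<eta> = c" and
    k: "\<And>\<theta>. \<theta> \<in> Poly_Mapping.keys f \<Longrightarrow> \<theta> \<in> lattice n \<and>
      (mless n \<theta> \<mu> \<or> (mle n \<theta> \<mu> \<and> mle n \<mu> \<theta> \<and> ple n (Rw pre (rw n i \<theta>)) \<mu>))"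
    using f unfolding transported_def by blast+
  define \<eta>' where "\<eta>' = rw n i \<eta>"
  have \<eta>': "\<eta>' \<in> lattice n" "Rw pre \<eta>' = \<mu>" unfolding \<eta>'_def using \<eta> rw_lattice[OF i n1] by auto
  have sim: "mle n \<eta>' \<nu> \<longleftrightarrow> mle n \<mu> \<nu>" "mle n \<nu> \<eta>' \<longleftrightarrow> mle n \<nu> \<mu>" for \<nu>
    using Rw_mle[OF pre] \<eta>'(2) by metis+
  have rwm: "mle n (rw n i \<theta>) \<nu> \<longleftrightarrow> mle n \<theta> \<nu>" "mle n \<nu> (rw n i \<theta>) \<longleftrightarrow> mle n \<nu> \<theta>" for \<theta> \<nu>
    using maxsum_W0[OF rw_W0'[OF n1 i]] by (simp_all add: mle_def)
  have e: "op (b, i) f = (\<Sum>\<theta>\<in>Poly_Mapping.keys f. op (b, i) (Poly_Mapping.single \<theta> (lk f \<theta>)))"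
    using arg_cong[OF poly_mapping_sum_single[of f], of "op (b, i)"] by (simp only: op_sum)
  have keys: "\<kappa> \<in> lattice n \<and> (mless n \<kappa> \<mu> \<or> (mle n \<kappa> \<mu> \<and> mle n \<mu> \<kappa> \<and> ple n (Rw pre \<kappa>) \<mu>))"
    if "\<kappa> \<in> Poly_Mapping.keys (op (b, i) f)" for \<kappa>
  proof -
    obtain \<theta> where \<theta>: "\<theta> \<in> Poly_Mapping.keys f" "\<kappa> \<in> Poly_Mapping.keys (op (b, i) (Poly_Mapping.single \<theta> (lk f \<theta>)))"
    proof (rule ccontr)
      assume "\<not> thesis"
      then have "lk (op (b, i) f) \<kappa> = 0" unfolding e lookup_sum
        by (intro sum.neutral) (use that in \<open>auto simp: in_keys_iff\<close>)
      then show False using \<open>\<kappa> \<in> Poly_Mapping.keys (op (b, i) f)\<close> by (simp add: in_keys_iff)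
    qed
    note k\<theta> = k[OF \<theta>(1)]
    have l\<theta>: "\<theta> \<in> lattice n" using k\<theta> by simp
    from keys_op_single[OF l\<theta> i \<theta>(2)]
    consider "\<kappa> = rw n i \<theta>" | "\<kappa> = \<theta>" "bad b (dd n i \<theta>)" | "\<kappa> \<in> lattice n" "mless n \<kappa> \<theta>" by blast
    then show ?thesis
    proof cases
      case 1
      then show ?thesis using k\<theta> rw_lattice[OF i n1 l\<theta>] by (auto simp: mless_def rwm)
    next
      case 2
      then show ?thesis using k\<theta> down[OF l\<theta> 2(2)] by (auto intro: ple_trans)
    next
      case 3
      then show ?thesis using k\<theta> by (auto intro: mless_mle_trans simp: mless_def intro: mle_trans)
    qed
  qed
  have "lk (op (b, i) (Poly_Mapping.single \<theta> (lk f \<theta>))) \<eta>' = (if \<theta> = \<eta> then c * tcoef b i (dd n i \<eta>) else 0)"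
    if \<theta>: "\<theta> \<in> Poly_Mapping.keys f" for \<theta>
  proof -
    note k\<theta> = k[OF \<theta>]
    have l\<theta>: "\<theta> \<in> lattice n" using k\<theta> by simp
    have "\<not> mless n \<eta>' \<theta>" using k\<theta> by (auto simp: mless_def sim)
    then have 1: "lk (op (b, i) (Poly_Mapping.single \<theta> (lk f \<theta>))) \<eta>'
      = lk (Poly_Mapping.single (rw n i \<theta>) (lk f \<theta> * tcoef b i (dd n i \<theta>))
      + Poly_Mapping.single \<theta> (lk f \<theta> * stay b i (dd n i \<theta>))) \<eta>'"
      using op_single[OF l\<theta> i, of b "lk f \<theta>"] unfolding low_iff lookup_minus by force
    have 2: "stay b i (dd n i \<theta>) = 0" if "\<theta> = \<eta>'"
    proof (rule stay_eq_0, rule notI)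
      assume bd: "bad b (dd n i \<theta>)"
      have "\<not> mless n \<theta> \<mu>" unfolding that by (auto simp: mless_def sim)
      then have "ple n (Rw pre (rw n i \<theta>)) (Rw pre \<theta>)" using k\<theta> \<eta>'(2) that by auto
      moreover have "ple n (Rw pre \<theta>) (Rw pre (rw n i \<theta>))" using down[OF l\<theta> bd] .
      ultimately have "Rw pre (rw n i \<theta>) = Rw pre \<theta>"
        using ple_antisym Rw_lattice[OF pre] l\<theta> rw_lattice[OF i n1 l\<theta>] by blast
      then have "rw n i \<theta> = \<theta>" by (rule Rw_inj)
      then have "dd n i \<theta> = 0" by (simp add: rw_eq zw_eq_0_iff)
      then show False using bd by (simp add: bad_def split: if_splits)
    qed
    have 3: "rw n i \<theta> = \<eta>' \<longleftrightarrow> \<theta> = \<eta>" unfolding \<eta>'_def by (metis rw_rw)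
    show ?thesis unfolding 1 using 2 3 \<eta>(3) by (auto simp: lookup_add lookup_single when_def)
  qed
  then have "lk (op (b, i) f) \<eta>' = (\<Sum>\<theta>\<in>Poly_Mapping.keys f. if \<theta> = \<eta> then c * tcoef b i (dd n i \<eta>) else 0)"
    unfolding e lookup_sum by (intro sum.cong) auto
  also have "\<dots> = c * tcoef b i (dd n i \<eta>)"
    using \<eta>(3) by (cases "\<eta> \<in> Poly_Mapping.keys f") (auto simp: in_keys_iff)
  finally show ?thesis unfolding transported_def using keys \<eta>' by (auto simp: \<eta>'_def)
qed

definition pr :: "weight \<Rightarrow> weight \<Rightarrow> int" where "pr \<mu> \<nu> = (\<Sum>i\<in>{1..n}. lk \<mu> i * lk \<nu> i)"

lemma pr_W0: assumes "w \<in> W0 n" shows "pr (w \<mu>) (w \<nu>) = pr \<mu> \<nu>"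
proof -
  obtain \<pi> \<epsilon> where a: "\<pi> permutes {1..n}" "\<And>i. \<epsilon> i \<in> {1::int, -1}" "\<And>\<mu> i. lk (w \<mu>) i = \<epsilon> i * lk \<mu> (\<pi> i)"
    using assms by (rule W0E) blast
  have "lk (w \<mu>) i * lk (w \<nu>) i = lk \<mu> (\<pi> i) * lk \<nu> (\<pi> i)" for i
    using a(2)[of i] a(3) by auto
  then have "pr (w \<mu>) (w \<nu>) = (\<Sum>i\<in>{1..n}. lk \<mu> (\<pi> i) * lk \<nu> (\<pi> i))" by (simp add: pr_def)
  also have "\<dots> = pr \<mu> \<nu>" unfolding pr_def using sum.permute[OF a(1), of "\<lambda>i. lk \<mu> i * lk \<nu> i"] by (simp add: o_def)
  finally show ?thesis .
qed

lemma pr_add: "pr \<mu> (\<nu> + \<nu>') = pr \<mu> \<nu> + pr \<mu> \<nu>'"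
  by (simp add: pr_def lookup_add distrib_left sum.distrib)

lemma pr_single: "pr \<mu> (Poly_Mapping.single i r) = (if i \<in> {1..n} then lk \<mu> i * r else 0)"
proof -
  have "pr \<mu> (Poly_Mapping.single i r) = (\<Sum>j\<in>{1..n}. if i = j then lk \<mu> i * r else 0)"
    unfolding pr_def by (rule sum.cong) (auto simp: lookup_single when_def)
  then show ?thesis by simp
qed

lemma pr_diff: "pr \<mu> (\<nu> - \<nu>') = pr \<mu> \<nu> - pr \<mu> \<nu>'"
  using pr_add[of \<mu> "\<nu> - \<nu>'" \<nu>'] by simp

lemma pr_zw: "i \<le> n \<Longrightarrow> pr \<mu> (zw n i 1) = - (if i = 0 \<or> i = n then 2 else 1) * dd n i \<mu>"
  using n_ge by (auto simp: zw_def dd_def pr_single pr_diff)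

text \<open>The pairing of \<open>\<mu>\<close> with the root belonging to the letter \<open>i\<close> that follows the prefix \<open>pre\<close>.\<close>

definition rootval :: "weight \<Rightarrow> nat list \<Rightarrow> nat \<Rightarrow> int" where
  "rootval \<mu> pre i = pr \<mu> (Rw pre (zw n i 1)) div (if i = 0 \<or> i = n then 2 else 1)"

lemma dd_rootval:
  assumes pre: "set pre \<subseteq> {..n}" and i: "i \<le> n" and e: "Rw pre (rw n i \<nu>) = \<mu>"
  shows "dd n i \<nu> = rootval \<mu> pre i"
proof -
  have "pr \<mu> (Rw pre (zw n i 1)) = pr (rw n i \<nu>) (zw n i 1)"
    unfolding e[symmetric] by (rule pr_W0[OF Rw_W0[OF pre]])
  also have "\<dots> = (if i = 0 \<or> i = n then 2 else 1) * dd n i \<nu>"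
    using pr_zw[OF i, of "rw n i \<nu>"] by (simp add: dd_rw)
  finally show ?thesis by (simp add: rootval_def)
qed

definition Op :: "(bool \<times> nat) list \<Rightarrow> 'r laurent \<Rightarrow> 'r laurent" where
  "Op ws = compose_list (map op ws)"

lemma Op_simps [simp]: "Op [] f = f" "Op (x # ws) f = op x (Op ws f)" "Op (ws @ vs) f = Op ws (Op vs f)"
  by (simp_all add: Op_def)

text \<open>A weight that a letter may leave in place ends up no higher than it would have after
  being reflected.\<close>

definition down_cond :: "(bool \<times> nat) list \<Rightarrow> bool" where
  "down_cond ws \<longleftrightarrow> (\<forall>pre b i post \<nu>. ws = pre @ (b, i) # post \<longrightarrow> \<nu> \<in> lattice n \<longrightarrow> bad b (dd n i \<nu>) \<longrightarrow>
    ple n (Rw (map snd pre) \<nu>) (Rw (map snd pre) (rw n i \<nu>)))"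

fun coefprod :: "weight \<Rightarrow> nat list \<Rightarrow> (bool \<times> nat) list \<Rightarrow> 'r" where
  "coefprod \<mu> pre [] = 1"
| "coefprod \<mu> pre ((b, i) # ws) = tcoef b i (rootval \<mu> pre i) * coefprod \<mu> (pre @ [i]) ws"

lemma coefprod_append:
  "coefprod \<mu> pre (ws @ vs) = coefprod \<mu> pre ws * coefprod \<mu> (pre @ map snd ws) vs"
  by (induction \<mu> pre ws rule: coefprod.induct) (simp_all add: mult.assoc)

text \<open>Letters act from the right end of the word, so the induction shifts the outermost letter
  of \<open>ws\<close> to \<open>pre\<close>. As the whole word fixes \<open>\<mu>\<close>, the
  leading weight returns to \<open>\<mu>\<close>.\<close>

lemma transported_word:
  assumes ws: "snd ` set (pre @ ws) \<subseteq> {..n}" and dc: "down_cond (pre @ ws)" and \<mu>: "\<mu> \<in> lattice n"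
    and id: "Rw (map snd (pre @ ws)) \<mu> = \<mu>"
  shows "transported (Rw (map snd pre)) \<mu> (Rw (map snd ws) \<mu>) (coefprod \<mu> (map snd pre) ws) (Op ws (Poly_Mapping.single \<mu> 1))"
  using assms
proof (induction ws arbitrary: pre)
  case Nil
  then show ?case by (simp add: transported_def)
next
  case (Cons x ws)
  obtain b i where x: "x = (b, i)" by (cases x)
  have pre: "set (map snd pre) \<subseteq> {..n}" and i: "i \<le> n" using Cons(2) x by auto
  have "transported (Rw (map snd (pre @ [x]))) \<mu> (Rw (map snd ws) \<mu>) (coefprod \<mu> (map snd (pre @ [x])) ws) (Op ws (Poly_Mapping.single \<mu> 1))"
    using Cons(2-5) by (intro Cons.IH) auto
  then have 1: "transported (\<lambda>\<nu>. Rw (map snd pre) (rw n i \<nu>)) \<mu> (Rw (map snd ws) \<mu>) (coefprod \<mu> (map snd pre @ [i]) ws) (Op ws (Poly_Mapping.single \<mu> 1))"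
    by (simp add: x transported_def)
  have 2: "ple n (Rw (map snd pre) \<nu>) (Rw (map snd pre) (rw n i \<nu>))"
    if "\<nu> \<in> lattice n" "bad b (dd n i \<nu>)" for \<nu>
    using Cons(3) that unfolding down_cond_def x by blast
  have 3: "dd n i (Rw (map snd ws) \<mu>) = rootval \<mu> (map snd pre) i"
    by (rule dd_rootval[OF pre i]) (use Cons(5) x in simp)
  show ?case using transported_step[OF 1 pre i 2] by (simp add: x 3 mult.commute)
qed

definition Yword :: "nat \<Rightarrow> (bool \<times> nat) list" where
  "Yword i = map (Pair True) [i..<n] @ [(True, n)] @ map (Pair True) (rev [1..<n]) @ [(True, 0)] @ map (Pair False) [1..<i]"

lemma Y_Op: "Y i f = Op (Yword i) f"
proof -
  have 1: "op \<circ> Pair True = T" "op \<circ> Pair False = Ti" "op (True, j) = T j" for j by (auto simp: op_def fun_eq_iff)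
  show ?thesis by (simp add: Y_def Op_def Yword_def 1)
qed

lemma rw_single: "rw n i (Poly_Mapping.single p r) = (if i = 0 then Poly_Mapping.single p (if p = 1 then - r else r)
   else if i = n then Poly_Mapping.single p (if p = n then - r else r)
   else Poly_Mapping.single (if p = i then Suc i else if p = Suc i then i else p) r)"
  by (rule poly_mapping_eqI) (auto simp: lookup_rw lookup_single when_def)

lemma Rw_asc:
  assumes "1 \<le> i" "i \<le> j" "j \<le> n"
  shows "Rw [i..<j] (Poly_Mapping.single p r) = Poly_Mapping.single (if p = j then i else if i \<le> p \<and> p < j then Suc p else p) r"
  using assms(2,3)
proof (induction j arbitrary: p rule: dec_induct)
  case (step j)
  then show ?case using assms(1) by (auto simp: rw_single)
qed simp

lemma Rw_desc:
  assumes "1 \<le> i" "i \<le> j" "j \<le> n"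
  shows "Rw (rev [i..<j]) (Poly_Mapping.single p r) = Poly_Mapping.single (if p = i then j else if i < p \<and> p \<le> j then p - 1 else p) r"
  using assms(2,3)
proof (induction j arbitrary: p rule: dec_induct)
  case (step j)
  then show ?case using assms(1) by (auto simp: rw_single le_Suc_eq)
qed simp

lemma Rw_diff: "Rw is (\<mu> - \<nu>) = Rw is \<mu> - Rw is \<nu>"
  using Rw_add[of "is" "\<mu> - \<nu>" \<nu>] by simp

lemma snd_o_Pair [simp]: "snd \<circ> Pair b = (\<lambda>x. x)"
  by (simp add: fun_eq_iff)

text \<open>The roots inverted by the word that defines \<open>Y i\<close>.\<close>

lemma root1: "1 \<le> i \<Longrightarrow> i \<le> j \<Longrightarrow> j < n \<Longrightarrow> Rw [i..<j] (zw n j r) = Poly_Mapping.single i r - Poly_Mapping.single (Suc j) r"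
  by (simp add: zw_def Rw_diff Rw_asc)

lemma root2: "1 \<le> i \<Longrightarrow> i \<le> n \<Longrightarrow> Rw [i..<n] (zw n n r) = Poly_Mapping.single i (2 * r)"
  using n_ge by (simp add: zw_def Rw_asc)

lemma root3: "1 \<le> i \<Longrightarrow> i \<le> n \<Longrightarrow> 1 \<le> j \<Longrightarrow> j < n \<Longrightarrow>
  Rw ([i..<n] @ [n] @ rev [Suc j..<n]) (zw n j r) = Poly_Mapping.single (if j < i then j else Suc j) r + Poly_Mapping.single i r"
  using n_ge by (simp add: zw_def Rw_diff Rw_asc Rw_desc rw_single, simp add: single_uminus)

lemma root4: "1 \<le> i \<Longrightarrow> i \<le> n \<Longrightarrow> Rw ([i..<n] @ [n] @ rev [1..<n]) (zw n 0 r) = Poly_Mapping.single i (2 * r)"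
  using n_ge Rw_desc[of 1 n 1] by (simp add: zw_def Rw_asc rw_single)

lemma root5: "1 \<le> i \<Longrightarrow> i \<le> n \<Longrightarrow> 1 \<le> j \<Longrightarrow> j < i \<Longrightarrow>
  Rw ([i..<n] @ [n] @ rev [1..<n] @ [0] @ [1..<j]) (zw n j r) = Poly_Mapping.single i r - Poly_Mapping.single j r"
proof -
  assume i: "1 \<le> i" "i \<le> n" and j: "1 \<le> j" "j < i"
  have a: "Rw [1..<j] (Poly_Mapping.single j r) = Poly_Mapping.single 1 r"
    "Rw [1..<j] (Poly_Mapping.single (Suc j) r) = Poly_Mapping.single (Suc j) r" for r
    using i j Rw_asc[of 1 j j r] Rw_asc[of 1 j "Suc j" r] by auto
  have b: "Rw (rev [1..<n]) (Poly_Mapping.single 1 r) = Poly_Mapping.single n r"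
    "Rw (rev [1..<n]) (Poly_Mapping.single (Suc j) r) = Poly_Mapping.single j r" for r
    using i j Rw_desc[of 1 n 1 r] Rw_desc[of 1 n "Suc j" r] by auto
  show ?thesis
    using i j n_ge a b by (simp add: zw_def Rw_diff Rw_asc rw_single del: One_nat_def)
qed

text \<open>\<open>Y i\<close> belongs to a translation in the affine Weyl group, whose linear part
  is trivial.\<close>

lemma Rw_Yword:
  assumes "1 \<le> i" "i \<le> n"
  shows "Rw (map snd (Yword i)) \<mu> = \<mu>"
proof (induction \<mu> rule: poly_mapping_additive_induct)
  case (single p r)
  have "Rw ([i..<n] @ [n] @ rev [1..<n] @ [0] @ [1..<i]) (Poly_Mapping.single p r) = Poly_Mapping.single p r"
    using assms n_ge Rw_desc[of 1 n] Rw_asc[of 1 i]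
    by (auto simp: Rw_asc rw_single)
  then show ?case by (simp add: Yword_def)
next
  case zero
  have "Rw is 0 = 0" for "is" by (induction "is") auto
  then show ?case .
qed (simp add: Rw_add)

lemma upt_split: "[a..<b] = xs @ j # ys \<Longrightarrow> a \<le> j \<and> j < b \<and> xs = [a..<j] \<and> ys = [Suc j..<b]"
proof (induction xs arbitrary: a)
  case Nil
  then show ?case by (cases "a < b") (auto simp: upt_conv_Cons)
next
  case (Cons x xs)
  then have "a < b" by (cases "a < b") auto
  then have "x = a" "[Suc a..<b] = xs @ j # ys" using Cons(2) by (auto simp: upt_conv_Cons)
  then show ?case using Cons(1)[of "Suc a"] by (auto simp: upt_conv_Cons)
qed

lemma rev_upt_split: "rev [a..<b] = xs @ j # ys \<Longrightarrow> a \<le> j \<and> j < b \<and> xs = rev [Suc j..<b]"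
  using upt_split[of a b "rev ys" j "rev xs"] by (metis append_assoc append_Cons append_Nil rev.simps(2) rev_append rev_rev_ident rev_swap)

lemma map_Pair_split: "map (Pair b) zs = xs @ (b', j) # ys \<Longrightarrow> b' = b \<and> zs = map snd xs @ j # map snd ys"
  by (auto simp: map_eq_append_conv)

lemma Yword_split:
  assumes i: "1 \<le> i" "i \<le> n" and e: "Yword i = pre @ (b, j) # post"
  obtains "b" "i \<le> j" "j < n" "map snd pre = [i..<j]"
  | "b" "j = n" "map snd pre = [i..<n]"
  | "b" "1 \<le> j" "j < n" "map snd pre = [i..<n] @ [n] @ rev [Suc j..<n]"
  | "b" "j = 0" "map snd pre = [i..<n] @ [n] @ rev [1..<n]"
  | "\<not> b" "1 \<le> j" "j < i" "map snd pre = [i..<n] @ [n] @ rev [1..<n] @ [0] @ [1..<j]"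
proof -
  define A B where "A = map (Pair True) [i..<n]" and "B = map (Pair True) (rev [1..<n])"
  define C where "C = map (Pair False) [1..<i]"
  have e': "A @ (True, n) # B @ (True, 0) # C = pre @ (b, j) # post"
    using e by (simp add: Yword_def A_def B_def C_def)
  consider ys where "A = pre @ (b, j) # ys" | "pre = A" "b" "j = n"
    | xs ys where "pre = A @ (True, n) # xs" "B = xs @ (b, j) # ys" | "pre = A @ (True, n) # B" "b" "j = 0"
    | xs where "pre = A @ (True, n) # B @ (True, 0) # xs" "C = xs @ (b, j) # post"
    using e' by (auto simp: append_eq_append_conv2 append_eq_Cons_conv Cons_eq_append_conv)
  then show thesis
  proof cases
    case 1
    have c: "b = True \<and> [i..<n] = map snd pre @ j # map snd ys"
      using 1 unfolding A_def by (rule map_Pair_split)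
    show ?thesis by (rule that(1)) (use c upt_split[OF conjunct2[OF c]] in simp_all)
  next
    case 2
    then show ?thesis by (intro that(2)) (simp_all add: A_def)
  next
    case 3
    have c: "b = True \<and> rev [1..<n] = map snd xs @ j # map snd ys"
      using 3(2) unfolding B_def by (rule map_Pair_split)
    show ?thesis by (rule that(3)) (use c rev_upt_split[OF conjunct2[OF c]] 3(1) in \<open>simp_all add: A_def\<close>)
  next
    case 4
    then show ?thesis by (intro that(4)) (simp_all add: A_def B_def)
  next
    case 5
    have c: "b = False \<and> [1..<i] = map snd xs @ j # map snd post"
      using 5(2) unfolding C_def by (rule map_Pair_split)
    show ?thesis by (rule that(5)) (use c upt_split[OF conjunct2[OF c]] 5(1) in \<open>simp_all add: A_def B_def\<close>)
  qed
qed

lemma pleI_add: "(\<And>k. k \<in> {1..n} \<Longrightarrow> 0 \<le> psum k z) \<Longrightarrow> ple n \<nu> (\<nu> + z)"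
  by (simp add: ple_def psum_add)

text \<open>In the first four stretches the inverted roots \<open>e_i - e_j\<close> with
  \<open>j > i\<close>, \<open>2 e_i\<close> and \<open>e_i + e_j\<close> are positive. In the last
  one \<open>e_i - e_j\<close> with \<open>j < i\<close> is negative, but \<open>bad\<close> has the
  opposite sign for inverse operators. This is where the inverses in \<open>Y i\<close> make it
  triangular.\<close>

lemma down_cond_Yword:
  assumes i: "1 \<le> i" "i \<le> n"
  shows "down_cond (Yword i)"
  unfolding down_cond_def
proof (intro allI impI)
  fix pre b j post \<nu>
  assume e: "Yword i = pre @ (b, j) # post" and b: "bad b (dd n j \<nu>)"
  define d where "d = dd n j \<nu>"
  have "0 \<le> psum k (Rw (map snd pre) (zw n j d))" for k
    using i e
  proof (cases rule: Yword_split)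
    case 1
    then show ?thesis using i b root1[of i j d] by (auto simp: psum_diff psum_single bad_def d_def)
  next
    case 2
    then show ?thesis using i b root2[of i d] by (auto simp: psum_single bad_def d_def)
  next
    case 3
    then show ?thesis unfolding 3(4) using i b root3[of i j d] by (auto simp: psum_add psum_single bad_def d_def)
  next
    case 4
    then show ?thesis unfolding 4(3) using i b root4[of i d] by (auto simp: psum_single bad_def d_def)
  next
    case 5
    then show ?thesis unfolding 5(4) using i b root5[of i j d] by (auto simp: psum_diff psum_single bad_def d_def)
  qed
  then show "ple n (Rw (map snd pre) \<nu>) (Rw (map snd pre) (rw n j \<nu>))"
    unfolding rw_eq d_def[symmetric] Rw_add by (intro pleI_add)
qed

section \<open>The diagonal coefficients of the triangular operators\<close>

definition diag :: "weight \<Rightarrow> nat \<Rightarrow> 'r" where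
  "diag \<mu> i = coefprod \<mu> [] (Yword i)"

lemma set_Yword: "1 \<le> i \<Longrightarrow> i \<le> n \<Longrightarrow> snd ` set (Yword i) \<subseteq> {..n}"
  by (auto simp: Yword_def)

lemma Y_triangular:
  assumes i: "1 \<le> i" "i \<le> n" and \<mu>: "\<mu> \<in> lattice n"
  shows "lk (Y i (Poly_Mapping.single \<mu> 1)) \<mu> = diag \<mu> i"
    "\<theta> \<in> Poly_Mapping.keys (Y i (Poly_Mapping.single \<mu> 1)) \<Longrightarrow> \<theta> \<in> lattice n \<and> wt_succeq n \<mu> \<theta>"
proof -
  have "transported (Rw (map snd [])) \<mu> (Rw (map snd (Yword i)) \<mu>) (coefprod \<mu> (map snd []) (Yword i)) (Op (Yword i) (Poly_Mapping.single \<mu> 1))"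
    using transported_word[of "[]" "Yword i" \<mu>] set_Yword[OF i] down_cond_Yword[OF i] \<mu> Rw_Yword[OF i] by simp
  then have t: "transported (Rw []) \<mu> \<mu> (diag \<mu> i) (Y i (Poly_Mapping.single \<mu> 1))"
    by (simp add: Y_Op Rw_Yword[OF i] diag_def)
  then show "lk (Y i (Poly_Mapping.single \<mu> 1)) \<mu> = diag \<mu> i" by (simp add: transported_def)
  assume "\<theta> \<in> Poly_Mapping.keys (Y i (Poly_Mapping.single \<mu> 1))"
  then show "\<theta> \<in> lattice n \<and> wt_succeq n \<mu> \<theta>" using t \<mu> by (auto simp: transported_def wt_succeq_mless[OF n1])
qed

definition sgnexp :: "bool \<Rightarrow> int" where "sgnexp b = (if b then 1 else -1)"

text \<open>The exponent of \<open>t^(1/2)\<close> in \<open>diag\<close>, with one sign for every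
  letter other than \<open>0\<close> and \<open>n\<close>.\<close>

definition texp :: "weight \<Rightarrow> nat \<Rightarrow> int" where
  "texp \<mu> i = (\<Sum>j\<in>{i..<n}. sgnexp (lk \<mu> (Suc j) \<le> lk \<mu> i))
    + (\<Sum>j\<in>{1..<n}. sgnexp (0 \<le> lk \<mu> (if j < i then j else Suc j) + lk \<mu> i))
    + (\<Sum>j\<in>{1..<i}. sgnexp (lk \<mu> j < lk \<mu> i))"

definition pw :: "param \<Rightarrow> int \<Rightarrow> 'r" where "pw p = upow (P p) (Pi p)"

lemma pw_add: "pw p (r + s) = pw p r * pw p s"
  unfolding pw_def by (rule upow_add) (rule P_Pi)

lemma pw_0 [simp]: "pw p 0 = 1" and pw_1: "pw p 1 = P p" and pw_m1: "pw p (-1) = Pi p"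
  by (simp_all add: pw_def)

lemma coefprod_asc:
  "coefprod \<mu> pre (map (Pair b) [i..<k]) = (\<Prod>j\<in>{i..<k}. tcoef b j (rootval \<mu> (pre @ [i..<j]) j))"
proof (induction k)
  case (Suc k)
  show ?case
  proof (cases "i \<le> k")
    case True
    then have "{i..<Suc k} = insert k {i..<k}" by auto
    then show ?thesis using Suc True by (simp add: coefprod_append mult.commute)
  qed simp
qed simp

lemma coefprod_desc:
  "coefprod \<mu> pre (map (Pair b) (rev [i..<k])) = (\<Prod>j\<in>{i..<k}. tcoef b j (rootval \<mu> (pre @ rev [Suc j..<k]) j))"
proof (induction "k - i" arbitrary: i)
  case (Suc l)
  then have "i < k" by simp
  then have "rev [i..<k] = rev [Suc i..<k] @ [i]" "{i..<k} = insert i {Suc i..<k}" by (auto simp: upt_conv_Cons)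
  then show ?case using Suc(1)[of "Suc i"] Suc(2) by (simp add: coefprod_append mult.commute)
qed simp

lemma prod_pw: "(\<Prod>j\<in>A. pw p (f j)) = pw p (\<Sum>j\<in>A. f j)"
  by (induction A rule: infinite_finite_induct) (simp_all add: pw_add)

lemma tcoef_mid: "j \<noteq> 0 \<Longrightarrow> j \<noteq> n \<Longrightarrow> tcoef b j d = pw ParT (sgnexp (if b then 0 \<le> d else 0 < d))"
  by (auto simp: tcoef_def zc_def tau_def taui_def sgnexp_def pw_1 pw_m1)

lemma diag_eq:
  assumes i: "1 \<le> i" "i \<le> n"
  shows "diag \<mu> i = qpow (lk \<mu> i) * pw ParTn (sgnexp (0 \<le> lk \<mu> i)) * pw ParT0 (sgnexp (0 \<le> lk \<mu> i)) * pw ParT (texp \<mu> i)"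
proof -
  have e: "diag \<mu> i = coefprod \<mu> [] (map (Pair True) [i..<n]) * (tcoef True n (rootval \<mu> [i..<n] n) *
    (coefprod \<mu> ([i..<n] @ [n]) (map (Pair True) (rev [1..<n])) * (tcoef True 0 (rootval \<mu> ([i..<n] @ [n] @ rev [1..<n]) 0)
     * coefprod \<mu> ([i..<n] @ [n] @ rev [1..<n] @ [0]) (map (Pair False) [1..<i]))))"
    unfolding diag_def Yword_def coefprod_append by simp
  have 1: "coefprod \<mu> [] (map (Pair True) [i..<n]) = pw ParT (\<Sum>j\<in>{i..<n}. sgnexp (lk \<mu> (Suc j) \<le> lk \<mu> i))"
    unfolding coefprod_asc prod_pw[symmetric]
  proof (rule prod.cong[OF refl])
    fix j assume j: "j \<in> {i..<n}"
    have "rootval \<mu> ([] @ [i..<j]) j = lk \<mu> i - lk \<mu> (Suc j)"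
      using j i root1[of i j 1] by (simp add: rootval_def pr_diff pr_single)
    then show "tcoef True j (rootval \<mu> ([] @ [i..<j]) j) = pw ParT (sgnexp (lk \<mu> (Suc j) \<le> lk \<mu> i))"
      using j i by (simp add: tcoef_mid)
  qed
  have 2: "tcoef True n (rootval \<mu> [i..<n] n) = pw ParTn (sgnexp (0 \<le> lk \<mu> i))"
    using i n_ge root2[of i 1] by (auto simp: rootval_def pr_single tcoef_def zc_def tau_def taui_def sgnexp_def pw_1 pw_m1)
  have 3: "coefprod \<mu> ([i..<n] @ [n]) (map (Pair True) (rev [1..<n])) = pw ParT (\<Sum>j\<in>{1..<n}. sgnexp (0 \<le> lk \<mu> (if j < i then j else Suc j) + lk \<mu> i))"
    unfolding coefprod_desc prod_pw[symmetric]
  proof (rule prod.cong[OF refl])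
    fix j assume j: "j \<in> {1..<n}"
    have "rootval \<mu> (([i..<n] @ [n]) @ rev [Suc j..<n]) j = lk \<mu> (if j < i then j else Suc j) + lk \<mu> i"
      using j i root3[of i j 1] unfolding rootval_def append_assoc by (simp add: pr_add pr_single)
    then show "tcoef True j (rootval \<mu> (([i..<n] @ [n]) @ rev [Suc j..<n]) j) = pw ParT (sgnexp (0 \<le> lk \<mu> (if j < i then j else Suc j) + lk \<mu> i))"
      using j i by (simp add: tcoef_mid)
  qed
  have 4: "tcoef True 0 (rootval \<mu> ([i..<n] @ [n] @ rev [1..<n]) 0) = qpow (lk \<mu> i) * pw ParT0 (sgnexp (0 \<le> lk \<mu> i))"
    using i n_ge root4[of i 1] unfolding rootval_def
    by (auto simp: pr_single tcoef_def zc_def tau_def taui_def sgnexp_def pw_1 pw_m1)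
  have 5: "coefprod \<mu> ([i..<n] @ [n] @ rev [1..<n] @ [0]) (map (Pair False) [1..<i]) = pw ParT (\<Sum>j\<in>{1..<i}. sgnexp (lk \<mu> j < lk \<mu> i))"
    unfolding coefprod_asc prod_pw[symmetric]
  proof (rule prod.cong[OF refl])
    fix j assume j: "j \<in> {1..<i}"
    have "rootval \<mu> (([i..<n] @ [n] @ rev [1..<n] @ [0]) @ [1..<j]) j = lk \<mu> i - lk \<mu> j"
      using j i root5[of i j 1] unfolding rootval_def append_assoc by (simp add: pr_diff pr_single)
    then show "tcoef False j (rootval \<mu> (([i..<n] @ [n] @ rev [1..<n] @ [0]) @ [1..<j]) j) = pw ParT (sgnexp (lk \<mu> j < lk \<mu> i))"
      using j i by (simp add: tcoef_mid)
  qed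
  show ?thesis unfolding e 1 2 3 4 5 texp_def pw_add by (simp add: ac_simps)
qed

text \<open>The middle sum is \<open>n - 1\<close>. The other two range over \<open>n - 1\<close>
  letters together, and the positive signs among them are counted by \<open>wrank\<close>.\<close>

lemma texp_nonneg:
  assumes i: "1 \<le> i" "i \<le> n" and nn: "\<And>j. j \<in> {1..n} \<Longrightarrow> 0 \<le> lk \<mu> j"
  shows "texp \<mu> i = 2 * wrank n \<mu> i"
proof -
  have s: "(\<Sum>j\<in>A. sgnexp (Q j)) = 2 * int (card {j \<in> A. Q j}) - int (card A)" if "finite A" for A :: "nat set" and Q
  proof -
    have "sgnexp (Q j) = 2 * (if Q j then 1 else 0) - 1" for j by (simp add: sgnexp_def)
    then have "(\<Sum>j\<in>A. sgnexp (Q j)) = 2 * (\<Sum>j\<in>A. if Q j then 1 else 0) - int (card A)"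
      by (simp add: sum_subtractf sum_distrib_left)
    also have "(\<Sum>j\<in>A. if Q j then 1 else 0) = int (card {j \<in> A. Q j})"
      using that by (simp add: sum.If_cases Int_def)
    finally show ?thesis .
  qed
  have 1: "(\<Sum>j\<in>{1..<n}. sgnexp (0 \<le> lk \<mu> (if j < i then j else Suc j) + lk \<mu> i)) = int n - 1"
  proof -
    have "0 \<le> lk \<mu> (if j < i then j else Suc j) + lk \<mu> i" if "j \<in> {1..<n}" for j
      using nn[of j] nn[of "Suc j"] nn[of i] that i by auto
    then have "(\<Sum>j\<in>{1..<n}. sgnexp (0 \<le> lk \<mu> (if j < i then j else Suc j) + lk \<mu> i)) = (\<Sum>j\<in>{1..<n}. 1)"
      by (intro sum.cong) (auto simp: sgnexp_def)
    then show ?thesis using n_ge by simp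
  qed
  have "bij_betw Suc {j \<in> {i..<n}. lk \<mu> (Suc j) \<le> lk \<mu> i} {l \<in> {Suc i..n}. lk \<mu> l \<le> lk \<mu> i}"
    by (rule bij_betw_byWitness[where f' = "\<lambda>j. j - 1"]) auto
  then have "card {j \<in> {i..<n}. lk \<mu> (Suc j) \<le> lk \<mu> i} = card {l \<in> {Suc i..n}. lk \<mu> l \<le> lk \<mu> i}"
    by (rule bij_betw_same_card)
  then show ?thesis unfolding texp_def 1 wrank_def using i by (simp add: s)
qed

end

section \<open>The spectrum determines the staircase weight\<close>

lemma wrank_level:
  assumes "i \<in> {1..n}"
  shows "wrank n \<mu> i = int (card {l \<in> {1..n}. lk \<mu> l < lk \<mu> i}) + int (card {l \<in> {1..n}. lk \<mu> l = lk \<mu> i \<and> i < l})"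
proof -
  have 1: "{l \<in> {1..n}. lk \<mu> l < lk \<mu> i} = {l \<in> {1..<i}. lk \<mu> l < lk \<mu> i} \<union> {l \<in> {Suc i..n}. lk \<mu> l < lk \<mu> i}"
  proof (rule set_eqI)
    fix l
    have "l < i \<or> l = i \<or> Suc i \<le> l" by linarith
    then show "l \<in> {l \<in> {1..n}. lk \<mu> l < lk \<mu> i} \<longleftrightarrow> l \<in> {l \<in> {1..<i}. lk \<mu> l < lk \<mu> i} \<union> {l \<in> {Suc i..n}. lk \<mu> l < lk \<mu> i}"
      using assms by auto
  qed
  have 2: "{l \<in> {Suc i..n}. lk \<mu> l \<le> lk \<mu> i} = {l \<in> {Suc i..n}. lk \<mu> l < lk \<mu> i} \<union> {l \<in> {1..n}. lk \<mu> l = lk \<mu> i \<and> i < l}"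
    using assms by auto
  have "card {l \<in> {1..n}. lk \<mu> l < lk \<mu> i} = card {l \<in> {1..<i}. lk \<mu> l < lk \<mu> i} + card {l \<in> {Suc i..n}. lk \<mu> l < lk \<mu> i}"
    unfolding 1 by (rule card_Un_disjoint) auto
  moreover have "card {l \<in> {Suc i..n}. lk \<mu> l \<le> lk \<mu> i} = card {l \<in> {Suc i..n}. lk \<mu> l < lk \<mu> i} + card {l \<in> {1..n}. lk \<mu> l = lk \<mu> i \<and> i < l}"
    unfolding 2 by (rule card_Un_disjoint) auto
  ultimately show ?thesis by (simp add: wrank_def)
qed

text \<open>
  Within a level set of \<open>\<mu>\<close> the spectral exponents drop by one at each step to the right, which
  is only possible by moving to a later block. Hence level sets have at most \<open>k\<close> elements, which
  bounds \<open>\<mu>\<close> by the staircase weight from above, and counting forces equality.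
\<close>

lemma staircase_unique:
  fixes \<mu> :: weight
  assumes m: "1 \<le> m" and n: "n = k * m" and nn: "\<And>i. i \<in> {1..n} \<Longrightarrow> 0 \<le> lk \<mu> i"
    and c: "\<And>i. i \<in> {1..n} \<Longrightarrow> wrank n \<mu> i - (int k + 1) * lk \<mu> i
      = int k - int m - int ((i - 1) div m) + int ((i - 1) mod m)"
    and i: "i \<in> {1..n}"
  shows "lk \<mu> i = int m - 1 - int ((i - 1) mod m)"
proof -
  \<comment> \<open>Block number, position inside the block, number of equal entries further right,
    and number of entries below \<open>v\<close>.\<close>
  define u where "u i = (i - 1) div m" for i
  define w where "w i = (i - 1) mod m" for i
  define g where "g i = card {l \<in> {1..n}. lk \<mu> l = lk \<mu> i \<and> i < l}" for i
  define N where "N v = card {l \<in> {1..n}. lk \<mu> l < v}" for v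
  have c': "int (N (lk \<mu> i)) + int (g i) - (int k + 1) * lk \<mu> i = int k - int m - int (u i) + int (w i)" if "i \<in> {1..n}" for i
    using c[OF that] wrank_level[OF that] by (simp add: N_def g_def u_def w_def)
  have uw: "u i * m + w i = i - 1" for i by (simp add: u_def w_def)
  have uk: "u i < k" if "i \<in> {1..n}" for i
    unfolding u_def using that n m by (intro less_mult_imp_div_less) auto
  have umono: "u i \<le> u j" if "i \<le> j" for i j unfolding u_def using that by (intro div_le_mono) auto
  have bound: "u i + g i \<le> k - 1" if "i \<in> {1..n}" for i
    using that
  proof (induction "g i" arbitrary: i)
    case 0
    then show ?case using uk[of i] by simp
  next
    case (Suc d)
    let ?S = "{l \<in> {1..n}. lk \<mu> l = lk \<mu> i \<and> i < l}"
    have "?S \<noteq> {}" using Suc(2) unfolding g_def by (metis card.empty nat.distinct(1))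
    define j where "j = Min ?S"
    have jS: "j \<in> ?S" unfolding j_def by (rule Min_in) (use \<open>?S \<noteq> {}\<close> in auto)
    have jmin: "j \<le> l" if "l \<in> ?S" for l unfolding j_def by (rule Min_le) (use that in auto)
    have "?S = insert j {l \<in> {1..n}. lk \<mu> l = lk \<mu> j \<and> j < l}"
    proof (rule set_eqI)
      fix l
      show "l \<in> ?S \<longleftrightarrow> l \<in> insert j {l \<in> {1..n}. lk \<mu> l = lk \<mu> j \<and> j < l}"
        using jS jmin[of l] by (cases "l = j") auto
    qed
    then have "card ?S = card (insert j {l \<in> {1..n}. lk \<mu> l = lk \<mu> j \<and> j < l})" by (rule arg_cong)
    then have gi: "g i = Suc (g j)" unfolding g_def by simp
    have e: "lk \<mu> j = lk \<mu> i" "j \<in> {1..n}" "i < j" using jS by auto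
    have IH: "u j + g j \<le> k - 1" using Suc(1)[of j] Suc(2) gi e by simp
    \<comment> \<open>The next equal entry has one successor fewer. Inside the same block its
      position would grow, contrary to this equation; hence its block number is larger.\<close>
    have "int (w i) - int (u i) = int (w j) - int (u j) + 1"
      using c'[OF e(2)] c'[OF Suc(3)] e(1) gi by simp
    moreover have "u i \<le> u j" using umono e by simp
    moreover have "w i < w j" if "u i = u j" using uw[of i] uw[of j] that e(3) Suc(3) by auto
    ultimately have "u i < u j" by (cases "u i = u j") auto
    then show ?case using IH gi by simp
  qed
  have level: "card {l \<in> {1..n}. lk \<mu> l = x} \<le> k" for x
  proof (cases "{l \<in> {1..n}. lk \<mu> l = x} = {}")
    case True
    then show ?thesis by (metis card.empty le0)
  next
    case False
    let ?S = "{l \<in> {1..n}. lk \<mu> l = x}"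
    define j where "j = Min ?S"
    have jS: "j \<in> ?S" unfolding j_def by (rule Min_in) (use False in auto)
    have jmin: "j \<le> l" if "l \<in> ?S" for l unfolding j_def by (rule Min_le) (use that in auto)
    have 1: "?S = insert j {l \<in> {1..n}. lk \<mu> l = lk \<mu> j \<and> j < l}"
    proof (rule set_eqI)
      fix l
      show "l \<in> ?S \<longleftrightarrow> l \<in> insert j {l \<in> {1..n}. lk \<mu> l = lk \<mu> j \<and> j < l}"
        using jS jmin[of l] by (cases "l = j") auto
    qed
    have "card ?S = card (insert j {l \<in> {1..n}. lk \<mu> l = lk \<mu> j \<and> j < l})" using 1 by (rule arg_cong)
    then have "card ?S = Suc (g j)" unfolding g_def by simp
    moreover have "u j + g j \<le> k - 1" "u j < k" using bound uk jS by auto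
    ultimately show ?thesis by linarith
  qed
  have Nle: "N (int v) \<le> k * v" for v
  proof (induction v)
    case 0
    have "{l \<in> {1..n}. lk \<mu> l < 0} = {}" using nn by force
    then show ?case by (simp add: N_def)
  next
    case (Suc v)
    have "{l \<in> {1..n}. lk \<mu> l < int (Suc v)} = {l \<in> {1..n}. lk \<mu> l < int v} \<union> {l \<in> {1..n}. lk \<mu> l = int v}" by auto
    then have "N (int (Suc v)) = card ({l \<in> {1..n}. lk \<mu> l < int v} \<union> {l \<in> {1..n}. lk \<mu> l = int v})"
      unfolding N_def by (rule arg_cong)
    also have "\<dots> \<le> N (int v) + card {l \<in> {1..n}. lk \<mu> l = int v}"
      unfolding N_def by (rule card_Un_le)
    finally have "N (int (Suc v)) \<le> N (int v) + card {l \<in> {1..n}. lk \<mu> l = int v}" .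
    then show ?case using Suc level[of "int v"] by simp
  qed
  \<comment> \<open>Insert \<open>N (lk \<mu> i) \<le> k * lk \<mu> i\<close> and
    \<open>u i + g i \<le> k - 1\<close> into \<open>c'\<close>.\<close>
  have upper: "lk \<mu> i \<le> int m - 1 - int (w i)" if i: "i \<in> {1..n}" for i
  proof -
    have "int (N (lk \<mu> i)) \<le> int k * lk \<mu> i"
      using Nle[of "nat (lk \<mu> i)"] nn[OF i] by (metis int_nat_eq of_nat_le_iff of_nat_mult)
    moreover have "int (u i) + int (g i) \<le> int k - 1" using bound[OF i] uk[OF i] by linarith
    ultimately show ?thesis using c'[OF i] by (simp add: algebra_simps)
  qed
  \<comment> \<open>The staircase has at least \<open>k * v\<close> entries below \<open>v\<close>
    and \<open>\<mu>\<close> has at most that many, while the first index set is contained in the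
    second.\<close>
  have eq: "{l \<in> {1..n}. int m - 1 - int (w l) < int v} = {l \<in> {1..n}. lk \<mu> l < int v}" if "v \<le> m" for v
  proof (rule card_seteq)
    show "{l \<in> {1..n}. int m - 1 - int (w l) < int v} \<subseteq> {l \<in> {1..n}. lk \<mu> l < int v}"
      using upper by fastforce
    define h where "h = (\<lambda>(a, b). a * m + b + 1 :: nat)"
    have h: "u (h (a, b)) = a \<and> w (h (a, b)) = b" if "b < m" for a b
      using that by (simp add: h_def u_def w_def)
    have "h ` ({..<k} \<times> {m - v..<m}) \<subseteq> {l \<in> {1..n}. int m - 1 - int (w l) < int v}"
    proof (rule image_subsetI)
      fix x assume "x \<in> {..<k} \<times> {m - v..<m}"
      then obtain a b where x: "x = (a, b)" and a: "a \<in> {..<k}" and b: "b \<in> {m - v..<m}" by auto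
      have "a * m + b < (a + 1) * m" using b by simp
      also have "\<dots> \<le> k * m" using a by (intro mult_le_mono1) auto
      finally have "h (a, b) \<in> {1..n}" by (simp add: h_def n)
      moreover have "w (h (a, b)) = b" using h b by simp
      moreover have "int m - 1 - int b < int v" using b that by auto
      ultimately show "h x \<in> {l \<in> {1..n}. int m - 1 - int (w l) < int v}" by (simp add: x)
    qed
    then have "card (h ` ({..<k} \<times> {m - v..<m})) \<le> card {l \<in> {1..n}. int m - 1 - int (w l) < int v}"
      by (intro card_mono) auto
    moreover have "inj_on h ({..<k} \<times> {m - v..<m})"
      by (rule inj_on_inverseI[where g = "\<lambda>x. (u x, w x)"]) (use h in auto)
    ultimately have "k * v \<le> card {l \<in> {1..n}. int m - 1 - int (w l) < int v}"
      using that by (simp add: card_image)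
    then show "card {l \<in> {1..n}. lk \<mu> l < int v} \<le> card {l \<in> {1..n}. int m - 1 - int (w l) < int v}"
      using Nle[of v] by (simp add: N_def)
  qed simp
  have wm: "w i < m" unfolding w_def using m by simp
  show ?thesis
  proof (rule ccontr)
    assume "\<not> ?thesis"
    then have "lk \<mu> i < int (m - 1 - w i)" using upper[OF i] wm by (simp add: w_def)
    then have "i \<in> {l \<in> {1..n}. int m - 1 - int (w l) < int (m - 1 - w i)}"
      using eq[of "m - 1 - w i"] i by auto
    then show False using wm by auto
  qed
qed

section \<open>Garnir relations\<close>

text \<open>The factor \<open>\<zeta> i - \<zeta> s\<close> cancels one denominator and removes the
  node \<open>s\<close>.\<close>

lemma divided_difference_mult:
  fixes \<zeta> :: "nat \<Rightarrow> 'a::field"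
  assumes "finite S" "s \<in> S" "inj_on \<zeta> S"
  shows "(\<Sum>i\<in>S. (\<zeta> i - \<zeta> s) * g i / (\<Prod>a\<in>S - {i}. \<zeta> i - \<zeta> a)) = (\<Sum>i\<in>S - {s}. g i / (\<Prod>a\<in>S - {s} - {i}. \<zeta> i - \<zeta> a))"
proof -
  have "(\<Sum>i\<in>S. (\<zeta> i - \<zeta> s) * g i / (\<Prod>a\<in>S - {i}. \<zeta> i - \<zeta> a)) = (\<Sum>i\<in>S - {s}. (\<zeta> i - \<zeta> s) * g i / (\<Prod>a\<in>S - {i}. \<zeta> i - \<zeta> a))"
    using assms by (subst sum.remove[of S s]) auto
  also have "\<dots> = (\<Sum>i\<in>S - {s}. g i / (\<Prod>a\<in>S - {s} - {i}. \<zeta> i - \<zeta> a))"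
  proof (rule sum.cong[OF refl])
    fix i assume i: "i \<in> S - {s}"
    have "S - {i} = insert s (S - {s} - {i})" using i assms by auto
    then have "(\<Prod>a\<in>S - {i}. \<zeta> i - \<zeta> a) = (\<zeta> i - \<zeta> s) * (\<Prod>a\<in>S - {s} - {i}. \<zeta> i - \<zeta> a)"
      using assms(1) by simp
    moreover have "\<zeta> i - \<zeta> s \<noteq> 0" using i assms by (auto dest: inj_onD)
    ultimately show "(\<zeta> i - \<zeta> s) * g i / (\<Prod>a\<in>S - {i}. \<zeta> i - \<zeta> a) = g i / (\<Prod>a\<in>S - {s} - {i}. \<zeta> i - \<zeta> a)"
      by simp
  qed
  finally show ?thesis .
qed

text \<open>Subtracting \<open>divided_difference_mult\<close> at two nodes gives a nonzero multiple
  of the sum as a difference of the sums over one node fewer. For two nodes both of these are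
  \<open>1\<close>.\<close>

lemma divided_difference_1:
  fixes \<zeta> :: "nat \<Rightarrow> 'a::field"
  assumes "finite S" "inj_on \<zeta> S" "2 \<le> card S"
  shows "(\<Sum>i\<in>S. 1 / (\<Prod>a\<in>S - {i}. \<zeta> i - \<zeta> a)) = 0"
  using assms
proof (induction "card S" arbitrary: S rule: less_induct)
  case less
  obtain s where s: "s \<in> S" using less(4) by fastforce
  have "card (S - {s}) \<ge> 1" using less s by simp
  then obtain s' where s': "s' \<in> S" "s' \<noteq> s" by (metis One_nat_def Suc_leD card.empty Diff_iff all_not_in_conv insertI1 not_one_le_zero)
  define DD where "DD U = (\<Sum>i\<in>U. 1 / (\<Prod>a\<in>U - {i}. \<zeta> i - \<zeta> a))" for U
  have r: "(\<Sum>i\<in>S. (\<zeta> i - \<zeta> x) * 1 / (\<Prod>a\<in>S - {i}. \<zeta> i - \<zeta> a)) = DD (S - {x})" if "x \<in> S" for x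
    unfolding DD_def by (rule divided_difference_mult[OF less(2) that less(3)])
  have "(\<zeta> s' - \<zeta> s) * DD S = (\<Sum>i\<in>S. (\<zeta> i - \<zeta> s) * 1 / (\<Prod>a\<in>S - {i}. \<zeta> i - \<zeta> a)) - (\<Sum>i\<in>S. (\<zeta> i - \<zeta> s') * 1 / (\<Prod>a\<in>S - {i}. \<zeta> i - \<zeta> a))"
    unfolding DD_def sum_distrib_left sum_subtractf[symmetric] by (intro sum.cong) (auto simp: divide_inverse algebra_simps)
  also have "\<dots> = DD (S - {s}) - DD (S - {s'})" using r[OF s] r[OF s'(1)] by simp
  also have "\<dots> = 0"
  proof (cases "card S = 2")
    case True
    have "{s, s'} \<subseteq> S" "card {s, s'} = 2" using s s' by auto
    then have "S = {s, s'}" using True less(2) by (metis card_subset_eq)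
    then have "S - {s} = {s'}" "S - {s'} = {s}" using s' by auto
    then show ?thesis by (simp add: DD_def)
  next
    case False
    have "DD (S - {x}) = 0" if "x \<in> S" for x
      unfolding DD_def
    proof (rule less(1))
      show "card (S - {x}) < card S" using that less(2,4) by simp
      show "2 \<le> card (S - {x})" using that less(2,4) False by simp
    qed (use less in \<open>auto intro: inj_on_subset\<close>)
    then show ?thesis using s s' by simp
  qed
  finally have "(\<zeta> s' - \<zeta> s) * DD S = 0" .
  moreover have "\<zeta> s' \<noteq> \<zeta> s" using s s' less(3) by (auto dest: inj_onD)
  ultimately show ?case by (simp add: DD_def)
qed

text \<open>Divided differences kill polynomials of degree at most \<open>card S - 2\<close>.
  Writing \<open>\<zeta> i - \<kappa> c\<close> as
  \<open>(\<zeta> i - \<zeta> s) + (\<zeta> s - \<kappa> c)\<close> lowers the degree, in the first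
  summand together with the number of nodes.\<close>

lemma divided_difference_prod:
  fixes \<zeta> :: "nat \<Rightarrow> 'a::field"
  assumes "finite D" "finite S" "inj_on \<zeta> S" "card D + 2 \<le> card S"
  shows "(\<Sum>i\<in>S. (\<Prod>c\<in>D. \<zeta> i - \<kappa> c) / (\<Prod>a\<in>S - {i}. \<zeta> i - \<zeta> a)) = 0"
  using assms
proof (induction D arbitrary: S rule: finite_induct)
  case empty
  then show ?case using divided_difference_1[of S \<zeta>] by simp
next
  case (insert c D)
  then obtain s where s: "s \<in> S" by fastforce
  let ?g = "\<lambda>i. (\<Prod>c\<in>D. \<zeta> i - \<kappa> c)"
  have "(\<Sum>i\<in>S. (\<Prod>c\<in>insert c D. \<zeta> i - \<kappa> c) / (\<Prod>a\<in>S - {i}. \<zeta> i - \<zeta> a))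
    = (\<Sum>i\<in>S. (\<zeta> i - \<zeta> s) * ?g i / (\<Prod>a\<in>S - {i}. \<zeta> i - \<zeta> a)) + (\<zeta> s - \<kappa> c) * (\<Sum>i\<in>S. ?g i / (\<Prod>a\<in>S - {i}. \<zeta> i - \<zeta> a))"
    unfolding sum_distrib_left sum.distrib[symmetric]
    using insert(1,2) by (intro sum.cong) (auto simp: divide_inverse algebra_simps)
  also have "(\<Sum>i\<in>S. ?g i / (\<Prod>a\<in>S - {i}. \<zeta> i - \<zeta> a)) = 0"
    using insert by (intro insert.IH) auto
  also have "(\<Sum>i\<in>S. (\<zeta> i - \<zeta> s) * ?g i / (\<Prod>a\<in>S - {i}. \<zeta> i - \<zeta> a)) = (\<Sum>i\<in>S - {s}. ?g i / (\<Prod>a\<in>S - {s} - {i}. \<zeta> i - \<zeta> a))"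
    by (rule divided_difference_mult[OF insert.prems(1) s insert.prems(2)])
  also have "\<dots> = 0"
    by (rule insert.IH) (use insert s in \<open>auto intro: inj_on_subset\<close>)
  finally show ?case by simp
qed

section \<open>Products over pairs and the alternating sum of moved vectors\<close>

definition pairs :: "nat \<Rightarrow> nat \<Rightarrow> (nat \<times> nat) set" where
  "pairs lo hi = {(i, j). lo < i \<and> i < j \<and> j \<le> hi}"

lemma finite_pairs [simp]: "finite (pairs lo hi)"
  by (rule finite_subset[of _ "{..hi} \<times> {..hi}"]) (auto simp: pairs_def)

lemma pairs_swap:
  fixes h :: "nat \<Rightarrow> nat \<Rightarrow> 'a::comm_monoid_mult"
  assumes "lo < j" "j < hi"
  shows "(\<Prod>(a, b)\<in>pairs lo hi - {(j, Suc j)}. h (Transposition.transpose j (Suc j) a) (Transposition.transpose j (Suc j) b))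
    = (\<Prod>(a, b)\<in>pairs lo hi - {(j, Suc j)}. h a b)"
  by (rule prod.reindex_bij_witness[where i = "map_prod (Transposition.transpose j (Suc j)) (Transposition.transpose j (Suc j))"
        and j = "map_prod (Transposition.transpose j (Suc j)) (Transposition.transpose j (Suc j))"])
    (use assms in \<open>auto simp: pairs_def Transposition.transpose_def split: if_splits\<close>)

lemma pairs_first: "lo < hi \<Longrightarrow> (\<Prod>(a, b)\<in>pairs lo hi. h a b) = (\<Prod>b\<in>{Suc (Suc lo)..hi}. h (Suc lo) b) * (\<Prod>(a, b)\<in>pairs (Suc lo) hi. h a b)"
  for h :: "nat \<Rightarrow> nat \<Rightarrow> 'a::comm_monoid_mult"
proof -
  assume lo: "lo < hi"
  have e: "pairs lo hi = (Pair (Suc lo) ` {Suc (Suc lo)..hi}) \<union> pairs (Suc lo) hi"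
    by (auto simp: pairs_def)
  have "(\<Prod>(a, b)\<in>pairs lo hi. h a b) = (\<Prod>(a, b)\<in>Pair (Suc lo) ` {Suc (Suc lo)..hi}. h a b) * (\<Prod>(a, b)\<in>pairs (Suc lo) hi. h a b)"
    unfolding e by (rule prod.union_disjoint) (simp, simp, auto simp: pairs_def)
  also have "(\<Prod>(a, b)\<in>Pair (Suc lo) ` {Suc (Suc lo)..hi}. h a b) = (\<Prod>b\<in>{Suc (Suc lo)..hi}. h (Suc lo) b)"
    by (subst prod.reindex) (auto simp: inj_on_def)
  finally show ?thesis .
qed

text \<open>By \<open>s\<Delta>\<close> the vector \<open>\<Delta>\<close> is antisymmetric,
  \<open>T_j \<Delta> = - t' \<Delta>\<close>, so that dividing by \<open>\<Delta>\<close>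
  simplifies the operators. Each partial sum then becomes a sum over the index whose
  \<open>\<phi>\<close> is selected, by a recursion in \<open>J\<close> that involves the two
  preceding partial sums.\<close>

lemma garnir_partial_sums:
  fixes \<sigma> :: "nat \<Rightarrow> 'a::field \<Rightarrow> 'a" and z \<phi> v :: "nat \<Rightarrow> 'a" and t t' \<Delta> :: 'a
  assumes h: "\<And>j. j \<in> {1..m} \<Longrightarrow> rhom (\<sigma> j)"
    and sz: "\<And>i j. j \<in> {1..m} \<Longrightarrow> i \<in> {1..Suc m} \<Longrightarrow> \<sigma> j (z i) = z (Transposition.transpose j (Suc j) i)"
    and s\<phi>: "\<And>i j. j \<in> {1..m} \<Longrightarrow> i \<in> {1..Suc m} \<Longrightarrow> \<sigma> j (\<phi> i) = \<phi> (Transposition.transpose j (Suc j) i)"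
    and st: "\<And>j. j \<in> {1..m} \<Longrightarrow> \<sigma> j t = t" "\<And>j. j \<in> {1..m} \<Longrightarrow> \<sigma> j t' = t'" and tt: "t * t' = 1"
    and s\<Delta>: "\<And>j. j \<in> {1..m} \<Longrightarrow> (z j - t'^2 * z (Suc j)) * \<sigma> j \<Delta> = (z (Suc j) - t'^2 * z j) * \<Delta>"
    and ne: "\<And>i j. i \<in> {1..Suc m} \<Longrightarrow> j \<in> {1..Suc m} \<Longrightarrow> i \<noteq> j \<Longrightarrow> z i \<noteq> z j"
    and nz: "\<And>j. j \<in> {1..m} \<Longrightarrow> z j - t'^2 * z (Suc j) \<noteq> 0" "\<And>j. j \<in> {1..Suc m} \<Longrightarrow> z j \<noteq> 0"
    and T: "\<And>j u. j \<in> {1..m} \<Longrightarrow> T j u = t * u + (t + (t' - t) / (1 - z j / z (Suc j))) * (\<sigma> j u - u)"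
    and v0: "v 0 = \<Delta> * \<phi> 1" and vS: "\<And>j. j < m \<Longrightarrow> v (Suc j) = T (Suc j) (v j)"
  shows "J \<le> Suc m \<Longrightarrow> (\<Sum>i<J. (- t')^i * v i) =
    \<Delta> * (\<Sum>i\<in>{1..J}. \<phi> i * (\<Prod>a\<in>{1..J} - {i}. (z i - t'^2 * z a) / (z i - z a)))"
proof -
  define A where "A i a = (z i - t'^2 * z a) / (z i - z a)" for i a
  define Fs where "Fs J = (\<Sum>i\<in>{1..J}. \<phi> i * (\<Prod>a\<in>{1..J} - {i}. A i a))" for J
  define Ss where "Ss J = (\<Sum>i<J. (- t')^i * v i)" for J
  have T\<Delta>: "T j (\<Delta> * x) = \<Delta> * (- t' * x - t * A (Suc j) j * (\<sigma> j x - x))" if j: "j \<in> {1..m}" for j x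
  proof -
    define X Y where "X = z j" and "Y = z (Suc j)"
    have XY: "X \<noteq> Y" "X \<noteq> 0" "Y \<noteq> 0" using ne[of j "Suc j"] nz(2)[of j] nz(2)[of "Suc j"] j by (auto simp: X_def Y_def)
    have d: "X - t'^2 * Y \<noteq> 0" using nz(1)[OF j] by (simp add: X_def Y_def)
    have s: "\<sigma> j \<Delta> = (Y - t'^2 * X) / (X - t'^2 * Y) * \<Delta>"
      using s\<Delta>[OF j] d by (simp add: X_def Y_def field_simps)
    have c: "t + (t' - t) / (1 - X / Y) = - t * (X - t'^2 * Y) / (Y - X)"
    proof -
      have "t + (t' - t) / (1 - X / Y) = (t * (Y - X) + (t' - t) * Y) / (Y - X)"
        using XY by (simp add: divide_simps)
      also have "t * (Y - X) + (t' - t) * Y = - t * (X - t'^2 * Y)" using tt by algebra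
      finally show ?thesis .
    qed
    have "T j (\<Delta> * x) = t * (\<Delta> * x) + (- t * (X - t'^2 * Y) / (Y - X)) * ((Y - t'^2 * X) / (X - t'^2 * Y) * \<Delta> * \<sigma> j x - \<Delta> * x)"
      unfolding T[OF j] X_def[symmetric] Y_def[symmetric] c rhomD(3)[OF h[OF j]] s by simp
    also have "\<dots> = \<Delta> * (- t' * x - t * ((Y - t'^2 * X) / (Y - X)) * (\<sigma> j x - x))"
    proof -
      have "(- t * (X - t'^2 * Y) / (Y - X)) * ((Y - t'^2 * X) / (X - t'^2 * Y)) = - t * ((Y - t'^2 * X) / (Y - X))"
        using d by simp
      moreover have "t - (- t * (X - t'^2 * Y) / (Y - X)) = - t' + t * ((Y - t'^2 * X) / (Y - X))"
      proof -
        have "t - (- t * (X - t'^2 * Y) / (Y - X)) = (t * (Y - X) + t * (X - t'^2 * Y)) / (Y - X)"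
          using XY by (simp add: divide_simps)
        also have "t * (Y - X) + t * (X - t'^2 * Y) = - t' * (Y - X) + t * (Y - t'^2 * X)" using tt by algebra
        also have "(- t' * (Y - X) + t * (Y - t'^2 * X)) / (Y - X) = - t' + t * ((Y - t'^2 * X) / (Y - X))"
          using XY by (simp add: divide_simps)
        finally show ?thesis .
      qed
      moreover have "t * (\<Delta> * x) + a * (b * \<Delta> * u - \<Delta> * x) = \<Delta> * (- t' * x - t * c * (u - x))"
        if "a * b = - t * c" "t - a = - t' + t * c" for a b c u
      proof -
        have "t * (\<Delta> * x) + a * (b * \<Delta> * u - \<Delta> * x) = \<Delta> * ((t - a) * x + (a * b) * u)" by (simp add: algebra_simps)
        then show ?thesis unfolding that by (simp add: algebra_simps)
      qed
      ultimately show ?thesis by blast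
    qed
    finally show ?thesis by (simp add: A_def X_def Y_def)
  qed
  have T_scal: "T j (c * u) = c * T j u" if "j \<in> {1..m}" "\<sigma> j c = c" for j c u
    using that by (simp add: T rhomD(3)[OF h] algebra_simps)
  have sA: "\<sigma> j (A i a) = A (Transposition.transpose j (Suc j) i) (Transposition.transpose j (Suc j) a)"
    if "j \<in> {1..m}" "i \<in> {1..Suc m}" "a \<in> {1..Suc m}" for i j a
    using that by (simp add: A_def rhom_divide[OF h] rhomD[OF h] sz st)
  have "Ss J = \<Delta> * Fs J" if "J \<le> Suc m" for J
    using that
  proof (induction J rule: less_induct)
    case (less J)
    consider "J = 0" | "J = 1" | K where "J = Suc (Suc K)" by (metis One_nat_def not0_implies_Suc)
    then show ?case
    proof cases
      case 1
      then show ?thesis by (simp add: Ss_def Fs_def)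
    next
      case 2
      then show ?thesis using v0 by (simp add: Ss_def Fs_def)
    next
      case (3 K)
      define k where "k = Suc K"
      have k: "k \<in> {1..m}" using 3 less.prems by (simp add: k_def)
      \<comment> \<open>By the induction hypotheses \<open>\<Delta> * x\<close> is the latest
        summand \<open>(- t')^K * v K\<close>, to which the next operator applies.\<close>
      define x where "x = Fs k - Fs K"
      define P where "P i = (\<Prod>a\<in>{1..K} - {i}. A i a)" for i
      define Q where "Q i = (\<Prod>a\<in>{1..K}. A i a)" for i
      note r = rhomD[OF h[OF k]] rhom_sum[OF h[OF k]] rhom_prod[OF h[OF k]]
      have tr: "Transposition.transpose k (Suc k) i = i" if "i \<in> {1..K}" for i
        using that by (auto simp: Transposition.transpose_def k_def)
      have km: "i \<in> {1..Suc m}" if "i \<in> {1..K} \<or> i = k \<or> i = Suc k" for i using that k by (auto simp: k_def)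
      have FK: "Fs K = (\<Sum>i\<in>{1..K}. \<phi> i * P i)" by (simp add: Fs_def P_def)
      have e1: "{1..k} - {i} = insert k ({1..K} - {i})" if "i \<in> {1..K}" for i using that by (auto simp: k_def)
      have e2: "{1..Suc k} - {i} = insert (Suc k) (insert k ({1..K} - {i}))" if "i \<in> {1..K}" for i using that by (auto simp: k_def)
      have e3: "{1..k} - {k} = {1..K}" "{1..Suc k} - {k} = insert (Suc k) {1..K}" "{1..Suc k} - {Suc k} = insert k {1..K}"
        by (auto simp: k_def)
      have u: "{1..k} = insert k {1..K}" "{1..Suc k} = insert (Suc k) (insert k {1..K})" by (auto simp: k_def)
      have Fk: "Fs k = (\<Sum>i\<in>{1..K}. \<phi> i * P i * A i k) + \<phi> k * Q k"
      proof -
        have "Fs k = (\<phi> k * (\<Prod>a\<in>{1..k} - {k}. A k a)) + (\<Sum>i\<in>{1..K}. \<phi> i * (\<Prod>a\<in>{1..k} - {i}. A i a))"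
          unfolding Fs_def by (subst (1) u(1)) (simp add: k_def)
        also have "(\<Sum>i\<in>{1..K}. \<phi> i * (\<Prod>a\<in>{1..k} - {i}. A i a)) = (\<Sum>i\<in>{1..K}. \<phi> i * P i * A i k)"
        proof (intro sum.cong refl)
          fix i assume i: "i \<in> {1..K}"
          show "\<phi> i * (\<Prod>a\<in>{1..k} - {i}. A i a) = \<phi> i * P i * A i k"
            unfolding e1[OF i] by (simp add: P_def k_def)
        qed
        finally show ?thesis unfolding e3(1) Q_def by (simp only: add.commute)
      qed
      have FSk: "Fs (Suc k) = (\<Sum>i\<in>{1..K}. \<phi> i * P i * (A i k * A i (Suc k))) + \<phi> k * Q k * A k (Suc k) + \<phi> (Suc k) * Q (Suc k) * A (Suc k) k"
      proof -
        have "Fs (Suc k) = \<phi> (Suc k) * (\<Prod>a\<in>{1..Suc k} - {Suc k}. A (Suc k) a) + (\<phi> k * (\<Prod>a\<in>{1..Suc k} - {k}. A k a)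
          + (\<Sum>i\<in>{1..K}. \<phi> i * (\<Prod>a\<in>{1..Suc k} - {i}. A i a)))"
          unfolding Fs_def by (subst (1) u(2)) (simp add: k_def)
        also have "(\<Sum>i\<in>{1..K}. \<phi> i * (\<Prod>a\<in>{1..Suc k} - {i}. A i a)) = (\<Sum>i\<in>{1..K}. \<phi> i * P i * (A i k * A i (Suc k)))"
        proof (intro sum.cong refl)
          fix i assume i: "i \<in> {1..K}"
          show "\<phi> i * (\<Prod>a\<in>{1..Suc k} - {i}. A i a) = \<phi> i * P i * (A i k * A i (Suc k))"
            unfolding e2[OF i] by (simp add: P_def k_def)
        qed
        finally have *: "Fs (Suc k) = \<phi> (Suc k) * (\<Prod>a\<in>insert k {1..K}. A (Suc k) a) + (\<phi> k * (\<Prod>a\<in>insert (Suc k) {1..K}. A k a)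
          + (\<Sum>i\<in>{1..K}. \<phi> i * P i * (A i k * A i (Suc k))))" unfolding e3(2,3) .
        have "k \<notin> {1..K}" "Suc k \<notin> {1..K}" by (auto simp: k_def)
        then have "(\<Prod>a\<in>insert k {1..K}. A (Suc k) a) = A (Suc k) k * Q (Suc k)" "(\<Prod>a\<in>insert (Suc k) {1..K}. A k a) = A k (Suc k) * Q k"
          unfolding Q_def by (simp_all only: prod.insert finite_atLeastAtMost not_False_eq_True)
        then show ?thesis unfolding * by (simp only: ac_simps)
      qed
      have sP: "\<sigma> k (P i) = P i" if i: "i \<in> {1..K}" for i
        unfolding P_def r by (intro prod.cong refl) (use i km k in \<open>auto simp: sA tr simp del: atLeastAtMost_iff\<close>)
      have sQ: "\<sigma> k (Q k) = Q (Suc k)"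
        unfolding Q_def r by (intro prod.cong refl) (use km k in \<open>auto simp: sA tr simp del: atLeastAtMost_iff\<close>)
      have sFk: "\<sigma> k (Fs k) = (\<Sum>i\<in>{1..K}. \<phi> i * P i * A i (Suc k)) + \<phi> (Suc k) * Q (Suc k)"
      proof -
        have "\<sigma> k (\<phi> i * P i * A i k) = \<phi> i * P i * A i (Suc k)" if "i \<in> {1..K}" for i
          using that km[of i] km[of k] k by (simp add: r sP s\<phi> sA tr del: atLeastAtMost_iff)
        then have "(\<Sum>i\<in>{1..K}. \<sigma> k (\<phi> i * P i * A i k)) = (\<Sum>i\<in>{1..K}. \<phi> i * P i * A i (Suc k))"
          by (intro sum.cong refl)
        then show ?thesis using km[of k] k by (simp add: Fk r(2,3,8) sQ s\<phi> del: atLeastAtMost_iff)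
      qed
      have sFK: "\<sigma> k (Fs K) = Fs K"
        unfolding FK r by (intro sum.cong refl) (use km k in \<open>simp add: sP s\<phi> tr r del: atLeastAtMost_iff\<close>)
      have IH: "Ss k = \<Delta> * Fs k" "Ss K = \<Delta> * Fs K" using less 3 by (simp_all add: k_def)
      have vK: "(- t')^K * v K = \<Delta> * x"
        using IH by (simp add: Ss_def k_def x_def algebra_simps)
      have "\<sigma> k ((- t')^K) = (- t')^K" using k by (simp add: r(7,5) st)
      then have "(- t')^K * v (Suc K) = T k (\<Delta> * x)"
        using vS[of K] k T_scal[OF k, of "(- t')^K" "v K"] vK by (simp add: k_def)
      then have "Ss (Suc k) = Ss k - t' * T k (\<Delta> * x)"
        by (simp add: Ss_def k_def algebra_simps)
      also have "\<dots> = \<Delta> * (Fs k - t' * (- t' * x - t * A (Suc k) k * (\<sigma> k x - x)))"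
        unfolding T\<Delta>[OF k] IH by (simp add: algebra_simps)
      also have "Fs k - t' * (- t' * x - t * A (Suc k) k * (\<sigma> k x - x)) = Fs k + t'^2 * (Fs k - Fs K) + A (Suc k) k * (\<sigma> k (Fs k) - Fs k)"
        unfolding x_def r sFK using tt by algebra
      also have "\<dots> = Fs (Suc k)"
      proof -
        have AA: "A k (Suc k) = 1 + t'^2 - A (Suc k) k"
          using ne[of k "Suc k"] km[of k] km[of "Suc k"] unfolding A_def by (simp add: divide_simps) (simp add: algebra_simps)
        \<comment> \<open>A partial fraction identity making the product linear in the two factors;
          with it \<open>Fs k\<close>, its reflection and \<open>Fs K\<close> combine to
          \<open>Fs (Suc k)\<close>.\<close>
        have AI: "A i k * A i (Suc k) = (1 + t'^2 - A (Suc k) k) * A i k + A (Suc k) k * A i (Suc k) - t'^2" if "i \<in> {1..K}" for i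
        proof -
          have n: "z i \<noteq> z k" "z i \<noteq> z (Suc k)" "z k \<noteq> z (Suc k)"
            using ne[of i k] ne[of i "Suc k"] ne[of k "Suc k"] km[of i] km[of k] km[of "Suc k"] that by (auto simp: k_def)
          have "(X - s * Y) / (X - Y) * ((X - s * W) / (X - W)) = (1 + s - (W - s * Y) / (W - Y)) * ((X - s * Y) / (X - Y)) + (W - s * Y) / (W - Y) * ((X - s * W) / (X - W)) - s"
            if "X \<noteq> Y" "X \<noteq> W" "Y \<noteq> W" for X Y W s :: 'a
            using that by (simp add: divide_simps) (simp add: algebra_simps)
          from this[OF n] show ?thesis unfolding A_def by simp
        qed
        have "(\<Sum>i\<in>{1..K}. \<phi> i * P i * (A i k * A i (Suc k))) = (1 + t'^2 - A (Suc k) k) * (\<Sum>i\<in>{1..K}. \<phi> i * P i * A i k)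
          + A (Suc k) k * (\<Sum>i\<in>{1..K}. \<phi> i * P i * A i (Suc k)) - t'^2 * (\<Sum>i\<in>{1..K}. \<phi> i * P i)"
          unfolding sum_distrib_left sum.distrib[symmetric] sum_subtractf[symmetric]
          by (intro sum.cong refl) (simp add: AI del: atLeastAtMost_iff, simp add: algebra_simps)
        then show ?thesis unfolding sFk unfolding FSk FK Fk AA by (simp add: algebra_simps)
      qed
      finally show ?thesis by (simp add: 3 k_def)
    qed
  qed
  then show "J \<le> Suc m \<Longrightarrow> (\<Sum>i<J. (- t')^i * v i) =
    \<Delta> * (\<Sum>i\<in>{1..J}. \<phi> i * (\<Prod>a\<in>{1..J} - {i}. (z i - t'^2 * z a) / (z i - z a)))"
    by (simp add: Ss_def Fs_def A_def)
qed

lemma transpose_range: "j \<in> {1..m} \<Longrightarrow> Transposition.transpose j (Suc j) ` {1..Suc m} = {1..Suc m}"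
  by (rule transpose_image_eq) auto

text \<open>Since \<open>(z i - z a) * (1 - \<beta> / (z i * z a)) = \<zeta> i - \<zeta> a\<close>,
  the sum given by \<open>garnir_partial_sums\<close> has differences of the
  \<open>\<zeta> i\<close> as denominators. It is a divided difference at \<open>m + 1\<close> nodes
  of a polynomial of degree \<open>m - 1\<close> and hence zero.\<close>

theorem garnir_relation:
  fixes \<sigma> :: "nat \<Rightarrow> 'a::field \<Rightarrow> 'a" and z v :: "nat \<Rightarrow> 'a" and t t' \<beta> C :: 'a and \<kappa> :: "'c \<Rightarrow> 'a"
  assumes h: "\<And>j. j \<in> {1..m} \<Longrightarrow> rhom (\<sigma> j)"
    and sz: "\<And>i j. j \<in> {1..m} \<Longrightarrow> i \<in> {1..Suc m} \<Longrightarrow> \<sigma> j (z i) = z (Transposition.transpose j (Suc j) i)"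
    and st: "\<And>j. j \<in> {1..m} \<Longrightarrow> \<sigma> j t = t" "\<And>j. j \<in> {1..m} \<Longrightarrow> \<sigma> j t' = t'" and tt: "t * t' = 1"
    and sc: "\<And>j. j \<in> {1..m} \<Longrightarrow> \<sigma> j \<beta> = \<beta>" "\<And>j. j \<in> {1..m} \<Longrightarrow> \<sigma> j C = C"
      "\<And>j c. j \<in> {1..m} \<Longrightarrow> c \<in> D \<Longrightarrow> \<sigma> j (\<kappa> c) = \<kappa> c"
    and ne: "\<And>i j. i \<in> {1..Suc m} \<Longrightarrow> j \<in> {1..Suc m} \<Longrightarrow> i \<noteq> j \<Longrightarrow> z i \<noteq> z j"
    and nz: "\<And>i j. i \<in> {1..Suc m} \<Longrightarrow> j \<in> {1..Suc m} \<Longrightarrow> i \<noteq> j \<Longrightarrow> z i - t'^2 * z j \<noteq> 0"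
      "\<And>j. j \<in> {1..Suc m} \<Longrightarrow> z j \<noteq> 0"
      "\<And>i j. i \<in> {1..Suc m} \<Longrightarrow> j \<in> {1..Suc m} \<Longrightarrow> i \<noteq> j \<Longrightarrow> 1 - \<beta> / (z i * z j) \<noteq> 0"
    and T: "\<And>j u. j \<in> {1..m} \<Longrightarrow> T j u = t * u + (t + (t' - t) / (1 - z j / z (Suc j))) * (\<sigma> j u - u)"
    and D: "finite D" "card D + 1 = m"
    and v0: "v 0 = C * (\<Prod>c\<in>D. z 1 + \<beta> / z 1 - \<kappa> c) * (\<Prod>(a, b)\<in>pairs 1 (Suc m). (z a - t'^2 * z b) * (1 - \<beta> / (z a * z b)))"
    and vS: "\<And>j. j < m \<Longrightarrow> v (Suc j) = T (Suc j) (v j)"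
  shows "(\<Sum>i\<le>m. (- t')^i * v i) = 0"
proof -
  define \<zeta> where "\<zeta> i = z i + \<beta> / z i" for i
  define \<Delta> where "\<Delta> = (\<Prod>(a, b)\<in>pairs 0 (Suc m). z a - t'^2 * z b)"
  define H where "H = (\<Prod>(a, b)\<in>pairs 0 (Suc m). 1 - \<beta> / (z a * z b))"
  define g where "g i = (\<Prod>c\<in>D. \<zeta> i - \<kappa> c)" for i
  \<comment> \<open>Chosen such that \<open>v 0 = \<Delta> * \<phi> 1\<close> and the reflections
    permute the \<open>\<phi> i\<close>.\<close>
  define \<phi> where "\<phi> i = C * H * g i / (\<Prod>b\<in>{1..Suc m} - {i}. (z i - t'^2 * z b) * (1 - \<beta> / (z i * z b)))" for i
  have sz': "\<sigma> j (z i) = z (Transposition.transpose j (Suc j) i)" if "j \<in> {1..m}" "1 \<le> i" "i \<le> Suc m" for i j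
    using sz that by simp
  have sH: "\<sigma> j H = H" if j: "j \<in> {1..m}" for j
  proof -
    note r = rhomD[OF h[OF j]] rhom_divide[OF h[OF j]] rhom_prod[OF h[OF j]]
    let ?h = "\<lambda>a b. 1 - \<beta> / (z a * z b)"
    have p: "(j, Suc j) \<in> pairs 0 (Suc m)" using j by (auto simp: pairs_def)
    have H: "H = ?h j (Suc j) * (\<Prod>(a, b)\<in>pairs 0 (Suc m) - {(j, Suc j)}. ?h a b)"
      unfolding H_def by (subst prod.remove[OF _ p]) simp_all
    have "\<sigma> j (\<Prod>(a, b)\<in>pairs 0 (Suc m) - {(j, Suc j)}. ?h a b) = (\<Prod>(a, b)\<in>pairs 0 (Suc m) - {(j, Suc j)}. ?h (Transposition.transpose j (Suc j) a) (Transposition.transpose j (Suc j) b))"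
      unfolding r by (intro prod.cong refl) (use j in \<open>auto simp: pairs_def r sz' sc\<close>)
    also have "\<dots> = (\<Prod>(a, b)\<in>pairs 0 (Suc m) - {(j, Suc j)}. ?h a b)"
      by (rule pairs_swap) (use j in auto)
    finally show ?thesis unfolding H using j by (simp add: r sz' sc mult.commute)
  qed
  have s\<Delta>: "(z j - t'^2 * z (Suc j)) * \<sigma> j \<Delta> = (z (Suc j) - t'^2 * z j) * \<Delta>" if j: "j \<in> {1..m}" for j
  proof -
    note r = rhomD[OF h[OF j]] rhom_divide[OF h[OF j]] rhom_prod[OF h[OF j]]
    let ?h = "\<lambda>a b. z a - t'^2 * z b"
    have p: "(j, Suc j) \<in> pairs 0 (Suc m)" using j by (auto simp: pairs_def)
    have \<Delta>: "\<Delta> = ?h j (Suc j) * (\<Prod>(a, b)\<in>pairs 0 (Suc m) - {(j, Suc j)}. ?h a b)"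
      unfolding \<Delta>_def by (subst prod.remove[OF _ p]) simp_all
    have "\<sigma> j (\<Prod>(a, b)\<in>pairs 0 (Suc m) - {(j, Suc j)}. ?h a b) = (\<Prod>(a, b)\<in>pairs 0 (Suc m) - {(j, Suc j)}. ?h (Transposition.transpose j (Suc j) a) (Transposition.transpose j (Suc j) b))"
      unfolding r by (intro prod.cong refl) (use j in \<open>auto simp: pairs_def r sz' st\<close>)
    also have "\<dots> = (\<Prod>(a, b)\<in>pairs 0 (Suc m) - {(j, Suc j)}. ?h a b)"
      by (rule pairs_swap) (use j in auto)
    finally show ?thesis unfolding \<Delta> using j by (simp add: r sz' st)
  qed
  have s\<phi>: "\<sigma> j (\<phi> i) = \<phi> (Transposition.transpose j (Suc j) i)" if j: "j \<in> {1..m}" and i: "i \<in> {1..Suc m}" for i j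
  proof -
    note r = rhomD[OF h[OF j]] rhom_divide[OF h[OF j]] rhom_prod[OF h[OF j]]
    let ?t = "Transposition.transpose j (Suc j)"
    have ti: "?t i \<in> {1..Suc m}" using transpose_range[OF j] i by blast
    have g: "\<sigma> j (g i) = g (?t i)" unfolding g_def \<zeta>_def r by (intro prod.cong refl) (use j i in \<open>simp add: r sz sc del: atLeastAtMost_iff\<close>)
    let ?h = "\<lambda>i b. (z i - t'^2 * z b) * (1 - \<beta> / (z i * z b))"
    have "\<sigma> j (\<Prod>b\<in>{1..Suc m} - {i}. ?h i b) = (\<Prod>b\<in>{1..Suc m} - {i}. ?h (?t i) (?t b))"
      unfolding r by (intro prod.cong refl) (use j i in \<open>simp add: r sz sc st del: atLeastAtMost_iff\<close>)
    also have "\<dots> = (\<Prod>b\<in>?t ` ({1..Suc m} - {i}). ?h (?t i) b)"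
      by (subst prod.reindex) (auto intro: inj_on_subset[OF inj_transpose])
    also have "?t ` ({1..Suc m} - {i}) = {1..Suc m} - {?t i}"
      using transpose_range[OF j] by (simp add: image_set_diff[OF inj_transpose])
    finally show ?thesis unfolding \<phi>_def using j by (simp add: r g sH sc)
  qed
  have v0': "v 0 = \<Delta> * \<phi> 1"
  proof -
    have b: "{Suc (Suc 0)..Suc m} = {Suc 0..Suc m} - {Suc 0}" by auto
    have d: "\<Delta> = (\<Prod>b\<in>{1..Suc m} - {1}. z 1 - t'^2 * z b) * (\<Prod>(a, b)\<in>pairs 1 (Suc m). z a - t'^2 * z b)"
      unfolding \<Delta>_def using pairs_first[OF zero_less_Suc[of m], where h = "\<lambda>a b. z a - t'^2 * z b"] by (simp only: b One_nat_def)
    have hh: "H = (\<Prod>b\<in>{1..Suc m} - {1}. 1 - \<beta> / (z 1 * z b)) * (\<Prod>(a, b)\<in>pairs 1 (Suc m). 1 - \<beta> / (z a * z b))"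
      unfolding H_def using pairs_first[OF zero_less_Suc[of m], where h = "\<lambda>a b. 1 - \<beta> / (z a * z b)"] by (simp only: b One_nat_def)
    define p1 p2 q1 q2 where "p1 = (\<Prod>b\<in>{1..Suc m} - {1}. z 1 - t'^2 * z b)" and "p2 = (\<Prod>(a, b)\<in>pairs 1 (Suc m). z a - t'^2 * z b)"
      and "q1 = (\<Prod>b\<in>{1..Suc m} - {1}. 1 - \<beta> / (z 1 * z b))" and "q2 = (\<Prod>(a, b)\<in>pairs 1 (Suc m). 1 - \<beta> / (z a * z b))"
    have "z 1 - t'^2 * z b \<noteq> 0" "1 - \<beta> / (z 1 * z b) \<noteq> 0" if "b \<in> {1..Suc m} - {1}" for b
      by (rule nz; use that in auto)+
    then have "p1 \<noteq> 0" "q1 \<noteq> 0" unfolding p1_def q1_def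
      by (simp_all only: prod_zero_iff finite_Diff finite_atLeastAtMost) blast+
    moreover have "\<phi> 1 = C * (q1 * q2) * g 1 / (p1 * q1)"
      unfolding \<phi>_def prod.distrib hh p1_def q1_def q2_def ..
    moreover have "v 0 = C * g 1 * (p2 * q2)"
      unfolding v0 g_def \<zeta>_def p2_def q2_def by (simp add: prod.distrib case_prod_unfold)
    ultimately show ?thesis unfolding d p1_def[symmetric] p2_def[symmetric] by simp
  qed
  have "(\<Sum>i<Suc m. (- t')^i * v i) = \<Delta> * (\<Sum>i\<in>{1..Suc m}. \<phi> i * (\<Prod>a\<in>{1..Suc m} - {i}. (z i - t'^2 * z a) / (z i - z a)))"
    by (rule garnir_partial_sums[OF h sz s\<phi> st tt s\<Delta> ne _ _ T v0' vS]) (use nz in auto)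
  also have "(\<Sum>i\<in>{1..Suc m}. \<phi> i * (\<Prod>a\<in>{1..Suc m} - {i}. (z i - t'^2 * z a) / (z i - z a)))
    = (\<Sum>i\<in>{1..Suc m}. C * H * (g i / (\<Prod>a\<in>{1..Suc m} - {i}. \<zeta> i - \<zeta> a)))"
  proof (intro sum.cong refl)
    fix i assume i: "i \<in> {1..Suc m}"
    have "(\<Prod>b\<in>{1..Suc m} - {i}. (z i - t'^2 * z b) * (1 - \<beta> / (z i * z b))) \<noteq> 0"
    proof -
      have "z i - t'^2 * z b \<noteq> 0" "1 - \<beta> / (z i * z b) \<noteq> 0" if "b \<in> {1..Suc m} - {i}" for b
        by (rule nz; use that i in auto)+
      then show ?thesis by (simp only: prod_zero_iff finite_Diff finite_atLeastAtMost mult_eq_0_iff) blast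
    qed
    moreover have "(\<Prod>a\<in>{1..Suc m} - {i}. (z i - t'^2 * z a) / (z i - z a)) = (\<Prod>b\<in>{1..Suc m} - {i}. (z i - t'^2 * z b) * (1 - \<beta> / (z i * z b))) / (\<Prod>a\<in>{1..Suc m} - {i}. \<zeta> i - \<zeta> a)"
      unfolding prod_dividef[symmetric]
    proof (intro prod.cong refl)
      fix a assume a: "a \<in> {1..Suc m} - {i}"
      have n: "z i \<noteq> 0" "z a \<noteq> 0" "1 - \<beta> / (z i * z a) \<noteq> 0" using nz a i by auto
      have "\<zeta> i - \<zeta> a = (z i - z a) * (1 - \<beta> / (z i * z a))"
        unfolding \<zeta>_def using n(1,2) by (simp add: divide_simps) algebra
      then show "(z i - t'^2 * z a) / (z i - z a) = (z i - t'^2 * z a) * (1 - \<beta> / (z i * z a)) / (\<zeta> i - \<zeta> a)"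
        using n(3) by simp
    qed
    moreover have "x / M * (M / N) = x / N" if "M \<noteq> 0" for x M N :: 'a using that by simp
    ultimately show "\<phi> i * (\<Prod>a\<in>{1..Suc m} - {i}. (z i - t'^2 * z a) / (z i - z a)) = C * H * (g i / (\<Prod>a\<in>{1..Suc m} - {i}. \<zeta> i - \<zeta> a))"
      unfolding \<phi>_def by (simp only: times_divide_eq_right)
  qed
  also have "\<dots> = C * H * (\<Sum>i\<in>{1..Suc m}. g i / (\<Prod>a\<in>{1..Suc m} - {i}. \<zeta> i - \<zeta> a))"
    by (simp only: sum_distrib_left)
  also have "(\<Sum>i\<in>{1..Suc m}. g i / (\<Prod>a\<in>{1..Suc m} - {i}. \<zeta> i - \<zeta> a)) = 0"
    unfolding g_def
  proof (rule divided_difference_prod[OF D(1)])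
    show "inj_on \<zeta> {1..Suc m}"
    proof (rule inj_onI, rule ccontr)
      fix a i assume a: "a \<in> {1..Suc m}" "i \<in> {1..Suc m}" "\<zeta> a = \<zeta> i" "a \<noteq> i"
      have n: "z i \<noteq> 0" "z a \<noteq> 0" "1 - \<beta> / (z i * z a) \<noteq> 0" "z i \<noteq> z a" using nz ne a by auto
      have "\<zeta> i - \<zeta> a = (z i - z a) * (1 - \<beta> / (z i * z a))"
        unfolding \<zeta>_def using n(1,2) by (simp add: divide_simps) algebra
      then show False using a(3) n by simp
    qed
    show "card D + 2 \<le> card {1..Suc m}" using D(2) by simp
  qed simp
  finally show ?thesis by (simp add: lessThan_Suc_atMost)
qed

section \<open>Chains of row-antisymmetric blocks\<close>

text \<open>
  The operators \<open>R 1, \<dots>, R (p * m)\<close> move a letter across \<open>p\<close> blocks of length \<open>m\<close>, starting just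
  before the first one. By the Garnir relations the outermost operator of each crossing can be
  avoided, so the result stays in the span of words that do not involve \<open>R (p * m)\<close>.
\<close>

locale block_chain =
  fixes R Ri :: "nat \<Rightarrow> 'a::field \<Rightarrow> 'a" and K :: "'a set" and F t t' :: 'a and m p :: nat
  assumes K: "t \<in> K" "t' \<in> K" "1 \<in> K" "\<And>a b. a \<in> K \<Longrightarrow> b \<in> K \<Longrightarrow> a * b \<in> K" "\<And>a b. a \<in> K \<Longrightarrow> b \<in> K \<Longrightarrow> a - b \<in> K"
    and tt: "t * t' = 1"
    and R_add: "\<And>j u w. R j (u + w) = R j u + R j w" and R_scal: "\<And>j c u. c \<in> K \<Longrightarrow> R j (c * u) = c * R j u"
    and R_Ri: "\<And>j u. R j (Ri j u) = u" and Ri_eq: "\<And>j u. Ri j u = R j u - (t - t') * u"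
    and comm: "\<And>i j u. i \<in> {1..p * m} \<Longrightarrow> j \<in> {1..p * m} \<Longrightarrow> i + 2 \<le> j \<Longrightarrow> R i (R j u) = R j (R i u)"
    and inblock: "\<And>c j. c < p \<Longrightarrow> 2 \<le> j \<Longrightarrow> j \<le> m \<Longrightarrow> R (c * m + j) F = - t' * F"
    and m1: "1 \<le> m"
begin

fun move :: "(nat \<Rightarrow> 'a \<Rightarrow> 'a) \<Rightarrow> nat \<Rightarrow> nat \<Rightarrow> 'a \<Rightarrow> 'a" where
  "move S b 0 u = u"
| "move S b (Suc j) u = S (b + Suc j) (move S b j u)"

text \<open>The span over \<open>K\<close> of the words in \<open>R 1, ..., R b\<close> applied to
  \<open>F\<close>. A linear operator commuting with these letters is determined on it by its value
  at \<open>F\<close>.\<close>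

inductive_set sub :: "nat \<Rightarrow> 'a set" for b :: nat where
  base: "F \<in> sub b"
| add: "u \<in> sub b \<Longrightarrow> w \<in> sub b \<Longrightarrow> u + w \<in> sub b"
| scal: "c \<in> K \<Longrightarrow> u \<in> sub b \<Longrightarrow> c * u \<in> sub b"
| act: "1 \<le> j \<Longrightarrow> j \<le> b \<Longrightarrow> u \<in> sub b \<Longrightarrow> R j u \<in> sub b"

lemma sub_mono: assumes "b \<le> b'" "u \<in> sub b" shows "u \<in> sub b'"
  using assms(2) by induction (use assms(1) in \<open>auto intro: sub.intros\<close>)

lemma K0: "0 \<in> K" using K(5)[OF K(3) K(3)] by simp

lemma K_uminus: "c \<in> K \<Longrightarrow> - c \<in> K" using K(5)[OF K0] by simp

lemma K_power: "c \<in> K \<Longrightarrow> c ^ j \<in> K" by (induction j) (auto intro: K)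

lemma R_0: "R j 0 = 0" using R_scal[OF K0, of j 0] by simp

lemma R_diff: "R j (u - w) = R j u - R j w"
  using R_add[of j u "- 1 * w"] R_scal[OF K_uminus[OF K(3)], of j w] by simp

lemma R_sum: "R j (\<Sum>i\<in>A. f i) = (\<Sum>i\<in>A. R j (f i))"
  by (induction A rule: infinite_finite_induct) (simp_all add: R_0 R_add)

lemma Ri_add: "Ri j (u + w) = Ri j u + Ri j w" by (simp add: Ri_eq R_add algebra_simps)

lemma Ri_scal: "c \<in> K \<Longrightarrow> Ri j (c * u) = c * Ri j u" by (simp add: Ri_eq R_scal algebra_simps)

lemma move_add: "(\<And>j u w. S j (u + w) = S j u + S j w) \<Longrightarrow> move S b j (u + w) = move S b j u + move S b j w"
  by (induction j) simp_all

lemma move_scal: "(\<And>j u. S j (c * u) = c * S j u) \<Longrightarrow> move S b j (c * u) = c * move S b j u"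
  by (induction j) simp_all

lemma move_R_comm: "1 \<le> l \<Longrightarrow> l + 1 \<le> b \<Longrightarrow> b + j \<le> p * m \<Longrightarrow> move R b j (R l u) = R l (move R b j u)"
proof (induction j)
  case (Suc j)
  then show ?case using comm[of l "b + Suc j" "move R b j u"] by simp
qed simp

lemma Ri_R_comm: "i \<in> {1..p * m} \<Longrightarrow> j \<in> {1..p * m} \<Longrightarrow> i + 2 \<le> j \<Longrightarrow> Ri j (R i u) = R i (Ri j u)"
  using comm[of i j u] by (simp add: Ri_eq R_diff R_scal K)

lemma move_Ri_comm: "1 \<le> l \<Longrightarrow> l + 1 \<le> b \<Longrightarrow> b + j \<le> p * m \<Longrightarrow> move Ri b j (R l u) = R l (move Ri b j u)"
proof (induction j)
  case (Suc j)
  then show ?case using Ri_R_comm[of l "b + Suc j" "move Ri b j u"] by simp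
qed simp

lemma move_sub: "b + j \<le> b' \<Longrightarrow> u \<in> sub b' \<Longrightarrow> move R b j u \<in> sub b'"
  by (induction j) (auto intro: sub.intros)

lemma sub_sum: "(\<And>i. i \<in> A \<Longrightarrow> f i \<in> sub b) \<Longrightarrow> (\<Sum>i\<in>A. f i) \<in> sub b"
proof (induction A rule: infinite_finite_induct)
  case (insert x A)
  then show ?case by (auto intro: sub.add)
qed (use sub.scal[OF K0 sub.base, of b] in simp_all)

definition garnir :: "nat \<Rightarrow> bool" where
  "garnir c \<longleftrightarrow> (\<Sum>j\<le>m. (- t')^j * move R (c * m) j F) = 0"

text \<open>Letters up to \<open>c * m - 1\<close> commute with all letters of the crossing, so the
  relation passes from \<open>F\<close> to their span.\<close>

lemma garnir_sub:
  assumes c: "c < p" "garnir c" and u: "u \<in> sub (c * m - 1)"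
  shows "(\<Sum>j\<le>m. (- t')^j * move R (c * m) j u) = 0"
  using u
proof induction
  case base
  then show ?case using c(2) by (simp add: garnir_def)
next
  case (add u w)
  then show ?case by (simp add: move_add R_add distrib_left sum.distrib)
next
  case (scal a u)
  then have "(\<Sum>j\<le>m. (- t')^j * move R (c * m) j (a * u)) = a * (\<Sum>j\<le>m. (- t')^j * move R (c * m) j u)"
    unfolding sum_distrib_left by (intro sum.cong refl) (simp add: move_scal R_scal)
  then show ?case using scal by simp
next
  case (act l u)
  have b: "c * m + j \<le> p * m" if "j \<le> m" for j
    using c(1) that mult_le_mono1[of "Suc c" p m] by simp
  have "(\<Sum>j\<le>m. (- t')^j * move R (c * m) j (R l u)) = R l (\<Sum>j\<le>m. (- t')^j * move R (c * m) j u)"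
    unfolding R_sum using act b
    by (intro sum.cong refl) (simp add: move_R_comm R_scal K_power K_uminus K)
  then show ?case using act by (simp add: R_0)
qed

text \<open>The summand for \<open>j = m\<close> in the Garnir relation is the full crossing with an
  invertible coefficient, and the other summands avoid its last letter.\<close>

lemma move_sub_last:
  assumes c: "c < p" "garnir c" and u: "u \<in> sub (c * m - 1)"
  shows "move R (c * m) m u \<in> sub (c * m + m - 1)"
proof -
  have e: "(- t)^m * (- t')^m = 1" using tt by (simp flip: power_mult_distrib)
  have "(\<Sum>j\<le>m. (- t')^j * move R (c * m) j u) = (- t')^m * move R (c * m) m u + (\<Sum>j<m. (- t')^j * move R (c * m) j u)"
    by (simp add: lessThan_Suc_atMost[symmetric])
  then have "(- t')^m * move R (c * m) m u = - (\<Sum>j<m. (- t')^j * move R (c * m) j u)"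
    using garnir_sub[OF assms] by (simp add: eq_neg_iff_add_eq_0)
  then have "(- t)^m * ((- t')^m * move R (c * m) m u) = - ((- t)^m) * (\<Sum>j<m. (- t')^j * move R (c * m) j u)"
    by simp
  then have "move R (c * m) m u = - ((- t)^m) * (\<Sum>j<m. (- t')^j * move R (c * m) j u)"
    unfolding mult.assoc[symmetric] e by simp
  moreover have "(\<Sum>j<m. (- t')^j * move R (c * m) j u) \<in> sub (c * m + m - 1)"
  proof (rule sub_sum)
    fix j assume "j \<in> {..<m}"
    then show "(- t')^j * move R (c * m) j u \<in> sub (c * m + m - 1)"
      using sub_mono[OF _ u, of "c * m + m - 1"]
      by (intro sub.scal move_sub K_power K_uminus K) auto
  qed
  moreover have "- ((- t)^m) \<in> K" by (intro K_uminus K_power K)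
  ultimately show ?thesis by (simp only: sub.scal)
qed

text \<open>Expand \<open>Ri\<close> as \<open>R - (t - t')\<close>. Later letters act on the
  partial crossings \<open>v i\<close> by \<open>- t'\<close>, so a geometric combination of the
  \<open>v i\<close> remains. The Garnir relation evaluates it to \<open>t' * v m\<close>, and
  \<open>1 - (t - t') * t' = t'^2\<close>.\<close>

lemma move_F_inv:
  assumes c: "c < p" "garnir c"
  shows "move R (c * m) m F = t^2 * move Ri (c * m) m F"
proof -
  define b where "b = c * m"
  have b: "b + j \<le> p * m" if "j \<le> m" for j
    unfolding b_def using c(1) that mult_le_mono1[of "Suc c" p m] by simp
  define v where "v j = move R b j F" for j
  have vin: "R (b + Suc j) (v i) = - t' * v i" if "i < j" "Suc j \<le> m" for i j
    using that
  proof (induction i)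
    case 0
    then show ?case using inblock[OF c(1), of "Suc j"] by (simp add: v_def b_def)
  next
    case (Suc i)
    have "R (b + Suc j) (R (b + Suc i) (v i)) = R (b + Suc i) (R (b + Suc j) (v i))"
      by (rule comm[symmetric]) (use Suc b[of "Suc j"] b[of "Suc i"] in auto)
    then show ?case using Suc R_scal[OF K_uminus[OF K(2)], of "b + Suc i" "v i"] by (simp add: v_def)
  qed
  have u: "move Ri b j F = v j - (t - t') * (\<Sum>i<j. (- t)^(j - 1 - i) * v i)" if "j \<le> m" for j
    using that
  proof (induction j)
    case 0
    then show ?case by (simp add: v_def)
  next
    case (Suc j)
    define W where "W = (\<Sum>i<j. (- t)^(j - 1 - i) * v i)"
    have 1: "R (b + Suc j) ((- t)^(j - 1 - i) * v i) = - t' * ((- t)^(j - 1 - i) * v i)" if "i < j" for i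
      using vin[OF that Suc.prems] by (simp add: R_scal K_power K_uminus K)
    have RW: "R (b + Suc j) W = - t' * W"
      unfolding W_def R_sum sum_distrib_left using 1 by (intro sum.cong refl) simp
    have W: "(\<Sum>i<Suc j. (- t)^(Suc j - 1 - i) * v i) = v j + (- t) * W"
    proof -
      have "(\<Sum>i<j. (- t)^(j - i) * v i) = (- t) * W"
        unfolding W_def sum_distrib_left
      proof (intro sum.cong refl)
        fix i assume "i \<in> {..<j}"
        then have "j - i = Suc (j - 1 - i)" by auto
        then show "(- t)^(j - i) * v i = (- t) * ((- t)^(j - 1 - i) * v i)" by simp
      qed
      then show ?thesis by simp
    qed
    have vS: "R (b + Suc j) (v j) = v (Suc j)" by (simp add: v_def)
    have "move Ri b (Suc j) F = Ri (b + Suc j) (v j - (t - t') * W)"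
      using Suc by (simp add: W_def)
    also have "\<dots> = v (Suc j) - (t - t') * (- t' * W) - (t - t') * (v j - (t - t') * W)"
      unfolding Ri_eq R_diff vS R_scal[OF K(5)[OF K(1,2)]] RW ..
    also have "\<dots> = v (Suc j) - (t - t') * (v j + (- t) * W)" by (simp add: algebra_simps)
    finally show ?case unfolding W .
  qed
  define S where "S = (\<Sum>j<m. (- t')^j * v j)"
  have g: "(- t')^m * v m + S = 0"
    using c(2) by (simp add: garnir_def S_def v_def b_def lessThan_Suc_atMost[symmetric] add.commute)
  have "(\<Sum>i<m. (- t)^(m - 1 - i) * v i) = (- t)^(m - 1) * S"
    unfolding S_def sum_distrib_left
  proof (intro sum.cong refl)
    fix i assume i: "i \<in> {..<m}"
    have "(- t)^(m - 1) = (- t)^(m - 1 - i) * (- t)^i" using i by (simp flip: power_add)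
    moreover have "(- t)^i * (- t')^i = 1" using tt by (simp flip: power_mult_distrib)
    ultimately show "(- t)^(m - 1 - i) * v i = (- t)^(m - 1) * ((- t')^i * v i)" by (simp add: ac_simps)
  qed
  moreover have "(- t)^(m - 1) * S = t' * v m"
  proof -
    define a b where "a = (- t)^(m - 1)" and "b = (- t')^(m - 1)"
    have ab: "a * b = 1" unfolding a_def b_def using tt by (simp flip: power_mult_distrib)
    have "(- t')^m = - t' * b" unfolding b_def using m1 by (cases m) simp_all
    then have "- t' * b * v m + S = 0" using g by simp
    then show ?thesis unfolding a_def[symmetric] using ab by algebra
  qed
  ultimately have "move Ri b m F = v m - (t - t') * (t' * v m)" using u[of m] by simp
  then have "t^2 * move Ri b m F = v m" using tt by algebra
  then show ?thesis by (simp add: v_def b_def)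
qed

lemma move_inv_sub:
  assumes c: "c < p" "garnir c" and u: "u \<in> sub (c * m - 1)"
  shows "move R (c * m) m u = t^2 * move Ri (c * m) m u"
  using u
proof induction
  case base
  then show ?case using move_F_inv[OF c] .
next
  case (add u w)
  then show ?case by (simp add: move_add R_add Ri_add distrib_left)
next
  case (scal a u)
  then show ?case by (simp add: move_scal R_scal Ri_scal)
next
  case (act l u)
  have "c * m + m \<le> p * m" using c(1) mult_le_mono1[of "Suc c" p m] by simp
  then show ?case using act by (simp add: move_R_comm move_Ri_comm R_scal K_power K)
qed

lemma move_split: "move S 0 (c * m + j) u = move S (c * m) j (move S 0 (c * m) u)"
  by (induction j) simp_all

text \<open>Both claims go through the induction together: membership in the span is what permits
  the next Garnir relation to be applied to the moved vector.\<close>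

lemma chain:
  assumes g: "\<And>c. c < p \<Longrightarrow> garnir c" and "c \<le> p"
  shows "move R 0 (c * m) F \<in> sub (c * m - 1) \<and> move R 0 (c * m) F = t^(2 * c) * move Ri 0 (c * m) F"
  using assms(2)
proof (induction c)
  case 0
  then show ?case by (simp add: sub.base)
next
  case (Suc c)
  then have IH: "move R 0 (c * m) F \<in> sub (c * m - 1)" "move R 0 (c * m) F = t^(2 * c) * move Ri 0 (c * m) F"
    and c: "c < p" by auto
  have e: "Suc c * m = c * m + m" by simp
  have "move R 0 (Suc c * m) F = t^2 * move Ri (c * m) m (move R 0 (c * m) F)"
    unfolding e move_split using move_inv_sub[OF c g[OF c] IH(1)] by simp
  also have "\<dots> = t^2 * (t^(2 * c) * move Ri 0 (Suc c * m) F)"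
    unfolding IH(2) e move_split by (subst move_scal) (simp_all add: Ri_scal K_power K)
  finally have "move R 0 (Suc c * m) F = t^(2 * Suc c) * move Ri 0 (Suc c * m) F"
    by (simp add: power_add power2_eq_square ac_simps)
  moreover have "move R 0 (Suc c * m) F \<in> sub (Suc c * m - 1)"
    unfolding e move_split by (rule move_sub_last[OF c g[OF c] IH(1)])
  ultimately show ?case by blast
qed

theorem chain_inverse:
  "(\<And>c. c < p \<Longrightarrow> garnir c) \<Longrightarrow> move R 0 (p * m) F = t^(2 * p) * move Ri 0 (p * m) F"
  using chain[OF _ order_refl] by (rule conjunct2)

text \<open>The last letter, the one that may fail to commute with \<open>Q\<close>, is absent from
  the span containing the moved vector. \<open>Q\<close> will be \<open>T 0\<close> or
  \<open>T n\<close>.\<close>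

theorem chain_eigen:
  assumes g: "\<And>c. c < p \<Longrightarrow> garnir c"
    and Q: "\<And>u w. Q (u + w) = Q u + Q w" "\<And>a u. a \<in> K \<Longrightarrow> Q (a * u) = a * Q u"
      "\<And>j u. 1 \<le> j \<Longrightarrow> j < p * m \<Longrightarrow> Q (R j u) = R j (Q u)" and F: "d \<in> K" "Q F = d * F"
  shows "Q (move R 0 (p * m) F) = d * move R 0 (p * m) F"
proof -
  have "move R 0 (p * m) F \<in> sub (p * m - 1)" using chain[OF g order_refl] by (rule conjunct1)
  then show ?thesis
  proof induction
    case (act j u)
    have "j < p * m" using act.hyps(1,2) by linarith
    then show ?case using act by (simp add: Q(3) R_scal F)
  qed (simp_all add: F Q algebra_simps)
qed

end

section \<open>The product is an eigenvector\<close>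

lemma pairs_last: "lo < hi \<Longrightarrow> (\<Prod>(a, b)\<in>pairs lo hi. h a b) = (\<Prod>a\<in>{lo<..<hi}. h a hi) * (\<Prod>(a, b)\<in>pairs lo (hi - 1). h a b)"
  for h :: "nat \<Rightarrow> nat \<Rightarrow> 'a::comm_monoid_mult"
proof -
  assume lo: "lo < hi"
  have e: "pairs lo hi = ((\<lambda>a. (a, hi)) ` {lo<..<hi}) \<union> pairs lo (hi - 1)"
    using lo by (auto simp: pairs_def)
  have "(\<Prod>(a, b)\<in>pairs lo hi. h a b) = (\<Prod>(a, b)\<in>(\<lambda>a. (a, hi)) ` {lo<..<hi}. h a b) * (\<Prod>(a, b)\<in>pairs lo (hi - 1). h a b)"
    unfolding e by (rule prod.union_disjoint) (simp, simp, auto simp: pairs_def)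
  also have "(\<Prod>(a, b)\<in>(\<lambda>a. (a, hi)) ` {lo<..<hi}. h a b) = (\<Prod>a\<in>{lo<..<hi}. h a hi)"
    by (subst prod.reindex) (auto simp: inj_on_def)
  finally show ?thesis .
qed

lemma pairs_shift:
  fixes h :: "nat \<Rightarrow> nat \<Rightarrow> 'a::comm_monoid_mult"
  shows "(\<Prod>(a, b)\<in>pairs (c + lo) (c + hi). h a b) = (\<Prod>(a, b)\<in>pairs lo hi. h (c + a) (c + b))"
  by (rule prod.reindex_bij_witness[where i = "map_prod ((+) c) ((+) c)" and j = "map_prod (\<lambda>x. x - c) (\<lambda>x. x - c)"])
    (auto simp: pairs_def)

lemma pairs_reverse:
  fixes h :: "nat \<Rightarrow> nat \<Rightarrow> 'a::comm_monoid_mult"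
  assumes "m \<le> b"
  shows "(\<Prod>(i, j)\<in>pairs (b - m) b. h i j) = (\<Prod>(a, c)\<in>pairs 1 (Suc m). h (b + 2 - c) (b + 2 - a))"
  by (rule prod.reindex_bij_witness[where i = "\<lambda>(a, c). (b + 2 - c, b + 2 - a)" and j = "\<lambda>(i, j). (b + 2 - j, b + 2 - i)"])
    (use assms in \<open>auto simp: pairs_def\<close>)

context koornwinder_params
begin

section \<open>Relations of the extended operators\<close>

lemma TL_TL: "TL i (TL i u) = (cst (tau i) - cst (taui i)) * TL i u + u"
proof (rule quadratic_relation[OF rhom_sL[of i] _ cL_sum])
  show "cst (tau i) * cst (taui i) = 1"
    using tau_taui[of i] rhomD(1,3)[OF rhom_cst] by metis
qed (simp_all add: TL_def)

lemma TL_commute: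
  assumes "i \<le> n" "j \<le> n" "i + 2 \<le> j \<or> j + 2 \<le> i"
  shows "TL i (TL j u) = TL j (TL i u)"
proof (rule commuting_operators[OF rhom_sL[of i] rhom_sL[of j],
      where ?t1.0 = "cst (tau i)" and ?t2.0 = "cst (tau j)" and ?c1.0 = "cL i" and ?c2.0 = "cL j"])
  show "sL i (sL j u) = sL j (sL i u)" for u using sL_commute[of i j u] sL_commute[of j i u] assms by metis
  show "sL i (cL j) = cL j" "sL j (cL i) = cL i" using assms by (auto intro: sL_cL_far)
qed (simp_all add: TL_def)

lemma TL_add: "TL i (u + w) = TL i u + TL i w"
  by (simp add: TL_def rhomD[OF rhom_sL] algebra_simps)

lemma TL_scal: "sL i c = c \<Longrightarrow> TL i (c * u) = c * TL i u"
  by (simp add: TL_def rhomD[OF rhom_sL] algebra_simps)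

lemma TL_fixed: "sL i u = u \<Longrightarrow> TL i u = cst (tau i) * u"
  by (simp add: TL_def)

definition TiL :: "nat \<Rightarrow> 'r laurent fract \<Rightarrow> 'r laurent fract" where
  "TiL i u = TL i u - (cst (tau i) - cst (taui i)) * u"

lemma Ti_fract: "to_fract (Ti i f) = TiL i (to_fract f)"
  by (simp add: Ti_def TiL_def T_fract cst_def rhomD[OF rhom_const])

lemma TL_TiL [simp]: "TL i (TiL i u) = u"
  using TL_TL[of i u] TL_scal[of i "cst (tau i) - cst (taui i)" u]
    TL_add[of i "TiL i u" "(cst (tau i) - cst (taui i)) * u"]
  by (simp add: TiL_def rhomD[OF rhom_sL])

lemma TiL_scal: "sL i c = c \<Longrightarrow> TiL i (c * u) = c * TiL i u"
  by (simp add: TiL_def TL_scal algebra_simps)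

lemma compose_T_fract: "to_fract (compose_list (map T is) f) = compose_list (map TL is) (to_fract f)"
  by (induction "is") (simp_all add: T_fract)

lemma compose_Ti_fract: "to_fract (compose_list (map Ti is) f) = compose_list (map TiL is) (to_fract f)"
  by (induction "is") (simp_all add: Ti_fract)

abbreviation (input) "tL \<equiv> cst (P ParT)"
abbreviation (input) "tiL \<equiv> cst (Pi ParT)"

lemma tL_tiL: "tL * tiL = 1"
  using P_Pi[of ParT] rhomD(1,3)[OF rhom_cst] by metis

text \<open>For \<open>a = t^l q\<close> this is one factor of the product; \<open>tiL\<close> is
  \<open>t^(-1/2)\<close>.\<close>

definition fac :: "'r laurent fract \<Rightarrow> 'r laurent fract \<Rightarrow> 'r laurent fract \<Rightarrow> 'r laurent fract" where
  "fac a x y = (x - tiL^2 * y) * (1 - a / (x * y))"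

definition al :: "nat \<Rightarrow> 'r laurent fract" where "al l = cst (P ParT ^ (2 * l) * P ParQ ^ 2)"

definition Bl :: "nat \<Rightarrow> nat \<Rightarrow> 'r laurent fract" where
  "Bl m l = (\<Prod>(i, j)\<in>pairs (m * (l - 1)) (m * l). fac (al l) (xL i) (xL j))"

definition FL :: "nat \<Rightarrow> nat \<Rightarrow> 'r laurent fract" where "FL k m = (\<Prod>l\<in>{1..k}. Bl m l)"

definition Fprod :: "nat \<Rightarrow> nat \<Rightarrow> 'r laurent" where
  "Fprod k m = (\<Prod>l\<in>{1..k}. \<Prod>(i, j)\<in>pairs (m * (l - 1)) (m * l).
     (xpow i 1 - const (Pi ParT ^ 2) * xpow j 1) *
     (1 - const (P ParT ^ (2 * l) * P ParQ ^ 2) * xpow i (-1) * xpow j (-1)))"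

lemma Fprod_fract: "to_fract (Fprod k m) = FL k m"
proof -
  have "to_fract ((xpow i 1 - const (Pi ParT ^ 2) * xpow j 1) *
     (1 - const (P ParT ^ (2 * l) * P ParQ ^ 2) * xpow i (-1) * xpow j (-1))) = fac (al l) (xL i) (xL j)" for i j l
    by (simp add: fac_def al_def xpow_m1_fract rhomD(7)[OF rhom_cst, symmetric]) (simp add: xL_def cst_def)
  then show ?thesis
    unfolding Fprod_def FL_def Bl_def rhom_prod[OF rhom_to_fract] case_prod_unfold by simp
qed

lemma sL_fac: "sL i (fac (al l) x y) = fac (al l) (sL i x) (sL i y)"
  by (simp add: fac_def al_def rhomD[OF rhom_sL] rhom_divide[OF rhom_sL])

lemma sL_al [simp]: "sL i (al l) = al l" by (simp add: al_def)

lemma sL_pairs_fixed: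
  assumes "\<And>j. lo < j \<Longrightarrow> j \<le> hi \<Longrightarrow> sL i (xL j) = xL j"
  shows "sL i (\<Prod>(a, b)\<in>pairs lo hi. fac (al l) (xL a) (xL b)) = (\<Prod>(a, b)\<in>pairs lo hi. fac (al l) (xL a) (xL b))"
  unfolding rhom_prod[OF rhom_sL] by (intro prod.cong refl) (use assms in \<open>auto simp: pairs_def sL_fac\<close>)

lemma sL_Bl_fixed:
  assumes "\<And>j. m * (l - 1) < j \<Longrightarrow> j \<le> m * l \<Longrightarrow> sL i (xL j) = xL j"
  shows "sL i (Bl m l) = Bl m l"
  unfolding Bl_def by (rule sL_pairs_fixed) (use assms in auto)

lemma sL_xL_mid: "1 \<le> i \<Longrightarrow> i < n \<Longrightarrow> sL i (xL j) = xL (Transposition.transpose i (Suc i) j)"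
  by (auto simp: sL_xL Transposition.transpose_def)

lemma sL_xL_other: "1 \<le> i \<Longrightarrow> i < n \<Longrightarrow> j \<noteq> i \<Longrightarrow> j \<noteq> Suc i \<Longrightarrow> sL i (xL j) = xL j"
  by (simp add: sL_xL)

lemma al_nz: "al l \<noteq> 0"
  by (simp add: al_def cst_nz)

lemma cst_xL_eq: "cst a * xL i = cst b * xL j \<Longrightarrow> a \<noteq> 0 \<Longrightarrow> i = j"
proof -
  assume "cst a * xL i = cst b * xL j" and a: "a \<noteq> 0"
  then have "to_fract (const a * xpow i 1) = to_fract (const b * xpow j 1)" by (simp add: cst_def xL_def)
  then have "Poly_Mapping.single (Poly_Mapping.single i 1) a = Poly_Mapping.single (Poly_Mapping.single j (1::int)) b"
    by (simp add: const_def xpow_def mult_single del: to_fract_mult)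
  then have "lk (Poly_Mapping.single (Poly_Mapping.single j (1::int)) b) (Poly_Mapping.single i 1) = a" by (metis lookup_single_eq)
  then have "Poly_Mapping.single j (1::int) = Poly_Mapping.single i 1" using a by (simp add: lookup_single when_def split: if_splits)
  then show "i = j" by (metis lookup_single_eq lookup_single_not_eq zero_neq_one)
qed

lemma xL_mult_ne: "cst a * (xL i * xL j) \<noteq> cst b" if "i \<noteq> j" "a \<noteq> 0"
proof
  assume "cst a * (xL i * xL j) = cst b"
  then have "to_fract (const a * (xpow i 1 * xpow j 1)) = to_fract (const b)" by (simp add: cst_def xL_def)
  then have "Poly_Mapping.single (Poly_Mapping.single i 1 + Poly_Mapping.single j (1::int)) a = Poly_Mapping.single 0 b"
    by (simp add: const_def xpow_def mult_single del: to_fract_mult)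
  then have "lk (Poly_Mapping.single 0 b) (Poly_Mapping.single i 1 + Poly_Mapping.single j (1::int)) = a" by (metis lookup_single_eq)
  then have "Poly_Mapping.single i 1 + Poly_Mapping.single j (1::int) = 0" using that by (auto simp: lookup_single when_def split: if_splits)
  then have "lk (Poly_Mapping.single i 1 + Poly_Mapping.single j (1::int)) i = 0" by simp
  then show False using that by (simp add: lookup_add lookup_single)
qed

lemma cst_1 [simp]: "cst 1 = 1" and cst_0 [simp]: "cst 0 = 0"
  by (rule rhomD[OF rhom_cst])+

lemma xL_ne: "i \<noteq> j \<Longrightarrow> xL i \<noteq> xL j" "i \<noteq> j \<Longrightarrow> xL i - tiL^2 * xL j \<noteq> 0" "i \<noteq> j \<Longrightarrow> 1 - al l / (xL i * xL j) \<noteq> 0"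
proof -
  assume ij: "i \<noteq> j"
  show "xL i \<noteq> xL j" using cst_xL_eq[of 1 i 1 j] ij by auto
  show "xL i - tiL^2 * xL j \<noteq> 0"
    using cst_xL_eq[of 1 i "Pi ParT ^ 2" j] ij by (auto simp: rhomD(7)[OF rhom_cst])
  show "1 - al l / (xL i * xL j) \<noteq> 0"
    using xL_mult_ne[OF ij, of 1 "P ParT ^ (2 * l) * P ParQ ^ 2"] by (auto simp: al_def divide_simps)
qed

lemma TL_mid: "1 \<le> i \<Longrightarrow> i < n \<Longrightarrow> TL i u = tL * u + (tL + (tiL - tL) / (1 - xL i / xL (Suc i))) * (sL i u - u)"
  by (simp add: TL_def cL_mid tau_def taui_def rhomD[OF rhom_cst])

text \<open>Here \<open>s_i - 1\<close> produces the factor \<open>x_(i+1) - x_i\<close>, which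
  cancels the denominator of \<open>T_i\<close>.\<close>

lemma TL_antisym:
  assumes i: "1 \<le> i" "i < n" and r: "sL i r = r"
  shows "TL i ((xL i - tiL^2 * xL (Suc i)) * r) = - tiL * ((xL i - tiL^2 * xL (Suc i)) * r)"
proof -
  have ne: "xL i \<noteq> xL (Suc i)" by (rule xL_ne) simp
  have s: "sL i ((xL i - tiL^2 * xL (Suc i)) * r) = (xL (Suc i) - tiL^2 * xL i) * r"
    using i by (simp add: rhomD[OF rhom_sL] r sL_xL)
  define x y t t' where "x = xL i" and "y = xL (Suc i)" and "t = tL" and "t' = tiL"
  have tt: "t * t' = 1" unfolding t_def t'_def by (rule tL_tiL)
  have xy: "x \<noteq> y" "y \<noteq> 0" using ne by (auto simp: x_def y_def)
  have "t + (t' - t) / (1 - x / y) = (t' * y - t * x) / (y - x)"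
    using xy by (simp add: divide_simps) (simp add: algebra_simps)
  moreover have "(t' * y - t * x) / (y - x) * ((y - t'^2 * x) * r - (x - t'^2 * y) * r) = (t' * y - t * x) * (1 + t'^2) * r"
  proof -
    have "(y - t'^2 * x) * r - (x - t'^2 * y) * r = (y - x) * ((1 + t'^2) * r)" by algebra
    then show ?thesis using xy by simp
  qed
  ultimately have "TL i ((x - t'^2 * y) * r) = t * ((x - t'^2 * y) * r) + (t' * y - t * x) * (1 + t'^2) * r"
    using TL_mid[OF i, of "(xL i - tiL^2 * xL (Suc i)) * r"] unfolding s by (simp add: x_def y_def t_def t'_def)
  also have "\<dots> = - t' * ((x - t'^2 * y) * r)" using tt by algebra
  finally show ?thesis by (simp add: x_def y_def t_def t'_def)
qed

lemma block_index:
  fixes m l l' j :: nat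
  assumes "1 \<le> m" "m * (l - 1) < j" "j \<le> m * l" "m * (l' - 1) < j" "j \<le> m * l'"
  shows "l = l'"
proof (rule ccontr)
  assume "l \<noteq> l'"
  then have "l < l' \<or> l' < l" by linarith
  then show False
  proof
    assume "l < l'"
    then have "l \<le> l' - 1" by linarith
    then have "m * l \<le> m * (l' - 1)" by (rule mult_le_mono2)
    then show ?thesis using assms by linarith
  next
    assume "l' < l"
    then have "l' \<le> l - 1" by linarith
    then have "m * l' \<le> m * (l - 1)" by (rule mult_le_mono2)
    then show ?thesis using assms by linarith
  qed
qed

context
  fixes k m :: nat
  assumes n: "n = k * m" and m1: "1 \<le> m" and k1: "1 \<le> k"
begin

text \<open>Apart from the factor \<open>x_j - t^(-1) x_(j+1)\<close> the product is symmetric in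
  these two variables.\<close>

lemma FL_inblock:
  assumes u: "u < k" and j: "u * m < j" "j < Suc u * m"
  shows "TL j (FL k m) = - tiL * FL k m"
proof -
  have l: "Suc u \<in> {1..k}" using u by simp
  have jn: "1 \<le> j" "j < n" using j mult_le_mono1[of "Suc u" k m] u n by auto
  have p: "(j, Suc j) \<in> pairs (m * u) (m * Suc u)" using j by (auto simp: pairs_def mult.commute)
  define R1 where "R1 = (\<Prod>(a, b)\<in>pairs (m * u) (m * Suc u) - {(j, Suc j)}. fac (al (Suc u)) (xL a) (xL b))"
  define R2 where "R2 = (\<Prod>l\<in>{1..k} - {Suc u}. Bl m l)"
  have B: "Bl m (Suc u) = fac (al (Suc u)) (xL j) (xL (Suc j)) * R1"
    unfolding Bl_def R1_def by (simp only: diff_Suc_1) (subst prod.remove[OF _ p], simp_all)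
  have F: "FL k m = (xL j - tiL^2 * xL (Suc j)) * ((1 - al (Suc u) / (xL j * xL (Suc j))) * R1 * R2)"
    unfolding FL_def R2_def by (subst prod.remove[OF _ l]) (simp_all add: B fac_def mult.assoc)
  have "sL j R1 = (\<Prod>(a, b)\<in>pairs (m * u) (m * Suc u) - {(j, Suc j)}. fac (al (Suc u)) (xL (Transposition.transpose j (Suc j) a)) (xL (Transposition.transpose j (Suc j) b)))"
    unfolding R1_def rhom_prod[OF rhom_sL] by (intro prod.cong refl) (auto simp: sL_fac sL_xL_mid[OF jn])
  also have "\<dots> = R1" unfolding R1_def by (rule pairs_swap) (use j in \<open>auto simp: mult.commute\<close>)
  finally have 1: "sL j R1 = R1" .
  have 2: "sL j R2 = R2"
    unfolding R2_def rhom_prod[OF rhom_sL]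
  proof (intro prod.cong refl sL_Bl_fixed)
    fix l i assume "l \<in> {1..k} - {Suc u}" "m * (l - 1) < i" "i \<le> m * l"
    then have "i \<noteq> j" "i \<noteq> Suc j" using block_index[OF m1, of l i "Suc u"] j by (auto simp: mult.commute)
    then show "sL j (xL i) = xL i" by (intro sL_xL_other jn) auto
  qed
  have 3: "sL j (1 - al (Suc u) / (xL j * xL (Suc j))) = 1 - al (Suc u) / (xL j * xL (Suc j))"
    by (simp add: rhomD[OF rhom_sL] rhom_divide[OF rhom_sL] sL_xL_mid[OF jn] mult.commute)
  show ?thesis
    unfolding F by (rule TL_antisym[OF jn]) (simp add: rhomD(3)[OF rhom_sL] 1 2 3)
qed

text \<open>Substituting \<open>q / x_1\<close> for \<open>x_1\<close> interchanges the two brackets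
  of a factor with \<open>x_1\<close>, up to reciprocal monomials, because
  \<open>al 1 = t q\<close>.\<close>

lemma FL_sL_0: "sL 0 (FL k m) = FL k m"
proof -
  have f: "sL 0 (fac (al 1) (xL 1) (xL j)) = fac (al 1) (xL 1) (xL j)" if "j \<noteq> 1" for j
  proof -
    define x y q t t' where "x = xL 1" and "y = xL j" and "q = cst (P ParQ) ^ 2" and "t = tL" and "t' = tiL"
    have tt: "t * t' = 1" unfolding t_def t'_def by (rule tL_tiL)
    have nz: "x \<noteq> 0" "y \<noteq> 0" "q \<noteq> 0" by (auto simp: x_def y_def q_def cst_nz)
    have a: "al 1 = t^2 * q" by (simp add: al_def q_def t_def rhomD[OF rhom_cst])
    have "sL 0 x = q / x" "sL 0 y = y" using that by (simp_all add: x_def y_def q_def sL_xL)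
    then have "sL 0 (fac (al 1) x y) = (q / x - t'^2 * y) * (1 - t^2 * q / (q / x * y))"
      using sL_fac[of 0 1 x y] by (simp add: fac_def a t'_def del: One_nat_def)
    also have "\<dots> = (q - t'^2 * (x * y)) * (y - t^2 * x) / (x * y)"
      using nz by (simp add: divide_simps)
    also have "(q - t'^2 * (x * y)) * (y - t^2 * x) = (x - t'^2 * y) * (x * y - t^2 * q)"
      using tt by algebra
    also have "\<dots> / (x * y) = (x - t'^2 * y) * (1 - t^2 * q / (x * y))"
      using nz by (simp add: divide_simps)
    finally show ?thesis by (simp add: fac_def a x_def y_def t'_def del: One_nat_def)
  qed
  have "sL 0 (Bl m l) = Bl m l" if l: "l \<in> {1..k}" for l
  proof (cases "l = 1")
    case True
    show ?thesis
      unfolding Bl_def rhom_prod[OF rhom_sL]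
    proof (intro prod.cong refl, clarify)
      fix a b assume ab: "(a, b) \<in> pairs (m * (l - 1)) (m * l)"
      show "sL 0 (fac (al l) (xL a) (xL b)) = fac (al l) (xL a) (xL b)"
      proof (cases "a = 1")
        case True
        then show ?thesis using f[of b] ab \<open>l = 1\<close> by (auto simp: pairs_def)
      next
        case False
        then show ?thesis using ab by (auto simp: sL_fac sL_xL pairs_def)
      qed
    qed
  next
    case False
    then have "m \<le> m * (l - 1)" using l by auto
    then show ?thesis using m1 by (intro sL_Bl_fixed) (auto simp: sL_xL)
  qed
  then show ?thesis unfolding FL_def rhom_prod[OF rhom_sL] by (intro prod.cong refl)
qed

text \<open>By \<open>tq\<close> the last block has \<open>al k = t^(-1)\<close>, and then inverting
  \<open>x_n\<close> interchanges the two brackets of a factor with \<open>x_n\<close>, up to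
  reciprocal monomials.\<close>

lemma FL_sL_n:
  assumes tq: "P ParT ^ (2 * (k + 1)) * P ParQ ^ 2 = 1"
  shows "sL n (FL k m) = FL k m"
proof -
  have a: "al k = tiL^2"
  proof -
    have "P ParT ^ (2 * k) * P ParQ ^ 2 = Pi ParT ^ 2 * (P ParT ^ 2 * (P ParT ^ (2 * k) * P ParQ ^ 2))"
    proof -
      have "Pi ParT ^ 2 * (P ParT ^ 2 * (P ParT ^ (2 * k) * P ParQ ^ 2)) = (P ParT * Pi ParT)^2 * (P ParT ^ (2 * k) * P ParQ ^ 2)"
        by (simp only: power_mult_distrib ac_simps)
      then show ?thesis by (simp add: P_Pi)
    qed
    also have "P ParT ^ 2 * (P ParT ^ (2 * k) * P ParQ ^ 2) = 1" using tq by (simp add: power_add power2_eq_square ac_simps)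
    finally show ?thesis by (simp add: al_def rhomD(7)[OF rhom_cst])
  qed
  have f: "sL n (fac (al k) (xL j) (xL n)) = fac (al k) (xL j) (xL n)" if "j \<noteq> n" for j
  proof -
    define x y t' where "x = xL j" and "y = xL n" and "t' = tiL"
    have nz: "x \<noteq> 0" "y \<noteq> 0" by (auto simp: x_def y_def)
    have a': "al k = t'^2" by (simp add: a t'_def)
    have "sL n x = x" "sL n y = 1 / y" using that n_ge by (simp_all add: x_def y_def sL_xL)
    then have "sL n (fac (al k) x y) = (x - t'^2 * (1 / y)) * (1 - t'^2 / (x * (1 / y)))"
      using sL_fac[of n k x y] by (simp add: fac_def a' t'_def)
    also have "\<dots> = (x - t'^2 * y) * (1 - t'^2 / (x * y))"
      using nz by (simp add: divide_simps)
    finally show ?thesis by (simp add: fac_def a' x_def y_def flip: t'_def)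
  qed
  have "sL n (Bl m l) = Bl m l" if l: "l \<in> {1..k}" for l
  proof (cases "l = k")
    case True
    show ?thesis
      unfolding Bl_def rhom_prod[OF rhom_sL]
    proof (intro prod.cong refl, clarify)
      fix a b assume ab: "(a, b) \<in> pairs (m * (l - 1)) (m * l)"
      show "sL n (fac (al l) (xL a) (xL b)) = fac (al l) (xL a) (xL b)"
      proof (cases "b = n")
        case True
        then show ?thesis using f[of a] ab \<open>l = k\<close> by (auto simp: pairs_def)
      next
        case False
        then have "a \<noteq> n" "b \<noteq> n" using ab n True by (auto simp: pairs_def mult.commute)
        then show ?thesis using n_ge by (simp add: sL_fac sL_xL)
      qed
    qed
  next
    case False
    then have "m * l < m * k" using l m1 by simp
    then have "m * l < n" by (simp only: n mult.commute)
    then show ?thesis using n_ge by (intro sL_Bl_fixed) (auto simp: sL_xL)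
  qed
  then show ?thesis unfolding FL_def rhom_prod[OF rhom_sL] by (intro prod.cong refl)
qed

lemma al_Suc: "al (Suc l) = tL^2 * al l"
  by (simp add: al_def rhomD(3,7)[OF rhom_cst] ac_simps power2_eq_square)

lemma FL_split:
  assumes "1 \<le> c" "c < k"
  shows "FL k m = Bl m c * Bl m (Suc c) * (\<Prod>l\<in>{1..k} - {c, Suc c}. Bl m l)"
proof -
  have "{1..k} - {c} - {Suc c} = {1..k} - {c, Suc c}" by auto
  then show ?thesis
    unfolding FL_def using assms
    by (subst prod.remove[of _ c], simp, simp, subst prod.remove[of _ "Suc c"], simp, simp) (simp add: mult.assoc)
qed

lemma sL_other_blocks:
  assumes c: "1 \<le> c" "c < k" and i: "m * (c - 1) < i" "i < m * Suc c"
  shows "sL i (\<Prod>l\<in>{1..k} - {c, Suc c}. Bl m l) = (\<Prod>l\<in>{1..k} - {c, Suc c}. Bl m l)"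
  unfolding rhom_prod[OF rhom_sL]
proof (intro prod.cong refl sL_Bl_fixed)
  fix l j assume l: "l \<in> {1..k} - {c, Suc c}" "m * (l - 1) < j" "j \<le> m * l"
  have "m * Suc c \<le> m * k" using c by (intro mult_le_mono2) simp
  then have ii: "1 \<le> i" "i < n" using i n by (auto simp: mult.commute)
  have x: "x \<noteq> j" if "m * (c - 1) < x" "x \<le> m * Suc c" for x
  proof (cases "x \<le> m * c")
    case True
    then show ?thesis using block_index[OF m1, of l j c] l that by auto
  next
    case False
    then show ?thesis using block_index[OF m1, of l j "Suc c"] l that by auto
  qed
  show "sL i (xL j) = xL j" using x[of i] x[of "Suc i"] i by (intro sL_xL_other ii) auto
qed

text \<open>The last variable of block \<open>c\<close> crosses block \<open>c + 1\<close>. Because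
  \<open>al (c + 1) = t * al c\<close>, a factor of block \<open>c\<close> that contains this
  variable \<open>z\<close> is \<open>- t^(-1)\<close> times \<open>z + al (c + 1) / z\<close> minus
  a quantity \<open>\<kappa>\<close> free of \<open>z\<close>. The other \<open>m - 1\<close>
  variables of the block supply these factors.\<close>

lemma garnir_right:
  assumes c: "1 \<le> c" "c < k" and v0: "v 0 = FL k m" and vS: "\<And>j. j < m \<Longrightarrow> v (Suc j) = TL (m * c + j) (v j)"
  shows "(\<Sum>i\<le>m. (- tiL)^i * v i) = 0"
proof -
  define e where "e = m * c"
  have em: "m \<le> e" unfolding e_def using c by simp
  have en: "e + m \<le> n" using mult_le_mono2[of "Suc c" k m] c n by (simp add: e_def mult.commute)
  have mc: "m * (c - 1) = e - m" unfolding e_def by (simp add: diff_mult_distrib2)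
  have mS: "m * Suc c = e + m" by (simp add: e_def)
  \<comment> \<open>The crossing variable at position \<open>e\<close>, followed by the
    \<open>m\<close> variables of block \<open>c + 1\<close>.\<close>
  define z where "z i = xL (e + i - 1)" for i
  define D where "D = {e - m<..<e}"
  define \<kappa> where "\<kappa> i = tL^2 * xL i + al c / xL i" for i
  define C where "C = (- (tiL^2))^(m - 1) * (\<Prod>(a, b)\<in>pairs (e - m) (e - 1). fac (al c) (xL a) (xL b)) * (\<Prod>l\<in>{1..k} - {c, Suc c}. Bl m l)"
  have idx: "1 \<le> e + j - 1" "e + j - 1 < n" "Suc (e + j - 1) = e + j" if "j \<in> {1..m}" for j
    using that em en m1 by auto
  have "(\<Sum>i\<le>m. (- tiL)^i * v i) = 0"
  proof (rule garnir_relation[where \<sigma> = "\<lambda>j. sL (e + j - 1)" and z = z and t = tL and \<beta> = "al (Suc c)" and C = C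
        and \<kappa> = \<kappa> and D = D and T = "\<lambda>j. TL (e + j - 1)"])
    show "sL (e + j - 1) (z i) = z (Transposition.transpose j (Suc j) i)" if "j \<in> {1..m}" "i \<in> {1..Suc m}" for i j
      unfolding z_def sL_xL_mid[OF idx(1,2)[OF that(1)]] using that em m1
      by (intro arg_cong[where f = xL]) (auto simp: Transposition.transpose_def)
    show "tL * tiL = 1" by (rule tL_tiL)
    show "sL (e + j - 1) C = C" if j: "j \<in> {1..m}" for j
    proof -
      have 1: "sL (e + j - 1) (\<Prod>(a, b)\<in>pairs (e - m) (e - 1). fac (al c) (xL a) (xL b)) = (\<Prod>(a, b)\<in>pairs (e - m) (e - 1). fac (al c) (xL a) (xL b))"
        by (rule sL_pairs_fixed, rule sL_xL_other[OF idx(1,2)[OF j]]) (use j em m1 in auto)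
      have 2: "sL (e + j - 1) (\<Prod>l\<in>{1..k} - {c, Suc c}. Bl m l) = (\<Prod>l\<in>{1..k} - {c, Suc c}. Bl m l)"
      proof (rule sL_other_blocks[OF c])
        show "m * (c - 1) < e + j - 1" "e + j - 1 < m * Suc c" unfolding mc mS using j em m1 by auto
      qed
      show ?thesis unfolding C_def by (simp only: rhomD(3)[OF rhom_sL] 1 2) (simp add: rhomD[OF rhom_sL])
    qed
    show "sL (e + j - 1) (\<kappa> i) = \<kappa> i" if "j \<in> {1..m}" "i \<in> D" for i j
    proof -
      have "sL (e + j - 1) (xL i) = xL i" by (rule sL_xL_other[OF idx(1,2)[OF that(1)]]) (use that in \<open>auto simp: D_def\<close>)
      then show ?thesis by (simp add: \<kappa>_def rhomD[OF rhom_sL] rhom_divide[OF rhom_sL])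
    qed
    show "z i \<noteq> z j" "z i - tiL^2 * z j \<noteq> 0" "1 - al (Suc c) / (z i * z j) \<noteq> 0"
      if "i \<in> {1..Suc m}" "j \<in> {1..Suc m}" "i \<noteq> j" for i j
      unfolding z_def by (rule xL_ne; use that em m1 in auto)+
    show "z j \<noteq> 0" for j by (simp add: z_def)
    show "TL (e + j - 1) u = tL * u + (tL + (tiL - tL) / (1 - z j / z (Suc j))) * (sL (e + j - 1) u - u)" if "j \<in> {1..m}" for j u
      using TL_mid[OF idx(1,2)[OF that], of u] idx(3)[OF that] by (simp add: z_def)
    show "finite D" "card D + 1 = m" using em m1 by (auto simp: D_def)
    show "v (Suc j) = TL (e + Suc j - 1) (v j)" if "j < m" for j using vS[OF that] by (simp add: e_def)
    show "v 0 = C * (\<Prod>i\<in>D. z 1 + al (Suc c) / z 1 - \<kappa> i) * (\<Prod>(a, b)\<in>pairs 1 (Suc m). (z a - tiL^2 * z b) * (1 - al (Suc c) / (z a * z b)))"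
    proof -
      have f: "fac (al c) x z = - (tiL^2) * (z + al (Suc c) / z - (tL^2 * x + al c / x))" if "x \<noteq> 0" "z \<noteq> 0" for x z
      proof -
        define t t' a where "t = tL" and "t' = tiL" and "a = al c"
        have tt: "t^2 * t'^2 = 1" using tL_tiL by (simp add: t_def t'_def flip: power_mult_distrib)
        have s: "al (Suc c) = t^2 * a" by (simp add: al_Suc t_def a_def)
        have "- (t'^2) * (z + t^2 * a / z - (t^2 * x + a / x)) = - (t'^2) * z - (t^2 * t'^2) * (a / z) + (t^2 * t'^2) * x + t'^2 * a / x"
          by (simp add: algebra_simps)
        also have "\<dots> = (x - t'^2 * z) * (1 - a / (x * z))" unfolding tt using that by (simp add: divide_simps) (simp add: algebra_simps)
        finally show ?thesis unfolding fac_def s t'_def t_def a_def by simp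
      qed
      have "Bl m c = (\<Prod>i\<in>D. fac (al c) (xL i) (xL e)) * (\<Prod>(a, b)\<in>pairs (e - m) (e - 1). fac (al c) (xL a) (xL b))"
        unfolding Bl_def mc e_def[symmetric] D_def by (rule pairs_last) (use em m1 in auto)
      also have "(\<Prod>i\<in>D. fac (al c) (xL i) (xL e)) = (\<Prod>i\<in>D. - (tiL^2) * (z 1 + al (Suc c) / z 1 - \<kappa> i))"
        by (intro prod.cong refl) (simp add: f z_def \<kappa>_def)
      also have "\<dots> = (- (tiL^2))^(m - 1) * (\<Prod>i\<in>D. z 1 + al (Suc c) / z 1 - \<kappa> i)"
      proof -
        have "card D = m - 1" using em m1 by (simp add: D_def)
        then show ?thesis by (simp only: prod.distrib prod_constant)
      qed
      finally have b1: "Bl m c = (- (tiL^2))^(m - 1) * (\<Prod>i\<in>D. z 1 + al (Suc c) / z 1 - \<kappa> i) * (\<Prod>(a, b)\<in>pairs (e - m) (e - 1). fac (al c) (xL a) (xL b))" .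
      have "Bl m (Suc c) = (\<Prod>(a, b)\<in>pairs (e - 1 + 1) (e - 1 + Suc m). fac (al (Suc c)) (xL a) (xL b))"
        unfolding Bl_def using em m1 by (simp add: e_def add.commute)
      also have "\<dots> = (\<Prod>(a, b)\<in>pairs 1 (Suc m). (z a - tiL^2 * z b) * (1 - al (Suc c) / (z a * z b)))"
        unfolding pairs_shift fac_def z_def using em m1 by (intro prod.cong refl) (auto simp: pairs_def)
      finally have b2: "Bl m (Suc c) = \<dots>" .
      show ?thesis unfolding v0 FL_split[OF c] b1 b2 C_def by (simp only: ac_simps)
    qed
  qed (simp_all add: rhom_sL)
  then show ?thesis .
qed

text \<open>The mirror image: the first variable of block \<open>c + 1\<close> crosses block
  \<open>c\<close> leftwards. Passing to inverse variables absorbs the reversal, since the ratios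
  \<open>z j / z (Suc j)\<close> are again of the form in \<open>T\<close>; accordingly
  \<open>\<beta>\<close> is \<open>1 / al c\<close>.\<close>

lemma garnir_left:
  assumes c: "1 \<le> c" "c < k" and v0: "v 0 = FL k m" and vS: "\<And>j. j < m \<Longrightarrow> v (Suc j) = TL (m * c - j) (v j)"
  shows "(\<Sum>i\<le>m. (- tiL)^i * v i) = 0"
proof -
  define e where "e = m * c"
  have em: "m \<le> e" unfolding e_def using c by simp
  have en: "e + m \<le> n" using mult_le_mono2[of "Suc c" k m] c n by (simp add: e_def mult.commute)
  have mc: "m * (c - 1) = e - m" unfolding e_def by (simp add: diff_mult_distrib2)
  have mS: "m * Suc c = e + m" by (simp add: e_def)
  define z where "z i = 1 / xL (e + 2 - i)" for i
  define D where "D = {Suc (Suc e)..e + m}"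
  define \<kappa> where "\<kappa> i = (tiL^2 * xL i + al (Suc c) / xL i) / al c" for i
  define C where "C = (al c)^(m - 1) * (- al c)^card (pairs 1 (Suc m)) * (\<Prod>(a, b)\<in>pairs (Suc e) (e + m). fac (al (Suc c)) (xL a) (xL b)) * (\<Prod>l\<in>{1..k} - {c, Suc c}. Bl m l)"
  have idx: "1 \<le> e + 1 - j" "e + 1 - j < n" "Suc (e + 1 - j) = e + 2 - j" "e + 2 - Suc j = e + 1 - j" if "j \<in> {1..m}" for j
    using that em en m1 by auto
  have "(\<Sum>i\<le>m. (- tiL)^i * v i) = 0"
  proof (rule garnir_relation[where \<sigma> = "\<lambda>j. sL (e + 1 - j)" and z = z and t = tL and \<beta> = "1 / al c" and C = C
        and \<kappa> = \<kappa> and D = D and T = "\<lambda>j. TL (e + 1 - j)"])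
    show "sL (e + 1 - j) (z i) = z (Transposition.transpose j (Suc j) i)" if j: "j \<in> {1..m}" and i: "i \<in> {1..Suc m}" for i j
    proof -
      have "Transposition.transpose (e + 1 - j) (Suc (e + 1 - j)) (e + 2 - i) = e + 2 - Transposition.transpose j (Suc j) i"
        using i j em by (auto simp: Transposition.transpose_def)
      then have "sL (e + 1 - j) (xL (e + 2 - i)) = xL (e + 2 - Transposition.transpose j (Suc j) i)"
        by (simp only: sL_xL_mid[OF idx(1,2)[OF j]])
      then show ?thesis unfolding z_def rhom_divide[OF rhom_sL] rhomD(1)[OF rhom_sL] by (simp only:)
    qed
    show "tL * tiL = 1" by (rule tL_tiL)
    show "sL (e + 1 - j) C = C" if j: "j \<in> {1..m}" for j
    proof -
      have 1: "sL (e + 1 - j) (\<Prod>(a, b)\<in>pairs (Suc e) (e + m). fac (al (Suc c)) (xL a) (xL b)) = (\<Prod>(a, b)\<in>pairs (Suc e) (e + m). fac (al (Suc c)) (xL a) (xL b))"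
        by (rule sL_pairs_fixed, rule sL_xL_other[OF idx(1,2)[OF j]]) (use j em m1 in auto)
      have 2: "sL (e + 1 - j) (\<Prod>l\<in>{1..k} - {c, Suc c}. Bl m l) = (\<Prod>l\<in>{1..k} - {c, Suc c}. Bl m l)"
      proof (rule sL_other_blocks[OF c])
        show "m * (c - 1) < e + 1 - j" "e + 1 - j < m * Suc c" unfolding mc mS using j em m1 by auto
      qed
      show ?thesis unfolding C_def by (simp only: rhomD(3)[OF rhom_sL] 1 2) (simp add: rhomD[OF rhom_sL])
    qed
    show "sL (e + 1 - j) (\<kappa> i) = \<kappa> i" if j: "j \<in> {1..m}" and i: "i \<in> D" for i j
    proof -
      have "sL (e + 1 - j) (xL i) = xL i" by (rule sL_xL_other[OF idx(1,2)[OF j]]) (use i j in \<open>auto simp: D_def\<close>)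
      then show ?thesis by (simp add: \<kappa>_def rhomD[OF rhom_sL] rhom_divide[OF rhom_sL])
    qed
    show "z i \<noteq> z j" "z i - tiL^2 * z j \<noteq> 0" "1 - (1 / al c) / (z i * z j) \<noteq> 0"
      if "i \<in> {1..Suc m}" "j \<in> {1..Suc m}" "i \<noteq> j" for i j
    proof -
      have d: "e + 2 - i \<noteq> e + 2 - j" using that em by auto
      define x y where "x = xL (e + 2 - i)" and "y = xL (e + 2 - j)"
      have nz: "x \<noteq> 0" "y \<noteq> 0" "al c \<noteq> 0" by (auto simp: x_def y_def al_nz)
      have ne: "x \<noteq> y" "y - tiL^2 * x \<noteq> 0" "1 - al c / (x * y) \<noteq> 0" unfolding x_def y_def using xL_ne d by metis+
      show "z i \<noteq> z j" unfolding z_def x_def[symmetric] y_def[symmetric] using nz ne by (simp add: divide_simps)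
      have "z i - tiL^2 * z j = (y - tiL^2 * x) / (x * y)"
        unfolding z_def x_def[symmetric] y_def[symmetric] using nz by (simp add: divide_simps)
      then show "z i - tiL^2 * z j \<noteq> 0" using nz ne by simp
      have "1 - (1 / al c) / (z i * z j) = - (x * y / al c) * (1 - al c / (x * y))"
        unfolding z_def x_def[symmetric] y_def[symmetric] using nz by (simp add: divide_simps)
      then show "1 - (1 / al c) / (z i * z j) \<noteq> 0" using nz ne by simp
    qed
    show "z j \<noteq> 0" for j by (simp add: z_def)
    show "TL (e + 1 - j) u = tL * u + (tL + (tiL - tL) / (1 - z j / z (Suc j))) * (sL (e + 1 - j) u - u)" if "j \<in> {1..m}" for j u
    proof -
      have "z j / z (Suc j) = xL (e + 1 - j) / xL (Suc (e + 1 - j))"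
        unfolding z_def using idx(3,4)[OF that] by simp
      then show ?thesis using TL_mid[OF idx(1,2)[OF that], of u] by simp
    qed
    show "finite D" "card D + 1 = m" using em m1 by (auto simp: D_def)
    show "v (Suc j) = TL (e + 1 - Suc j) (v j)" if "j < m" for j using vS[OF that] by (simp add: e_def)
    show "v 0 = C * (\<Prod>i\<in>D. z 1 + (1 / al c) / z 1 - \<kappa> i) * (\<Prod>(a, b)\<in>pairs 1 (Suc m). (z a - tiL^2 * z b) * (1 - (1 / al c) / (z a * z b)))"
    proof -
      have f1: "fac (al (Suc c)) x y = al c * (1 / x + (1 / al c) / (1 / x) - (tiL^2 * y + al (Suc c) / y) / al c)" if "x \<noteq> 0" "y \<noteq> 0" for x y
      proof -
        define t t' a where "t = tL" and "t' = tiL" and "a = al c"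
        have tt: "t'^2 * t^2 = 1" using tL_tiL by (simp add: t_def t'_def mult.commute flip: power_mult_distrib)
        have s: "al (Suc c) = t^2 * a" by (simp add: al_Suc t_def a_def)
        have nz: "a \<noteq> 0" by (simp add: a_def al_nz)
        have "(x - t'^2 * y) * (1 - t^2 * a / (x * y)) = x - t'^2 * y - t^2 * a / y + (t'^2 * t^2) * a / x"
          using that by (simp add: divide_simps) (simp add: algebra_simps)
        also have "\<dots> = a * (1 / x + (1 / a) / (1 / x) - (t'^2 * y + t^2 * a / y) / a)"
          unfolding tt using that nz by (simp add: divide_simps) (simp add: algebra_simps)
        finally show ?thesis unfolding fac_def s t'_def t_def a_def .
      qed
      have f2: "fac (al c) x y = - al c * ((1 / y - tiL^2 * (1 / x)) * (1 - (1 / al c) / ((1 / y) * (1 / x))))" if "x \<noteq> 0" "y \<noteq> 0" for x y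
        unfolding fac_def using that al_nz[of c] by (simp add: divide_simps) (simp add: algebra_simps)
      have mS: "m * Suc c = e + m" "m * (Suc c - 1) = e" by (simp_all add: e_def)
      have "Bl m (Suc c) = (\<Prod>j\<in>D. fac (al (Suc c)) (xL (Suc e)) (xL j)) * (\<Prod>(a, b)\<in>pairs (Suc e) (e + m). fac (al (Suc c)) (xL a) (xL b))"
        unfolding Bl_def mS D_def by (rule pairs_first) (use m1 in auto)
      also have "(\<Prod>j\<in>D. fac (al (Suc c)) (xL (Suc e)) (xL j)) = (\<Prod>j\<in>D. al c * (z 1 + (1 / al c) / z 1 - \<kappa> j))"
        by (intro prod.cong refl) (simp add: f1 z_def \<kappa>_def)
      also have "\<dots> = (al c)^(m - 1) * (\<Prod>j\<in>D. z 1 + (1 / al c) / z 1 - \<kappa> j)"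
      proof -
        have "card D = m - 1" using em m1 by (simp add: D_def)
        then show ?thesis by (simp only: prod.distrib prod_constant)
      qed
      finally have b1: "Bl m (Suc c) = (al c)^(m - 1) * (\<Prod>i\<in>D. z 1 + (1 / al c) / z 1 - \<kappa> i) * (\<Prod>(a, b)\<in>pairs (Suc e) (e + m). fac (al (Suc c)) (xL a) (xL b))" .
      have "Bl m c = (\<Prod>(a, b)\<in>pairs 1 (Suc m). fac (al c) (xL (e + 2 - b)) (xL (e + 2 - a)))"
        unfolding Bl_def mc e_def[symmetric] by (rule pairs_reverse[OF em])
      also have "\<dots> = (\<Prod>p\<in>pairs 1 (Suc m). - al c * (case p of (a, b) \<Rightarrow> (z a - tiL^2 * z b) * (1 - (1 / al c) / (z a * z b))))"
        by (intro prod.cong refl) (simp add: case_prod_unfold f2 z_def)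
      also have "\<dots> = (- al c)^card (pairs 1 (Suc m)) * (\<Prod>(a, b)\<in>pairs 1 (Suc m). (z a - tiL^2 * z b) * (1 - (1 / al c) / (z a * z b)))"
        by (simp only: prod.distrib prod_constant)
      finally have b2: "Bl m c = \<dots>" .
      show ?thesis unfolding v0 FL_split[OF c] b1 b2 C_def by (simp only: ac_simps)
    qed
  qed (simp_all add: rhom_sL rhom_divide[OF rhom_sL] rhomD[OF rhom_sL])
  then show ?thesis .
qed

text \<open>The letters outside the range of a chain are filled up by a scalar to make all of them invertible.\<close>

definition chR :: "(nat \<Rightarrow> nat) \<Rightarrow> nat \<Rightarrow> nat \<Rightarrow> 'r laurent fract \<Rightarrow> 'r laurent fract" where
  "chR f N j u = (if j \<in> {1..N} then TL (f j) u else tL * u)"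

definition chRi :: "(nat \<Rightarrow> nat) \<Rightarrow> nat \<Rightarrow> nat \<Rightarrow> 'r laurent fract \<Rightarrow> 'r laurent fract" where
  "chRi f N j u = chR f N j u - (tL - tiL) * u"

text \<open>\<open>f\<close> gives the operator index at each position of the chain, increasing for
  chains to the right and decreasing for chains to the left.\<close>

lemma chain_locale:
  assumes f: "\<And>j. j \<in> {1..p * m} \<Longrightarrow> 1 \<le> f j \<and> f j < n"
    and far: "\<And>i j. i \<in> {1..p * m} \<Longrightarrow> j \<in> {1..p * m} \<Longrightarrow> i + 2 \<le> j \<Longrightarrow> f i + 2 \<le> f j \<or> f j + 2 \<le> f i"
    and ib: "\<And>c j. c < p \<Longrightarrow> 2 \<le> j \<Longrightarrow> j \<le> m \<Longrightarrow> TL (f (c * m + j)) (FL k m) = - tiL * FL k m"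
  shows "block_chain (chR f (p * m)) (chRi f (p * m)) (range cst) (FL k m) tL tiL m p"
proof
  note rc = rhomD[OF rhom_cst]
  show "cst (P ParT) \<in> range cst" "cst (Pi ParT) \<in> range cst" "1 \<in> range cst" using cst_1 by (metis rangeI)+
  show "a * b \<in> range cst" "a - b \<in> range cst" if "a \<in> range cst" "b \<in> range cst" for a b
    using that by (auto simp flip: rc)
  show "tL * tiL = 1" by (rule tL_tiL)
  show "1 \<le> m" by (rule m1)
  show "chR f (p * m) j (u + w) = chR f (p * m) j u + chR f (p * m) j w" for j u w
    by (simp add: chR_def TL_add distrib_left)
  show "chR f (p * m) j (c * u) = c * chR f (p * m) j u" if "c \<in> range cst" for j c u
    using that by (auto simp: chR_def TL_scal)
  show "chR f (p * m) j (chRi f (p * m) j u) = u" for j u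
  proof (cases "j \<in> {1..p * m}")
    case True
    then have "tau (f j) = P ParT" "taui (f j) = Pi ParT" using f[OF True] by (auto simp: tau_def taui_def)
    then have "chRi f (p * m) j u = TiL (f j) u" using True by (simp add: chRi_def chR_def TiL_def)
    then show ?thesis using True by (simp add: chR_def)
  next
    case False
    then have "chR f (p * m) j (chRi f (p * m) j u) = tL * tiL * u" by (simp only: chRi_def chR_def if_False) (simp add: algebra_simps)
    then show ?thesis using tL_tiL by simp
  qed
  show "chRi f (p * m) j u = chR f (p * m) j u - (tL - tiL) * u" for j u by (simp add: chRi_def)
  show "chR f (p * m) i (chR f (p * m) j u) = chR f (p * m) j (chR f (p * m) i u)"
    if "i \<in> {1..p * m}" "j \<in> {1..p * m}" "i + 2 \<le> j" for i j u
  proof -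
    have "TL (f i) (TL (f j) u) = TL (f j) (TL (f i) u)" by (rule TL_commute) (use f that far in \<open>auto intro: less_imp_le\<close>)
    then show ?thesis using that by (simp add: chR_def)
  qed
  show "chR f (p * m) (c * m + j) (FL k m) = - tiL * FL k m" if "c < p" "2 \<le> j" "j \<le> m" for c j
  proof -
    have "c * m + j \<in> {1..p * m}" using that mult_le_mono1[of "Suc c" p m] by auto
    then show ?thesis using ib[OF that] by (simp add: chR_def)
  qed
qed

lemma move_chRi:
  assumes "block_chain (chR f N) (chRi f N) (range cst) (FL k m) tL tiL m p" "\<And>j. j \<in> {1..N} \<Longrightarrow> 1 \<le> f j \<and> f j < n" "j \<le> N"
  shows "block_chain.move (chRi f N) 0 j u = compose_list (map TiL (rev (map f [1..<Suc j]))) u"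
  using assms(3)
proof (induction j)
  case 0
  then show ?case by (simp add: block_chain.move.simps[OF assms(1)])
next
  case (Suc j)
  have "tau (f (Suc j)) = P ParT" "taui (f (Suc j)) = Pi ParT" using assms(2)[of "Suc j"] Suc by (auto simp: tau_def taui_def)
  then have "chRi f N (Suc j) w = TiL (f (Suc j)) w" for w using Suc by (simp add: chRi_def chR_def TiL_def)
  then show ?case using Suc by (simp add: block_chain.move.simps[OF assms(1)])
qed

lemma move_chR:
  assumes "block_chain (chR f N) (chRi f N) (range cst) (FL k m) tL tiL m p" "j \<le> N"
  shows "block_chain.move (chR f N) 0 j u = compose_list (map TL (rev (map f [1..<Suc j]))) u"
  using assms(2)
proof (induction j)
  case 0
  then show ?case by (simp add: block_chain.move.simps[OF assms(1)])
next
  case (Suc j)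
  then show ?case by (simp add: block_chain.move.simps[OF assms(1)] chR_def)
qed

lemma compose_TL_scal: "compose_list (map TL is) (cst a * u) = cst a * compose_list (map TL is) u"
  by (induction "is") (simp_all add: TL_scal)

lemma compose_TiL_scal: "compose_list (map TiL is) (cst a * u) = cst a * compose_list (map TiL is) u"
  by (induction "is") (simp_all add: TiL_scal)

lemma compose_TL_TiL: "compose_list (map TL is) (compose_list (map TiL (rev is)) u) = u"
  by (induction "is" arbitrary: u) simp_all

text \<open>The chain crosses the \<open>k - l\<close> blocks after block \<open>l\<close>, each
  contributing a factor \<open>t\<close>. \<open>T n\<close> commutes with all its letters but the
  last one, so \<open>chain_eigen\<close> applies.\<close>

lemma right_chain:
  assumes l: "1 \<le> l" "l \<le> k" and tq: "P ParT ^ (2 * (k + 1)) * P ParQ ^ 2 = 1"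
  defines "XR \<equiv> compose_list (map TL (rev [m * l..<n])) (FL k m)"
  shows "XR = tL ^ (2 * (k - l)) * compose_list (map TiL (rev [m * l..<n])) (FL k m)" "TL n XR = cst (tau n) * XR"
proof -
  define e p f where "e = m * l" and "p = k - l" and "f j = e + j - 1" for j
  have e1: "1 \<le> e" using l m1 by (simp add: e_def)
  have kl: "k = l + p" using l by (simp add: p_def)
  have np: "n = e + p * m" unfolding n kl by (simp add: e_def algebra_simps)
  have lt: "c * m + m \<le> p * m" if "c < p" for c using that mult_le_mono1[of "Suc c" p m] by simp
  have fb: "1 \<le> f j \<and> f j < n" if "j \<in> {1..p * m}" for j using that e1 np by (auto simp: f_def)
  have bc: "block_chain (chR f (p * m)) (chRi f (p * m)) (range cst) (FL k m) tL tiL m p"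
  proof (rule chain_locale[OF fb])
    show "f i + 2 \<le> f j \<or> f j + 2 \<le> f i" if "i \<in> {1..p * m}" "j \<in> {1..p * m}" "i + 2 \<le> j" for i j
      using that e1 by (auto simp: f_def)
    show "TL (f (c * m + j)) (FL k m) = - tiL * FL k m" if "c < p" "2 \<le> j" "j \<le> m" for c j
    proof (rule FL_inblock[of "l + c"])
      show "l + c < k" using that kl by simp
      have "(l + c) * m = e + c * m" by (simp add: e_def algebra_simps)
      then show "(l + c) * m < f (c * m + j)" "f (c * m + j) < Suc (l + c) * m" using that by (auto simp: f_def)
    qed
  qed
  interpret B: block_chain "chR f (p * m)" "chRi f (p * m)" "range cst" "FL k m" tL tiL m p by (rule bc)
  have g: "B.garnir c" if "c < p" for c
    unfolding B.garnir_def
  proof (rule garnir_right[of "l + c"])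
    show "1 \<le> l + c" "l + c < k" using l that kl by auto
    show "B.move (chR f (p * m)) (c * m) (Suc j) (FL k m) = TL (m * (l + c) + j) (B.move (chR f (p * m)) (c * m) j (FL k m))" if "j < m" for j
    proof -
      have "c * m + Suc j \<in> {1..p * m}" using lt[OF \<open>c < p\<close>] that by auto
      moreover have "f (c * m + Suc j) = m * (l + c) + j" by (simp add: f_def e_def algebra_simps)
      ultimately show ?thesis by (simp add: chR_def)
    qed
  qed simp
  have fl: "map f [1..<Suc (p * m)] = [e..<n]"
    by (rule nth_equalityI) (auto simp: f_def np simp del: upt_Suc)
  have XR: "XR = B.move (chR f (p * m)) 0 (p * m) (FL k m)"
    unfolding XR_def using move_chR[OF bc order_refl, of "FL k m"] unfolding fl by (simp add: e_def)
  have Xi: "compose_list (map TiL (rev [m * l..<n])) (FL k m) = B.move (chRi f (p * m)) 0 (p * m) (FL k m)"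
    using move_chRi[OF bc fb order_refl, of "FL k m"] unfolding fl by (simp add: e_def)
  show "XR = tL ^ (2 * (k - l)) * compose_list (map TiL (rev [m * l..<n])) (FL k m)"
    unfolding Xi unfolding XR p_def[symmetric] by (rule B.chain_inverse[OF g])
  show "TL n XR = cst (tau n) * XR"
    unfolding XR
  proof (rule B.chain_eigen[OF g])
    show "TL n (a * u) = a * TL n u" if "a \<in> range cst" for a u using that by (auto simp: TL_scal)
    show "TL n (chR f (p * m) j u) = chR f (p * m) j (TL n u)" if "1 \<le> j" "j < p * m" for j u
    proof -
      have "f j + 2 \<le> n" using that e1 by (simp add: f_def np)
      then show ?thesis using that by (auto simp: chR_def TL_scal intro!: TL_commute)
    qed
    show "TL n (FL k m) = cst (tau n) * FL k m" by (rule TL_fixed) (rule FL_sL_n[OF tq])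
  qed (auto simp: TL_add)
qed

text \<open>The chain runs leftwards through the \<open>l - 1\<close> earlier blocks.
  \<open>Y\<close> contains these letters inverted, so \<open>chain_inverse\<close> first replaces
  \<open>W\<close> by a multiple of the vector moved by the \<open>T_j\<close>, to which
  \<open>chain_eigen\<close> applies.\<close>

lemma left_chain:
  assumes l: "1 \<le> l" "l \<le> k"
  defines "W \<equiv> compose_list (map TiL [1..<Suc (m * (l - 1))]) (FL k m)"
  shows "TL 0 W = cst (tau 0) * W"
proof -
  define b p f where "b = m * (l - 1)" and "p = l - 1" and "f j = Suc b - j" for j
  have bp: "b = p * m" by (simp add: b_def p_def)
  have pk: "p < k" using l by (simp add: p_def)
  have bn: "b + m \<le> n" using mult_le_mono1[of "Suc p" k m] pk by (simp add: bp n)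
  have lt: "c * m + m \<le> p * m" if "c < p" for c using that mult_le_mono1[of "Suc c" p m] by simp
  have fb: "1 \<le> f j \<and> f j < n" if "j \<in> {1..p * m}" for j using that bp bn m1 by (auto simp: f_def)
  have bc: "block_chain (chR f (p * m)) (chRi f (p * m)) (range cst) (FL k m) tL tiL m p"
  proof (rule chain_locale[OF fb])
    show "f i + 2 \<le> f j \<or> f j + 2 \<le> f i" if "i \<in> {1..p * m}" "j \<in> {1..p * m}" "i + 2 \<le> j" for i j
      using that bp by (auto simp: f_def)
    show "TL (f (c * m + j)) (FL k m) = - tiL * FL k m" if c: "c < p" and j: "2 \<le> j" "j \<le> m" for c j
    proof (rule FL_inblock[of "p - Suc c"])
      show "p - Suc c < k" using pk by simp
      have "(p - Suc c) * m = b - (c * m + m)" by (simp add: bp diff_mult_distrib)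
      moreover have "Suc (p - Suc c) * m = b - c * m" using c by (simp add: bp Suc_diff_Suc diff_mult_distrib)
      ultimately show "(p - Suc c) * m < f (c * m + j)" "f (c * m + j) < Suc (p - Suc c) * m"
        using j lt[OF c] bp by (auto simp: f_def simp del: mult_Suc)
    qed
  qed
  interpret B: block_chain "chR f (p * m)" "chRi f (p * m)" "range cst" "FL k m" tL tiL m p by (rule bc)
  have g: "B.garnir c" if "c < p" for c
    unfolding B.garnir_def
  proof (rule garnir_left[of "p - c"])
    show "1 \<le> p - c" "p - c < k" using that pk by auto
    show "B.move (chR f (p * m)) (c * m) (Suc j) (FL k m) = TL (m * (p - c) - j) (B.move (chR f (p * m)) (c * m) j (FL k m))" if "j < m" for j
    proof -
      have "c * m + Suc j \<in> {1..p * m}" using lt[OF \<open>c < p\<close>] that by auto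
      moreover have "f (c * m + Suc j) = m * (p - c) - j" by (simp add: f_def bp diff_mult_distrib2 mult.commute)
      ultimately show ?thesis by (simp add: chR_def)
    qed
  qed simp
  have fl: "rev (map f [1..<Suc (p * m)]) = [1..<Suc b]"
    by (rule nth_equalityI) (auto simp: f_def bp rev_nth simp del: upt_Suc)
  have X: "compose_list (map TL [1..<Suc b]) (FL k m) = B.move (chR f (p * m)) 0 (p * m) (FL k m)"
    using move_chR[OF bc order_refl, of "FL k m"] by (simp only: fl rev_map[symmetric] flip: map_map)
  have Xi: "W = B.move (chRi f (p * m)) 0 (p * m) (FL k m)"
    using move_chRi[OF bc fb order_refl, of "FL k m"] by (simp only: fl W_def b_def)
  have Q: "TL 0 (B.move (chR f (p * m)) 0 (p * m) (FL k m)) = cst (tau 0) * B.move (chR f (p * m)) 0 (p * m) (FL k m)"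
  proof (rule B.chain_eigen[OF g])
    show "TL 0 (a * u) = a * TL 0 u" if "a \<in> range cst" for a u using that by (auto simp: TL_scal)
    show "TL 0 (chR f (p * m) j u) = chR f (p * m) j (TL 0 u)" if "1 \<le> j" "j < p * m" for j u
    proof -
      have "2 \<le> f j" "f j \<le> n" using that bn by (auto simp: f_def bp)
      then show ?thesis using that by (auto simp: chR_def TL_scal intro!: TL_commute)
    qed
    show "TL 0 (FL k m) = cst (tau 0) * FL k m" by (rule TL_fixed) (rule FL_sL_0)
  qed (auto simp: TL_add)
  have e: "B.move (chR f (p * m)) 0 (p * m) (FL k m) = cst (P ParT ^ (2 * p)) * W"
    unfolding Xi rhomD(7)[OF rhom_cst] by (rule B.chain_inverse[OF g])
  have nz: "cst (P ParT ^ (2 * p)) \<noteq> 0" using tL_tiL by (auto simp: rhomD(7)[OF rhom_cst])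
  have "cst (P ParT ^ (2 * p)) * TL 0 W = cst (P ParT ^ (2 * p)) * (cst (tau 0) * W)"
    using Q unfolding e by (simp add: TL_scal mult.left_commute)
  then show ?thesis using nz by simp
qed

text \<open>\<open>T_0\<close> and \<open>T_n\<close> act by scalars on the moved vectors. Once they
  are removed, the letters before position \<open>m * l\<close> cancel against the inverses in
  \<open>Y\<close>, and those after it cancel because \<open>chain_inverse\<close> turns them into
  inverses.\<close>

lemma FL_end:
  assumes l: "1 \<le> l" "l \<le> k" and tq: "P ParT ^ (2 * (k + 1)) * P ParQ ^ 2 = 1"
  shows "Y (m * l) (Fprod k m) = const (P ParTn * P ParT0 * P ParT ^ (2 * (k - l))) * Fprod k m"
proof -
  define e b F where "e = m * l" and "b = m * (l - 1)" and "F = FL k m"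
  have eb: "e = b + m" using l by (simp add: e_def b_def diff_mult_distrib2)
  have en: "e \<le> n" using mult_le_mono2[OF l(2), of m] by (simp add: e_def n mult.commute)
  have e1: "1 \<le> e" using m1 eb by simp
  define W0 where "W0 = compose_list (map TiL [1..<Suc b]) F"
  \<comment> \<open>The inverse letters inside block \<open>l\<close> are scalars
    \<open>- t^(1/2)\<close> on the product, so only the letters up to \<open>b\<close> really move
    it.\<close>
  have tail: "compose_list (map TiL [Suc b..<Suc b + j]) F = cst ((- P ParT) ^ j) * F" if "j < m" for j
    using that
  proof (induction j)
    case (Suc j)
    have "TL (Suc b + j) F = - tiL * F"
      unfolding F_def
    proof (rule FL_inblock[of "l - 1"])
      have "(l - 1) * m = b" by (simp only: b_def mult.commute)
      then show "(l - 1) * m < Suc b + j" "Suc b + j < Suc (l - 1) * m" using Suc.prems by auto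
    qed (use l in auto)
    moreover have "taui (Suc b + j) = Pi ParT" "tau (Suc b + j) = P ParT" using Suc.prems en eb by (auto simp: taui_def tau_def)
    ultimately have "TiL (Suc b + j) F = cst (- P ParT) * F"
      by (simp add: TiL_def rhomD[OF rhom_cst] algebra_simps)
    moreover have "[Suc b..<Suc b + Suc j] = [Suc b..<Suc b + j] @ [Suc b + j]" by simp
    moreover have "compose_list (map TiL [Suc b..<Suc b + j]) F = cst ((- P ParT) ^ j) * F" using Suc by simp
    ultimately show ?case
      by (simp only: map_append list.map compose_list_simps o_apply id_apply compose_TiL_scal power_Suc rhomD(3)[OF rhom_cst] mult.assoc)
  qed simp
  define a where "a = (- P ParT) ^ (m - 1)"
  have W: "compose_list (map TiL [1..<e]) F = cst a * W0"
  proof -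
    have "e = Suc b + (m - 1)" using eb m1 by simp
    then have "[1..<e] = [1..<Suc b] @ [Suc b..<Suc b + (m - 1)]" by (simp only:) (rule upt_add_eq_append, simp)
    then show ?thesis using tail[of "m - 1"] m1
      by (simp only: map_append compose_list_simps o_apply) (simp add: compose_TiL_scal W0_def a_def)
  qed
  have W0: "TL 0 W0 = cst (tau 0) * W0" unfolding W0_def F_def b_def by (rule left_chain[OF l])
  have r: "rev [1..<n] = rev [e..<n] @ rev [1..<e]" using upt_add_eq_append[of 1 e "n - e"] e1 en by simp
  have "to_fract (Y e (Fprod k m)) = compose_list (map TL [e..<n]) (TL n (compose_list (map TL (rev [1..<n]))
      (TL 0 (compose_list (map TiL [1..<e]) F))))"
    by (simp add: Y_def compose_T_fract compose_Ti_fract T_fract Fprod_fract F_def)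
  also have "TL 0 (compose_list (map TiL [1..<e]) F) = cst (tau 0) * compose_list (map TiL [1..<e]) F"
    unfolding W by (simp add: TL_scal W0 mult.left_commute)
  \<comment> \<open>The letters below \<open>e\<close> cancel here.\<close>
  also have "compose_list (map TL (rev [1..<n])) \<dots> = cst (tau 0) * compose_list (map TL (rev [e..<n])) F"
    unfolding r using compose_TL_TiL[of "rev [1..<e]" F] by (simp add: compose_TL_scal)
  also have "TL n \<dots> = cst (tau 0) * (cst (tau n) * compose_list (map TL (rev [e..<n])) F)"
    unfolding e_def F_def using right_chain(2)[OF l tq] by (simp add: TL_scal)
  \<comment> \<open>Trading these letters for inverses prepares the cancellation against the
    outermost stretch of \<open>Y\<close>.\<close>
  also have "compose_list (map TL (rev [e..<n])) F = cst (P ParT ^ (2 * (k - l))) * compose_list (map TiL (rev [e..<n])) F"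
    unfolding e_def F_def rhomD(7)[OF rhom_cst] by (rule right_chain(1)[OF l tq])
  also have "compose_list (map TL [e..<n]) (cst (tau 0) * (cst (tau n) * \<dots>)) = cst (tau 0) * (cst (tau n) * (cst (P ParT ^ (2 * (k - l))) * F))"
    by (simp only: compose_TL_scal compose_TL_TiL)
  also have "\<dots> = to_fract (const (P ParTn * P ParT0 * P ParT ^ (2 * (k - l))) * Fprod k m)"
    using n_ge unfolding F_def Fprod_fract[symmetric] cst_def
    by (simp add: tau_def rhomD(3)[OF rhom_const] ac_simps)
  finally show ?thesis unfolding e_def by (simp only: to_fract_eq_iff)
qed

text \<open>Inside a block \<open>Y i = T_i Y (i + 1) T_i\<close>, and both outer letters act by
  \<open>- t^(-1/2)\<close>; so each step to the left contributes \<open>t^(-1)\<close>.\<close>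

theorem Fprod_eigen:
  assumes l: "1 \<le> l" "l \<le> k" and r: "r < m" and tq: "P ParT ^ (2 * (k + 1)) * P ParQ ^ 2 = 1"
  shows "Y (m * l - r) (Fprod k m) = const (P ParTn * P ParT0 * P ParT ^ (2 * (k - l)) * Pi ParT ^ (2 * r)) * Fprod k m"
  using r
proof (induction r)
  case 0
  then show ?case using FL_end[OF l tq] by simp
next
  case (Suc r)
  define i where "i = m * l - Suc r"
  have ml: "m \<le> m * l" using l by simp
  have mn: "m * l \<le> n" using mult_le_mono2[OF l(2), of m] by (simp add: n mult.commute)
  have i: "1 \<le> i" "i < n" "Suc i = m * l - r" unfolding i_def using Suc.prems ml mn by linarith+
  define F c where "F = Fprod k m" and "c = P ParTn * P ParT0 * P ParT ^ (2 * (k - l)) * Pi ParT ^ (2 * r)"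
  have "TL i (FL k m) = - tiL * FL k m"
  proof (rule FL_inblock[of "l - 1"])
    have "(l - 1) * m = m * l - m" by (simp only: diff_mult_distrib nat_mult_1 mult.commute[of l m])
    moreover have "Suc (l - 1) * m = m * l" using l by simp
    ultimately show "(l - 1) * m < i" "i < Suc (l - 1) * m" unfolding i_def using Suc.prems ml by linarith+
  qed (use l in auto)
  then have "to_fract (T i F) = to_fract (const (- Pi ParT) * F)"
    by (simp add: F_def T_fract Fprod_fract cst_def rhomD(5)[OF rhom_const])
  then have TF: "T i F = const (- Pi ParT) * F" by (simp only: to_fract_eq_iff)
  have YF: "Y (Suc i) F = const c * F" using Suc by (simp add: i(3) F_def c_def)
  have Ys: "Y (Suc i) (const a * f) = const a * Y (Suc i) f" for a f
  proof -
    have "compose_list (map T is) (const a * f) = const a * compose_list (map T is) f" for "is" and f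
      by (induction "is") (simp_all add: T_linear)
    moreover have "compose_list (map Ti is) (const a * f) = const a * compose_list (map Ti is) f" for "is" and f
      by (induction "is") (simp_all add: Ti_linear)
    ultimately show ?thesis by (simp add: Y_def T_linear)
  qed
  have "Y i F = const (- Pi ParT) * (const c * (const (- Pi ParT) * F))"
    unfolding Y_rec[OF i(1,2)] TF Ys YF by (simp only: T_linear TF)
  also have "\<dots> = const (c * Pi ParT ^ 2) * F"
    by (simp add: rhomD[OF rhom_const] power2_eq_square ac_simps)
  finally show ?case by (simp add: i_def F_def c_def power2_eq_square ac_simps)
qed

end

end

section \<open>Triangular commuting operators\<close>

lemma keys_subset_iff: "Poly_Mapping.keys f \<subseteq> D \<longleftrightarrow> (\<forall>x. x \<notin> D \<longrightarrow> lk f x = 0)"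
  by (auto simp: in_keys_iff)

definition down_set :: "nat \<Rightarrow> weight \<Rightarrow> weight set" where
  "down_set n \<mu> = {\<nu> \<in> lattice n. wt_succeq n \<mu> \<nu>}"

lemma down_set_refl: "1 \<le> n \<Longrightarrow> \<mu> \<in> lattice n \<Longrightarrow> \<mu> \<in> down_set n \<mu>"
  by (simp add: down_set_def wt_succeq_iff)

lemma down_set_trans:
  assumes "1 \<le> n" "\<mu> \<in> lattice n" "\<nu> \<in> down_set n \<mu>" "\<theta> \<in> down_set n \<nu>"
  shows "\<theta> \<in> down_set n \<mu>"
proof -
  have l: "\<nu> \<in> lattice n" "\<theta> \<in> lattice n" using assms by (auto simp: down_set_def)
  show ?thesis using assms unfolding down_set_def
    by (auto simp: wt_succeq_iff l intro: mle_trans ple_trans)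
qed

lemma down_set_antisym:
  assumes "1 \<le> n" "\<mu> \<in> lattice n" "\<nu> \<in> down_set n \<mu>" "\<mu> \<in> down_set n \<nu>"
  shows "\<mu> = \<nu>"
proof -
  have l: "\<nu> \<in> lattice n" using assms by (auto simp: down_set_def)
  then show ?thesis using assms unfolding down_set_def
    by (intro ple_antisym[of \<mu> n \<nu>]) (auto simp: wt_succeq_iff)
qed

lemma finite_down_set: "1 \<le> n \<Longrightarrow> \<mu> \<in> lattice n \<Longrightarrow> finite (down_set n \<mu>)"
  by (rule finite_subset[OF _ finite_mle[of n \<mu>]]) (auto simp: down_set_def wt_succeq_iff)

definition down_closed :: "nat \<Rightarrow> weight set \<Rightarrow> bool" where
  "down_closed n D \<longleftrightarrow> D \<subseteq> lattice n \<and> (\<forall>\<mu>\<in>D. down_set n \<mu> \<subseteq> D)"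

lemma down_closed_down_set: "1 \<le> n \<Longrightarrow> \<mu> \<in> lattice n \<Longrightarrow> down_closed n (down_set n \<mu>)"
  using down_set_trans[of n \<mu>] by (auto simp: down_closed_def down_set_def)

lemma down_closed_remove:
  assumes "down_closed n D" "\<And>\<theta>. \<theta> \<in> D \<Longrightarrow> \<nu> \<in> down_set n \<theta> \<Longrightarrow> \<theta> = \<nu>"
  shows "down_closed n (D - {\<nu>})"
  using assms by (auto simp: down_closed_def)

text \<open>A strictly larger weight has a strictly larger down-set, so a down-set of maximal size
  belongs to a maximal weight.\<close>

lemma exists_maximal:
  assumes n: "1 \<le> n" and D: "finite D" "D \<noteq> {}" "D \<subseteq> lattice n"
  shows "\<exists>\<nu>\<in>D. \<forall>\<theta>\<in>D. \<nu> \<in> down_set n \<theta> \<longrightarrow> \<theta> = \<nu>"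
proof -
  let ?c = "\<lambda>\<nu>. card (down_set n \<nu>)"
  have "Max (?c ` D) \<in> ?c ` D" using D by (intro Max_in) auto
  then obtain \<nu> where \<nu>: "\<nu> \<in> D" "?c \<nu> = Max (?c ` D)" by auto
  have "\<theta> = \<nu>" if t: "\<theta> \<in> D" "\<nu> \<in> down_set n \<theta>" for \<theta>
  proof (rule ccontr)
    assume "\<theta> \<noteq> \<nu>"
    have tl: "\<theta> \<in> lattice n" using t D by auto
    have "\<theta> \<notin> down_set n \<nu>" using down_set_antisym[OF n tl t(2)] \<open>\<theta> \<noteq> \<nu>\<close> by auto
    moreover have "\<theta> \<in> down_set n \<theta>" by (rule down_set_refl[OF n tl])
    moreover have "down_set n \<nu> \<subseteq> down_set n \<theta>" using down_set_trans[OF n tl t(2)] by auto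
    ultimately have "down_set n \<nu> \<subset> down_set n \<theta>" by auto
    then have "?c \<nu> < ?c \<theta>" by (rule psubset_card_mono[OF finite_down_set[OF n tl]])
    moreover have "?c \<theta> \<le> ?c \<nu>" unfolding \<nu>(2) using D t by simp
    ultimately show False by simp
  qed
  then show ?thesis using \<nu> by blast
qed

context koornwinder_params
begin

lemma Y_linear: "Y i (f + g) = Y i f + Y i g" "Y i (const c * f) = const c * Y i f" "Y i 0 = 0"
proof -
  have "compose_list (map T is) (f + g) = compose_list (map T is) f + compose_list (map T is) g"
    "compose_list (map Ti is) (f + g) = compose_list (map Ti is) f + compose_list (map Ti is) g"
    "compose_list (map T is) (const c * f) = const c * compose_list (map T is) f"
    "compose_list (map Ti is) (const c * f) = const c * compose_list (map Ti is) f" for "is" f g c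
    by (induction "is") (simp_all add: T_linear Ti_linear)
  then show a: "Y i (f + g) = Y i f + Y i g" and s: "Y i (const c * f) = const c * Y i f" for f g c
    by (simp_all add: Y_def T_linear)
  show "Y i 0 = 0" using s[of 0 0] by (simp add: rhomD(4)[OF rhom_const])
qed

lemma Y_expand: "Y i f = (\<Sum>\<mu>\<in>Poly_Mapping.keys f. const (lk f \<mu>) * Y i (Poly_Mapping.single \<mu> 1))"
proof -
  have s: "Y i (sum g A) = (\<Sum>x\<in>A. Y i (g x))" for g :: "weight \<Rightarrow> 'r laurent" and A
    by (induction A rule: infinite_finite_induct) (simp_all add: Y_linear)
  have "Y i f = Y i (\<Sum>\<mu>\<in>Poly_Mapping.keys f. const (lk f \<mu>) * Poly_Mapping.single \<mu> 1)"
    unfolding const_mult_single mult_1_right by (rule arg_cong[OF poly_mapping_sum_single])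
  then show ?thesis by (simp add: s Y_linear)
qed

lemma lookup_Y: "lk (Y i f) \<theta> = (\<Sum>\<mu>\<in>Poly_Mapping.keys f. lk f \<mu> * lk (Y i (Poly_Mapping.single \<mu> 1)) \<theta>)"
  by (subst Y_expand) (simp add: lookup_sum lookup_const_mult)

lemma Y_single_zero:
  "i \<in> {1..n} \<Longrightarrow> \<mu> \<in> lattice n \<Longrightarrow> \<theta> \<notin> down_set n \<mu> \<Longrightarrow> lk (Y i (Poly_Mapping.single \<mu> 1)) \<theta> = 0"
  using Y_triangular(2)[of i \<mu> \<theta>] by (auto simp: down_set_def in_keys_iff)

lemma keys_Y:
  assumes i: "i \<in> {1..n}" and D: "down_closed n D" "Poly_Mapping.keys f \<subseteq> D"
  shows "Poly_Mapping.keys (Y i f) \<subseteq> D"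
proof
  fix \<theta> assume "\<theta> \<in> Poly_Mapping.keys (Y i f)"
  then have "lk (Y i f) \<theta> \<noteq> 0" by (simp add: in_keys_iff)
  then have "(\<Sum>\<mu>\<in>Poly_Mapping.keys f. lk f \<mu> * lk (Y i (Poly_Mapping.single \<mu> 1)) \<theta>) \<noteq> 0"
    by (subst (asm) lookup_Y[of i f \<theta>])
  then obtain \<mu> where "\<mu> \<in> Poly_Mapping.keys f" "lk f \<mu> * lk (Y i (Poly_Mapping.single \<mu> 1)) \<theta> \<noteq> 0"
    by (rule sum.not_neutral_contains_not_neutral)
  then have \<mu>: "\<mu> \<in> Poly_Mapping.keys f" "lk (Y i (Poly_Mapping.single \<mu> 1)) \<theta> \<noteq> 0" by auto
  then show "\<theta> \<in> D" using Y_single_zero[OF i, of \<mu> \<theta>] D by (auto simp: down_closed_def)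
qed

lemma lookup_Y_maximal:
  assumes i: "i \<in> {1..n}" and f: "Poly_Mapping.keys f \<subseteq> lattice n"
    and m: "\<And>\<theta>. \<theta> \<in> Poly_Mapping.keys f \<Longrightarrow> \<mu> \<in> down_set n \<theta> \<Longrightarrow> \<theta> = \<mu>"
  shows "lk (Y i f) \<mu> = diag \<mu> i * lk f \<mu>"
proof -
  have "lk (Y i f) \<mu> = (\<Sum>\<theta>\<in>Poly_Mapping.keys f. if \<theta> = \<mu> then diag \<mu> i * lk f \<mu> else 0)"
  proof (subst lookup_Y[of i f \<mu>], rule sum.cong[OF refl])
    fix \<theta> assume t: "\<theta> \<in> Poly_Mapping.keys f"
    show "lk f \<theta> * lk (Y i (Poly_Mapping.single \<theta> 1)) \<mu> = (if \<theta> = \<mu> then diag \<mu> i * lk f \<mu> else 0)"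
    proof (cases "\<theta> = \<mu>")
      case True
      have "lk (Y i (Poly_Mapping.single \<mu> 1)) \<mu> = diag \<mu> i"
        by (rule Y_triangular(1)) (use i f t True in auto)
      then show ?thesis using True by simp
    next
      case False
      then have "\<mu> \<notin> down_set n \<theta>" using m[OF t] by blast
      then have "lk (Y i (Poly_Mapping.single \<theta> 1)) \<mu> = 0" by (rule Y_single_zero[OF i subsetD[OF f t]])
      then show ?thesis using False by simp
    qed
  qed
  then show ?thesis by (simp add: in_keys_iff)
qed

lemma exists_maximal_key:
  assumes "f \<noteq> 0" "Poly_Mapping.keys f \<subseteq> lattice n"
  obtains \<mu> where "\<mu> \<in> Poly_Mapping.keys f" "\<And>\<theta>. \<theta> \<in> Poly_Mapping.keys f \<Longrightarrow> \<mu> \<in> down_set n \<theta> \<Longrightarrow> \<theta> = \<mu>"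
  using exists_maximal[OF n1, of "Poly_Mapping.keys f"] assms by auto

text \<open>No other monomial of \<open>f\<close> contributes to the coefficient at a maximal
  one.\<close>

lemma eigenvalue_diag:
  assumes i: "i \<in> {1..n}" and f: "Poly_Mapping.keys f \<subseteq> lattice n" "\<mu> \<in> Poly_Mapping.keys f"
    and m: "\<And>\<theta>. \<theta> \<in> Poly_Mapping.keys f \<Longrightarrow> \<mu> \<in> down_set n \<theta> \<Longrightarrow> \<theta> = \<mu>"
    and e: "Y i f = const c * f"
  shows "c = diag \<mu> i"
  using lookup_Y_maximal[OF i f(1) m] f(2) unfolding e by (simp add: lookup_const_mult in_keys_iff)

lemma lead_maximal:
  assumes "\<mu> \<in> lattice n" "Poly_Mapping.keys f \<subseteq> down_set n \<mu>" "\<theta> \<in> Poly_Mapping.keys f" "\<mu> \<in> down_set n \<theta>"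
  shows "\<theta> = \<mu>"
  using down_set_antisym[OF n1 assms(1) _ assms(4)] assms(2,3) by auto

text \<open>A maximal monomial of the difference lies strictly below \<open>\<mu>\<close> and would
  have the eigenvalues of \<open>\<mu>\<close>.\<close>

lemma eigenvector_unique:
  assumes \<mu>: "\<mu> \<in> lattice n" and k: "Poly_Mapping.keys f \<subseteq> down_set n \<mu>" "Poly_Mapping.keys g \<subseteq> down_set n \<mu>"
    and l: "lk f \<mu> = lk g \<mu>"
    and e: "\<And>i. i \<in> {1..n} \<Longrightarrow> Y i f = const (diag \<mu> i) * f" "\<And>i. i \<in> {1..n} \<Longrightarrow> Y i g = const (diag \<mu> i) * g"
    and sep: "\<And>\<nu>. \<nu> \<in> down_set n \<mu> \<Longrightarrow> \<nu> \<noteq> \<mu> \<Longrightarrow> \<exists>i\<in>{1..n}. diag \<nu> i \<noteq> diag \<mu> i"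
  shows "f = g"
proof (rule ccontr)
  assume "f \<noteq> g"
  define h where "h = f + const (-1) * g"
  have lh: "lk h \<theta> = lk f \<theta> - lk g \<theta>" for \<theta> by (simp add: h_def lookup_add lookup_const_mult)
  have "h \<noteq> 0"
  proof
    assume "h = 0"
    then have "f = g" by (intro poly_mapping_eqI) (use lh in \<open>simp add: \<open>h = 0\<close>\<close>)
    with \<open>f \<noteq> g\<close> show False by simp
  qed
  have kh: "Poly_Mapping.keys h \<subseteq> down_set n \<mu>" using k unfolding keys_subset_iff by (simp add: lh)
  then have kl: "Poly_Mapping.keys h \<subseteq> lattice n" by (auto simp: down_set_def)
  obtain \<nu> where \<nu>: "\<nu> \<in> Poly_Mapping.keys h" "\<And>\<theta>. \<theta> \<in> Poly_Mapping.keys h \<Longrightarrow> \<nu> \<in> down_set n \<theta> \<Longrightarrow> \<theta> = \<nu>"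
    using exists_maximal_key[OF \<open>h \<noteq> 0\<close> kl] by blast
  have "\<nu> \<noteq> \<mu>" using \<nu>(1) l by (auto simp: in_keys_iff lh)
  then obtain i where i: "i \<in> {1..n}" "diag \<nu> i \<noteq> diag \<mu> i" using sep \<nu>(1) kh by blast
  have "Y i h = const (diag \<mu> i) * h"
    unfolding h_def Y_linear e[OF i(1)] by (simp add: algebra_simps)
  then have "Y i h = const (diag \<mu> i) * h" .
  from eigenvalue_diag[OF i(1) kl \<nu>(1) \<nu>(2) this] show False using i(2) by simp
qed

text \<open>\<open>I\<close> selects for every weight the operator used to remove it.\<close>

definition shifted :: "(weight \<Rightarrow> nat) \<Rightarrow> weight \<Rightarrow> 'r laurent \<Rightarrow> 'r laurent" where
  "shifted I \<nu> f = Y (I \<nu>) f - const (diag \<nu> (I \<nu>)) * f"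

definition proj :: "(weight \<Rightarrow> nat) \<Rightarrow> weight list \<Rightarrow> 'r laurent \<Rightarrow> 'r laurent" where
  "proj I \<nu>s = foldr (shifted I) \<nu>s"

lemma proj_simps [simp]: "proj I [] f = f" "proj I (\<nu> # \<nu>s) f = shifted I \<nu> (proj I \<nu>s f)"
  by (simp_all add: proj_def)

lemma Y_diff: "Y i (f - g) = Y i f - Y i g"
  using Y_linear(1)[of i "f - g" g] by simp

lemma shifted_linear: "shifted I \<nu> (f + g) = shifted I \<nu> f + shifted I \<nu> g"
  "shifted I \<nu> (const c * f) = const c * shifted I \<nu> f" "shifted I \<nu> 0 = 0"
proof -
  show "shifted I \<nu> (const c * f) = const c * shifted I \<nu> f"
    by (simp only: shifted_def Y_linear right_diff_distrib mult.left_commute)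
qed (simp_all add: shifted_def Y_linear algebra_simps)

lemma proj_linear: "proj I \<nu>s (f + g) = proj I \<nu>s f + proj I \<nu>s g"
  "proj I \<nu>s (const c * f) = const c * proj I \<nu>s f" "proj I \<nu>s 0 = 0"
  by (induction \<nu>s) (simp_all add: shifted_linear)

context
  fixes I :: "weight \<Rightarrow> nat"
  assumes I: "\<And>\<nu>. I \<nu> \<in> {1..n}"
begin

lemma Y_shifted: "i \<in> {1..n} \<Longrightarrow> Y i (shifted I \<nu> f) = shifted I \<nu> (Y i f)"
  using Y_commute[of i "I \<nu>" f] I[of \<nu>] by (simp add: shifted_def Y_linear Y_diff)

lemma Y_proj: "i \<in> {1..n} \<Longrightarrow> Y i (proj I \<nu>s f) = proj I \<nu>s (Y i f)"
  by (induction \<nu>s) (simp_all add: Y_shifted)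

lemma shifted_proj: "shifted I \<nu> (proj I \<nu>s f) = proj I \<nu>s (shifted I \<nu> f)"
proof -
  have "shifted I \<nu> f = Y (I \<nu>) f + const (- diag \<nu> (I \<nu>)) * f" for f
    by (simp add: shifted_def rhomD[OF rhom_const])
  then show ?thesis by (simp only: proj_linear Y_proj[OF I])
qed

lemma proj_remove1: "\<nu> \<in> set \<nu>s \<Longrightarrow> proj I \<nu>s f = proj I (remove1 \<nu> \<nu>s) (shifted I \<nu> f)"
proof (induction \<nu>s)
  case (Cons a \<nu>s)
  then show ?case by (cases "a = \<nu>") (simp_all add: shifted_proj)
qed simp

lemma keys_shifted:
  assumes "down_closed n D" "Poly_Mapping.keys f \<subseteq> D"
  shows "Poly_Mapping.keys (shifted I \<nu> f) \<subseteq> D"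
  using keys_Y[OF I assms, of \<nu>] assms(2) unfolding keys_subset_iff by (simp add: shifted_def lookup_minus lookup_const_mult)

text \<open>Commutativity lets the factor of a maximal weight act first. It kills the coefficient
  there, and the support shrinks to a smaller down-closed set.\<close>

lemma proj_zero:
  assumes "finite D" "down_closed n D" "D \<subseteq> set \<nu>s" "Poly_Mapping.keys f \<subseteq> D"
  shows "proj I \<nu>s f = 0"
  using assms
proof (induction "card D" arbitrary: D \<nu>s f)
  case 0
  then show ?case by (simp add: proj_linear)
next
  case (Suc c)
  have l: "D \<subseteq> lattice n" using Suc.prems by (simp add: down_closed_def)
  obtain \<nu> where \<nu>: "\<nu> \<in> D" "\<And>\<theta>. \<theta> \<in> D \<Longrightarrow> \<nu> \<in> down_set n \<theta> \<Longrightarrow> \<theta> = \<nu>"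
    using exists_maximal[OF n1 Suc.prems(1) _ l] Suc.hyps(2) by fastforce
  have z: "lk (shifted I \<nu> f) \<nu> = 0"
    using lookup_Y_maximal[OF I, of f \<nu> \<nu>] \<nu>(2) Suc.prems(4) l
    by (auto simp: shifted_def lookup_minus lookup_const_mult)
  have "proj I (remove1 \<nu> \<nu>s) (shifted I \<nu> f) = 0"
  proof (rule Suc.hyps(1))
    show "c = card (D - {\<nu>})" using Suc.hyps(2) \<nu>(1) Suc.prems(1) by simp
    show "down_closed n (D - {\<nu>})" by (rule down_closed_remove[OF Suc.prems(2) \<nu>(2)])
    show "D - {\<nu>} \<subseteq> set (remove1 \<nu> \<nu>s)"
    proof
      fix x assume "x \<in> D - {\<nu>}"
      then have "x \<in> set \<nu>s" "x \<noteq> \<nu>" using Suc.prems(3) by auto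
      then show "x \<in> set (remove1 \<nu> \<nu>s)" by simp
    qed
    show "Poly_Mapping.keys (shifted I \<nu> f) \<subseteq> D - {\<nu>}"
      using keys_shifted[OF Suc.prems(2,4), of \<nu>] z by (auto simp: in_keys_iff)
  qed (use Suc.prems(1) in simp)
  then show ?case using proj_remove1[of \<nu> \<nu>s f] \<nu>(1) Suc.prems(3) by auto
qed

text \<open>The scalar by which \<open>proj\<close> acts on the leading coefficient at
  \<open>\<mu>\<close> and on joint eigenvectors with the eigenvalues of
  \<open>\<mu>\<close>.\<close>

definition gap :: "weight \<Rightarrow> weight list \<Rightarrow> 'r" where
  "gap \<mu> \<nu>s = (\<Prod>\<nu>\<leftarrow>\<nu>s. diag \<mu> (I \<nu>) - diag \<nu> (I \<nu>))"

lemma keys_proj: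
  assumes "down_closed n D" "Poly_Mapping.keys f \<subseteq> D"
  shows "Poly_Mapping.keys (proj I \<nu>s f) \<subseteq> D"
  by (induction \<nu>s) (simp_all add: assms keys_shifted)

lemma lookup_proj:
  assumes \<mu>: "\<mu> \<in> lattice n" and f: "Poly_Mapping.keys f \<subseteq> down_set n \<mu>"
  shows "lk (proj I \<nu>s f) \<mu> = gap \<mu> \<nu>s * lk f \<mu>"
proof (induction \<nu>s)
  case (Cons \<nu> \<nu>s)
  have k: "Poly_Mapping.keys (proj I \<nu>s f) \<subseteq> down_set n \<mu>" by (rule keys_proj[OF down_closed_down_set[OF n1 \<mu>] f])
  have "lk (Y (I \<nu>) (proj I \<nu>s f)) \<mu> = diag \<mu> (I \<nu>) * lk (proj I \<nu>s f) \<mu>"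
    using k lead_maximal[OF \<mu> k] by (intro lookup_Y_maximal[OF I]) (auto simp: down_set_def)
  then show ?case using Cons by (simp add: shifted_def lookup_minus lookup_const_mult gap_def left_diff_distrib mult.assoc)
qed (simp add: gap_def)

lemma proj_eigen:
  assumes "\<And>i. i \<in> {1..n} \<Longrightarrow> Y i f = const (diag \<mu> i) * f"
  shows "proj I \<nu>s f = const (gap \<mu> \<nu>s) * f"
proof (induction \<nu>s)
  case (Cons \<nu> \<nu>s)
  then show ?case
    by (simp add: shifted_linear) (simp add: shifted_def assms[OF I] gap_def rhomD[OF rhom_const] algebra_simps)
qed (simp add: gap_def rhomD[OF rhom_const])

context
  fixes \<mu> \<nu>s assumes \<mu>: "\<mu> \<in> lattice n" and \<nu>s: "set \<nu>s = down_set n \<mu> - {\<mu>}"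
begin

lemma proj_lower:
  assumes "Poly_Mapping.keys f \<subseteq> down_set n \<mu>" "lk f \<mu> = 0"
  shows "proj I \<nu>s f = 0"
proof (rule proj_zero)
  show "down_closed n (down_set n \<mu> - {\<mu>})"
    using down_set_antisym[OF n1 \<mu>] by (intro down_closed_remove down_closed_down_set n1 \<mu>) blast
qed (use assms finite_down_set[OF n1 \<mu>] in \<open>auto simp: \<nu>s in_keys_iff\<close>)

lemma keys_proj_single: "Poly_Mapping.keys (proj I \<nu>s (Poly_Mapping.single \<mu> 1)) \<subseteq> down_set n \<mu>"
  by (rule keys_proj[OF down_closed_down_set[OF n1 \<mu>]]) (simp add: down_set_refl[OF n1 \<mu>])

lemma lookup_proj_single: "lk (proj I \<nu>s (Poly_Mapping.single \<mu> 1)) \<mu> = gap \<mu> \<nu>s"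
  by (subst lookup_proj[OF \<mu>]) (simp_all add: down_set_refl[OF n1 \<mu>])

text \<open>\<open>Y i - diag \<mu> i\<close> maps the monomial of \<open>\<mu>\<close> to lower
  terms, which are killed by \<open>proj\<close>, and \<open>proj\<close> commutes with
  \<open>Y i\<close>.\<close>

lemma Y_proj_single:
  assumes i: "i \<in> {1..n}"
  shows "Y i (proj I \<nu>s (Poly_Mapping.single \<mu> 1)) = const (diag \<mu> i) * proj I \<nu>s (Poly_Mapping.single \<mu> 1)"
proof -
  define x where "x = (Poly_Mapping.single \<mu> 1 :: 'r laurent)"
  have x: "Poly_Mapping.keys x \<subseteq> down_set n \<mu>" "lk x \<mu> = 1" by (simp_all add: x_def down_set_refl[OF n1 \<mu>])
  define y where "y = Y i x + const (- diag \<mu> i) * x"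
  have "Poly_Mapping.keys y \<subseteq> down_set n \<mu>"
    using keys_Y[OF i down_closed_down_set[OF n1 \<mu>] x(1)] x(1)
    unfolding keys_subset_iff by (simp add: y_def lookup_add lookup_const_mult)
  moreover have "lk y \<mu> = 0"
    using Y_triangular(1)[of i \<mu>] i \<mu> by (simp add: y_def lookup_add lookup_const_mult x(2)) (simp add: x_def)
  ultimately have "proj I \<nu>s y = 0" by (rule proj_lower)
  then have "Y i (proj I \<nu>s x) + const (- diag \<mu> i) * proj I \<nu>s x = 0"
    unfolding y_def proj_linear Y_proj[OF i] .
  then show ?thesis unfolding x_def by (simp add: rhomD[OF rhom_const])
qed

text \<open>The monomial of \<open>\<mu>\<close> differs from \<open>f\<close> by lower terms, which
  are killed, and \<open>proj\<close> acts on \<open>f\<close> by the scalar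
  \<open>gap\<close>.\<close>

lemma proj_single_eigen:
  assumes "Poly_Mapping.keys f \<subseteq> down_set n \<mu>" "lk f \<mu> = 1"
    and e: "\<And>i. i \<in> {1..n} \<Longrightarrow> Y i f = const (diag \<mu> i) * f"
  shows "proj I \<nu>s (Poly_Mapping.single \<mu> 1) = const (gap \<mu> \<nu>s) * f"
proof -
  define y where "y = Poly_Mapping.single \<mu> 1 + const (-1) * f"
  have "Poly_Mapping.keys y \<subseteq> down_set n \<mu>"
    using assms(1) down_set_refl[OF n1 \<mu>]
    by (auto simp: y_def in_keys_iff lookup_add lookup_const_mult lookup_single when_def split: if_splits)
  moreover have "lk y \<mu> = 0" by (simp add: y_def lookup_add lookup_const_mult assms(2))
  ultimately have "proj I \<nu>s y = 0" by (rule proj_lower)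
  then have "proj I \<nu>s (Poly_Mapping.single \<mu> 1) + const (-1) * proj I \<nu>s f = 0"
    unfolding y_def proj_linear .
  moreover have "proj I \<nu>s f = const (gap \<mu> \<nu>s) * f" by (rule proj_eigen[OF e])
  ultimately show ?thesis by (simp add: rhomD[OF rhom_const])
qed

end

end

end

text \<open>Change of coefficients. The embedding of A into K and the reduction modulo
  \<open>s\<close> are the two instances.\<close>

locale params_hom = koornwinder_params n P Pi for n and P Pi :: "param \<Rightarrow> 'r::idom" +
  fixes h :: "'r \<Rightarrow> 's::idom"
  assumes h: "rhom h"
begin

sublocale N: koornwinder_params n "\<lambda>p. h (P p)" "\<lambda>p. h (Pi p)"
  by standard (use n_ge in \<open>simp_all add: P_Pi rhomD(1)[OF h] flip: rhomD(3)[OF h]\<close>)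

abbreviation "hm \<equiv> Poly_Mapping.map h :: 'r laurent \<Rightarrow> 's laurent"

lemmas hm = rhomD[OF rhom_map[OF h]]

lemma hm_single: "hm (Poly_Mapping.single \<mu> c) = Poly_Mapping.single \<mu> (h c)"
  by (simp add: rhomD(4)[OF h])

lemma hm_tau: "N.tau i = h (tau i)" "N.taui i = h (taui i)"
  by (simp_all add: N.tau_def N.taui_def tau_def taui_def)

lemma hm_Zm: "hm (Zm i r) = N.Zm i r"
  by (simp add: Zm_def N.Zm_def hm_single zc_def N.zc_def qpow_def N.qpow_def rhom_upow[OF h] rhomD[OF h])

lemma hm_geo: "hm (geo i d) = N.geo i d"
  by (simp add: geo_def N.geo_def hm rhom_sum[OF rhom_map[OF h]] hm_Zm)

lemma hm_num: "hm (num i) = N.num i"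
  by (simp add: num_def N.num_def hm map_const[OF h] map_xpow[OF h] rhomD[OF h])

lemma hm_del: "hm (del i f) = N.del i (hm f)"
proof (induction f rule: poly_mapping_additive_induct)
  case (single \<mu> c)
  show ?case by (simp add: del_single N.del_single hm hm_geo hm_single)
qed (simp_all add: hm del_add N.del_add)

lemma hm_T: "hm (T i f) = N.T i (hm f)"
  by (simp add: T_def N.T_def hm hm_num hm_del map_const[OF h] hm_tau)

lemma hm_Ti: "hm (Ti i f) = N.Ti i (hm f)"
  by (simp add: Ti_def N.Ti_def hm hm_T map_const[OF h] hm_tau rhomD[OF h])

lemma hm_Y: "hm (Y i f) = N.Y i (hm f)"
proof -
  have "hm (compose_list (map T is) f) = compose_list (map N.T is) (hm f)"
    "hm (compose_list (map Ti is) f) = compose_list (map N.Ti is) (hm f)" for "is" f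
    by (induction "is") (simp_all add: hm_T hm_Ti)
  then show ?thesis by (simp add: Y_def N.Y_def hm_T)
qed

text \<open>Compares the leading coefficients of \<open>Y i\<close> on a monomial before and after
  the change of coefficients.\<close>

lemma h_diag: "i \<in> {1..n} \<Longrightarrow> \<mu> \<in> lattice n \<Longrightarrow> h (diag \<mu> i) = N.diag \<mu> i"
  using Y_triangular(1)[of i \<mu>] N.Y_triangular(1)[of i \<mu>] hm_Y[of i "Poly_Mapping.single \<mu> 1"]
  by (metis atLeastAtMost_iff hm_single lookup_map_rhom[OF h] rhomD(1)[OF h])

lemma hm_proj:
  assumes "\<And>\<nu>. I \<nu> \<in> {1..n}" "set \<nu>s \<subseteq> lattice n"
  shows "hm (proj I \<nu>s f) = N.proj I \<nu>s (hm f)"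
  using assms(2)
  by (induction \<nu>s) (simp_all add: shifted_def N.shifted_def hm hm_Y map_const[OF h] h_diag[OF assms(1)])

lemma h_gap:
  assumes I: "\<And>\<nu>. I \<nu> \<in> {1..n}" "set \<nu>s \<subseteq> lattice n" "\<mu> \<in> lattice n"
  shows "h (gap I \<mu> \<nu>s) = N.gap I \<mu> \<nu>s"
  using assms(2)
  by (induction \<nu>s) (simp_all add: gap_def[OF I(1)] N.gap_def[OF I(1)] rhomD[OF h] h_diag[OF I(1)] I(3))

end

section \<open>Triangularity of the product\<close>

text \<open>Collects what is multiplicative in products and implies triangularity: a leading
  monomial for \<open>ple\<close>, and for each set \<open>S\<close> a bound on the absolute
  exponents, to be compared with \<open>maxsum\<close>.\<close>

definition dominated :: "nat \<Rightarrow> 'a::comm_ring_1 laurent \<Rightarrow> weight \<Rightarrow> (nat set \<Rightarrow> int) \<Rightarrow> bool" where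
  "dominated n f \<mu> B \<longleftrightarrow> \<mu> \<in> lattice n \<and> lk f \<mu> = 1 \<and>
     (\<forall>\<nu>\<in>Poly_Mapping.keys f. \<nu> \<in> lattice n \<and> ple n \<nu> \<mu> \<and> (\<forall>S. finite S \<longrightarrow> (\<Sum>i\<in>S. \<bar>lk \<nu> i\<bar>) \<le> B S))"

lemma dominated_1: "dominated n 1 0 (\<lambda>_. 0)"
  by (auto simp: dominated_def lookup_one latticeI in_keys_iff when_def split: if_splits)

lemma ple_add: "ple n a b \<Longrightarrow> ple n c d \<Longrightarrow> ple n (a + c) (b + d)"
  by (auto simp: ple_def psum_add intro: add_mono)

lemma ple_add_eq:
  assumes "a \<in> lattice n" "b \<in> lattice n" "c \<in> lattice n" "d \<in> lattice n" "ple n a b" "ple n c d" "a + c = b + d"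
  shows "a = b \<and> c = d"
proof -
  have e: "psum j a + psum j c = psum j b + psum j d" for j using assms(7) by (metis psum_add)
  have "ple n b a" "ple n d c" unfolding ple_def using assms(5,6) e unfolding ple_def by (smt (verit))+
  then show ?thesis using assms by (auto intro: ple_antisym)
qed

lemma keys_multE:
  assumes "\<theta> \<in> Poly_Mapping.keys (f * g)"
  obtains a b where "a \<in> Poly_Mapping.keys f" "b \<in> Poly_Mapping.keys g" "\<theta> = a + b"
  using assms keys_mult[of f g] by blast

lemma lookup_mult_unique:
  fixes f g :: "'a::comm_monoid_add \<Rightarrow>\<^sub>0 'b::comm_ring_1"
  assumes ne: "\<And>a b. a \<in> Poly_Mapping.keys f \<Longrightarrow> b \<in> Poly_Mapping.keys g \<Longrightarrow> a + b = \<mu> + \<nu> \<Longrightarrow> a = \<mu> \<and> b = \<nu>"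
  shows "lk (f * g) (\<mu> + \<nu>) = lk f \<mu> * lk g \<nu>"
proof (cases "lk f \<mu> = 0 \<or> lk g \<nu> = 0")
  case True
  have "\<mu> + \<nu> \<notin> Poly_Mapping.keys (f * g)"
  proof
    assume "\<mu> + \<nu> \<in> Poly_Mapping.keys (f * g)"
    then obtain a b where "a \<in> Poly_Mapping.keys f" "b \<in> Poly_Mapping.keys g" "\<mu> + \<nu> = a + b" by (rule keys_multE)
    then show False using ne[of a b] True by (auto simp: in_keys_iff)
  qed
  then show ?thesis using True by (auto simp: in_keys_iff)
next
  case False
  define f' where "f' = f - Poly_Mapping.single \<mu> (lk f \<mu>)"
  define g' where "g' = g - Poly_Mapping.single \<nu> (lk g \<nu>)"
  have kf: "a \<in> Poly_Mapping.keys f \<and> a \<noteq> \<mu>" if "a \<in> Poly_Mapping.keys f'" for a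
    using that by (auto simp: f'_def in_keys_iff lookup_minus lookup_single when_def split: if_splits)
  have kg: "b \<in> Poly_Mapping.keys g \<and> b \<noteq> \<nu>" if "b \<in> Poly_Mapping.keys g'" for b
    using that by (auto simp: g'_def in_keys_iff lookup_minus lookup_single when_def split: if_splits)
  have "\<mu> + \<nu> \<notin> Poly_Mapping.keys (f' * g)"
  proof
    assume "\<mu> + \<nu> \<in> Poly_Mapping.keys (f' * g)"
    then obtain a b where "a \<in> Poly_Mapping.keys f'" "b \<in> Poly_Mapping.keys g" "\<mu> + \<nu> = a + b" by (rule keys_multE)
    then show False using kf[of a] ne[of a b] by simp
  qed
  moreover have "\<mu> + \<nu> \<notin> Poly_Mapping.keys (Poly_Mapping.single \<mu> (lk f \<mu>) * g')"
  proof
    assume "\<mu> + \<nu> \<in> Poly_Mapping.keys (Poly_Mapping.single \<mu> (lk f \<mu>) * g')"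
    then obtain a b where ab: "a \<in> Poly_Mapping.keys (Poly_Mapping.single \<mu> (lk f \<mu>))" "b \<in> Poly_Mapping.keys g'" "\<mu> + \<nu> = a + b"
      by (rule keys_multE)
    then have "a = \<mu>" by (simp split: if_splits)
    then show False using ab False kg[of b] ne[of \<mu> b] by (simp add: in_keys_iff)
  qed
  moreover have "f * g = f' * g + Poly_Mapping.single \<mu> (lk f \<mu>) * g' + Poly_Mapping.single (\<mu> + \<nu>) (lk f \<mu> * lk g \<nu>)"
  proof -
    have "f' * g + Poly_Mapping.single \<mu> (lk f \<mu>) * g' + Poly_Mapping.single \<mu> (lk f \<mu>) * Poly_Mapping.single \<nu> (lk g \<nu>) = f * g"
      unfolding f'_def g'_def by (simp add: algebra_simps)
    then show ?thesis by (simp add: mult_single)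
  qed
  ultimately show ?thesis by (simp add: lookup_add in_keys_iff)
qed

lemma dominated_mult:
  assumes f: "dominated n f \<mu> B" and g: "dominated n g \<nu> C"
  shows "dominated n (f * g) (\<mu> + \<nu>) (\<lambda>S. B S + C S)"
proof -
  have l: "\<mu> \<in> lattice n" "\<nu> \<in> lattice n" using f g by (auto simp: dominated_def)
  have ne: "a = \<mu> \<and> b = \<nu>" if "a \<in> Poly_Mapping.keys f" "b \<in> Poly_Mapping.keys g" "a + b = \<mu> + \<nu>" for a b
    using that f g l by (intro ple_add_eq[of a n \<mu> b \<nu>]) (auto simp: dominated_def)
  have "lk (f * g) (\<mu> + \<nu>) = lk f \<mu> * lk g \<nu>" by (rule lookup_mult_unique) (rule ne)
  then have "lk (f * g) (\<mu> + \<nu>) = 1" using f g by (simp add: dominated_def)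
  moreover have "\<theta> \<in> lattice n \<and> ple n \<theta> (\<mu> + \<nu>) \<and> (\<forall>S. finite S \<longrightarrow> (\<Sum>i\<in>S. \<bar>lk \<theta> i\<bar>) \<le> B S + C S)"
    if t: "\<theta> \<in> Poly_Mapping.keys (f * g)" for \<theta>
  proof -
    obtain a b where ab: "a \<in> Poly_Mapping.keys f" "b \<in> Poly_Mapping.keys g" "\<theta> = a + b" using t by (rule keys_multE)
    have fa: "a \<in> lattice n" "ple n a \<mu>" "\<And>S. finite S \<Longrightarrow> (\<Sum>i\<in>S. \<bar>lk a i\<bar>) \<le> B S"
      and gb: "b \<in> lattice n" "ple n b \<nu>" "\<And>S. finite S \<Longrightarrow> (\<Sum>i\<in>S. \<bar>lk b i\<bar>) \<le> C S"
      using f g ab by (auto simp: dominated_def)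
    have "(\<Sum>i\<in>S. \<bar>lk \<theta> i\<bar>) \<le> B S + C S" if "finite S" for S
    proof -
      have "(\<Sum>i\<in>S. \<bar>lk \<theta> i\<bar>) \<le> (\<Sum>i\<in>S. \<bar>lk a i\<bar> + \<bar>lk b i\<bar>)" unfolding ab(3) by (intro sum_mono) (simp add: lookup_add)
      also have "\<dots> \<le> B S + C S" unfolding sum.distrib using fa(3)[OF that] gb(3)[OF that] by simp
      finally show ?thesis .
    qed
    then show ?thesis using fa gb ab(3) by (simp add: ple_add lattice_add)
  qed
  ultimately show ?thesis using l unfolding dominated_def by (auto simp: lattice_add)
qed

lemma dominated_prod:
  assumes "finite X" "\<And>x. x \<in> X \<Longrightarrow> dominated n (f x) (\<mu> x) (B x)"
  shows "dominated n (\<Prod>x\<in>X. f x) (\<Sum>x\<in>X. \<mu> x) (\<lambda>S. \<Sum>x\<in>X. B x S)"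
  using assms by (induction X rule: finite_induct) (simp_all add: dominated_1 dominated_mult)

text \<open>Multiplied out, only the monomials \<open>x_i\<close>, \<open>x_j\<close> and their
  inverses occur. Hence a set collects at most \<open>1\<close> from each, and only if it meets
  \<open>{i, j}\<close>.\<close>

lemma dominated_factor:
  fixes c d :: "'a::comm_ring_1"
  assumes ij: "1 \<le> i" "i < j" "j \<le> n"
  shows "dominated n ((xpow i 1 - const c * xpow j 1) * (1 - const d * xpow i (-1) * xpow j (-1)))
    (Poly_Mapping.single i 1) (\<lambda>S. of_bool (i \<in> S \<or> j \<in> S))"
proof -
  define f where "f = (xpow i 1 - const c * xpow j 1) * (1 - const d * xpow i (-1) * xpow j (-1))"
  have f: "f = Poly_Mapping.single (Poly_Mapping.single i 1) 1 - Poly_Mapping.single (Poly_Mapping.single j 1) c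
    - Poly_Mapping.single (Poly_Mapping.single j (-1)) d + Poly_Mapping.single (Poly_Mapping.single i (-1)) (c * d)"
  proof -
    have s: "Poly_Mapping.single p 1 + (Poly_Mapping.single p (-1) + \<theta>) = (\<theta> :: weight)" for p \<theta>
      by (simp flip: single_add add.assoc)
    have s': "Poly_Mapping.single p 1 + (\<theta> + Poly_Mapping.single p (-1)) = (\<theta> :: weight)" for p \<theta>
      using s[of p \<theta>] by (simp only: add.commute)
    have 1: "xpow i 1 * (const d * xpow i (-1) * xpow j (-1)) = Poly_Mapping.single (Poly_Mapping.single j (-1)) d"
      by (simp only: xpow_def const_def mult_single add_0_left add.assoc s mult_1_left mult_1_right)
    have 2: "const c * xpow j 1 * (const d * xpow i (-1) * xpow j (-1)) = Poly_Mapping.single (Poly_Mapping.single i (-1)) (c * d)"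
      by (simp only: xpow_def const_def mult_single add_0_left add.assoc s' mult_1_left mult_1_right)
    have 3: "const c * xpow j 1 = Poly_Mapping.single (Poly_Mapping.single j 1) c" "xpow i 1 = Poly_Mapping.single (Poly_Mapping.single i 1) (1::'a)"
      by (simp_all add: xpow_def const_def mult_single)
    have "f = xpow i 1 - const c * xpow j 1 - xpow i 1 * (const d * xpow i (-1) * xpow j (-1))
      + const c * xpow j 1 * (const d * xpow i (-1) * xpow j (-1))"
      unfolding f_def by (simp only: left_diff_distrib right_diff_distrib mult_1_right) simp
    then show ?thesis unfolding 1 2 unfolding 3 .
  qed
  have d: "Poly_Mapping.single p r \<noteq> Poly_Mapping.single i (1::int)" if "p \<noteq> i \<or> r \<noteq> 1" "r \<noteq> 0" for p r
  proof
    assume "Poly_Mapping.single p r = Poly_Mapping.single i (1::int)"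
    then have "lk (Poly_Mapping.single p r) p = lk (Poly_Mapping.single i 1) p" by simp
    then show False using that by (auto simp: lookup_single when_def split: if_splits)
  qed
  have lat: "Poly_Mapping.single p r \<in> lattice n" if "p = i \<or> p = j" for p r
    using that ij by (intro latticeI) (auto simp: lookup_single when_def)
  have a: "(\<Sum>x\<in>S. \<bar>lk (Poly_Mapping.single p r) x\<bar>) = (if p \<in> S then \<bar>r\<bar> else 0)" if "finite S" for S p and r :: int
  proof -
    have "(\<Sum>x\<in>S. \<bar>lk (Poly_Mapping.single p r) x\<bar>) = (\<Sum>x\<in>S. if p = x then \<bar>r\<bar> else 0)"
      by (intro sum.cong) (auto simp: lookup_single when_def)
    then show ?thesis using that by (simp add: sum.delta)
  qed
  have "lk f (Poly_Mapping.single i 1) = 1"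
    unfolding f using ij d[of j 1] d[of j "-1"] d[of i "-1"] by (simp add: lookup_add lookup_minus lookup_single)
  moreover have "\<nu> \<in> lattice n \<and> ple n \<nu> (Poly_Mapping.single i 1) \<and> (\<forall>S. finite S \<longrightarrow> (\<Sum>x\<in>S. \<bar>lk \<nu> x\<bar>) \<le> of_bool (i \<in> S \<or> j \<in> S))"
    if "\<nu> \<in> Poly_Mapping.keys f" for \<nu>
  proof -
    have "\<exists>p r. \<nu> = Poly_Mapping.single p r \<and> ((p, r) \<in> {(i, 1), (j, 1), (j, -1), (i, -1)})"
      using that unfolding f in_keys_iff
      by (auto simp: lookup_add lookup_minus lookup_single when_def split: if_splits)
    then show ?thesis using ij lat by (auto simp: ple_def psum_single a)
  qed
  ultimately show ?thesis using lat[of i 1] unfolding f_def dominated_def by auto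
qed

text \<open>When the elements of \<open>S\<close> are added one by one, a new element meets
  \<open>m - 1 - r\<close> elements outside, where \<open>r\<close> elements were present before;
  its pairs with those are already counted.\<close>

lemma card_touching_pairs:
  assumes "S \<subseteq> {lo<..lo + m}"
  shows "int (card {p \<in> pairs lo (lo + m). fst p \<in> S \<or> snd p \<in> S}) \<le> (\<Sum>r<card S. int m - 1 - int r)"
proof -
  have "finite S" using assms finite_subset by blast
  then show ?thesis using assms
  proof (induction S rule: finite_induct)
    case (insert i S)
    let ?p = "pairs lo (lo + m)" and ?R = "{lo<..lo + m} - insert i S"
    let ?t = "\<lambda>S. {p \<in> ?p. fst p \<in> S \<or> snd p \<in> S}"
    have cR: "int (card ?R) = int m - 1 - int (card S)"
    proof -
      have "card (insert i S) \<le> m" using card_mono[OF _ insert.prems] by simp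
      then show ?thesis using insert.hyps insert.prems by (subst card_Diff_subset) auto
    qed
    have "?t (insert i S) \<subseteq> ?t S \<union> (\<lambda>j. (min i j, max i j)) ` ?R"
    proof
      fix p assume "p \<in> ?t (insert i S)"
      then obtain a b where p: "p = (a, b)" "lo < a" "a < b" "b \<le> lo + m" "a \<in> insert i S \<or> b \<in> insert i S"
        by (auto simp: pairs_def)
      consider "a \<in> S \<or> b \<in> S" | "a = i" "b \<notin> S" | "b = i" "a \<notin> S" using p(5) by auto
      then show "p \<in> ?t S \<union> (\<lambda>j. (min i j, max i j)) ` ?R"
      proof cases
        case 1
        then show ?thesis using p by (auto simp: pairs_def)
      next
        case 2
        then have "b \<in> ?R" "p = (min i b, max i b)" using p by auto
        then show ?thesis by blast
      next
        case 3
        then have "a \<in> ?R" "p = (min i a, max i a)" using p by auto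
        then show ?thesis by blast
      qed
    qed
    then have "card (?t (insert i S)) \<le> card (?t S \<union> (\<lambda>j. (min i j, max i j)) ` ?R)" by (intro card_mono) auto
    also have "\<dots> \<le> card (?t S) + card ?R" by (rule order_trans[OF card_Un_le]) (simp add: card_image_le)
    finally have "int (card (?t (insert i S))) \<le> int (card (?t S)) + int (card ?R)" by linarith
    then show ?case using insert by (simp add: cR)
  qed simp
qed

lemma lookup_staircase_weight:
  "lk (staircase_weight k m) i = (if i \<in> {1..k * m} then int m - 1 - int ((i - 1) mod m) else 0)"
proof -
  have "lk (staircase_weight k m) i = (\<Sum>j\<in>{1..k * m}. if i = j then int m - 1 - int ((i - 1) mod m) else 0)"
    unfolding staircase_weight_def lookup_sum by (intro sum.cong) (auto simp: lookup_single when_def)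
  then show ?thesis by (simp add: sum.delta)
qed

text \<open>The leading monomial of the factor for \<open>(i, j)\<close> is \<open>x_i\<close>, so
  the exponent of \<open>x_i\<close> counts the later indices in the block of
  \<open>i\<close>.\<close>

lemma staircase_weight_pairs:
  assumes m: "1 \<le> m"
  shows "(\<Sum>l\<in>{1..k}. \<Sum>p\<in>pairs (m * (l - 1)) (m * l). Poly_Mapping.single (fst p) 1) = staircase_weight k m"
proof (rule poly_mapping_eqI)
  fix i
  have "lk (\<Sum>p\<in>pairs (m * (l - 1)) (m * l). Poly_Mapping.single (fst p) (1::int)) i
      = (if m * (l - 1) < i \<and> i \<le> m * l then int (m * l - i) else 0)" if "l \<in> {1..k}" for l
  proof -
    let ?P = "pairs (m * (l - 1)) (m * l)"
    have "lk (\<Sum>p\<in>?P. Poly_Mapping.single (fst p) (1::int)) i = (\<Sum>p\<in>?P. if fst p = i then 1 else 0)"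
      unfolding lookup_sum by (intro sum.cong) (auto simp: lookup_single when_def)
    also have "\<dots> = int (card {p \<in> ?P. fst p = i})" by (simp add: sum.If_cases Int_def)
    also have "{p \<in> ?P. fst p = i} = (if m * (l - 1) < i then (\<lambda>b. (i, b)) ` {i<..m * l} else {})"
      by (auto simp: pairs_def)
    also have "int (card \<dots>) = (if m * (l - 1) < i \<and> i \<le> m * l then int (m * l - i) else 0)"
      by (auto simp: card_image inj_on_def)
    finally show ?thesis .
  qed
  then have "lk (\<Sum>l\<in>{1..k}. \<Sum>p\<in>pairs (m * (l - 1)) (m * l). Poly_Mapping.single (fst p) (1::int)) i
      = (\<Sum>l\<in>{1..k}. if m * (l - 1) < i \<and> i \<le> m * l then int (m * l - i) else 0)"
    unfolding lookup_sum[of _ "{1..k}"] by (intro sum.cong) auto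
  also have "\<dots> = (\<Sum>l\<in>{1..k}. if l = Suc ((i - 1) div m) \<and> 1 \<le> i then int m - 1 - int ((i - 1) mod m) else 0)"
  proof (rule sum.cong[OF refl])
    fix l assume l: "l \<in> {1..k}"
    then obtain u where u: "l = Suc u" by (cases l) auto
    have "m * u < i \<and> i \<le> m * u + m \<longleftrightarrow> u = (i - 1) div m \<and> 1 \<le> i"
    proof
      assume a: "m * u < i \<and> i \<le> m * u + m"
      have "(i - 1) div m = u" by (rule div_nat_eqI) (use a m in \<open>auto simp: mult.commute\<close>)
      then show "u = (i - 1) div m \<and> 1 \<le> i" using a by auto
    next
      assume a: "u = (i - 1) div m \<and> 1 \<le> i"
      have "i - 1 = m * u + (i - 1) mod m" "(i - 1) mod m < m" using a m by auto
      then show "m * u < i \<and> i \<le> m * u + m" using a by linarith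
    qed
    moreover have "int (m * u + m - i) = int m - 1 - int ((i - 1) mod m)" if "u = (i - 1) div m" "1 \<le> i"
    proof -
      have "i - 1 = m * u + (i - 1) mod m" "(i - 1) mod m < m" using that m by auto
      then show ?thesis using that(2) by linarith
    qed
    ultimately show "(if m * (l - 1) < i \<and> i \<le> m * l then int (m * l - i) else 0) =
        (if l = Suc ((i - 1) div m) \<and> 1 \<le> i then int m - 1 - int ((i - 1) mod m) else 0)"
      by (auto simp: u add.commute)
  qed
  also have "\<dots> = (if i \<in> {1..k * m} then int m - 1 - int ((i - 1) mod m) else 0)"
  proof (cases "1 \<le> i")
    case True
    have "(i - 1) div m < k \<longleftrightarrow> i \<le> k * m"
      using m True by (subst div_less_iff_less_mult) auto
    then show ?thesis using True by (auto simp: sum.delta Suc_le_eq)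
  qed auto
  finally show "lk (\<Sum>l\<in>{1..k}. \<Sum>p\<in>pairs (m * (l - 1)) (m * l). Poly_Mapping.single (fst p) (1::int)) i = lk (staircase_weight k m) i"
    unfolding lookup_staircase_weight .
qed

lemma staircase_weight_lattice: "staircase_weight k m \<in> lattice (k * m)"
  by (rule latticeI) (metis lookup_staircase_weight)

context koornwinder_params
begin

context
  fixes k m :: nat
  assumes n: "n = k * m" and m1: "1 \<le> m"
begin

text \<open>Take for \<open>S'\<close> the same number of positions in each block as
  \<open>S\<close> has, but at its front, where the staircase entries are
  \<open>m - 1, m - 2, ...\<close>. These match the bound of
  \<open>card_touching_pairs\<close>.\<close>

lemma touching_pairs_le:
  assumes S: "S \<subseteq> {1..n}"
  shows "\<exists>S'\<subseteq>{1..n}. card S' = card S \<and>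
    (\<Sum>l\<in>{1..k}. \<Sum>p\<in>pairs (m * (l - 1)) (m * l). of_bool (fst p \<in> S \<or> snd p \<in> S)) \<le> (\<Sum>i\<in>S'. \<bar>lk (staircase_weight k m) i\<bar>)"
proof -
  define b where "b l = {m * (l - 1)<..m * l}" for l
  define s where "s l = card (S \<inter> b l)" for l
  define S' where "S' l = {m * (l - 1)<..m * (l - 1) + s l}" for l
  have ml: "m * l = m * (l - 1) + m" if "l \<in> {1..k}" for l using that by (cases l) auto
  have bS: "S = (\<Union>l\<in>{1..k}. S \<inter> b l)"
  proof
    show "S \<subseteq> (\<Union>l\<in>{1..k}. S \<inter> b l)"
    proof
      fix i assume i: "i \<in> S"
      let ?u = "(i - 1) div m"
      have i1: "1 \<le> i" "i \<le> k * m" using i S n by auto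
      have "i - 1 = m * ?u + (i - 1) mod m" "(i - 1) mod m < m" using m1 by auto
      then have "m * ?u < i" "i \<le> m * ?u + m" using i1 by linarith+
      moreover have "?u < k" using m1 i1 by (subst div_less_iff_less_mult) auto
      ultimately have "Suc ?u \<in> {1..k} \<and> i \<in> S \<inter> b (Suc ?u)" using i by (auto simp: b_def add.commute)
      then show "i \<in> (\<Union>l\<in>{1..k}. S \<inter> b l)" by blast
    qed
  qed auto
  have dis: "b l \<inter> b l' = {}" if "l \<noteq> l'" for l l'
    using block_index[OF m1] that by (fastforce simp: b_def)
  have finS: "finite S" using S finite_subset by blast
  have sm: "s l \<le> m" if "l \<in> {1..k}" for l
  proof -
    have "s l \<le> card (b l)" unfolding s_def by (intro card_mono) (auto simp: b_def)
    then show ?thesis using ml[OF that] by (simp add: b_def)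
  qed
  have S'b: "S' l \<subseteq> b l" if "l \<in> {1..k}" for l using sm[OF that] ml[OF that] by (auto simp: S'_def b_def)
  have bn: "b l \<subseteq> {1..n}" if "l \<in> {1..k}" for l
  proof -
    have "m * l \<le> n" using that mult_le_mono2[of l k m] by (simp add: n mult.commute)
    then show ?thesis by (auto simp: b_def)
  qed
  have disS': "S' l \<inter> S' l' = {}" if "l \<in> {1..k}" "l' \<in> {1..k}" "l \<noteq> l'" for l l'
    using S'b that dis by blast
  have "card (\<Union>l\<in>{1..k}. S' l) = (\<Sum>l\<in>{1..k}. card (S' l))"
    by (rule card_UN_disjoint) (use disS' in \<open>auto simp: S'_def\<close>)
  also have "\<dots> = (\<Sum>l\<in>{1..k}. card (S \<inter> b l))" by (simp add: S'_def s_def)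
  also have "\<dots> = card (\<Union>l\<in>{1..k}. S \<inter> b l)"
    by (rule card_UN_disjoint[symmetric]) (use dis finS in auto)
  finally have 1: "card (\<Union>l\<in>{1..k}. S' l) = card S" using bS by simp
  have 2: "(\<Sum>p\<in>pairs (m * (l - 1)) (m * l). of_bool (fst p \<in> S \<or> snd p \<in> S)) \<le> (\<Sum>i\<in>S' l. \<bar>lk (staircase_weight k m) i\<bar>)"
    if l: "l \<in> {1..k}" for l
  proof -
    let ?lo = "m * (l - 1)"
    have "(\<Sum>p\<in>pairs ?lo (m * l). of_bool (fst p \<in> S \<or> snd p \<in> S)) = int (card {p \<in> pairs ?lo (m * l). fst p \<in> S \<or> snd p \<in> S})"
      by (simp add: sum.If_cases Int_def of_bool_def)
    also have "{p \<in> pairs ?lo (m * l). fst p \<in> S \<or> snd p \<in> S} = {p \<in> pairs ?lo (?lo + m). fst p \<in> S \<inter> b l \<or> snd p \<in> S \<inter> b l}"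
      unfolding ml[OF l] b_def by (auto simp: pairs_def)
    also have "int (card \<dots>) \<le> (\<Sum>r<s l. int m - 1 - int r)"
      unfolding s_def by (rule card_touching_pairs) (use ml[OF l] in \<open>auto simp: b_def\<close>)
    also have "\<dots> = (\<Sum>i\<in>S' l. \<bar>lk (staircase_weight k m) i\<bar>)"
    proof (rule sum.reindex_bij_witness[where i = "\<lambda>i. i - 1 - ?lo" and j = "\<lambda>r. ?lo + r + 1"])
      fix r assume r: "r \<in> {..<s l}"
      then have rm: "r < m" using sm[OF l] by simp
      have "?lo + r + 1 \<in> b l" using rm ml[OF l] by (auto simp: b_def)
      then have "?lo + r + 1 \<in> {1..k * m}" using bn[OF l] n by auto
      moreover have "(?lo + r + 1 - 1) mod m = r" using rm by simp
      ultimately show "\<bar>lk (staircase_weight k m) (?lo + r + 1)\<bar> = int m - 1 - int r"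
        using rm by (simp add: lookup_staircase_weight)
    qed (auto simp: S'_def)
    finally show ?thesis .
  qed
  have "(\<Sum>l\<in>{1..k}. \<Sum>p\<in>pairs (m * (l - 1)) (m * l). of_bool (fst p \<in> S \<or> snd p \<in> S)) \<le> (\<Sum>l\<in>{1..k}. \<Sum>i\<in>S' l. \<bar>lk (staircase_weight k m) i\<bar>)"
    by (rule sum_mono) (rule 2)
  also have "\<dots> = (\<Sum>i\<in>(\<Union>l\<in>{1..k}. S' l). \<bar>lk (staircase_weight k m) i\<bar>)"
    by (rule sum.UNION_disjoint[symmetric]) (use disS' in \<open>auto simp: S'_def\<close>)
  finally have "(\<Sum>l\<in>{1..k}. \<Sum>p\<in>pairs (m * (l - 1)) (m * l). of_bool (fst p \<in> S \<or> snd p \<in> S))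
    \<le> (\<Sum>i\<in>(\<Union>l\<in>{1..k}. S' l). \<bar>lk (staircase_weight k m) i\<bar>)" .
  moreover have "(\<Union>l\<in>{1..k}. S' l) \<subseteq> {1..n}" using S'b bn by blast
  ultimately show ?thesis using 1 by blast
qed

lemma Fprod_triangular:
  "Poly_Mapping.keys (Fprod k m) \<subseteq> down_set n (staircase_weight k m)" "lk (Fprod k m) (staircase_weight k m) = 1"
proof -
  let ?B = "\<lambda>S. \<Sum>l\<in>{1..k}. \<Sum>p\<in>pairs (m * (l - 1)) (m * l). of_bool (fst p \<in> S \<or> snd p \<in> S)"
  have "dominated n (Fprod k m) (\<Sum>l\<in>{1..k}. \<Sum>p\<in>pairs (m * (l - 1)) (m * l). Poly_Mapping.single (fst p) 1) ?B"
    unfolding Fprod_def case_prod_unfold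
  proof (intro dominated_prod dominated_factor)
    fix l p assume l: "l \<in> {1..k}" and p: "p \<in> pairs (m * (l - 1)) (m * l)"
    have "m * l \<le> n" using l mult_le_mono2[of l k m] n by (simp add: mult.commute)
    then show "1 \<le> fst p" "fst p < snd p" "snd p \<le> n" using p by (auto simp: pairs_def)
  qed auto
  then have d: "dominated n (Fprod k m) (staircase_weight k m) ?B" unfolding staircase_weight_pairs[OF m1] .
  then show "lk (Fprod k m) (staircase_weight k m) = 1" by (simp add: dominated_def)
  have lat: "staircase_weight k m \<in> lattice n" using staircase_weight_lattice[of k m] n by simp
  show "Poly_Mapping.keys (Fprod k m) \<subseteq> down_set n (staircase_weight k m)"
  proof
    fix \<nu> assume "\<nu> \<in> Poly_Mapping.keys (Fprod k m)"
    then have \<nu>: "\<nu> \<in> lattice n" "ple n \<nu> (staircase_weight k m)" "\<And>S. finite S \<Longrightarrow> (\<Sum>i\<in>S. \<bar>lk \<nu> i\<bar>) \<le> ?B S"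
      using d by (auto simp: dominated_def)
    have "mle n \<nu> (staircase_weight k m)"
    proof (rule mleI)
      fix S assume S: "S \<subseteq> {1..n}"
      then have "(\<Sum>i\<in>S. \<bar>lk \<nu> i\<bar>) \<le> ?B S" using \<nu>(3) finite_subset by blast
      then show "\<exists>S'\<subseteq>{1..n}. card S' = card S \<and> (\<Sum>i\<in>S. \<bar>lk \<nu> i\<bar>) \<le> (\<Sum>i\<in>S'. \<bar>lk (staircase_weight k m) i\<bar>)"
        using touching_pairs_le[OF S] by (meson order_trans)
    qed
    then show "\<nu> \<in> down_set n (staircase_weight k m)"
      using \<nu> by (simp add: down_set_def wt_succeq_iff[OF n1 lat])
  qed
qed

end

end

section \<open>Specialization\<close>

text \<open>Highest and lowest degrees are additive in products, so they agree in each factor if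
  they agree in the product.\<close>

lemma factor_of_single:
  fixes p q :: "int \<Rightarrow>\<^sub>0 'a::idom"
  assumes pq: "p * q = Poly_Mapping.single a c" and c: "c \<noteq> 0"
  shows "\<exists>d e. p = Poly_Mapping.single d e"
proof -
  have nz: "p \<noteq> 0" "q \<noteq> 0" using pq c by (metis lookup_single_eq lookup_zero mult_zero_left mult_zero_right)+
  have ext: "\<mu> + \<nu> = a" if "\<mu> \<in> Poly_Mapping.keys p" "\<nu> \<in> Poly_Mapping.keys q"
    and e: "\<And>x y. x \<in> Poly_Mapping.keys p \<Longrightarrow> y \<in> Poly_Mapping.keys q \<Longrightarrow> x + y = \<mu> + \<nu> \<Longrightarrow> x = \<mu> \<and> y = \<nu>" for \<mu> \<nu>
  proof -
    have "lk (p * q) (\<mu> + \<nu>) = lk p \<mu> * lk q \<nu>" by (rule lookup_mult_unique) (rule e)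
    then have "lk (Poly_Mapping.single a c) (\<mu> + \<nu>) \<noteq> 0" using that(1,2) pq by (simp add: in_keys_iff)
    then show ?thesis by (simp add: lookup_single when_def split: if_splits)
  qed
  let ?P = "Poly_Mapping.keys p" and ?Q = "Poly_Mapping.keys q"
  have ne: "finite ?P" "?P \<noteq> {}" "finite ?Q" "?Q \<noteq> {}" using nz by auto
  have "Max ?P + Max ?Q = a"
  proof (rule ext)
    fix x y assume "x \<in> ?P" "y \<in> ?Q" "x + y = Max ?P + Max ?Q"
    moreover from this have "x \<le> Max ?P" "y \<le> Max ?Q" by simp_all
    ultimately show "x = Max ?P \<and> y = Max ?Q" by linarith
  qed (use ne in auto)
  moreover have "Min ?P + Min ?Q = a"
  proof (rule ext)
    fix x y assume "x \<in> ?P" "y \<in> ?Q" "x + y = Min ?P + Min ?Q"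
    moreover from this have "Min ?P \<le> x" "Min ?Q \<le> y" by simp_all
    ultimately show "x = Min ?P \<and> y = Min ?Q" by linarith
  qed (use ne in auto)
  moreover have "Min ?P \<le> Max ?P" "Min ?Q \<le> Max ?Q" using ne by auto
  ultimately have m: "Min ?P = Max ?P" by linarith
  have "x = Max ?P" if "x \<in> ?P" for x
    using that ne m Min_le[of ?P x] Max_ge[of ?P x] by linarith
  then have "p = Poly_Mapping.single (Max ?P) (lk p (Max ?P))"
    by (intro poly_mapping_eqI) (auto simp: lookup_single when_def in_keys_iff)
  then show ?thesis by blast
qed

text \<open>
  Grading \<open>\<A>\<close> by an additive functional \<open>f\<close> that vanishes on \<open>w\<close>, every divisor of \<open>x\<^sup>w - 1\<close> is
  homogeneous, and a homogeneous divisor of the inhomogeneous \<open>x\<^sup>v - 1\<close> divides \<open>1\<close>.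
\<close>

lemma common_divisor_unit:
  fixes f :: "(param \<Rightarrow>\<^sub>0 int) \<Rightarrow> int" and s :: ringA
  assumes f: "\<And>a b. f (a + b) = f a + f b" and w: "f w = 0" "w \<noteq> 0" and v: "f v \<noteq> 0"
    and sw: "s dvd Poly_Mapping.single w 1 - 1" and sv: "s dvd Poly_Mapping.single v 1 - 1"
  shows "s dvd 1"
proof -
  \<comment> \<open>\<open>\<Psi>\<close> records the degree as an extra exponent, and
    \<open>\<epsilon>\<close> below forgets it again.\<close>
  define \<Psi> :: "ringA \<Rightarrow> int \<Rightarrow>\<^sub>0 ringA" where "\<Psi> = lin_ext (\<lambda>e c. Poly_Mapping.single (f e) (Poly_Mapping.single e c))"
  have \<Psi>s: "\<Psi> (Poly_Mapping.single e c) = Poly_Mapping.single (f e) (Poly_Mapping.single e c)" for e c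
    unfolding \<Psi>_def by (rule lin_ext_single) simp
  have \<Psi>a: "\<Psi> (g + h) = \<Psi> g + \<Psi> h" for g h
    unfolding \<Psi>_def by (rule lin_ext_add) (simp_all add: single_add)
  have f0: "f 0 = 0" using f[of 0 0] by simp
  have one: "1 = (Poly_Mapping.single 0 1 :: ringA)" by simp
  have r: "rhom \<Psi>"
  proof (rule rhom_poly_mappingI[OF \<Psi>a])
    show "\<Psi> 1 = 1" unfolding one \<Psi>s f0 by simp
    show "\<Psi> (Poly_Mapping.single a b * Poly_Mapping.single c d) = \<Psi> (Poly_Mapping.single a b) * \<Psi> (Poly_Mapping.single c d)" for a b c d
      by (simp add: mult_single \<Psi>s f)
  qed
  define \<epsilon> :: "(int \<Rightarrow>\<^sub>0 ringA) \<Rightarrow> ringA" where "\<epsilon> = lin_ext (\<lambda>d c. c)"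
  have \<epsilon>a: "\<epsilon> (g + h) = \<epsilon> g + \<epsilon> h" for g h unfolding \<epsilon>_def by (rule lin_ext_add) simp_all
  have \<epsilon>s: "\<epsilon> (Poly_Mapping.single d c) = c" for d c unfolding \<epsilon>_def by (rule lin_ext_single) simp
  have \<epsilon>\<Psi>: "\<epsilon> (\<Psi> g) = g" for g
  proof (induction g rule: poly_mapping_additive_induct)
    case zero
    then show ?case by (simp add: rhomD(4)[OF r] \<epsilon>_def)
  qed (simp_all add: \<Psi>s \<epsilon>s \<Psi>a \<epsilon>a)
  obtain g where g: "Poly_Mapping.single w 1 - 1 = s * g" using sw by (rule dvdE)
  have "\<Psi> s * \<Psi> g = Poly_Mapping.single 0 (Poly_Mapping.single w 1 - 1)"
    using arg_cong[OF g, of \<Psi>] by (simp add: rhomD[OF r] \<Psi>s w(1) single_diff)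
  moreover have "Poly_Mapping.single w 1 - 1 \<noteq> (0 :: ringA)"
  proof
    assume "Poly_Mapping.single w 1 - 1 = (0 :: ringA)"
    then have "lk (Poly_Mapping.single w 1 :: ringA) w = lk 1 w" by simp
    then show False using w(2) by (simp add: lookup_one)
  qed
  ultimately obtain d e where de: "\<Psi> s = Poly_Mapping.single d e" using factor_of_single by blast
  then have es: "e = s" using \<epsilon>\<Psi>[of s] by (simp add: \<epsilon>s)
  obtain h where h: "Poly_Mapping.single v 1 - 1 = s * h" using sv by (rule dvdE)
  have "Poly_Mapping.single (f v) (Poly_Mapping.single v 1) - 1 = Poly_Mapping.single d s * \<Psi> h"
    using arg_cong[OF h, of \<Psi>] by (simp add: rhomD[OF r] \<Psi>s de es)
  \<comment> \<open>In degree \<open>0\<close> the left side of the equation above leaves only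
    \<open>- 1\<close>, as \<open>v\<close> has degree \<open>f v\<close>, which is nonzero; the
    right side has a multiple of \<open>s\<close> there.\<close>
  then have "lk (Poly_Mapping.single d s * \<Psi> h) 0 = - 1"
    using v by (simp add: lookup_minus lookup_one lookup_single when_def flip: \<open>_ = Poly_Mapping.single d s * \<Psi> h\<close>)
  moreover have "lk (Poly_Mapping.single d s * \<Psi> h) (d + (- d)) = s * lk (\<Psi> h) (- d)"
    by (subst lookup_mult_unique) (auto split: if_splits)
  ultimately have "s * lk (\<Psi> h) (- d) = - 1" by simp
  then have "s * (- lk (\<Psi> h) (- d)) = 1" by (simp only: mult_minus_right minus_minus)
  then show ?thesis by (metis dvd_triv_left)
qed

section \<open>Monomials in the parameters\<close>

definition varAi :: "param \<Rightarrow> ringA" where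
  "varAi p = Poly_Mapping.single (Poly_Mapping.single p (-1)) 1"

lemma varA_varAi: "varA p * varAi p = 1"
  by (simp add: varA_def varAi_def mult_single flip: single_add)

lemma varA_power: "varA p ^ j = Poly_Mapping.single (Poly_Mapping.single p (int j)) 1"
  "varAi p ^ j = Poly_Mapping.single (Poly_Mapping.single p (- int j)) 1"
  by (induction j) (simp_all add: varA_def varAi_def mult_single flip: single_add)

lemma upow_varA: "upow (varA p) (varAi p) r = Poly_Mapping.single (Poly_Mapping.single p r) 1"
  by (simp add: upow_def varA_power)

locale specialization =
  fixes n k m :: nat and s :: ringA and \<phi> :: "ringA \<Rightarrow> 'k::field"
  assumes k1: "1 \<le> k" and nk: "k + 1 \<le> n" and n: "n = k * m"
    and irr: "irreducible s" and s_dvd: "s dvd tA ^ (k + 1) * qA - 1"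
    and \<phi>: "residue_field_map s \<phi>"
begin

lemma m1: "1 \<le> m" using nk n by (cases m) auto

lemma n2: "2 \<le> n" using k1 nk by simp

lemma rhom_\<phi>: "rhom \<phi>" using \<phi> by (simp add: residue_field_map_def rhom_def)

lemma \<phi>_eq_0: "\<phi> f = 0 \<longleftrightarrow> s dvd f" using \<phi> by (simp add: residue_field_map_def)

sublocale A: koornwinder_params n varA varAi
  by standard (rule varA_varAi n2)+

sublocale K: params_hom n varA varAi to_fract
  by unfold_locales (rule rhom_to_fract)

sublocale S: params_hom n varA varAi \<phi>
  by unfold_locales (rule rhom_\<phi>)

definition lam :: weight where "lam = staircase_weight k m"

lemma lam: "lam \<in> lattice n"
  using staircase_weight_lattice[of k m] n by (simp add: lam_def)

lemma lookup_lam: "i \<in> {1..n} \<Longrightarrow> lk lam i = int m - 1 - int ((i - 1) mod m)"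
  unfolding lam_def lookup_staircase_weight n by simp

lemma lam_nonneg: assumes "i \<in> {1..n}" shows "0 \<le> lk lam i"
proof -
  have "(i - 1) mod m < m" using m1 by simp
  then show ?thesis using lookup_lam[OF assms] by linarith
qed

text \<open>Two gradings vanish on the exponent \<open>w\<close> of \<open>t^(k+1) q\<close>: the
  degree in \<open>t_n^(1/2)\<close>, and the degree in \<open>t^(1/2)\<close> minus
  \<open>k + 1\<close> times that in \<open>q^(1/2)\<close>. As \<open>s\<close> is not a unit,
  \<open>common_divisor_unit\<close> forces both to agree on the two monomials.\<close>

lemma monomial_exponents:
  assumes e: "\<phi> (Poly_Mapping.single e 1) = \<phi> (Poly_Mapping.single e' 1)"
  shows "lk e ParTn = lk e' ParTn"
    "lk e ParT - (int k + 1) * lk e ParQ = lk e' ParT - (int k + 1) * lk e' ParQ"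
proof -
  define w where "w = Poly_Mapping.single ParT (int (2 * (k + 1))) + Poly_Mapping.single ParQ (int 2)"
  have sw: "s dvd Poly_Mapping.single w 1 - 1"
  proof -
    have "tA ^ (k + 1) * qA = varA ParT ^ (2 * (k + 1)) * varA ParQ ^ 2" by (simp only: tA_def qA_def power_mult)
    also have "\<dots> = Poly_Mapping.single w 1" unfolding varA_power by (simp add: mult_single w_def)
    finally show ?thesis using s_dvd by simp
  qed
  have w0: "w \<noteq> 0"
  proof
    assume "w = 0"
    then have "lk w ParQ = 0" by simp
    then show False by (simp add: w_def lookup_add lookup_single)
  qed
  have sv: "s dvd Poly_Mapping.single (e - e') 1 - 1"
  proof -
    have "\<phi> (Poly_Mapping.single e 1 - Poly_Mapping.single e' 1) = 0" using e by (simp add: rhomD[OF rhom_\<phi>])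
    then have "s dvd (Poly_Mapping.single e 1 - Poly_Mapping.single e' 1) * Poly_Mapping.single (- e') 1"
      unfolding \<phi>_eq_0 by (rule dvd_mult2)
    then show ?thesis by (simp add: left_diff_distrib mult_single)
  qed
  have nu: "\<not> s dvd 1" using irr by (rule irreducible_not_unit)
  have g: "f e = f e'" if f: "\<And>a b. f (a + b) = f a + f b" and fw: "f w = 0" for f :: "(param \<Rightarrow>\<^sub>0 int) \<Rightarrow> int"
  proof -
    have "f (e - e') = 0" using common_divisor_unit[of f w "e - e'" s, OF f fw w0 _ sw sv] nu by blast
    then show ?thesis using f[of "e - e'" e'] by simp
  qed
  show "lk e ParTn = lk e' ParTn"
    by (rule g[of "\<lambda>e. lk e ParTn"]) (simp_all add: lookup_add w_def lookup_single)
  show "lk e ParT - (int k + 1) * lk e ParQ = lk e' ParT - (int k + 1) * lk e' ParQ"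
    by (rule g[of "\<lambda>e. lk e ParT - (int k + 1) * lk e ParQ"])
      (simp_all add: lookup_add w_def lookup_single algebra_simps)
qed

definition exponent :: "weight \<Rightarrow> nat \<Rightarrow> param \<Rightarrow>\<^sub>0 int" where
  "exponent \<mu> i = Poly_Mapping.single ParQ (2 * lk \<mu> i) + Poly_Mapping.single ParTn (A.sgnexp (0 \<le> lk \<mu> i))
    + Poly_Mapping.single ParT0 (A.sgnexp (0 \<le> lk \<mu> i)) + Poly_Mapping.single ParT (A.texp \<mu> i)"

lemma diag_exponent:
  assumes i: "i \<in> {1..n}"
  shows "A.diag \<mu> i = Poly_Mapping.single (exponent \<mu> i) 1"
proof -
  have "upow (varA ParQ ^ 2) (varAi ParQ ^ 2) r = Poly_Mapping.single (Poly_Mapping.single ParQ (2 * r)) 1" for r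
  proof -
    have "upow (varA ParQ ^ 2) (varAi ParQ ^ 2) r = (if 0 \<le> r then varA ParQ ^ (2 * nat r) else varAi ParQ ^ (2 * nat (- r)))"
      by (simp add: upow_def power_mult)
    then show ?thesis by (simp add: varA_power)
  qed
  then show ?thesis
    using A.diag_eq[of i \<mu>] i by (simp add: A.qpow_def A.pw_def upow_varA exponent_def mult_single)
qed

lemma lookup_exponent: "lk (exponent \<mu> i) ParTn = A.sgnexp (0 \<le> lk \<mu> i)"
  "lk (exponent \<mu> i) ParT - (int k + 1) * lk (exponent \<mu> i) ParQ = A.texp \<mu> i - 2 * ((int k + 1) * lk \<mu> i)"
  by (simp_all add: exponent_def lookup_add lookup_single)

lemma S_tq: "\<phi> (varA ParT) ^ (2 * (k + 1)) * \<phi> (varA ParQ) ^ 2 = 1"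
proof -
  have "\<phi> (tA ^ (k + 1) * qA - 1) = 0" using s_dvd by (simp only: \<phi>_eq_0)
  then have "\<phi> (tA ^ (k + 1) * qA) = 1" by (simp add: rhomD[OF rhom_\<phi>])
  then show ?thesis by (simp only: rhomD[OF rhom_\<phi>] tA_def qA_def power_mult)
qed

section \<open>Eigenvalues of the product modulo \<open>s\<close>\<close>

abbreviation "F \<equiv> S.N.Fprod k m"

lemma F_triangular: "Poly_Mapping.keys F \<subseteq> down_set n lam" "lk F lam = 1"
  using S.N.Fprod_triangular[OF n m1] by (simp_all add: lam_def)

lemma F_lattice: "Poly_Mapping.keys F \<subseteq> lattice n"
  using F_triangular(1) by (auto simp: down_set_def)

lemma F_diag:
  assumes i: "i \<in> {1..n}" and F: "S.N.Y i F = const c * F"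
  shows "c = S.N.diag lam i"
proof (rule S.N.eigenvalue_diag[OF i F_lattice _ _ F])
  show "lam \<in> Poly_Mapping.keys F" using F_triangular(2) by (simp add: in_keys_iff)
  show "\<theta> = lam" if "\<theta> \<in> Poly_Mapping.keys F" "lam \<in> down_set n \<theta>" for \<theta>
    by (rule S.N.lead_maximal[OF lam F_triangular(1) that])
qed

lemma block_coords:
  assumes "i \<in> {1..n}"
  obtains l r where "1 \<le> l" "l \<le> k" "r < m" "i = m * l - r" "(i - 1) div m = l - 1" "(i - 1) mod m = m - 1 - r"
proof
  let ?u = "(i - 1) div m" and ?w = "(i - 1) mod m"
  have i: "i - 1 = m * ?u + ?w" "?w < m" using m1 by auto
  show "?u + 1 \<le> k"
  proof -
    have "?u < k" using assms m1 n by (subst div_less_iff_less_mult) auto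
    then show ?thesis by simp
  qed
  show "i = m * (?u + 1) - (m - 1 - ?w)" using i assms by (simp add: algebra_simps)
  show "?w = m - 1 - (m - 1 - ?w)" using i by simp
qed (use m1 in auto)

text \<open>The eigenvalue is known in two ways, as a monomial from the chains and as
  \<open>diag\<close> from the leading term. Comparing their degrees yields the spectral exponents
  of \<open>lam\<close> without any count of ranks.\<close>

lemma F_eigen:
  assumes i: "i \<in> {1..n}"
  shows "S.N.Y i F = const (S.N.diag lam i) * F"
    "A.texp lam i - 2 * ((int k + 1) * lk lam i) = 2 * (int k - int m - int ((i - 1) div m) + int ((i - 1) mod m))"
proof -
  obtain l r where lr: "1 \<le> l" "l \<le> k" "r < m" "i = m * l - r" "(i - 1) div m = l - 1" "(i - 1) mod m = m - 1 - r"
    using block_coords[OF i] .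
  define c where "c = varA ParTn * varA ParT0 * varA ParT ^ (2 * (k - l)) * varAi ParT ^ (2 * r)"
  have "S.N.Y i F = const (\<phi> c) * F"
    using S.N.Fprod_eigen[OF n m1 k1 lr(1,2,3) S_tq] by (simp add: lr(4) c_def rhomD[OF rhom_\<phi>])
  moreover from this have c: "\<phi> c = S.N.diag lam i" by (rule F_diag[OF i])
  ultimately show "S.N.Y i F = const (S.N.diag lam i) * F" by simp
  define e where "e = Poly_Mapping.single ParTn 1 + Poly_Mapping.single ParT0 1
    + Poly_Mapping.single ParT (2 * int (k - l)) + Poly_Mapping.single ParT (- (2 * int r))"
  have ce: "c = Poly_Mapping.single e 1"
    unfolding c_def varA_power unfolding varA_def by (simp add: mult_single e_def)
  have "\<phi> (Poly_Mapping.single e 1) = \<phi> (Poly_Mapping.single (exponent lam i) 1)"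
    using c S.h_diag[OF i lam] diag_exponent[OF i, of lam] ce by simp
  from monomial_exponents(2)[OF this] show "A.texp lam i - 2 * ((int k + 1) * lk lam i)
      = 2 * (int k - int m - int ((i - 1) div m) + int ((i - 1) mod m))"
    unfolding lookup_exponent lr(5,6) using lr(1-3) by (simp add: e_def lookup_add lookup_single of_nat_diff)
qed

text \<open>The degree in \<open>t_n^(1/2)\<close> shows that all entries of \<open>\<mu>\<close>
  are nonnegative; the other degree provides the hypothesis of
  \<open>staircase_unique\<close>.\<close>

lemma separated:
  assumes \<mu>: "\<mu> \<in> lattice n" and e: "\<And>i. i \<in> {1..n} \<Longrightarrow> \<phi> (A.diag \<mu> i) = \<phi> (A.diag lam i)"
  shows "\<mu> = lam"
proof -
  have ex: "A.sgnexp (0 \<le> lk \<mu> i) = A.sgnexp (0 \<le> lk lam i)"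
    "A.texp \<mu> i - 2 * ((int k + 1) * lk \<mu> i) = A.texp lam i - 2 * ((int k + 1) * lk lam i)" if "i \<in> {1..n}" for i
    using monomial_exponents[of "exponent \<mu> i" "exponent lam i"] e[OF that]
    by (simp_all only: diag_exponent[OF that] lookup_exponent)
  have nn: "0 \<le> lk \<mu> i" if "i \<in> {1..n}" for i
    using ex(1)[OF that] lam_nonneg[OF that] by (simp add: A.sgnexp_def split: if_splits)
  have c: "wrank n \<mu> i - (int k + 1) * lk \<mu> i = int k - int m - int ((i - 1) div m) + int ((i - 1) mod m)"
    if i: "i \<in> {1..n}" for i
  proof -
    have "A.texp \<mu> i = 2 * wrank n \<mu> i" by (rule A.texp_nonneg) (use i nn in auto)
    moreover have "a = 2 * w \<Longrightarrow> a - 2 * x = b - 2 * y \<Longrightarrow> b - 2 * y = 2 * z \<Longrightarrow> w - x = z" for a b w x y z :: int by linarith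
    ultimately show ?thesis using ex(2)[OF i] F_eigen(2)[OF i] by blast
  qed
  show ?thesis
  proof (rule lattice_eqI[OF \<mu> lam])
    fix i assume i: "i \<in> {1..n}"
    show "lk \<mu> i = lk lam i" using staircase_unique[OF m1 n nn c i] lookup_lam[OF i] by simp
  qed
qed

section \<open>Agreement with the operators and the spectrum over K\<close>

lemma to_fract_varAi: "to_fract (varAi p) = inverse (to_fract (varA p))"
proof -
  have "to_fract (varA p) * to_fract (varAi p) = 1" by (simp add: varA_varAi flip: to_fract_mult)
  then show ?thesis by (rule inverse_unique[symmetric])
qed

lemma K_tau: "K.N.tau i = (if i = 0 then t0h else if i = n then tnh else th)"
  "K.N.taui i = inverse (K.N.tau i)"
  unfolding K.N.tau_def K.N.taui_def by (simp_all add: t0h_def tnh_def th_def to_fract_varAi)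

lemma K_num: "K.N.num i = (if i = 0 then (1 - const cK * xpow 1 (-1)) * (1 - const dK * xpow 1 (-1))
  else if i = n then (1 - const aK * xpow n 1) * (1 - const bK * xpow n 1)
  else 1 - const tK * xpow i 1 * xpow (Suc i) (-1))"
  unfolding K.N.num_def
  by (simp add: aK_def bK_def cK_def dK_def tK_def tA_def t0h_def tnh_def unh_def u0h_def qh_def
      to_fract_varAi divide_inverse rhomD(7)[OF rhom_to_fract])

lemma K_s_act: "s_act n i f = K.N.sact i f"
proof -
  have q: "K.N.qpow r = qK powi r" for r
  proof -
    have "(to_fract (varA ParQ))^2 * (to_fract (varAi ParQ))^2 = 1"
      using K.N.P_Pi[of ParQ] by (simp flip: power_mult_distrib)
    then show ?thesis unfolding K.N.qpow_def by (simp add: upow_field qK_def qA_def rhomD(7)[OF rhom_to_fract])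
  qed
  show ?thesis
    unfolding s_act_def K.N.sact_def lin_ext_def
    by (rule sum.cong[OF refl]) (auto simp: rw_def K.N.zc_def dd_def q)
qed

lemma exact_quot_mult: "g \<noteq> 0 \<Longrightarrow> exact_quot (h * g) g = h"
  unfolding exact_quot_def by (rule the_equality) auto

text \<open>By \<open>one_minus_Zm_del\<close> the exact quotient is \<open>num\<close> times
  \<open>del\<close>.\<close>

lemma K_T: "T_op n i f = K.N.T i f"
proof -
  have e: "exact_quot (K.N.num i * (s_act n i f - f)) (1 - K.N.Zm i 1) = K.N.num i * K.N.del i f"
  proof -
    have "K.N.num i * (s_act n i f - f) = (K.N.num i * K.N.del i f) * (1 - K.N.Zm i 1)"
      unfolding K_s_act K.N.one_minus_Zm_del[symmetric] by (simp add: ac_simps)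
    moreover have "1 - K.N.Zm i 1 \<noteq> 0" using K.N.Zm_ne_1[of i] by simp
    ultimately show ?thesis by (metis exact_quot_mult)
  qed
  have "qK = to_fract (varA ParQ) ^ 2" by (simp add: qK_def qA_def rhomD(7)[OF rhom_to_fract])
  then show ?thesis
    unfolding K.N.T_def e[symmetric] using n2 by (auto simp: T_op_def K_num K_tau K.N.Zm_1)
qed

lemma K_Y: "Y_op n i = K.N.Y i"
proof -
  have "T_op n = K.N.T" by (intro ext) (rule K_T)
  moreover have "inv (K.N.T j) = K.N.Ti j" for j by (rule K.N.inv_T)
  ultimately show ?thesis by (simp add: Y_op_def K.N.Y_def)
qed

lemma K_spectrum:
  assumes i: "i \<in> {1..n}"
  shows "spectrum n lam i = K.N.diag lam i"
proof -
  have pw: "K.N.pw p r = to_fract (varA p) powi r" for p r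
    unfolding K.N.pw_def by (rule upow_field) (rule K.N.P_Pi)
  have "K.N.qpow (lk lam i) = qK powi lk lam i"
  proof -
    have "(to_fract (varA ParQ))^2 * (to_fract (varAi ParQ))^2 = 1"
      using K.N.P_Pi[of ParQ] by (simp flip: power_mult_distrib)
    then show ?thesis unfolding K.N.qpow_def by (simp add: upow_field qK_def qA_def rhomD(7)[OF rhom_to_fract])
  qed
  moreover have "K.N.texp lam i = 2 * lk (rho n lam) i"
    using K.N.texp_nonneg[of i lam] lookup_rho[of n lam i] lam_nonneg i by simp
  moreover have "to_fract (varA ParT) powi (2 * r) = tK powi r" for r
    by (simp add: tK_def tA_def power_int_mult rhomD(7)[OF rhom_to_fract])
  ultimately show ?thesis
    using K.N.diag_eq[of i lam] i lam_nonneg[OF i]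
    by (simp add: spectrum_def sigma_def pw A.sgnexp_def astarK_def tnh_def t0h_def)
qed

text \<open>The default value \<open>1\<close> keeps the index in range for every weight, as the
  selector of \<open>proj\<close> must be.\<close>

definition sep_index :: "weight \<Rightarrow> nat" where
  "sep_index \<nu> = (if \<exists>i\<in>{1..n}. \<phi> (A.diag \<nu> i) \<noteq> \<phi> (A.diag lam i)
     then SOME i. i \<in> {1..n} \<and> \<phi> (A.diag \<nu> i) \<noteq> \<phi> (A.diag lam i) else 1)"

lemma sep_index: "sep_index \<nu> \<in> {1..n}"
  "\<nu> \<in> lattice n \<Longrightarrow> \<nu> \<noteq> lam \<Longrightarrow> \<phi> (A.diag \<nu> (sep_index \<nu>)) \<noteq> \<phi> (A.diag lam (sep_index \<nu>))"
proof -
  let ?Q = "\<lambda>i. i \<in> {1..n} \<and> \<phi> (A.diag \<nu> i) \<noteq> \<phi> (A.diag lam i)"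
  have s: "?Q (SOME i. ?Q i)" if "\<exists>i. ?Q i" using that by (rule someI_ex)
  have d: "sep_index \<nu> = (SOME i. ?Q i)" if "\<exists>i. ?Q i"
    unfolding sep_index_def Bex_def by (rule if_P) (rule that)
  show "sep_index \<nu> \<in> {1..n}"
  proof (cases "\<exists>i. ?Q i")
    case True
    then show ?thesis using s[OF True] unfolding d[OF True] by blast
  next
    case False
    then have "sep_index \<nu> = 1" unfolding sep_index_def Bex_def by (rule if_not_P)
    then show ?thesis using n2 by simp
  qed
  assume "\<nu> \<in> lattice n" "\<nu> \<noteq> lam"
  then have e: "\<exists>i. ?Q i" using separated[of \<nu>] by blast
  show "\<phi> (A.diag \<nu> (sep_index \<nu>)) \<noteq> \<phi> (A.diag lam (sep_index \<nu>))" using s[OF e] unfolding d[OF e] by blast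
qed

section \<open>The projection over A and its two images\<close>

definition lower :: "weight list" where "lower = (SOME \<nu>s. set \<nu>s = down_set n lam - {lam})"

lemma set_lower: "set lower = down_set n lam - {lam}"
  unfolding lower_def by (rule someI_ex, rule finite_list) (simp add: finite_down_set[OF A.n1 lam])

lemma lower_lattice: "set lower \<subseteq> lattice n"
  by (auto simp: set_lower down_set_def)

text \<open>\<open>D\<close> is the leading coefficient of \<open>G\<close>, which has coefficients
  in A; so \<open>G / D\<close> is the candidate for \<open>E\<close>, with a denominator that
  survives reduction.\<close>

definition D :: ringA where "D = A.gap sep_index lam lower"

definition G :: "ringA laurent" where "G = A.proj sep_index lower (Poly_Mapping.single lam 1)"

text \<open>Every factor of \<open>D\<close> is a difference of diagonal coefficients that
  \<open>sep_index\<close> keeps nonzero under \<open>\<phi>\<close>, and the target of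
  \<open>\<phi>\<close> is a field.\<close>

lemma D_not_dvd: "\<not> s dvd D"
proof -
  have nz: "\<phi> (prod_list (map (\<lambda>\<nu>. A.diag lam (sep_index \<nu>) - A.diag \<nu> (sep_index \<nu>)) \<nu>s)) \<noteq> 0"
    if "\<And>\<nu>. \<nu> \<in> set \<nu>s \<Longrightarrow> \<nu> \<in> lattice n \<and> \<nu> \<noteq> lam" for \<nu>s
    using that
  proof (induction \<nu>s)
    case (Cons a \<nu>s)
    have "\<phi> (A.diag a (sep_index a)) \<noteq> \<phi> (A.diag lam (sep_index a))" using sep_index(2)[of a] Cons.prems[of a] by simp
    then show ?case using Cons by (simp add: rhomD[OF rhom_\<phi>])
  qed (simp add: rhomD[OF rhom_\<phi>])
  show ?thesis
    unfolding \<phi>_eq_0[symmetric] D_def A.gap_def[OF sep_index(1)]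
    by (rule nz) (use lower_lattice set_lower in auto)
qed

lemma D_nz: "D \<noteq> 0" using D_not_dvd by auto

text \<open>Modulo \<open>s\<close> the projection is formed from the operators having the product
  as eigenvector, so \<open>proj_single_eigen\<close> evaluates it.\<close>

lemma S_G: "Poly_Mapping.map \<phi> G = const (\<phi> D) * F"
  unfolding G_def D_def S.hm_proj[OF sep_index(1) lower_lattice] S.h_gap[OF sep_index(1) lower_lattice lam] S.hm_single rhomD(1)[OF rhom_\<phi>]
  by (rule S.N.proj_single_eigen[OF sep_index(1) lam set_lower F_triangular F_eigen(1)])

lemma K_G:
  shows "Poly_Mapping.keys (Poly_Mapping.map to_fract G) \<subseteq> down_set n lam"
    "lk (Poly_Mapping.map to_fract G) lam = to_fract D"
    "i \<in> {1..n} \<Longrightarrow> K.N.Y i (Poly_Mapping.map to_fract G) = const (K.N.diag lam i) * Poly_Mapping.map to_fract G"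
proof -
  have e: "Poly_Mapping.map to_fract G = K.N.proj sep_index lower (Poly_Mapping.single lam 1)"
    unfolding G_def K.hm_proj[OF sep_index(1) lower_lattice] K.hm_single by simp
  show "Poly_Mapping.keys (Poly_Mapping.map to_fract G) \<subseteq> down_set n lam"
    unfolding e by (rule K.N.keys_proj_single[OF sep_index(1) lam set_lower])
  show "lk (Poly_Mapping.map to_fract G) lam = to_fract D"
    unfolding e D_def K.h_gap[OF sep_index(1) lower_lattice lam]
    by (rule K.N.lookup_proj_single[OF sep_index(1) lam set_lower])
  show "i \<in> {1..n} \<Longrightarrow> K.N.Y i (Poly_Mapping.map to_fract G) = const (K.N.diag lam i) * Poly_Mapping.map to_fract G"
    unfolding e by (rule K.N.Y_proj_single[OF sep_index(1) lam set_lower])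
qed

text \<open>Uniqueness over K is inherited from the separation modulo \<open>s\<close>: diagonal
  coefficients with different reductions differ over A, hence over K.\<close>

lemma koornwinder_E_eq: "koornwinder_E n lam = const (inverse (to_fract D)) * Poly_Mapping.map to_fract G"
  (is "_ = ?E")
proof -
  have Dnz: "to_fract D \<noteq> 0" using D_nz by simp
  have kE: "Poly_Mapping.keys ?E \<subseteq> down_set n lam"
    using K_G(1) unfolding keys_subset_iff by (simp add: lookup_const_mult)
  have lE: "lk ?E lam = 1" using Dnz by (simp add: lookup_const_mult K_G(2))
  have YE: "K.N.Y i ?E = const (K.N.diag lam i) * ?E" if "i \<in> {1..n}" for i
    unfolding K.N.Y_linear K_G(3)[OF that] by (simp only: mult.left_commute)
  have sep: "\<exists>i\<in>{1..n}. K.N.diag \<nu> i \<noteq> K.N.diag lam i" if \<nu>: "\<nu> \<in> down_set n lam" "\<nu> \<noteq> lam" for \<nu>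
  proof -
    have l: "\<nu> \<in> lattice n" using \<nu> by (simp add: down_set_def)
    have "A.diag \<nu> (sep_index \<nu>) \<noteq> A.diag lam (sep_index \<nu>)" using sep_index(2)[OF l \<nu>(2)] by auto
    then have "K.N.diag \<nu> (sep_index \<nu>) \<noteq> K.N.diag lam (sep_index \<nu>)"
      using K.h_diag[OF sep_index(1) l] K.h_diag[OF sep_index(1) lam] by (metis to_fract_eq_iff)
    then show ?thesis using sep_index(1) by blast
  qed
  have ord: "(\<nu> = lam \<or> wt_prec n \<nu> lam) \<longleftrightarrow> \<nu> \<in> down_set n lam" if "\<nu> \<in> lattice n" for \<nu>
    using that down_set_refl[OF A.n1 lam] by (auto simp: down_set_def wt_prec_def)
  show ?thesis
    unfolding koornwinder_E_def K_Y
  proof (rule the_equality)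
    have "?E \<in> Pn n" using kE by (auto simp: Pn_def down_set_def)
    moreover have "\<nu> = lam \<or> wt_prec n \<nu> lam" if "\<nu> \<in> Poly_Mapping.keys ?E" for \<nu>
      using ord[of \<nu>] that kE by (auto simp: down_set_def)
    ultimately show "?E \<in> Pn n \<and> (\<forall>i\<in>{1..n}. K.N.Y i ?E = const (spectrum n lam i) * ?E) \<and> lk ?E lam = 1 \<and>
        (\<forall>\<nu>\<in>Poly_Mapping.keys ?E. \<nu> = lam \<or> wt_prec n \<nu> lam)"
      using YE lE K_spectrum by simp
    fix f assume f: "f \<in> Pn n \<and> (\<forall>i\<in>{1..n}. K.N.Y i f = const (spectrum n lam i) * f) \<and> lk f lam = 1 \<and>
        (\<forall>\<nu>\<in>Poly_Mapping.keys f. \<nu> = lam \<or> wt_prec n \<nu> lam)"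
    show "f = ?E"
    proof (rule K.N.eigenvector_unique[OF lam _ kE _ _ YE sep])
      show "Poly_Mapping.keys f \<subseteq> down_set n lam" using f ord by (auto simp: Pn_def)
      show "lk f lam = lk ?E lam" using f lE by simp
      show "K.N.Y i f = const (K.N.diag lam i) * f" if "i \<in> {1..n}" for i using f that K_spectrum[OF that] by simp
    qed
  qed
qed

lemma reduce_Fract:
  assumes "\<not> s dvd g"
  shows "reduce s \<phi> (Fract f g) = \<phi> f / \<phi> g"
  unfolding reduce_def
proof (rule the_equality)
  fix r assume "\<exists>f' g'. \<not> s dvd g' \<and> Fract f g = Fract f' g' \<and> r = \<phi> f' / \<phi> g'"
  then obtain f' g' where fg: "\<not> s dvd g'" "Fract f g = Fract f' g'" "r = \<phi> f' / \<phi> g'" by blast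
  have nz: "g \<noteq> 0" "g' \<noteq> 0" using assms fg(1) by auto
  have "f * g' = f' * g" using fg(2) nz by (simp add: eq_fract)
  then have "\<phi> f * \<phi> g' = \<phi> f' * \<phi> g" by (metis rhomD(3)[OF rhom_\<phi>])
  then show "r = \<phi> f / \<phi> g" using assms fg(1,3) by (simp add: frac_eq_eq flip: \<phi>_eq_0)
qed (use assms in blast)

text \<open>Such a denominator has valuation \<open>0\<close>, which is at most any
  valuation.\<close>

lemma val_nonneg_Fract:
  assumes "\<not> s dvd g"
  shows "val_nonneg s (Fract f g)"
proof -
  have "{j. s ^ j dvd g} = {0}"
  proof -
    have "j = 0" if "s ^ j dvd g" for j
    proof (rule ccontr)
      assume "j \<noteq> 0"
      then have "s dvd s ^ j" by (intro dvd_power) simp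
      then show False using that assms by (metis dvd_trans)
    qed
    then show ?thesis by auto
  qed
  then have "adic_ord s g = 0" by (simp add: adic_ord_def zero_enat_def)
  then show ?thesis using assms unfolding val_nonneg_def by (intro exI[of _ f] exI[of _ g]) auto
qed

lemma lookup_E: "lk (koornwinder_E n lam) \<mu> = Fract (lk G \<mu>) D"
  unfolding koornwinder_E_eq lookup_const_mult lookup_map_rhom[OF rhom_to_fract] Fract_conv_to_fract divide_inverse
  by (rule mult.commute)

lemma regular_E: "regular_at s (koornwinder_E n lam)"
  unfolding regular_at_def lookup_E by (simp add: val_nonneg_Fract[OF D_not_dvd])

lemma reduce_E: "reduce_laurent s \<phi> (koornwinder_E n lam) = F"
proof (rule poly_mapping_eqI)
  fix \<mu>
  \<comment> \<open>\<open>Poly_Mapping.map\<close> leaves zero coefficients at zero, so a formula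
    valid for all \<open>\<mu>\<close> requires that zero reduces to zero.\<close>
  have z: "reduce s \<phi> 0 = 0"
  proof -
    have "Fract 0 D = 0" by (simp add: Zero_fract_def eq_fract D_nz)
    then show ?thesis using reduce_Fract[OF D_not_dvd, of 0] by (simp add: rhomD(4)[OF rhom_\<phi>])
  qed
  have "lk (reduce_laurent s \<phi> (koornwinder_E n lam)) \<mu> = reduce s \<phi> (Fract (lk G \<mu>) D)"
    unfolding reduce_laurent_def by (simp add: map.rep_eq lookup_E when_def z)
  also have "\<dots> = \<phi> (lk G \<mu>) / \<phi> D" by (rule reduce_Fract[OF D_not_dvd])
  also have "\<phi> (lk G \<mu>) = \<phi> D * lk F \<mu>"
    using arg_cong[OF S_G, of "\<lambda>f. lk f \<mu>"] by (simp add: lookup_map_rhom[OF rhom_\<phi>] lookup_const_mult)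
  finally show "lk (reduce_laurent s \<phi> (koornwinder_E n lam)) \<mu> = lk F \<mu>"
    using D_not_dvd by (simp flip: \<phi>_eq_0)
qed

lemma F_eq: "F = (\<Prod>l\<in>{1..k}. \<Prod>(i, j)\<in>{(i, j). m * (l - 1) < i \<and> i < j \<and> j \<le> m * l}.
         (xpow i 1 - const (inverse (\<phi> tA)) * xpow j 1) *
         (1 - const (\<phi> tA ^ l * \<phi> qA) * xpow i (-1) * xpow j (-1)))"
proof -
  have "\<phi> (varA ParT) * \<phi> (varAi ParT) = 1" by (rule S.N.P_Pi)
  then have "\<phi> (varAi ParT) ^ 2 = inverse (\<phi> tA)"
    by (intro inverse_unique[symmetric]) (simp add: tA_def rhomD[OF rhom_\<phi>] flip: power_mult_distrib)
  moreover have "\<phi> (varA ParT) ^ (2 * l) * \<phi> (varA ParQ) ^ 2 = \<phi> tA ^ l * \<phi> qA" for l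
    by (simp add: tA_def qA_def rhomD[OF rhom_\<phi>] power_mult)
  ultimately show ?thesis unfolding S.N.Fprod_def pairs_def by (simp only:)
qed

end

theorem proposition4p16:
  fixes n k m :: nat and s :: ringA and \<phi> :: "ringA \<Rightarrow> 'k::field"
  assumes "k + 1 \<ge> 2" and "n \<ge> k + 1" and "n = k * m"
    and "irreducible s" and "s dvd tA ^ (k + 1) * qA - 1"
    and "residue_field_map s \<phi>"
  shows "regular_at s (koornwinder_E n (staircase_weight k m)) \<and>
    reduce_laurent s \<phi> (koornwinder_E n (staircase_weight k m)) =
      (\<Prod>l\<in>{1..k}. \<Prod>(i, j)\<in>{(i, j). m * (l - 1) < i \<and> i < j \<and> j \<le> m * l}.
         (xpow i 1 - const (inverse (\<phi> tA)) * xpow j 1) *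
         (1 - const (\<phi> tA ^ l * \<phi> qA) * xpow i (-1) * xpow j (-1)))"
proof -
  interpret specialization n k m s \<phi>
    using assms by unfold_locales auto
  show ?thesis using regular_E reduce_E F_eq by (simp add: lam_def)
qed

end
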